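(* Let $\varepsilon_\kappa>0$ and let $\theta_0\in L^3(\mathbb{T}^3)$ have mean zero on $\mathbb{T}^3$. Then there exists a unique global-in-time mild solution $\theta^{\varepsilon_\kappa}$ of $$\partial_t\theta+u\cdot\nabla\theta=\varepsilon_\kappa\Delta\theta,\qquad u=M[\theta],\qquad \theta(x,0)=\theta_0(x)$$ on $\mathbb{T}^3\times(0,\infty)$ such that $$\theta^{\varepsilon_\kappa}\in BC((0,\infty);L^3(\mathbb{T}^3)),$$ $$t^{\frac{s}{2}+\frac{1}{2}-\frac{3}{2p}}\theta^{\varepsilon_\kappa}\in C((0,\infty);\dot{W}^{s,p}(\mathbb{T}^3))$$ for all $s,p$ satisfying $s\in[0,1)$ and $p\in(3,\infty)$. In particular, $\theta^{\varepsilon_\kappa}(\cdot,t)\rightarrow\theta_0$ in $L^3(\mathbb{T}^3)$ as $t\rightarrow0^+$, and $\|\theta^{\varepsilon_\kappa}(\cdot,t)\|_{\dot{W}^{s,p}}\rightarrow0$ as $t\rightarrow\infty$ (for all such $s,p$).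
   Context: $\mathbb{T}^3=[0,2\pi]^3$ with periodic boundary conditions. The parameters $N>0$ and $\varepsilon_\nu>0$ are fixed real constants. The operator $M=(M_1,M_2,M_3)$ maps a scalar function $\theta$ on $\mathbb{T}^3$ to the vector field $u$ with components $u_j=M_j[\theta]$, where $M_j$ is the Fourier multiplier operator $\widehat{M_j[\theta]}(k)=\widehat M_j(k)\hat\theta(k)$, $k=(k_1,k_2,k_3)\in\mathbb{Z}^3$, with $\widehat M_j(k)=0$ if $k_3=0$, and for $k_3\neq0$ $$\widehat M_1(k)=\frac{N^4k_2k_3|k|^2-N^2k_1k_3(k_2^2+\varepsilon_\nu|k|^4)}{D(k)},$$ $$\widehat M_2(k)=\frac{-N^4k_1k_3|k|^2-N^2k_2k_3(k_2^2+\varepsilon_\nu|k|^4)}{D(k)},$$ $$\widehat M_3(k)=\frac{N^2(k_1^2+k_2^2)(k_2^2+\varepsilon_\nu|k|^4)}{D(k)},$$ $$D(k)=N^4|k|^2k_3^2+(\varepsilon_\nu|k|^4+k_2^2)^2.$$ In particular $u=M[\theta]$ is divergence-free. A mild solution is a solution of the integral equation $$\theta(t)=G(t)\theta_0-\int_0^tG(t-\tau)\left[\nabla\cdot\big(M[\theta(\tau)]\,\theta(\tau)\big)\right]d\tau,$$ where $G(t)$ is the heat semigroup with Fourier symbol $e^{-\varepsilon_\kappa t|\xi|^2}$. $BC$ stands for bounded continuous functions. $\dot W^{s,p}$ is the usual homogeneous Sobolev space, with norm $\|f\|_{\dot W^{s,p}}=\|(-\Delta)^{s/2}f\|_{L^p}$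 (so $\dot W^{0,p}=L^p$). *)

theory Defs
  imports "HOL-Analysis.Analysis"
begin

text \<open>
  Functions on the torus are given on the fundamental cube and identified when they agree almost
  everywhere, so periodicity needs no separate condition.
\<close>

definition torus :: "(real^3) measure" where
  "torus = restrict_space lborel (cbox 0 (\<chi> i. 2 * pi))"

definition in_Lp :: "real \<Rightarrow> (real^3 \<Rightarrow> real) \<Rightarrow> bool" where
  "in_Lp p f \<longleftrightarrow> f \<in> borel_measurable torus \<and> integrable torus (\<lambda>x. \<bar>f x\<bar> powr p)"

definition Lp_norm :: "real \<Rightarrow> (real^3 \<Rightarrow> real) \<Rightarrow> real" where
  "Lp_norm p f = (LINT x|torus. \<bar>f x\<bar> powr p) powr (1 / p)"

definition freq :: "int^3 \<Rightarrow> real^3" where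
  "freq k = (\<chi> i. real_of_int (k $ i))"

definition fourier_coeff :: "(real^3 \<Rightarrow> real) \<Rightarrow> int^3 \<Rightarrow> complex" where
  "fourier_coeff f k =
     (LINT x|torus. complex_of_real (f x) * cis (- (freq k \<bullet> x))) / complex_of_real ((2 * pi) ^ 3)"

text \<open>
  The symbols below are real and even, so the operators map real functions to real functions.
  By uniqueness of Fourier coefficients, the function chosen in \<open>multiplier\<close> is determined
  almost everywhere whenever it exists.
\<close>

definition is_multiplier :: "(int^3 \<Rightarrow> real) \<Rightarrow> (real^3 \<Rightarrow> real) \<Rightarrow> (real^3 \<Rightarrow> real) \<Rightarrow> bool" where
  "is_multiplier m f g \<longleftrightarrow> integrable torus f \<and> integrable torus g \<and>
     (\<forall>k. fourier_coeff g k = complex_of_real (m k) * fourier_coeff f k)"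

definition multiplier :: "(int^3 \<Rightarrow> real) \<Rightarrow> (real^3 \<Rightarrow> real) \<Rightarrow> real^3 \<Rightarrow> real" where
  "multiplier m f = (SOME g. is_multiplier m f g)"

definition D_symbol :: "real \<Rightarrow> real \<Rightarrow> real^3 \<Rightarrow> real" where
  "D_symbol N \<epsilon>\<^sub>\<nu> \<xi> =
     N^4 * (norm \<xi>)^2 * (\<xi>$3)^2 + (\<epsilon>\<^sub>\<nu> * (norm \<xi>)^4 + (\<xi>$2)^2)^2"

definition M_symbol :: "real \<Rightarrow> real \<Rightarrow> real^3 \<Rightarrow> real^3" where
  "M_symbol N \<epsilon>\<^sub>\<nu> \<xi> = (if \<xi>$3 = 0 then 0 else vector
     [(N^4 * \<xi>$2 * \<xi>$3 * (norm \<xi>)^2 - N^2 * \<xi>$1 * \<xi>$3 * ((\<xi>$2)^2 + \<epsilon>\<^sub>\<nu> * (norm \<xi>)^4))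
        / D_symbol N \<epsilon>\<^sub>\<nu> \<xi>,
      (- (N^4) * \<xi>$1 * \<xi>$3 * (norm \<xi>)^2 - N^2 * \<xi>$2 * \<xi>$3 * ((\<xi>$2)^2 + \<epsilon>\<^sub>\<nu> * (norm \<xi>)^4))
        / D_symbol N \<epsilon>\<^sub>\<nu> \<xi>,
      (N^2 * ((\<xi>$1)^2 + (\<xi>$2)^2) * ((\<xi>$2)^2 + \<epsilon>\<^sub>\<nu> * (norm \<xi>)^4))
        / D_symbol N \<epsilon>\<^sub>\<nu> \<xi>])"

definition velocity :: "real \<Rightarrow> real \<Rightarrow> (real^3 \<Rightarrow> real) \<Rightarrow> real^3 \<Rightarrow> real^3" where
  "velocity N \<epsilon>\<^sub>\<nu> f x = (\<chi> j. multiplier (\<lambda>k. M_symbol N \<epsilon>\<^sub>\<nu> (freq k) $ j) f x)"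

text \<open>
  The case distinction is needed because \<^term>\<open>0 powr 0 = (0::real)\<close>, while
  \<open>(-\<Delta>)\<^sup>0\<close> is the identity also on the mean.
\<close>

definition frac_laplacian_symbol :: "real \<Rightarrow> int^3 \<Rightarrow> real" where
  "frac_laplacian_symbol s k = (if s = 0 then 1 else norm (freq k) powr s)"

definition in_sobolev :: "real \<Rightarrow> real \<Rightarrow> (real^3 \<Rightarrow> real) \<Rightarrow> bool" where
  "in_sobolev s p f \<longleftrightarrow> (\<exists>g. is_multiplier (frac_laplacian_symbol s) f g \<and> in_Lp p g)"

definition sobolev_norm :: "real \<Rightarrow> real \<Rightarrow> (real^3 \<Rightarrow> real) \<Rightarrow> real" where
  "sobolev_norm s p f = Lp_norm p (multiplier (frac_laplacian_symbol s) f)"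

text \<open>
  Periodic distributions are represented by their Fourier coefficients. This is used for the
  divergence of an integrable vector field, which need not be a function. The heat semigroup at a
  positive time maps a distribution to a smooth function, the pointwise sum of an absolutely
  convergent Fourier series.
\<close>

definition divergence_coeff :: "(real^3 \<Rightarrow> real^3) \<Rightarrow> int^3 \<Rightarrow> complex" where
  "divergence_coeff F k =
     (\<Sum>j\<in>UNIV. \<i> * complex_of_real (freq k $ j) * fourier_coeff (\<lambda>x. F x $ j) k)"

definition heat :: "real \<Rightarrow> real \<Rightarrow> (int^3 \<Rightarrow> complex) \<Rightarrow> real^3 \<Rightarrow> complex" where
  "heat \<epsilon>\<^sub>\<kappa> t a x =
     (\<Sum>\<^sub>\<infinity>k. complex_of_real (exp (- \<epsilon>\<^sub>\<kappa> * t * (norm (freq k))^2)) * a k * cis (freq k \<bullet> x))"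

definition duhamel_integrand ::
  "real \<Rightarrow> real \<Rightarrow> real \<Rightarrow> (real \<Rightarrow> real^3 \<Rightarrow> real) \<Rightarrow> real \<Rightarrow> real^3 \<Rightarrow> real \<Rightarrow> complex" where
  "duhamel_integrand N \<epsilon>\<^sub>\<nu> \<epsilon>\<^sub>\<kappa> \<theta> t x \<tau> =
     heat \<epsilon>\<^sub>\<kappa> (t - \<tau>) (divergence_coeff (\<lambda>y. \<theta> \<tau> y *\<^sub>R velocity N \<epsilon>\<^sub>\<nu> (\<theta> \<tau>) y)) x"

text \<open>
  For \<open>\<theta> \<tau>\<close> in \<open>L\<^sup>3\<close> the velocity exists (its symbol is bounded and \<open>L\<^sup>3\<close> lies in \<open>L\<^sup>2\<close>) and its
  product with \<open>\<theta> \<tau>\<close> is integrable. The time integral is read for almost every point of space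
  as an absolutely convergent Lebesgue integral. Both sides of the integral equation are real; it is
  written in the complex numbers because the semigroup is.
\<close>

definition mild_solution ::
  "real \<Rightarrow> real \<Rightarrow> real \<Rightarrow> (real^3 \<Rightarrow> real) \<Rightarrow> (real \<Rightarrow> real^3 \<Rightarrow> real) \<Rightarrow> bool" where
  "mild_solution N \<epsilon>\<^sub>\<nu> \<epsilon>\<^sub>\<kappa> \<theta>\<^sub>0 \<theta> \<longleftrightarrow>
     (\<forall>t>0. in_Lp 3 (\<theta> t)) \<and>
     (\<forall>t>0. AE x in torus.
        set_integrable lborel {0<..<t} (duhamel_integrand N \<epsilon>\<^sub>\<nu> \<epsilon>\<^sub>\<kappa> \<theta> t x) \<and>
        complex_of_real (\<theta> t x) =
          heat \<epsilon>\<^sub>\<kappa> t (fourier_coeff \<theta>\<^sub>0) x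
          - (LINT \<tau>:{0<..<t}|lborel. duhamel_integrand N \<epsilon>\<^sub>\<nu> \<epsilon>\<^sub>\<kappa> \<theta> t x \<tau>))"

text \<open>
  Continuity and bounded continuity on \<open>(0,\<infinity>)\<close> with values in the space of functions satisfying
  \<open>X\<close>, normed by \<open>nrm\<close>.
\<close>

definition C_pos ::
  "((real^3 \<Rightarrow> real) \<Rightarrow> bool) \<Rightarrow> ((real^3 \<Rightarrow> real) \<Rightarrow> real) \<Rightarrow> (real \<Rightarrow> real^3 \<Rightarrow> real) \<Rightarrow> bool" where
  "C_pos X nrm f \<longleftrightarrow> (\<forall>t>0. X (f t)) \<and>
     (\<forall>t\<^sub>0>0. ((\<lambda>t. nrm (\<lambda>x. f t x - f t\<^sub>0 x)) \<longlongrightarrow> 0) (at t\<^sub>0))"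

definition BC_pos ::
  "((real^3 \<Rightarrow> real) \<Rightarrow> bool) \<Rightarrow> ((real^3 \<Rightarrow> real) \<Rightarrow> real) \<Rightarrow> (real \<Rightarrow> real^3 \<Rightarrow> real) \<Rightarrow> bool" where
  "BC_pos X nrm f \<longleftrightarrow> C_pos X nrm f \<and> (\<exists>B. \<forall>t>0. nrm (f t) \<le> B)"

definition solution_class :: "(real \<Rightarrow> real^3 \<Rightarrow> real) \<Rightarrow> bool" where
  "solution_class \<theta> \<longleftrightarrow>
     BC_pos (in_Lp 3) (Lp_norm 3) \<theta> \<and>
     (\<forall>s p. 0 \<le> s \<and> s < 1 \<and> 3 < p \<longrightarrow>
        C_pos (in_sobolev s p) (sobolev_norm s p)
          (\<lambda>t x. t powr (s / 2 + 1 / 2 - 3 / (2 * p)) * \<theta> t x))"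

end

theory Submission imports Defs begin

text \<open>
  The proof moves the equation to Fourier coefficients and works in \<open>\<ell>\<^sup>2(\<int>\<^sup>3)\<close>. The symbol of the velocity
  operator is real, even, orthogonal to the frequency and bounded by a multiple of
  \<open>|k|^(-2)\<close> (\<open>drift_symbol_drift\<close>), so the coefficients of a solution satisfy

  \<open>a\<^sub>k' = - \<epsilon> |k|\<^sup>2 a\<^sub>k - i |k| Q(a, a)\<^sub>k\<close>,
  \<open>Q(a, b)\<^sub>k = \<Sum>\<^sub>l (k/|k|) \<bullet> m(l) a\<^sub>l b_(k-l)\<close>,

  and \<open>Q\<close> is bounded on \<open>\<ell>\<^sup>2\<close>: by Cauchy and Schwarz only \<open>\<Sum>\<^sub>l |l|^(-4) < \<infinity>\<close> is used
  (\<open>norm_quad_sq_le\<close>). An \<open>L\<^sup>3\<close> function on the torus is an \<open>L\<^sup>2\<close> function, so existence and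
  uniqueness become statements about this equation, and \<open>L\<^sup>3\<close> matters only as \<open>t \<rightarrow> 0\<close>.

  Existence. The dissipation pays for the factor \<open>|k|\<close>: the energy inequality bounds the growth of the
  square norm by a time integral of \<open>|Q|\<^sup>2\<close> (\<open>forced_energy\<close>). With \<open>Q\<close> truncated outside a ball this
  makes the solution map a contraction in a norm with an exponential weight in time
  (\<open>forced_fixed_point\<close>). The velocity is free of divergence and the solution is real, so the
  nonlinear term drops out of the energy identity (\<open>advection_cancels\<close>, \<open>energy_identity\<close>). The norm
  therefore decreases, the truncation is never active, and the solution is global
  (\<open>global_coefficients\<close>). As the mean is zero, the dissipation also forces the norm to
  zero (\<open>norm_decay\<close>).

  Regularity. Energy estimates with weights \<open>t\<^sup>n\<close> give, by induction on \<open>n\<close>, smoothing of every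
  order (\<open>smoothing\<close>), hence a bound of \<open>|k|\<^sup>6 |a\<^sub>k(t)|\<close> by the norm at an earlier time
  (\<open>coeff_decay\<close>). All the Sobolev norms of the theorem are dominated by \<open>\<Sum>\<^sub>k |k|\<^sup>2 |a\<^sub>k|\<close>
  (\<open>real_series_sobolev\<close>), so this single bound yields membership, continuity and decay for all exponents.

  Initial time. The heat evolution of the data converges in \<open>L\<^sup>3\<close> because the heat semigroup is an
  \<open>L\<^sup>3\<close> contraction, its kernel being nonnegative (\<open>heat_kernel_nonneg\<close>,
  \<open>heat_op_L3_contraction\<close>, \<open>heat_op_tendsto_L3\<close>). The remaining Duhamel part \<open>d\<close> is at most
  \<open>t^(-3/4)\<close> in the supremum norm and \<open>t^(1/2)\<close> in \<open>L\<^sup>2\<close>, up to constants, so that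
  \<open>\<integral> |d|\<^sup>3 \<le> sup |d| \<cdot> \<integral> |d|\<^sup>2\<close> vanishes like \<open>t^(1/4)\<close> (\<open>duhamel_near_zero\<close>).

  Mild solutions. At lag \<open>t - \<tau>\<close> the Duhamel integrand has \<open>L\<^sup>2\<close> norm of order \<open>(t - \<tau>)^(-1/2)\<close>,
  which is integrable, so by Fubini the integral equation holds almost everywhere if and only if it
  holds for every Fourier coefficient (\<open>mild_solution_iff_coefficients\<close>). Two solutions in the class have
  bounded continuous coefficients in \<open>\<ell>\<^sup>2\<close>, and since \<open>\<integral> |k|\<^sup>2 exp(- 2 \<epsilon> (t - \<tau>) |k|\<^sup>2) d\<tau>\<close> is bounded
  uniformly in \<open>k\<close>, a Gronwall argument makes them equal (\<open>coefficient_equation_unique\<close>).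
\<close>

section \<open>Sums over the lattice as integrals\<close>

text \<open>
  Series over the frequencies are written as Lebesgue integrals for the counting measure, so that
  Fubini and dominated convergence apply to sums and to mixed sums and integrals alike.
\<close>

abbreviation lattice :: "(int^3) measure" where
  "lattice \<equiv> count_space UNIV"

lemma countable_lattice [simp]: "countable (UNIV :: (int^3) set)"
  by simp

lemma sigma_finite_lattice: "sigma_finite_measure lattice"
  by (rule sigma_finite_measure_count_space_countable) simp

lemma integrable_lattice_iff:
  fixes f :: "int^3 \<Rightarrow> 'b :: {banach, second_countable_topology}"
  shows "integrable lattice f \<longleftrightarrow> (\<lambda>k. norm (f k)) summable_on UNIV"
  by (simp add: abs_summable_equivalent Infinite_Set_Sum.abs_summable_on_def)

lemma infsum_eq_lattice_integral:
  fixes f :: "int^3 \<Rightarrow> 'b :: {banach, second_countable_topology}"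
  assumes "integrable lattice f"
  shows "(\<Sum>\<^sub>\<infinity>k. f k) = (LINT k|lattice. f k)"
  using infsetsum_infsum[of f UNIV] assms
  by (simp add: Infinite_Set_Sum.abs_summable_on_def infsetsum_def)

section \<open>Characters of the torus\<close>

text \<open>
  Opposite faces of the closed cube are the same points of the torus; on the open cube, which has
  full measure, the torus embedding below is injective.
\<close>

abbreviation cube :: "(real^3) set" where
  "cube \<equiv> cbox 0 (\<chi> i. 2 * pi)"

abbreviation open_cube :: "(real^3) set" where
  "open_cube \<equiv> box 0 (\<chi> i. 2 * pi)"

abbreviation character :: "int^3 \<Rightarrow> real^3 \<Rightarrow> complex" where
  "character k x \<equiv> cis (freq k \<bullet> x)"

lemma space_torus [simp]: "space torus = cube"
  by (simp add: torus_def space_restrict_space)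

lemma borel_imp_torus_measurable:
  "f \<in> borel_measurable borel \<Longrightarrow> f \<in> borel_measurable torus"
  unfolding torus_def by (rule measurable_restrict_space1) simp

lemma mem_cube_iff: "x \<in> cube \<longleftrightarrow> (\<forall>i. 0 \<le> x $ i \<and> x $ i \<le> 2 * pi)"
  by (simp add: mem_box_cart)

lemma mem_open_cube_iff: "x \<in> open_cube \<longleftrightarrow> (\<forall>i. 0 < x $ i \<and> x $ i < 2 * pi)"
  by (simp add: mem_box_cart)

lemma cube_Basis: "b \<in> Basis \<Longrightarrow> (\<chi> i. 2 * pi :: real^3) \<bullet> b = 2 * pi"
  by (auto simp: Basis_vec_def inner_axis)

lemma emeasure_torus: "emeasure torus cube = ennreal ((2 * pi) ^ 3)"
proof -
  have "emeasure torus cube = emeasure lborel cube"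
    unfolding torus_def by (subst emeasure_restrict_space) auto
  also have "\<dots> = ennreal (\<Prod>b\<in>(Basis :: (real^3) set). 2 * pi)"
    by (subst emeasure_lborel_cbox) (auto simp: cube_Basis)
  finally show ?thesis by simp
qed

lemma finite_measure_torus: "finite_measure torus"
  by (rule finite_measureI) (simp add: emeasure_torus)

interpretation torus: finite_measure torus by (rule finite_measure_torus)

lemma measure_torus: "measure torus cube = (2 * pi) ^ 3"
  by (simp add: measure_def emeasure_torus)

lemma AE_torus_iff: "(AE x in torus. P x) \<longleftrightarrow> (AE x in lborel. x \<in> cube \<longrightarrow> P x)"
  unfolding torus_def by (rule AE_restrict_space_iff) simp

lemma AE_torus_interior: "AE x in torus. x \<in> open_cube"
proof -
  have "negligible (cube - open_cube)"
    by (rule negligible_frontier_interval)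
  then have "AE x in lebesgue. x \<notin> cube - open_cube"
    by (intro AE_not_in) (simp add: negligible_iff_null_sets)
  then show ?thesis
    unfolding AE_torus_iff AE_completion_iff by (auto elim: AE_mp)
qed

lemma freq_nth [simp]: "freq k $ i = of_int (k $ i)"
  by (simp add: freq_def)

lemma freq_0 [simp]: "freq 0 = 0"
  by (simp add: freq_def vec_eq_iff)

lemma freq_minus: "freq (- k) = - freq k"
  by (simp add: freq_def vec_eq_iff)

lemma freq_add: "freq (k + l) = freq k + freq l"
  by (simp add: freq_def vec_eq_iff)

lemma freq_diff: "freq (k - l) = freq k - freq l"
  by (simp add: freq_def vec_eq_iff)

lemma freq_eq_0_iff [simp]: "freq k = 0 \<longleftrightarrow> k = 0"
  by (simp add: freq_def vec_eq_iff)

lemma continuous_on_character [continuous_intros]: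
  "continuous_on S (\<lambda>x. character k x)"
  by (intro continuous_intros)

lemma integrable_mult_character:
  fixes f :: "real^3 \<Rightarrow> complex"
  assumes "integrable torus f"
  shows "integrable torus (\<lambda>x. f x * character k x)"
proof (rule Bochner_Integration.integrable_bound[OF assms])
  have "(\<lambda>x. character k x) \<in> borel_measurable torus"
    by (intro borel_imp_torus_measurable borel_measurable_continuous_onI continuous_intros)
  then show "(\<lambda>x. f x * character k x) \<in> borel_measurable torus"
    using assms by measurable
qed (simp add: norm_mult)

text \<open>
  Lebesgue measure on a Euclidean space is the product of its one-dimensional copies along the
  basis.
\<close>

lemma integral_lborel_prod:
  fixes f :: "'a :: euclidean_space \<Rightarrow> real \<Rightarrow> complex"
  assumes int: "\<And>b. b \<in> Basis \<Longrightarrow> integrable lborel (f b)"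
  shows "(LINT x|lborel. (\<Prod>b\<in>Basis. f b (x \<bullet> b))) = (\<Prod>b\<in>Basis. LINT t|lborel. f b t)"
proof -
  interpret product_sigma_finite "\<lambda>_ :: 'a. lborel :: real measure"
    by (simp add: product_sigma_finite_def lborel.sigma_finite_measure_axioms)
  have f_meas: "f b \<in> borel_measurable borel" if "b \<in> Basis" for b
    using int[OF that] by (simp add: borel_measurable_integrable)
  have "(\<lambda>x. \<Prod>b\<in>Basis. f b (x \<bullet> b)) \<in> borel_measurable borel"
    by (intro borel_measurable_prod measurable_compose[OF _ f_meas]) auto
  then have "(LINT x|lborel. (\<Prod>b\<in>Basis. f b (x \<bullet> b)))
      = (LINT g|(\<Pi>\<^sub>M b\<in>Basis. lborel). (\<Prod>b\<in>Basis. f b ((\<Sum>c\<in>Basis. g c *\<^sub>R c) \<bullet> b)))"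
    by (subst lborel_eq, subst integral_distr) auto
  also have "\<dots> = (LINT g|(\<Pi>\<^sub>M b\<in>Basis. lborel). (\<Prod>b\<in>Basis. f b (g b)))"
    by (intro Bochner_Integration.integral_cong prod.cong refl) (simp add: inner_sum_left_Basis)
  also have "\<dots> = (\<Prod>b\<in>Basis. LINT t|lborel. f b t)"
    by (rule product_integral_prod) (auto intro: int)
  finally show ?thesis .
qed

lemma circle_character_integral:
  fixes n :: int
  shows "integrable lborel (\<lambda>t. indicator {0..2 * pi} t *\<^sub>R cis (of_int n * t))"
    and "(LINT t|lborel. indicator {0..2 * pi} t *\<^sub>R cis (of_int n * t)) = (if n = 0 then 2 * pi else 0)"
proof -
  have cont: "continuous_on {0..2 * pi} (\<lambda>t. cis (of_int n * t))"
    by (intro continuous_intros)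
  show "integrable lborel (\<lambda>t. indicator {0..2 * pi} t *\<^sub>R cis (of_int n * t))"
    using borel_integrable_compact[OF _ cont] by simp
  show "(LINT t|lborel. indicator {0..2 * pi} t *\<^sub>R cis (of_int n * t)) = (if n = 0 then 2 * pi else 0)"
  proof (cases "n = 0")
    case True
    then show ?thesis by (simp add: scaleR_conv_of_real)
  next
    case False
    define F where "F t = cis (of_int n * t) / (\<i> * of_int n)" for t
    have "(LINT t|lborel. indicator {0..2 * pi} t *\<^sub>R cis (of_int n * t)) = F (2 * pi) - F 0"
    proof (rule integral_FTC_Icc)
      fix t :: real
      have "((\<lambda>z. exp (\<i> * (of_int n * z)) / (\<i> * of_int n)) has_field_derivative
          exp (\<i> * (of_int n * of_real t))) (at (of_real t))"
      proof -
        have "- (\<i> * (z * \<i>)) = z" for z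
          by (simp add: complex_eq_iff)
        then show ?thesis
          using False by (auto intro!: derivative_eq_intros)
      qed
      from has_vector_derivative_real_field[OF this] show "(F has_vector_derivative cis (of_int n * t)) (at t within {0..2 * pi})"
        by (simp add: F_def[abs_def] cis_conv_exp)
    qed (use cont in auto)
    also have "\<dots> = 0"
    proof -
      have "cis (of_int n * (2 * pi)) = 1"
        using cis_multiple_2pi[of "of_int n"] by (simp add: mult.commute)
      then show ?thesis by (simp add: F_def)
    qed
    finally show ?thesis using False by simp
  qed
qed

lemma cis_sum: "finite A \<Longrightarrow> cis (\<Sum>a\<in>A. f a) = (\<Prod>a\<in>A. cis (f a))"
  by (induction A rule: finite_induct) (auto simp: cis_mult[symmetric])

text \<open>
  The integral factors over the coordinates into integrals of \<open>e^(int)\<close> over a full period.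
\<close>

lemma character_integral: "(LINT x|torus. character k x) = (if k = 0 then (2 * pi) ^ 3 else 0)"
proof -
  have k_int: "\<exists>n::int. freq k \<bullet> b = of_int n" if "b \<in> Basis" for b
    using that by (auto simp: Basis_vec_def inner_axis)
  then obtain n :: "real^3 \<Rightarrow> int" where n: "\<And>b. b \<in> Basis \<Longrightarrow> freq k \<bullet> b = of_int (n b)"
    by metis
  have "(LINT x|torus. character k x) = (LINT x|lborel. indicator cube x *\<^sub>R character k x)"
    unfolding torus_def by (subst integral_restrict_space) auto
  also have "\<dots> = (LINT x|lborel. (\<Prod>b\<in>Basis. indicator {0..2 * pi} (x \<bullet> b) *\<^sub>R cis (of_int (n b) * (x \<bullet> b))))"
  proof (intro Bochner_Integration.integral_cong refl)
    fix x :: "real^3"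
    have "indicator cube x = (\<Prod>b\<in>(Basis :: (real^3) set). indicator {0..2 * pi} (x \<bullet> b) :: real)"
      by (auto simp: indicator_def mem_box cube_Basis split: if_splits)
    moreover have "character k x = (\<Prod>b\<in>Basis. cis (of_int (n b) * (x \<bullet> b)))"
      by (subst euclidean_inner) (simp add: cis_sum n)
    ultimately show "indicator cube x *\<^sub>R character k x =
        (\<Prod>b\<in>Basis. indicator {0..2 * pi} (x \<bullet> b) *\<^sub>R cis (of_int (n b) * (x \<bullet> b)))"
      by (simp add: scaleR_conv_of_real prod.distrib)
  qed
  also have "\<dots> = (\<Prod>b\<in>(Basis :: (real^3) set). (if n b = 0 then 2 * pi else 0))"
    by (subst integral_lborel_prod[where f = "\<lambda>b t. indicator {0..2 * pi} t *\<^sub>R cis (of_int (n b) * t)"])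
      (auto simp: circle_character_integral)
  also have "\<dots> = (if k = 0 then (2 * pi) ^ 3 else 0)"
  proof (cases "k = 0")
    case True
    then have "n b = 0" if "b \<in> Basis" for b using n[OF that] by simp
    then show ?thesis using True by simp
  next
    case False
    then obtain b where "b \<in> Basis" "freq k \<bullet> b \<noteq> 0"
      using euclidean_all_zero_iff[of "freq k"] by auto
    then have "n b = 0 \<Longrightarrow> False" using n by auto
    then show ?thesis using False \<open>b \<in> Basis\<close> by (auto intro!: prod_zero)
  qed
  finally show ?thesis by simp
qed

section \<open>Trigonometric polynomials\<close>

inductive trig_poly :: "(real^3 \<Rightarrow> complex) \<Rightarrow> bool" where
  trig_poly_character: "trig_poly (\<lambda>x. c * character k x)"
| trig_poly_add: "trig_poly f \<Longrightarrow> trig_poly g \<Longrightarrow> trig_poly (\<lambda>x. f x + g x)"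

lemma trig_poly_const: "trig_poly (\<lambda>x. c)"
  using trig_poly_character[of c 0] by simp

lemma trig_poly_mult: "trig_poly f \<Longrightarrow> trig_poly g \<Longrightarrow> trig_poly (\<lambda>x. f x * g x)"
proof (induction f rule: trig_poly.induct)
  case (trig_poly_character c k)
  from trig_poly_character show ?case
  proof (induction g rule: trig_poly.induct)
    case (trig_poly_character d l)
    show ?case
      using trig_poly.trig_poly_character[of "c * d" "k + l"]
      by (simp add: freq_add inner_add_left cis_mult[symmetric] mult_ac)
  next
    case (trig_poly_add f g)
    then show ?case
      using trig_poly.trig_poly_add by (simp add: distrib_left)
  qed
next
  case (trig_poly_add f h)
  then show ?case
    using trig_poly.trig_poly_add by (simp add: distrib_right)
qed

lemma trig_poly_sum: "finite A \<Longrightarrow> (\<And>a. a \<in> A \<Longrightarrow> trig_poly (f a)) \<Longrightarrow> trig_poly (\<lambda>x. \<Sum>a\<in>A. f a x)"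
  by (induction A rule: finite_induct) (auto intro: trig_poly_const trig_poly_add)

lemma trig_poly_finite_sum:
  assumes "trig_poly f"
  obtains F c where "finite F" "f = (\<lambda>x. \<Sum>k\<in>F. c k * character k x)"
  using assms
proof (induction f arbitrary: thesis rule: trig_poly.induct)
  case (trig_poly_character c k)
  show ?case
    by (rule trig_poly_character[of "{k}" "\<lambda>_. c"]) auto
next
  case (trig_poly_add f g)
  obtain F c where F: "finite F" "f = (\<lambda>x. \<Sum>k\<in>F. c k * character k x)"
    using trig_poly_add.IH(1) by blast
  obtain G d where G: "finite G" "g = (\<lambda>x. \<Sum>k\<in>G. d k * character k x)"
    using trig_poly_add.IH(2) by blast
  define e where "e k = (if k \<in> F then c k else 0) + (if k \<in> G then d k else 0)" for k
  have "f x + g x = (\<Sum>k\<in>F \<union> G. e k * character k x)" for x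
  proof -
    have "f x = (\<Sum>k\<in>F \<union> G. (if k \<in> F then c k else 0) * character k x)"
      unfolding F(2) using F(1) G(1) by (intro sum.mono_neutral_cong_left) auto
    moreover have "g x = (\<Sum>k\<in>F \<union> G. (if k \<in> G then d k else 0) * character k x)"
      unfolding G(2) using F(1) G(1) by (intro sum.mono_neutral_cong_left) auto
    ultimately show ?thesis
      by (simp add: e_def distrib_right sum.distrib)
  qed
  then show ?case
    using F(1) G(1) by (intro trig_poly_add.prems[of "F \<union> G" e]) auto
qed

lemma trig_poly_continuous: "trig_poly f \<Longrightarrow> continuous_on S f"
  by (induction rule: trig_poly.induct) (auto intro!: continuous_intros)

lemma trig_poly_measurable: "trig_poly f \<Longrightarrow> f \<in> borel_measurable torus"
  by (intro borel_imp_torus_measurable borel_measurable_continuous_onI trig_poly_continuous)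

lemma trig_poly_cos: "trig_poly (\<lambda>x. complex_of_real (cos (x $ i)))"
  and trig_poly_sin: "trig_poly (\<lambda>x. complex_of_real (sin (x $ i)))"
proof -
  have *: "freq (axis i 1) \<bullet> x = x $ i" "freq (axis i (-1)) \<bullet> x = - (x $ i)" for x :: "real^3"
  proof -
    have "freq (axis i c) = axis i (of_int c)" for c
      by (simp add: vec_eq_iff axis_def)
    then show "freq (axis i 1) \<bullet> x = x $ i" "freq (axis i (-1)) \<bullet> x = - (x $ i)"
      by (simp_all add: inner_axis')
  qed
  have "trig_poly (\<lambda>x. 1/2 * character (axis i 1) x + 1/2 * character (axis i (-1)) x)"
    by (intro trig_poly.intros)
  moreover have "1/2 * character (axis i 1) x + 1/2 * character (axis i (-1)) x = complex_of_real (cos (x $ i))" for x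
    by (simp add: * complex_eq_iff)
  ultimately show "trig_poly (\<lambda>x. complex_of_real (cos (x $ i)))" by simp
  have "trig_poly (\<lambda>x. (-\<i>/2) * character (axis i 1) x + (\<i>/2) * character (axis i (-1)) x)"
    by (intro trig_poly.intros)
  moreover have "(-\<i>/2) * character (axis i 1) x + (\<i>/2) * character (axis i (-1)) x = complex_of_real (sin (x $ i))" for x
    by (simp add: * complex_eq_iff)
  ultimately show "trig_poly (\<lambda>x. complex_of_real (sin (x $ i)))" by simp
qed

text \<open>
  The pairs \<open>(cos x\<^sub>i, sin x\<^sub>i)\<close> realise the torus as a compact subset of a Euclidean space. Real
  polynomials restricted to it are the real trigonometric polynomials, which makes the
  Stone-Weierstrass theorem applicable.
\<close>

definition torus_embedding :: "real^3 \<Rightarrow> (real^3) \<times> (real^3)" where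
  "torus_embedding x = ((\<chi> i. cos (x $ i)), (\<chi> i. sin (x $ i)))"

lemma trig_poly_of_polynomial:
  assumes "real_polynomial_function p"
  shows "trig_poly (\<lambda>x. complex_of_real (p (torus_embedding x)))"
  using assms
proof (induction p rule: real_polynomial_function.induct)
  case (linear f)
  have f: "linear f" using linear by (rule bounded_linear.linear)
  have "f (torus_embedding x) = (\<Sum>i\<in>UNIV. cos (x $ i) * f (axis i 1, 0) + sin (x $ i) * f (0, axis i 1))" for x
  proof -
    have 1: "torus_embedding x = (\<Sum>i\<in>UNIV. cos (x $ i) *\<^sub>R (axis i 1, 0) + sin (x $ i) *\<^sub>R (0, axis i 1))"
      by (auto simp: torus_embedding_def prod_eq_iff fst_sum snd_sum vec_eq_iff axis_def if_distrib cong: if_cong)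
    show ?thesis
      unfolding 1 by (subst linear_sum[OF f], intro sum.cong refl, subst linear_add[OF f],
          subst (1 2) linear_cmul[OF f]) simp
  qed
  then show ?case
    by (simp, intro trig_poly_sum trig_poly_add trig_poly_mult trig_poly_cos trig_poly_sin trig_poly_const) auto
next
  case (const c)
  show ?case by (rule trig_poly_const)
next
  case (add f g)
  then show ?case using trig_poly_add by simp
next
  case (mult f g)
  then show ?case using trig_poly_mult by simp
qed

lemma torus_embedding_eq_imp:
  assumes "x \<in> cube" "y \<in> cube" "torus_embedding x = torus_embedding y"
  shows "x = y \<or> x \<notin> open_cube \<and> y \<notin> open_cube"
proof (rule ccontr)
  assume neg: "\<not> (x = y \<or> x \<notin> open_cube \<and> y \<notin> open_cube)"
  then obtain i where i: "x $ i \<noteq> y $ i" by (auto simp: vec_eq_iff)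
  have "sin (x $ i) = sin (y $ i) \<and> cos (x $ i) = cos (y $ i)"
    using assms(3) by (auto simp: torus_embedding_def vec_eq_iff)
  then obtain n :: int where n: "x $ i = y $ i + 2 * pi * n"
    unfolding sin_cos_eq_iff by blast
  have b: "0 \<le> x $ i" "x $ i \<le> 2 * pi" "0 \<le> y $ i" "y $ i \<le> 2 * pi"
    using assms(1,2) by (auto simp: mem_cube_iff)
  have "n \<noteq> 0" using n i by auto
  moreover have "n \<le> 1"
  proof (rule ccontr)
    assume "\<not> n \<le> 1"
    then have "2 * pi * 2 \<le> 2 * pi * of_int n" by (intro mult_left_mono) auto
    then show False using n b pi_gt_zero by linarith
  qed
  moreover have "n \<ge> -1"
  proof (rule ccontr)
    assume "\<not> n \<ge> -1"
    then have "2 * pi * of_int n \<le> 2 * pi * (-2)" by (intro mult_left_mono) auto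
    then show False using n b pi_gt_zero by linarith
  qed
  ultimately have "n = 1 \<or> n = -1" by linarith
  then have "\<not> (0 < x $ i \<and> x $ i < 2 * pi)" "\<not> (0 < y $ i \<and> y $ i < 2 * pi)"
    using n b by auto
  then have "x \<notin> open_cube \<and> y \<notin> open_cube"
    unfolding mem_open_cube_iff by blast
  then show False using neg by blast
qed

text \<open>
  The boundary condition makes \<open>h\<close> compatible with the identification of opposite faces, so it
  descends to a continuous function on the image of the torus embedding, where Stone-Weierstrass
  applies.
\<close>

lemma trig_poly_uniform_approx:
  fixes h :: "real^3 \<Rightarrow> real"
  assumes cont: "continuous_on cube h" and bd: "\<And>x. x \<in> cube \<Longrightarrow> x \<notin> open_cube \<Longrightarrow> h x = 0" and "e > 0"
  obtains p where "trig_poly (\<lambda>x. complex_of_real (p x))" "\<And>x. x \<in> cube \<Longrightarrow> \<bar>h x - p x\<bar> < e"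
proof -
  define T where "T = torus_embedding ` cube"
  define g where "g s = h (SOME x. x \<in> cube \<and> torus_embedding x = s)" for s
  have cont_E: "continuous_on cube torus_embedding"
    unfolding torus_embedding_def[abs_def] by (intro continuous_intros)
  have comp: "compact T"
    unfolding T_def by (intro compact_continuous_image cont_E) auto
  have g: "g (torus_embedding x) = h x" if "x \<in> cube" for x
  proof -
    have "\<exists>y. y \<in> cube \<and> torus_embedding y = torus_embedding x" using that by blast
    from someI_ex[OF this] show ?thesis
      unfolding g_def using torus_embedding_eq_imp[of x] that bd by (metis (no_types, lifting))
  qed
  have "continuous_on T g"
    unfolding continuous_on_open
  proof safe
    fix U assume U: "openin (top_of_set (g ` T)) U"
    have hg: "h ` cube = g ` T"
      unfolding T_def using g by (auto simp: image_image)
    have "openin (top_of_set cube) (cube \<inter> h -` U)"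
      using cont U hg unfolding continuous_on_open by simp
    moreover have "cube \<inter> h -` U = cube \<inter> torus_embedding -` (T \<inter> g -` U)"
    proof (rule set_eqI)
      fix x show "x \<in> cube \<inter> h -` U \<longleftrightarrow> x \<in> cube \<inter> torus_embedding -` (T \<inter> g -` U)"
        by (cases "x \<in> cube") (simp_all add: g T_def)
    qed
    ultimately have "openin (top_of_set cube) (cube \<inter> torus_embedding -` (T \<inter> g -` U))" by simp
    then show "openin (top_of_set T) (T \<inter> g -` U)"
      using Abstract_Topology_2.continuous_imp_quotient_map[OF cont_E T_def[symmetric], of "T \<inter> g -` U"] by simp
  qed
  from Stone_Weierstrass_real_polynomial_function[OF comp this \<open>e > 0\<close>]
  obtain q where q: "real_polynomial_function q" "\<And>x. x \<in> T \<Longrightarrow> \<bar>g x - q x\<bar> < e" by blast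
  show ?thesis
  proof (rule that[of "\<lambda>x. q (torus_embedding x)"])
    show "trig_poly (\<lambda>x. complex_of_real (q (torus_embedding x)))"
      by (rule trig_poly_of_polynomial[OF q(1)])
    show "\<bar>h x - q (torus_embedding x)\<bar> < e" if "x \<in> cube" for x
      using q(2)[of "torus_embedding x"] g[OF that] that by (auto simp: T_def)
  qed
qed

text \<open>
  A bounded measurable function is an almost everywhere limit of continuous functions. Clipping
  them to \<open>[-1, 1]\<close> and multiplying by a cutoff that vanishes on the boundary and tends to 1
  inside makes them uniformly approximable by trigonometric polynomials. The uniform bound of the
  approximants is what dominated convergence needs in the applications.
\<close>

lemma trig_poly_AE_approx:
  fixes g :: "real^3 \<Rightarrow> real"
  assumes g: "g \<in> borel_measurable torus" and bound: "\<And>x. \<bar>g x\<bar> \<le> 1"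
  obtains p where "\<And>n. trig_poly (\<lambda>x. complex_of_real (p n x))"
    "\<And>n x. x \<in> cube \<Longrightarrow> \<bar>p n x\<bar> \<le> 2" "AE x in torus. (\<lambda>n. p n x) \<longlonglongrightarrow> g x"
proof -
  define g' where "g' x = (if x \<in> cube then g x else 0)" for x
  have "(\<lambda>x. indicator cube x *\<^sub>R g x) \<in> borel_measurable lborel"
    using g unfolding torus_def by (subst (asm) borel_measurable_restrict_space_iff) auto
  moreover have "(\<lambda>x. indicator cube x *\<^sub>R g x) = g'"
    by (auto simp: g'_def)
  ultimately have "g' \<in> borel_measurable lebesgue"
    by (intro measurable_completion) simp
  then have "g' measurable_on UNIV"
    by (simp add: measurable_on_iff_borel_measurable lebesgue_on_UNIV_eq)
  then obtain N q where N: "negligible N" and q: "\<And>n. continuous_on UNIV (q n)"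
    and lim: "\<And>x. x \<notin> N \<Longrightarrow> (\<lambda>n. q n x) \<longlonglongrightarrow> g' x"
    unfolding measurable_on_def by auto
  \<comment> \<open>\<open>d\<close> vanishes exactly on the boundary of the cube, so the cutoff \<open>min 1 (n d)\<close> tends to 1
    inside.\<close>
  define d where "d x = (\<Prod>i\<in>UNIV. x $ i * (2 * pi - x $ i))" for x :: "real^3"
  define h where "h n x = max (-1) (min 1 (q n x)) * min 1 (real n * d x)" for n x
  have d0: "d x = 0" if bd: "x \<in> cube" "x \<notin> open_cube" for x
  proof -
    obtain i where "\<not> (0 < x $ i \<and> x $ i < 2 * pi)"
      using bd(2) unfolding mem_open_cube_iff by blast
    moreover have "0 \<le> x $ i" "x $ i \<le> 2 * pi"
      using bd(1) by (auto simp: mem_cube_iff)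
    ultimately have "x $ i * (2 * pi - x $ i) = 0" by auto
    then show ?thesis unfolding d_def by (intro prod_zero bexI[of _ i]) auto
  qed
  have dnn: "d x \<ge> 0" if "x \<in> cube" for x
    using that unfolding d_def mem_cube_iff by (intro prod_nonneg) auto
  have dpos: "d x > 0" if "x \<in> open_cube" for x
    using that unfolding d_def mem_open_cube_iff by (intro prod_pos) auto
  have h_bound: "\<bar>h n x\<bar> \<le> 1" if "x \<in> cube" for n x
  proof -
    have "\<bar>max (-1) (min 1 (q n x))\<bar> \<le> 1" "\<bar>min 1 (real n * d x)\<bar> \<le> 1"
      using dnn[OF that] by (auto simp: abs_le_iff)
    then show ?thesis unfolding h_def abs_mult by (intro mult_le_one) auto
  qed
  have "\<exists>p. trig_poly (\<lambda>x. complex_of_real (p x)) \<and> (\<forall>x\<in>cube. \<bar>h n x - p x\<bar> < inverse (real (Suc n)))" for n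
  proof -
    have "continuous_on cube (h n)"
      unfolding h_def d_def by (intro continuous_intros continuous_on_subset[OF q]) auto
    moreover have "h n x = 0" if "x \<in> cube" "x \<notin> open_cube" for x
      using d0[OF that] by (simp add: h_def)
    moreover have "0 < inverse (real (Suc n))" by simp
    ultimately obtain p where "trig_poly (\<lambda>x. complex_of_real (p x))"
        "\<And>x. x \<in> cube \<Longrightarrow> \<bar>h n x - p x\<bar> < inverse (real (Suc n))"
      by (rule trig_poly_uniform_approx) auto
    then show ?thesis by blast
  qed
  then obtain p where p: "\<And>n. trig_poly (\<lambda>x. complex_of_real (p n x))"
    and ph: "\<And>n x. x \<in> cube \<Longrightarrow> \<bar>h n x - p n x\<bar> < inverse (real (Suc n))"
    by metis
  show ?thesis
  proof (rule that[OF p])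
    fix n x assume x: "x \<in> cube"
    have "inverse (real (Suc n)) \<le> 1" by (simp add: field_simps)
    then show "\<bar>p n x\<bar> \<le> 2" using ph[OF x, of n] h_bound[OF x, of n] by linarith
  next
    have "AE x in lebesgue. x \<notin> N"
      by (intro AE_not_in) (use N in \<open>simp add: negligible_iff_null_sets\<close>)
    then have "AE x in torus. x \<notin> N"
      unfolding AE_torus_iff AE_completion_iff by auto
    with AE_torus_interior show "AE x in torus. (\<lambda>n. p n x) \<longlonglongrightarrow> g x"
    proof eventually_elim
      case (elim x)
      then have "x \<in> open_cube" by simp
      then have x: "x \<in> cube" using box_subset_cbox by blast
      have "(\<lambda>n. max (-1) (min 1 (q n x))) \<longlonglongrightarrow> max (-1) (min 1 (g' x))"
        using lim[of x] elim by (intro tendsto_intros) auto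
      also have "max (-1) (min 1 (g' x)) = g x"
        using bound[of x] x by (auto simp: g'_def)
      finally have 1: "(\<lambda>n. max (-1) (min 1 (q n x))) \<longlonglongrightarrow> g x" .
      have "\<forall>\<^sub>F n in sequentially. min 1 (real n * d x) = 1"
      proof -
        have "\<forall>\<^sub>F n in sequentially. real n \<ge> 1 / d x"
          using filterlim_real_sequentially unfolding filterlim_at_top by blast
        then show ?thesis
        proof eventually_elim
          case (elim n)
          then have "1 \<le> real n * d x"
            using dpos[OF \<open>x \<in> open_cube\<close>] by (simp add: divide_le_eq)
          then show ?case by simp
        qed
      qed
      then have "(\<lambda>n. min 1 (real n * d x)) \<longlonglongrightarrow> 1"
        by (rule tendsto_eventually)
      from tendsto_mult[OF 1 this] have 2: "(\<lambda>n. h n x) \<longlonglongrightarrow> g x"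
        by (simp add: h_def)
      have "(\<lambda>n. h n x - p n x) \<longlonglongrightarrow> 0"
      proof (rule Lim_null_comparison[OF always_eventually LIMSEQ_inverse_real_of_nat], rule allI)
        show "norm (h n x - p n x) \<le> inverse (real (Suc n))" for n
          using ph[OF x, of n] by simp
      qed
      from tendsto_diff[OF 2 this] show ?case by simp
    qed
  qed
qed

lemma integral_trig_poly_eq_0:
  fixes f :: "real^3 \<Rightarrow> complex"
  assumes f: "integrable torus f" and 0: "\<And>k. (LINT x|torus. f x * character k x) = 0"
    and p: "trig_poly p"
  shows "integrable torus (\<lambda>x. f x * p x) \<and> (LINT x|torus. f x * p x) = 0"
  using p
proof (induction p rule: trig_poly.induct)
  case (trig_poly_character c k)
  have "f x * (c * character k x) = c * (f x * character k x)" for x by (simp add: mult_ac)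
  then show ?case
    using integrable_mult_character[OF f, of k] 0[of k] by (simp only:) simp
next
  case (trig_poly_add p q)
  then show ?case by (simp add: distrib_left)
qed

text \<open>
  Testing \<open>f\<close> against uniformly bounded trigonometric polynomials that converge to \<open>sgn f\<close> gives
  \<open>\<integral> |f| = 0\<close>.
\<close>

lemma AE_eq_0_if_coeffs_0_real:
  fixes f :: "real^3 \<Rightarrow> real"
  assumes f: "integrable torus f"
    and 0: "\<And>k. (LINT x|torus. complex_of_real (f x) * character k x) = 0"
  shows "AE x in torus. f x = 0"
proof -
  have [measurable]: "f \<in> borel_measurable torus" using f by auto
  have fc: "integrable torus (\<lambda>x. complex_of_real (f x))" using f by simp
  obtain p where p: "\<And>n. trig_poly (\<lambda>x. complex_of_real (p n x))"
    and p2: "\<And>n x. x \<in> cube \<Longrightarrow> \<bar>p n x\<bar> \<le> 2"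
    and lim: "AE x in torus. (\<lambda>n. p n x) \<longlonglongrightarrow> sgn (f x)"
    by (rule trig_poly_AE_approx[of "\<lambda>x. sgn (f x)"]) (auto simp: abs_sgn_eq)
  have pm: "p n \<in> borel_measurable torus" for n
  proof -
    have "(\<lambda>x. Re (complex_of_real (p n x))) \<in> borel_measurable torus"
      using trig_poly_measurable[OF p] by measurable
    then show ?thesis by simp
  qed
  have zero: "(LINT x|torus. f x * p n x) = 0" for n
  proof -
    have "(LINT x|torus. complex_of_real (f x) * complex_of_real (p n x)) = 0"
      using integral_trig_poly_eq_0[OF fc 0 p] by blast
    then have "complex_of_real (LINT x|torus. f x * p n x) = 0"
      by (subst integral_complex_of_real[symmetric]) simp
    then show ?thesis by simp
  qed
  have "(\<lambda>n. LINT x|torus. f x * p n x) \<longlonglongrightarrow> (LINT x|torus. f x * sgn (f x))"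
  proof (rule integral_dominated_convergence[where w = "\<lambda>x. 2 * \<bar>f x\<bar>"])
    show "AE x in torus. (\<lambda>n. f x * p n x) \<longlonglongrightarrow> f x * sgn (f x)"
      using lim by eventually_elim (intro tendsto_intros)
    show "AE x in torus. norm (f x * p n x) \<le> 2 * \<bar>f x\<bar>" for n
      using p2[of _ n] by (intro AE_I2) (auto simp: abs_mult mult.commute intro!: mult_left_mono)
  qed (use f pm in auto)
  then have "(LINT x|torus. \<bar>f x\<bar>) = 0"
    unfolding zero abs_sgn by (simp only: LIMSEQ_const_iff)
  then show ?thesis
    using integral_nonneg_eq_0_iff_AE[of torus "\<lambda>x. \<bar>f x\<bar>"] f by auto
qed

text \<open>
  The coefficients of the complex conjugate vanish as well, so the real case applies to the real
  and imaginary parts.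
\<close>

lemma AE_eq_0_if_coeffs_0:
  fixes f :: "real^3 \<Rightarrow> complex"
  assumes f: "integrable torus f" and 0: "\<And>k. (LINT x|torus. f x * character k x) = 0"
  shows "AE x in torus. f x = 0"
proof -
  have cnj0: "(LINT x|torus. cnj (f x) * character k x) = 0" for k
  proof -
    have "(LINT x|torus. cnj (f x) * character k x) = (LINT x|torus. cnj (f x * character (- k) x))"
      by (intro Bochner_Integration.integral_cong refl) (simp add: freq_minus complex_eq_iff)
    also have "\<dots> = cnj (LINT x|torus. f x * character (- k) x)"
      by (rule Bochner_Integration.integral_cnj)
    finally have "(LINT x|torus. cnj (f x) * character k x) = cnj (LINT x|torus. f x * character (- k) x)" .
    then show ?thesis using 0 by simp
  qed
  have fi: "integrable torus (\<lambda>x. cnj (f x))" using f by simp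
  have *: "complex_of_real (Re (f x)) = (f x + cnj (f x)) / 2" "complex_of_real (Im (f x)) = (f x - cnj (f x)) / (2 * \<i>)" for x
    by (auto simp: complex_eq_iff)
  have "AE x in torus. Re (f x) = 0"
  proof (rule AE_eq_0_if_coeffs_0_real)
    fix k
    have eq: "complex_of_real (Re (f x)) * character k x = (f x * character k x + cnj (f x) * character k x) / 2" for x
      by (simp add: * algebra_simps add_divide_distrib)
    then show "(LINT x|torus. complex_of_real (Re (f x)) * character k x) = 0"
      unfolding eq using integrable_mult_character[OF f] integrable_mult_character[OF fi] 0 cnj0 by simp
  qed (use f in auto)
  moreover have "AE x in torus. Im (f x) = 0"
  proof (rule AE_eq_0_if_coeffs_0_real)
    fix k
    have eq: "complex_of_real (Im (f x)) * character k x = (f x * character k x - cnj (f x) * character k x) / (2 * \<i>)" for x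
      by (simp add: * algebra_simps diff_divide_distrib)
    then show "(LINT x|torus. complex_of_real (Im (f x)) * character k x) = 0"
      unfolding eq using integrable_mult_character[OF f] integrable_mult_character[OF fi] 0 cnj0 by simp
  qed (use f in auto)
  ultimately show ?thesis by eventually_elim (simp add: complex_eq_iff)
qed

section \<open>Fourier coefficients and absolutely convergent series\<close>

lemma measurable_pair_lattice:
  assumes "\<And>k. F k \<in> measurable M K"
  shows "(\<lambda>(k, x). F k x) \<in> measurable (lattice \<Otimes>\<^sub>M M) K"
  by (rule measurable_pair_measure_countable1) (auto intro: assms)

lemma measurable_pair_lattice_swap:
  assumes "\<And>k. F k \<in> measurable M K"
  shows "(\<lambda>(x, k). F k x) \<in> measurable (M \<Otimes>\<^sub>M lattice) K"
  using measurable_pair_swap[OF measurable_pair_lattice[of F, OF assms]]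
  by (simp add: case_prod_beta')

text \<open>
  Products of functions on the torus with characters are complex, so the coefficients are also
  needed for complex functions.
\<close>

definition coef :: "(real^3 \<Rightarrow> complex) \<Rightarrow> int^3 \<Rightarrow> complex" where
  "coef f k = (LINT x|torus. f x * character (- k) x) / complex_of_real ((2 * pi) ^ 3)"

lemma fourier_coeff_eq_coef: "fourier_coeff f k = coef (\<lambda>x. complex_of_real (f x)) k"
  by (simp add: fourier_coeff_def coef_def freq_minus)

lemma coef_add:
  assumes "integrable torus f" "integrable torus g"
  shows "coef (\<lambda>x. f x + g x) k = coef f k + coef g k"
  using assms by (simp add: coef_def distrib_right integrable_mult_character add_divide_distrib)

lemma coef_diff:
  assumes "integrable torus f" "integrable torus g"
  shows "coef (\<lambda>x. f x - g x) k = coef f k - coef g k"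
  using assms by (simp add: coef_def left_diff_distrib integrable_mult_character diff_divide_distrib)

lemma coef_cmult: "coef (\<lambda>x. c * f x) k = c * coef f k"
  by (simp add: coef_def mult.assoc)

lemma coef_cong_AE:
  assumes "f \<in> borel_measurable torus" "g \<in> borel_measurable torus" "AE x in torus. f x = g x"
  shows "coef f k = coef g k"
proof -
  have [measurable]: "(\<lambda>x. character (- k) x) \<in> borel_measurable torus"
    by (intro borel_imp_torus_measurable borel_measurable_continuous_onI continuous_intros)
  have "(LINT x|torus. f x * character (- k) x) = (LINT x|torus. g x * character (- k) x)"
    using assms by (intro integral_cong_AE) auto
  then show ?thesis by (simp add: coef_def)
qed

lemma coef_cnj: "coef (\<lambda>x. cnj (f x)) k = cnj (coef f (- k))"
proof -
  have "(LINT x|torus. cnj (f x) * character (- k) x) = (LINT x|torus. cnj (f x * character k x))"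
    by (intro Bochner_Integration.integral_cong refl) (simp add: freq_minus complex_eq_iff)
  also have "\<dots> = cnj (LINT x|torus. f x * character k x)"
    by (rule Bochner_Integration.integral_cnj)
  finally show ?thesis by (simp add: coef_def)
qed

lemma fourier_coeff_minus: "fourier_coeff f (- k) = cnj (fourier_coeff f k)"
  using coef_cnj[of "\<lambda>x. complex_of_real (f x)" "- k"] by (simp add: fourier_coeff_eq_coef)

lemma norm_coef_le: "cmod (coef f k) \<le> (LINT x|torus. cmod (f x)) / (2 * pi) ^ 3"
proof -
  have "cmod (LINT x|torus. f x * character (- k) x) \<le> (LINT x|torus. cmod (f x * character (- k) x))"
    by (rule integral_norm_bound)
  then show ?thesis
    by (simp add: coef_def norm_divide norm_mult norm_power divide_right_mono)
qed

lemma AE_eq_if_coef_eq: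
  assumes f: "integrable torus f" and g: "integrable torus g" and eq: "\<And>k. coef f k = coef g k"
  shows "AE x in torus. f x = g x"
proof -
  have "(LINT x|torus. (f x - g x) * character k x) = 0" for k
    using coef_diff[OF f g, of "- k"] eq[of "- k"] by (simp add: coef_def)
  from AE_eq_0_if_coeffs_0[OF Bochner_Integration.integrable_diff[OF f g] this]
  show ?thesis by simp
qed

definition fseries :: "(int^3 \<Rightarrow> complex) \<Rightarrow> real^3 \<Rightarrow> complex" where
  "fseries c x = (LINT k|lattice. c k * character k x)"

lemma character_measurable [measurable]: "(\<lambda>x. character k x) \<in> borel_measurable borel"
  by (intro borel_measurable_continuous_onI continuous_intros)

lemma character_torus_measurable [measurable]: "(\<lambda>x. character k x) \<in> borel_measurable torus"
  by (intro borel_imp_torus_measurable character_measurable)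

lemma integrable_fseries: "integrable lattice c \<Longrightarrow> integrable lattice (\<lambda>k. c k * character k x)"
  by (rule Bochner_Integration.integrable_bound[of _ c]) (auto simp: norm_mult)

lemma fseries_measurable_borel: "fseries c \<in> borel_measurable borel"
proof -
  interpret sigma_finite_measure lattice by (rule sigma_finite_lattice)
  have "(\<lambda>(x, k). c k * character k x) \<in> borel_measurable (borel \<Otimes>\<^sub>M lattice)"
    by (rule measurable_pair_lattice_swap) measurable
  then show ?thesis
    unfolding fseries_def[abs_def] by (rule borel_measurable_lebesgue_integral)
qed

lemma fseries_measurable [measurable]: "fseries c \<in> borel_measurable torus"
  by (intro borel_imp_torus_measurable fseries_measurable_borel)

lemma norm_fseries_le:
  assumes "integrable lattice c"
  shows "cmod (fseries c x) \<le> (LINT k|lattice. cmod (c k))"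
proof -
  have "cmod (fseries c x) \<le> (LINT k|lattice. cmod (c k * character k x))"
    unfolding fseries_def by (rule integral_norm_bound)
  then show ?thesis by (simp add: norm_mult)
qed

lemma fseries_integrable: "integrable lattice c \<Longrightarrow> integrable torus (fseries c)"
  by (rule torus.integrable_const_bound[of _ "LINT k|lattice. cmod (c k)"])
    (auto intro: norm_fseries_le)

lemma fseries_add:
  "integrable lattice c \<Longrightarrow> integrable lattice d \<Longrightarrow> fseries (\<lambda>k. c k + d k) x = fseries c x + fseries d x"
  by (simp add: fseries_def distrib_right integrable_fseries)

lemma fseries_diff:
  "integrable lattice c \<Longrightarrow> integrable lattice d \<Longrightarrow> fseries (\<lambda>k. c k - d k) x = fseries c x - fseries d x"
  by (simp add: fseries_def left_diff_distrib integrable_fseries)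

lemma integral_mult_fseries:
  assumes f: "integrable torus f" and c: "integrable lattice c"
  shows "integrable torus (\<lambda>x. f x * fseries c x)"
    and "integrable lattice (\<lambda>k. c k * (LINT x|torus. f x * character k x))"
    and "(LINT x|torus. f x * fseries c x) = (LINT k|lattice. c k * (LINT x|torus. f x * character k x))"
proof -
  interpret P: pair_sigma_finite torus lattice
    by (intro pair_sigma_finite.intro sigma_finite_lattice torus.sigma_finite_measure_axioms)
  have [measurable]: "f \<in> borel_measurable torus" using f by auto
  have meas: "(\<lambda>(x, k). f x * (c k * character k x)) \<in> borel_measurable (torus \<Otimes>\<^sub>M lattice)"
    by (rule measurable_pair_lattice_swap) measurable
  have int: "integrable (torus \<Otimes>\<^sub>M lattice) (\<lambda>(x, k). f x * (c k * character k x))"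
    by (rule P.Fubini_integrable[OF meas])
      (auto simp: norm_mult f intro!: Bochner_Integration.integrable_mult_right integrable_fseries c AE_I2)
  have 2: "(LINT x|torus. f x * (c k * character k x)) = c k * (LINT x|torus. f x * character k x)" for k
    by (simp add: mult.left_commute[of _ "c k"])
  show "integrable torus (\<lambda>x. f x * fseries c x)"
    using P.integrable_fst'[OF int] by (simp add: fseries_def)
  show "integrable lattice (\<lambda>k. c k * (LINT x|torus. f x * character k x))"
    using P.integrable_snd[OF int] by (simp add: 2)
  show "(LINT x|torus. f x * fseries c x) = (LINT k|lattice. c k * (LINT x|torus. f x * character k x))"
    using P.Fubini_integral[OF int] by (simp add: fseries_def 2)
qed

lemma character_add: "character (k + l) x = character k x * character l x"
  by (simp add: freq_add inner_add_left cis_mult)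

lemma lattice_integral_delta: "(LINT l|lattice. (if l = k then c else 0) :: complex) = c"
proof -
  have "(\<lambda>l. if l = k then c else 0) = (\<lambda>l. indicator {k} l *\<^sub>R c)"
    by (auto simp: indicator_def)
  then show ?thesis by (simp add: measure_def)
qed

text \<open>
  A product of functions has the convolution of the coefficients; with one factor an absolutely
  convergent series this is Fubini.
\<close>

lemma coef_mult_fseries:
  assumes f: "integrable torus f" and c: "integrable lattice c"
  shows "coef (\<lambda>x. f x * fseries c x) k = (LINT l|lattice. c l * coef f (k - l))"
proof -
  have "(LINT x|torus. f x * fseries c x * character (- k) x)
      = (LINT x|torus. (f x * character (- k) x) * fseries c x)"
    by (simp add: mult_ac)
  also have "\<dots> = (LINT l|lattice. c l * (LINT x|torus. (f x * character (- k) x) * character l x))"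
    by (rule integral_mult_fseries[OF integrable_mult_character[OF f] c])
  also have "\<dots> = (LINT l|lattice. c l * (LINT x|torus. f x * character (- (k - l)) x))"
    by (simp add: mult.assoc character_add[symmetric] add.commute)
  also have "\<dots> = (LINT l|lattice. c l * coef f (k - l)) * complex_of_real ((2 * pi) ^ 3)"
    by (simp add: coef_def)
  finally show ?thesis by (simp add: coef_def[of "\<lambda>x. f x * fseries c x"])
qed

lemma coef_const: "coef (\<lambda>x. c) k = (if k = 0 then c else 0)"
proof -
  have "coef (\<lambda>x. c) k = c * (LINT x|torus. character (- k) x) / complex_of_real ((2 * pi) ^ 3)"
    by (simp add: coef_def)
  then show ?thesis by (simp only: character_integral) auto
qed

lemma coef_fseries:
  assumes "integrable lattice c"
  shows "coef (fseries c) k = c k"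
proof -
  have "coef (fseries c) k = (LINT l|lattice. c l * coef (\<lambda>x. 1) (k - l))"
    using coef_mult_fseries[of "\<lambda>x. 1" c k] assms by simp
  also have "\<dots> = (LINT l|lattice. (if l = k then c k else 0))"
    by (intro Bochner_Integration.integral_cong refl) (auto simp: coef_const)
  finally show ?thesis by (simp add: lattice_integral_delta)
qed

lemma fseries_cnj:
  assumes "\<And>k. c (- k) = cnj (c k)"
  shows "cnj (fseries c x) = fseries c x"
proof -
  have "cnj (fseries c x) = (LINT k|lattice. cnj (c k * character k x))"
    unfolding fseries_def by (rule Bochner_Integration.integral_cnj[symmetric])
  also have "\<dots> = (LINT k|lattice. c (- k) * character (- k) x)"
    by (intro Bochner_Integration.integral_cong refl) (simp add: freq_minus assms complex_eq_iff)
  also have "\<dots> = fseries c x"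
    unfolding fseries_def
    by (rule integral_bij_count_space[where g = uminus]) (auto simp: bij_betw_def inj_on_def surj_def intro: exI[of _ "- _"])
  finally show ?thesis .
qed

lemma parseval_fseries:
  assumes c: "integrable lattice c"
  shows "integrable lattice (\<lambda>k. (cmod (c k))\<^sup>2)"
    and "integrable torus (\<lambda>x. (cmod (fseries c x))\<^sup>2)"
    and "(LINT x|torus. (cmod (fseries c x))\<^sup>2) = (2 * pi) ^ 3 * (LINT k|lattice. (cmod (c k))\<^sup>2)"
proof -
  have int: "integrable torus (\<lambda>x. cnj (fseries c x))"
    using fseries_integrable[OF c] by simp
  have cc: "(LINT x|torus. cnj (fseries c x) * character k x) = complex_of_real ((2 * pi) ^ 3) * cnj (c k)" for k
    using coef_cnj[of "fseries c" "- k"] coef_fseries[OF c, of k] by (simp add: coef_def field_simps)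
  have n2: "cnj z * z = complex_of_real ((cmod z)\<^sup>2)" for z
    by (metis complex_norm_square mult.commute of_real_power)
  have *: "c k * (complex_of_real ((2 * pi) ^ 3) * cnj (c k)) = complex_of_real ((2 * pi) ^ 3 * (cmod (c k))\<^sup>2)" for k
    using n2[of "c k"] by (simp add: mult_ac)
  note I = integral_mult_fseries[OF int c, unfolded cc * n2]
  show "integrable torus (\<lambda>x. (cmod (fseries c x))\<^sup>2)"
    using I(1) by (simp only: complex_of_real_integrable_eq)
  from I(2) have "integrable lattice (\<lambda>k. (2 * pi) ^ 3 * (cmod (c k))\<^sup>2)"
    by (simp only: complex_of_real_integrable_eq)
  then show "integrable lattice (\<lambda>k. (cmod (c k))\<^sup>2)" by simp
  have "complex_of_real (LINT x|torus. (cmod (fseries c x))\<^sup>2)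
      = complex_of_real (LINT k|lattice. (2 * pi) ^ 3 * (cmod (c k))\<^sup>2)"
    using I(3) by (simp only: integral_complex_of_real)
  then show "(LINT x|torus. (cmod (fseries c x))\<^sup>2) = (2 * pi) ^ 3 * (LINT k|lattice. (cmod (c k))\<^sup>2)"
    by (simp only: of_real_eq_iff) simp
qed

text \<open>
  For a finite set of frequencies, expand \<open>0 \<le> \<integral> |f - P|\<^sup>2\<close> with \<open>P\<close> the corresponding partial sum
  of the Fourier series.
\<close>

lemma bessel:
  fixes f :: "real^3 \<Rightarrow> complex"
  assumes f[measurable]: "f \<in> borel_measurable torus" and f2: "integrable torus (\<lambda>x. (cmod (f x))\<^sup>2)"
  shows "integrable torus f" "integrable lattice (\<lambda>k. (cmod (coef f k))\<^sup>2)"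
    "(2 * pi) ^ 3 * (LINT k|lattice. (cmod (coef f k))\<^sup>2) \<le> (LINT x|torus. (cmod (f x))\<^sup>2)"
proof -
  show int: "integrable torus f"
  proof (rule Bochner_Integration.integrable_bound[of _ "\<lambda>x. 1 + (cmod (f x))\<^sup>2"])
    have "r \<le> 1 + r\<^sup>2" for r :: real
      using sum_power2_ge_zero[of "r - 1/2" 0] by (simp add: power2_eq_square algebra_simps)
    then show "AE x in torus. norm (f x) \<le> norm (1 + (cmod (f x))\<^sup>2)"
      by (intro AE_I2) (simp add: abs_of_nonneg)
  qed (use f2 in auto)
  have fin: "(2 * pi) ^ 3 * (\<Sum>k\<in>F. (cmod (coef f k))\<^sup>2) \<le> (LINT x|torus. (cmod (f x))\<^sup>2)"
    if F: "finite F" for F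
  proof -
    define c where "c k = (if k \<in> F then coef f k else 0)" for k
    have supp: "(\<lambda>k. norm (c k)) summable_on UNIV"
      by (rule finite_nonzero_values_imp_summable_on, rule finite_subset[OF _ F]) (auto simp: c_def)
    then have c: "integrable lattice c"
      by (simp add: integrable_lattice_iff)
    define P where "P = fseries c"
    note pars = parseval_fseries[OF c]
    have c2: "(LINT k|lattice. (cmod (c k))\<^sup>2) = (\<Sum>k\<in>F. (cmod (coef f k))\<^sup>2)"
    proof -
      have "(LINT k|lattice. (cmod (c k))\<^sup>2) = (\<Sum>\<^sub>\<infinity>k. (cmod (c k))\<^sup>2)"
        by (rule infsum_eq_lattice_integral[OF pars(1), symmetric])
      also have "\<dots> = (\<Sum>\<^sub>\<infinity>k\<in>F. (cmod (coef f k))\<^sup>2)"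
        by (intro infsum_cong_neutral) (auto simp: c_def)
      finally show ?thesis using F by simp
    qed
    have cnjf: "integrable torus (\<lambda>x. cnj (f x))" using int by simp
    have cc: "(LINT x|torus. cnj (f x) * character k x) = complex_of_real ((2 * pi) ^ 3) * cnj (coef f k)" for k
      using coef_cnj[of f "- k"] by (simp add: coef_def field_simps)
    have *: "c k * (complex_of_real ((2 * pi) ^ 3) * cnj (coef f k)) = complex_of_real ((2 * pi) ^ 3 * (cmod (c k))\<^sup>2)" for k
      by (simp add: c_def complex_norm_square[symmetric] mult_ac del: of_real_power)
    note I = integral_mult_fseries[OF cnjf c, unfolded cc *]
    have cross: "(LINT x|torus. Re (cnj (f x) * P x)) = (2 * pi) ^ 3 * (LINT k|lattice. (cmod (c k))\<^sup>2)"
    proof -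
      have "(LINT x|torus. Re (cnj (f x) * P x)) = Re (LINT x|torus. cnj (f x) * P x)"
        unfolding P_def by (rule integral_Re[OF I(1)])
      also have "\<dots> = (LINT k|lattice. (2 * pi) ^ 3 * (cmod (c k))\<^sup>2)"
        unfolding P_def I(3) by (subst integral_complex_of_real) simp
      finally show ?thesis by simp
    qed
    have crossint: "integrable torus (\<lambda>x. Re (cnj (f x) * P x))"
      unfolding P_def by (rule integrable_Re[OF I(1)])
    have expand: "(cmod (f x - P x))\<^sup>2 = (cmod (f x))\<^sup>2 - 2 * Re (cnj (f x) * P x) + (cmod (P x))\<^sup>2" for x
      by (simp add: cmod_power2) (simp add: power2_eq_square algebra_simps)
    have "0 \<le> (LINT x|torus. (cmod (f x - P x))\<^sup>2)" by simp
    also have "\<dots> = (LINT x|torus. (cmod (f x))\<^sup>2) - 2 * (LINT x|torus. Re (cnj (f x) * P x)) + (LINT x|torus. (cmod (P x))\<^sup>2)"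
    proof -
      have "(LINT x|torus. a x - 2 * b x + d x) = integral\<^sup>L torus a - 2 * integral\<^sup>L torus b + integral\<^sup>L torus d"
        if "integrable torus a" "integrable torus b" "integrable torus d" for a b d :: "real^3 \<Rightarrow> real"
        using that by simp
      from this[OF f2 crossint pars(2)[folded P_def]] show ?thesis
        unfolding expand .
    qed
    finally show ?thesis
      unfolding cross c2 using pars(3) c2 by (simp add: P_def)
  qed
  have "(\<lambda>k. (cmod (coef f k))\<^sup>2) summable_on UNIV"
  proof (rule nonneg_bdd_above_summable_on)
    show "bdd_above (sum (\<lambda>k. (cmod (coef f k))\<^sup>2) ` {F. F \<subseteq> UNIV \<and> finite F})"
      using fin by (intro bdd_aboveI[of _ "(LINT x|torus. (cmod (f x))\<^sup>2) / (2 * pi) ^ 3"]) (auto simp: field_simps)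
  qed auto
  then show i2: "integrable lattice (\<lambda>k. (cmod (coef f k))\<^sup>2)"
    by (simp add: integrable_lattice_iff)
  have "(\<Sum>\<^sub>\<infinity>k. (cmod (coef f k))\<^sup>2) \<le> (LINT x|torus. (cmod (f x))\<^sup>2) / (2 * pi) ^ 3"
    using fin i2 by (intro infsum_le_finite_sums) (auto simp: field_simps integrable_lattice_iff)
  then show "(2 * pi) ^ 3 * (LINT k|lattice. (cmod (coef f k))\<^sup>2) \<le> (LINT x|torus. (cmod (f x))\<^sup>2)"
    using infsum_eq_lattice_integral[OF i2] by (simp add: field_simps)
qed

section \<open>A summable weight on the lattice\<close>

text \<open>
  The exponent \<open>-2/3\<close> is chosen such that the product of three such factors is of order
  \<open>|k|^(-4)\<close>.
\<close>

lemma summable_on_int_weight: "(\<lambda>n::int. (1 + (real_of_int n)\<^sup>2) powr (- 2 / 3)) summable_on UNIV"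
proof -
  let ?g = "\<lambda>n::int. (1 + (real_of_int n)\<^sup>2) powr (- 2 / 3)"
  have bound: "(1 + (real n)\<^sup>2) powr (- 2 / 3) \<le> real n powr (- 4 / 3)" if "n > 0" for n
  proof -
    have "(1 + (real n)\<^sup>2) powr (- 2 / 3) \<le> ((real n)\<^sup>2) powr (- 2 / 3)"
      using that by (intro powr_mono2') auto
    also have "\<dots> = real n powr (- 4 / 3)"
      using that by (simp add: powr_powr flip: powr_numeral)
    finally show ?thesis .
  qed
  have "summable (\<lambda>n. real n powr (- 4 / 3))"
    by (simp add: summable_real_powr_iff)
  then have "summable (\<lambda>n. (1 + (real n)\<^sup>2) powr (- 2 / 3))"
    by (rule summable_comparison_test_ev[rotated]) (use bound in \<open>auto intro!: eventually_at_top_linorderI[of 1]\<close>)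
  then have 1: "(\<lambda>n. (1 + (real n)\<^sup>2) powr (- 2 / 3)) summable_on UNIV"
    by (intro summable_nonneg_imp_summable_on) auto
  have "?g summable_on range int"
    using 1 by (subst summable_on_reindex) (auto simp: o_def)
  moreover have "?g summable_on range (\<lambda>n. - int n)"
    using 1 by (subst summable_on_reindex) (auto simp: o_def inj_on_def)
  ultimately have "?g summable_on range int \<union> range (\<lambda>n. - int n)"
    by (rule summable_on_union)
  also have "range int \<union> range (\<lambda>n. - int n) = UNIV"
    by (auto intro: int_cases2)
  finally show ?thesis .
qed

lemma norm_freq_ge_1: "k \<noteq> 0 \<Longrightarrow> 1 \<le> norm (freq k)"
proof -
  assume "k \<noteq> 0"
  then obtain i where "k $ i \<noteq> 0" by (auto simp: vec_eq_iff)
  then have "1 \<le> \<bar>freq k $ i\<bar>" by simp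
  also have "\<dots> \<le> norm (freq k)" by (rule component_le_norm_cart)
  finally show ?thesis .
qed

text \<open>
  By the inequality \<open>k\<^sub>i\<^sup>2 \<le> |k|\<^sup>2\<close> the weight is dominated by a product of one-dimensional
  summable weights.
\<close>

lemma integrable_lattice_weight: "integrable lattice (\<lambda>k. 1 / norm (freq k) ^ 4)"
proof -
  define g where "g n = (1 + (real_of_int n)\<^sup>2) powr (- 2 / 3)" for n :: int
  define S where "S = (\<Sum>\<^sub>\<infinity>n. g n)"
  have g0: "g n \<ge> 0" for n by (simp add: g_def)
  have gS: "(\<Sum>n\<in>G. g n) \<le> S" if "finite G" for G
    unfolding S_def using summable_on_int_weight that g0
    by (intro finite_sum_le_infsum) (auto simp: g_def[abs_def])
  have le: "1 / norm (freq k) ^ 4 \<le> 4 * (\<Prod>i\<in>UNIV. g (k $ i))" for k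
  proof (cases "k = 0")
    case True then show ?thesis by (simp add: g_def)
  next
    case False
    define r where "r = (norm (freq k))\<^sup>2"
    have r: "r \<ge> 1" using norm_freq_ge_1[OF False] by (simp add: r_def)
    have "g (k $ i) \<ge> (1 + r) powr (- 2 / 3)" for i
    proof -
      have "\<bar>freq k $ i\<bar> \<le> norm (freq k)" by (rule component_le_norm_cart)
      then have "(real_of_int (k $ i))\<^sup>2 \<le> r"
        unfolding r_def using power_mono[of "\<bar>freq k $ i\<bar>" _ 2] by simp
      then show ?thesis unfolding g_def
        by (intro powr_mono2') (auto intro: add_pos_nonneg)
    qed
    then have "(\<Prod>i\<in>(UNIV :: 3 set). (1 + r) powr (- 2 / 3)) \<le> (\<Prod>i\<in>UNIV. g (k $ i))"
      by (intro prod_mono) auto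
    moreover have "(\<Prod>i\<in>(UNIV :: 3 set). (1 + r) powr (- 2 / 3)) = 1 / (1 + r)\<^sup>2"
    proof -
      have "((1 + r) powr (- 2 / 3)) ^ 3 = (1 + r) powr (- 2)"
        using r by (subst powr_power) auto
      also have "\<dots> = 1 / (1 + r)\<^sup>2"
        using r by (subst powr_minus_divide, subst powr_numeral) auto
      finally show ?thesis by simp
    qed
    moreover have "1 / r\<^sup>2 \<le> 4 * (1 / (1 + r)\<^sup>2)"
    proof -
      have "(1 + r)\<^sup>2 \<le> (2 * r)\<^sup>2" using r by (intro power_mono) auto
      then show ?thesis using r by (simp add: field_simps)
    qed
    moreover have "r\<^sup>2 = norm (freq k) ^ 4" by (simp add: r_def)
    ultimately show ?thesis by simp
  qed
  have "(\<lambda>k. norm (1 / norm (freq k) ^ 4)) summable_on UNIV"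
  proof (rule nonneg_bdd_above_summable_on)
    show "bdd_above (sum (\<lambda>k. norm (1 / norm (freq k) ^ 4)) ` {F. F \<subseteq> UNIV \<and> finite F})"
    proof (rule bdd_aboveI[of _ "4 * S ^ 3"], safe)
      fix F :: "(int^3) set" assume F: "finite F"
      define G where "G = (\<Union>i. (\<lambda>k. k $ i) ` F)"
      have G: "finite G" using F by (auto simp: G_def)
      have "(\<Sum>k\<in>F. norm (1 / norm (freq k) ^ 4)) \<le> (\<Sum>k\<in>F. 4 * (\<Prod>i\<in>UNIV. g (k $ i)))"
        using le by (intro sum_mono) simp
      also have "\<dots> \<le> (\<Sum>k\<in>vec_lambda ` ((UNIV :: 3 set) \<rightarrow>\<^sub>E G). 4 * (\<Prod>i\<in>UNIV. g (k $ i)))"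
      proof (rule sum_mono2)
        show "F \<subseteq> vec_lambda ` ((UNIV :: 3 set) \<rightarrow>\<^sub>E G)"
        proof
          fix k assume "k \<in> F"
          then show "k \<in> vec_lambda ` ((UNIV :: 3 set) \<rightarrow>\<^sub>E G)"
            by (intro image_eqI[where x = "\<lambda>i. k $ i"]) (auto simp: G_def)
        qed
      qed (use G g0 in \<open>auto intro!: finite_PiE prod_nonneg mult_nonneg_nonneg\<close>)
      also have "\<dots> = (\<Sum>h\<in>(UNIV :: 3 set) \<rightarrow>\<^sub>E G. 4 * (\<Prod>i\<in>UNIV. g (h i)))"
        by (subst sum.reindex) (auto simp: inj_on_def vec_lambda_inject)
      also have "\<dots> = 4 * (\<Prod>i\<in>(UNIV :: 3 set). \<Sum>n\<in>G. g n)"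
        by (subst prod_sum_PiE) (auto simp: G sum_distrib_left)
      also have "\<dots> \<le> 4 * S ^ 3"
        using gS[OF G] g0 by (auto intro!: power_mono sum_nonneg)
      finally show "(\<Sum>k\<in>F. norm (1 / norm (freq k) ^ 4)) \<le> 4 * S ^ 3" .
    qed
  qed auto
  then show ?thesis by (simp add: integrable_lattice_iff)
qed

lemma integrable_lattice_decay:
  fixes c :: "int^3 \<Rightarrow> 'b :: {banach, second_countable_topology}"
  assumes "\<And>k. k \<noteq> 0 \<Longrightarrow> norm (c k) \<le> C / norm (freq k) ^ 4"
  shows "integrable lattice c"
proof (rule Bochner_Integration.integrable_bound)
  have "(\<lambda>k. norm (if k = 0 then norm (c 0) else 0)) summable_on (UNIV :: (int^3) set)"
    by (rule finite_nonzero_values_imp_summable_on, rule finite_subset[of _ "{0}"]) auto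
  then have "integrable lattice (\<lambda>k. if k = 0 then norm (c 0) else 0)"
    by (simp only: integrable_lattice_iff)
  moreover have "integrable lattice (\<lambda>k. C * (1 / norm (freq k) ^ 4))"
    by (intro Bochner_Integration.integrable_mult_right integrable_lattice_weight)
  ultimately show "integrable lattice (\<lambda>k. (if k = 0 then norm (c 0) else 0) + C * (1 / norm (freq k) ^ 4))"
    by (rule Bochner_Integration.integrable_add)
  show "AE k in lattice. norm (c k) \<le> norm ((if k = 0 then norm (c 0) else 0) + C * (1 / norm (freq k) ^ 4))"
  proof (rule AE_I2)
    fix k show "norm (c k) \<le> norm ((if k = 0 then norm (c 0) else 0) + C * (1 / norm (freq k) ^ 4))"
    proof (cases "k = 0")
      case False
      then have "norm (c k) \<le> C * (1 / norm (freq k) ^ 4)" using assms[OF False] by simp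
      also have "\<dots> \<le> norm (C * (1 / norm (freq k) ^ 4))" by (simp only: real_norm_def abs_ge_self)
      finally show ?thesis using False by (simp only: if_False add_0_left)
    qed simp
  qed
qed simp

section \<open>Positivity of the heat kernel\<close>

definition heat_symbol :: "real \<Rightarrow> int^3 \<Rightarrow> real" where
  "heat_symbol s k = exp (- s * (norm (freq k))\<^sup>2)"

lemma heat_symbol_0 [simp]: "heat_symbol s 0 = 1"
  by (simp add: heat_symbol_def)

lemma heat_symbol_minus [simp]: "heat_symbol s (- k) = heat_symbol s k"
  by (simp add: heat_symbol_def freq_minus)

lemma heat_symbol_pos: "0 < heat_symbol s k"
  by (simp add: heat_symbol_def)

lemma heat_symbol_le_1: "0 \<le> s \<Longrightarrow> heat_symbol s k \<le> 1"
  by (simp add: heat_symbol_def)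

lemma heat_symbol_decay:
  assumes "s > 0" "k \<noteq> 0"
  shows "heat_symbol s k \<le> (2 / s\<^sup>2) / norm (freq k) ^ 4"
proof -
  define y where "y = s * (norm (freq k))\<^sup>2"
  have y: "y > 0" using assms by (simp add: y_def)
  have "y\<^sup>2 / 2 \<le> exp y"
    using exp_lower_Taylor_quadratic[of y] y by simp
  then have "exp (- y) \<le> 2 / y\<^sup>2"
    using y by (simp add: exp_minus field_simps)
  also have "2 / y\<^sup>2 = (2 / s\<^sup>2) / norm (freq k) ^ 4"
    by (simp add: y_def power_mult_distrib)
  finally show ?thesis by (simp add: heat_symbol_def y_def)
qed

lemma integrable_heat_symbol: "s > 0 \<Longrightarrow> integrable lattice (\<lambda>k. heat_symbol s k)"
  by (rule integrable_lattice_decay[of _ "2 / s\<^sup>2"]) (use heat_symbol_decay heat_symbol_pos[THEN less_imp_le] in simp)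

lemma integrable_heat_symbol_mult:
  assumes "s > 0" "\<And>k. cmod (c k) \<le> B"
  shows "integrable lattice (\<lambda>k. complex_of_real (heat_symbol s k) * c k)"
proof (rule Bochner_Integration.integrable_bound)
  show "integrable lattice (\<lambda>k. B * heat_symbol s k)"
    using integrable_heat_symbol[OF assms(1)] by simp
  show "AE k in lattice. norm (complex_of_real (heat_symbol s k) * c k) \<le> norm (B * heat_symbol s k)"
  proof (rule AE_I2)
    fix k
    have "cmod (c k) \<le> \<bar>B\<bar>" using assms(2)[of k] by linarith
    then show "norm (complex_of_real (heat_symbol s k) * c k) \<le> norm (B * heat_symbol s k)"
      using heat_symbol_pos[of s k] by (simp add: norm_mult abs_mult mult.commute)
  qed
qed simp

text \<open>
  Schur's product theorem for the Gram matrix \<open>(v\<^sub>j \<bullet> v\<^sub>l)\<close>: expanding one factor of the power in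
  an orthonormal basis reduces the exponent by one and rescales the coefficients.
\<close>

lemma psd_power:
  fixes v :: "'i \<Rightarrow> 'a :: euclidean_space" and a :: "'i \<Rightarrow> complex"
  shows "0 \<le> Re (\<Sum>j\<in>F. \<Sum>l\<in>F. a j * cnj (a l) * of_real ((v j \<bullet> v l) ^ n))"
proof (induction n arbitrary: a)
  case 0
  have "(\<Sum>j\<in>F. \<Sum>l\<in>F. a j * cnj (a l)) = (\<Sum>j\<in>F. a j) * cnj (\<Sum>j\<in>F. a j)"
    by (simp add: sum_product)
  moreover have "0 \<le> Re (z * cnj z)" for z by (simp add: complex_mult_cnj)
  ultimately show ?case by (simp only: power_0 of_real_1 mult_1_right)
next
  case (Suc n)
  have "(\<Sum>j\<in>F. \<Sum>l\<in>F. a j * cnj (a l) * of_real ((v j \<bullet> v l) ^ Suc n))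
     = (\<Sum>j\<in>F. \<Sum>l\<in>F. \<Sum>b\<in>Basis. (a j * of_real (v j \<bullet> b)) * cnj (a l * of_real (v l \<bullet> b)) * of_real ((v j \<bullet> v l) ^ n))"
  proof (intro sum.cong refl)
    fix j l
    have "complex_of_real (v j \<bullet> v l) = (\<Sum>b\<in>Basis. of_real (v j \<bullet> b) * of_real (v l \<bullet> b))"
      by (subst euclidean_inner) simp
    then show "a j * cnj (a l) * of_real ((v j \<bullet> v l) ^ Suc n)
      = (\<Sum>b\<in>Basis. (a j * of_real (v j \<bullet> b)) * cnj (a l * of_real (v l \<bullet> b)) * of_real ((v j \<bullet> v l) ^ n))"
      by (simp add: sum_distrib_left sum_distrib_right mult_ac)
  qed
  also have "\<dots> = (\<Sum>b\<in>Basis. \<Sum>j\<in>F. \<Sum>l\<in>F. (a j * of_real (v j \<bullet> b)) * cnj (a l * of_real (v l \<bullet> b)) * of_real ((v j \<bullet> v l) ^ n))"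
    by (simp only: sum.swap[of _ Basis F])
  finally have eq: "(\<Sum>j\<in>F. \<Sum>l\<in>F. a j * cnj (a l) * of_real ((v j \<bullet> v l) ^ Suc n)) = \<dots>" .
  show ?case
    by (subst eq, subst Re_sum, intro sum_nonneg Suc.IH)
qed

lemma psd_exp:
  fixes v :: "'i \<Rightarrow> 'a :: euclidean_space" and a :: "'i \<Rightarrow> complex"
  assumes "s \<ge> 0"
  shows "0 \<le> Re (\<Sum>j\<in>F. \<Sum>l\<in>F. a j * cnj (a l) * of_real (exp (s * (v j \<bullet> v l))))"
proof -
  define T where "T n = Re (\<Sum>j\<in>F. \<Sum>l\<in>F. a j * cnj (a l) * of_real ((v j \<bullet> v l) ^ n))" for n
  have "(\<lambda>n. \<Sum>j\<in>F. \<Sum>l\<in>F. Re (a j * cnj (a l)) * ((s * (v j \<bullet> v l)) ^ n /\<^sub>R fact n))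
      sums (\<Sum>j\<in>F. \<Sum>l\<in>F. Re (a j * cnj (a l)) * exp (s * (v j \<bullet> v l)))"
    by (intro sums_sum sums_mult exp_converges)
  moreover have "(\<Sum>j\<in>F. \<Sum>l\<in>F. Re (a j * cnj (a l)) * ((s * (v j \<bullet> v l)) ^ n /\<^sub>R fact n)) = s ^ n / fact n * T n" for n
    by (simp add: T_def sum_distrib_left power_mult_distrib Re_sum field_simps del: complex_cnj)
  moreover have "0 \<le> s ^ n / fact n * T n" for n
    using psd_power assms unfolding T_def by (intro mult_nonneg_nonneg) auto
  ultimately have "0 \<le> (\<Sum>j\<in>F. \<Sum>l\<in>F. Re (a j * cnj (a l)) * exp (s * (v j \<bullet> v l)))"
    using sums_le[OF _ sums_zero] by (metis (no_types, lifting))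
  then show ?thesis by simp
qed

text \<open>
  Since \<open>|u - v|\<^sup>2 = |u|\<^sup>2 + |v|\<^sup>2 - 2 u \<bullet> v\<close>, the Gaussian is the positive definite kernel
  \<open>exp (2 s u \<bullet> v)\<close> up to factors that can be absorbed into the coefficients.
\<close>

lemma psd_gauss:
  fixes v :: "'i \<Rightarrow> 'a :: euclidean_space" and a :: "'i \<Rightarrow> complex"
  assumes "s \<ge> 0"
  shows "0 \<le> Re (\<Sum>j\<in>F. \<Sum>l\<in>F. a j * cnj (a l) * of_real (exp (- s * (norm (v j - v l))\<^sup>2)))"
proof -
  have *: "exp (- s * (norm (v j - v l))\<^sup>2)
      = exp (- s * (norm (v j))\<^sup>2) * exp (- s * (norm (v l))\<^sup>2) * exp (2 * s * (v j \<bullet> v l))" for j l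
    by (simp add: exp_add[symmetric] power2_norm_eq_inner inner_diff_left inner_diff_right inner_commute algebra_simps)
  have "0 \<le> Re (\<Sum>j\<in>F. \<Sum>l\<in>F. (a j * of_real (exp (- s * (norm (v j))\<^sup>2))) * cnj (a l * of_real (exp (- s * (norm (v l))\<^sup>2)))
      * of_real (exp (2 * s * (v j \<bullet> v l))))"
    by (rule psd_exp) (use assms in simp)
  then show ?thesis
    unfolding * by (simp add: mult_ac)
qed

text \<open>
  The Fourier coefficients of the kernel are Gaussian, hence positive definite, and so
  \<open>\<integral> K p\<^sup>2 \<ge> 0\<close> for every real trigonometric polynomial \<open>p\<close>. Letting \<open>p\<close> converge boundedly to the
  indicator function of \<open>K < 0\<close> shows that the negative part of \<open>K\<close> integrates to zero.
\<close>

lemma heat_kernel_nonneg: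
  fixes x :: "real^3"
  assumes s: "s > 0"
  defines "K \<equiv> fseries (\<lambda>k. complex_of_real (heat_symbol s k) * character (- k) x)"
  shows "AE y in torus. 0 \<le> Re (K y)" "cnj (K y) = K y" "integrable torus K"
    "\<exists>B. \<forall>y. cmod (K y) \<le> B"
proof -
  define d where "d k = complex_of_real (heat_symbol s k) * character (- k) x" for k
  have d: "integrable lattice d"
    unfolding d_def by (rule integrable_heat_symbol_mult[OF s, of _ 1]) simp
  have K: "K = fseries d" by (simp add: K_def d_def[abs_def])
  show bd: "\<exists>B. \<forall>y. cmod (K y) \<le> B"
    unfolding K using norm_fseries_le[OF d] by blast
  show cnjK: "cnj (K y) = K y" for y
    unfolding K by (rule fseries_cnj) (simp add: d_def freq_minus complex_eq_iff)
  show intK: "integrable torus K" unfolding K by (rule fseries_integrable[OF d])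
  have sq: "integrable torus (\<lambda>y. K y * complex_of_real (p y) * complex_of_real (p y)) \<and>
      0 \<le> Re (LINT y|torus. K y * complex_of_real (p y) * complex_of_real (p y))"
    if p: "trig_poly (\<lambda>y. complex_of_real (p y))" for p
  proof -
    obtain F a where F: "finite F" and pa: "(\<lambda>y. complex_of_real (p y)) = (\<lambda>x. \<Sum>k\<in>F. a k * character k x)"
      using trig_poly_finite_sum[OF p] by blast
    have pj: "complex_of_real (p y) = (\<Sum>j\<in>F. a j * character j y)" for y using fun_cong[OF pa] .
    \<comment> \<open>The second copy of the real polynomial is written as its own conjugate, so that its square
      becomes a Hermitian form in the coefficients.\<close>
    have pl: "complex_of_real (p y) = (\<Sum>l\<in>F. cnj (a l) * character (- l) y)" for y
    proof -
      have "complex_of_real (p y) = cnj (complex_of_real (p y))" by simp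
      also have "\<dots> = (\<Sum>l\<in>F. cnj (a l) * cnj (character l y))" by (subst pj) simp
      also have "\<dots> = (\<Sum>l\<in>F. cnj (a l) * character (- l) y)"
        by (intro sum.cong refl) (simp add: freq_minus complex_eq_iff)
      finally show ?thesis .
    qed
    have ex: "K y * complex_of_real (p y) * complex_of_real (p y)
      = (\<Sum>j\<in>F. \<Sum>l\<in>F. a j * cnj (a l) * (K y * character (- (l - j)) y))" for y
    proof -
      have "K y * complex_of_real (p y) * complex_of_real (p y)
        = K y * ((\<Sum>j\<in>F. a j * character j y) * (\<Sum>l\<in>F. cnj (a l) * character (- l) y))"
        by (simp add: pj[symmetric] pl[symmetric])
      also have "\<dots> = K y * (\<Sum>j\<in>F. \<Sum>l\<in>F. a j * character j y * (cnj (a l) * character (- l) y))"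
        by (simp only: sum_product)
      also have "\<dots> = (\<Sum>j\<in>F. \<Sum>l\<in>F. K y * (a j * character j y * (cnj (a l) * character (- l) y)))"
        by (simp only: sum_distrib_left)
      also have "\<dots> = (\<Sum>j\<in>F. \<Sum>l\<in>F. a j * cnj (a l) * (K y * character (- (l - j)) y))"
      proof (intro sum.cong refl)
        fix j l
        have "character (- (l - j)) y = character j y * character (- l) y"
          by (simp add: character_add[symmetric])
        then show "K y * (a j * character j y * (cnj (a l) * character (- l) y)) = a j * cnj (a l) * (K y * character (- (l - j)) y)"
          by (simp add: mult_ac)
      qed
      finally show ?thesis .
    qed
    have cK: "(LINT y|torus. K y * character (- m) y) = complex_of_real ((2 * pi) ^ 3) * d m" for m
      using coef_fseries[OF d, of m] by (simp add: K coef_def field_simps)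
    have int: "integrable torus (\<lambda>y. K y * complex_of_real (p y) * complex_of_real (p y))"
      unfolding ex by (intro Bochner_Integration.integrable_sum Bochner_Integration.integrable_mult_right integrable_mult_character intK)
    have "(LINT y|torus. K y * complex_of_real (p y) * complex_of_real (p y))
       = (\<Sum>j\<in>F. \<Sum>l\<in>F. a j * cnj (a l) * (complex_of_real ((2 * pi) ^ 3) * d (l - j)))"
      unfolding ex cK[symmetric]
      by (subst Bochner_Integration.integral_sum, intro Bochner_Integration.integrable_sum Bochner_Integration.integrable_mult_right integrable_mult_character intK,
          intro sum.cong refl, subst Bochner_Integration.integral_sum, intro Bochner_Integration.integrable_mult_right integrable_mult_character intK)
        simp
    also have "\<dots> = complex_of_real ((2 * pi) ^ 3) *
        (\<Sum>j\<in>F. \<Sum>l\<in>F. (a j * character j x) * cnj (a l * character l x) * of_real (exp (- s * (norm (freq j - freq l))\<^sup>2)))"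
      unfolding sum_distrib_left
    proof (intro sum.cong refl)
      fix j l
      have "d (l - j) = of_real (exp (- s * (norm (freq j - freq l))\<^sup>2)) * (character j x * character (- l) x)"
        by (simp add: d_def heat_symbol_def freq_diff character_add[symmetric] norm_minus_commute)
      moreover have "character (- l) x = cnj (character l x)"
        by (simp add: freq_minus complex_eq_iff)
      ultimately show "a j * cnj (a l) * (complex_of_real ((2 * pi) ^ 3) * d (l - j)) =
        complex_of_real ((2 * pi) ^ 3) * ((a j * character j x) * cnj (a l * character l x) * of_real (exp (- s * (norm (freq j - freq l))\<^sup>2)))"
        by (simp add: mult_ac)
    qed
    also have "Re \<dots> \<ge> 0"
    proof -
      have "Re (complex_of_real r * z) = r * Re z" for r z by simp
      then show ?thesis
        using psd_gauss[where s = s and F = F and a = "\<lambda>j. a j * character j x" and v = freq] s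
        by (simp only:) (intro mult_nonneg_nonneg, auto)
    qed
    finally show ?thesis using int by blast
  qed
  define k where "k y = Re (K y)" for y
  have kK: "K y = complex_of_real (k y)" for y
    using cnjK[of y] by (simp add: k_def complex_eq_iff)
  have ki: "integrable torus k" unfolding k_def by (rule integrable_Re[OF intK])
  have [measurable]: "k \<in> borel_measurable torus" using ki by auto
  obtain p where p: "\<And>n. trig_poly (\<lambda>x. complex_of_real (p n x))"
    and p2: "\<And>n x. x \<in> cube \<Longrightarrow> \<bar>p n x\<bar> \<le> 2"
    and lim: "AE x in torus. (\<lambda>n. p n x) \<longlonglongrightarrow> (if k x < 0 then 1 else 0)"
    by (rule trig_poly_AE_approx[of "\<lambda>x. if k x < 0 then 1 else 0"]) auto
  have [measurable]: "p n \<in> borel_measurable torus" for n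
  proof -
    have "(\<lambda>x. Re (complex_of_real (p n x))) \<in> borel_measurable torus"
      using trig_poly_measurable[OF p] by measurable
    then show ?thesis by simp
  qed
  have pos: "0 \<le> (LINT y|torus. k y * (p n y * p n y))" for n
  proof -
    have "(LINT y|torus. K y * complex_of_real (p n y) * complex_of_real (p n y)) = complex_of_real (LINT y|torus. k y * (p n y * p n y))"
      unfolding kK by (subst integral_complex_of_real[symmetric]) (simp add: mult.assoc)
    then show ?thesis using sq[OF p[of n]] by simp
  qed
  have "(\<lambda>n. LINT y|torus. k y * (p n y * p n y)) \<longlonglongrightarrow> (LINT y|torus. k y * ((if k y < 0 then 1 else 0) * (if k y < 0 then 1 else 0)))"
  proof (rule integral_dominated_convergence[where w = "\<lambda>y. \<bar>k y\<bar> * 4"])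
    show "AE y in torus. (\<lambda>n. k y * (p n y * p n y)) \<longlonglongrightarrow> k y * ((if k y < 0 then 1 else 0) * (if k y < 0 then 1 else 0))"
      using lim by eventually_elim (intro tendsto_intros)
    show "AE y in torus. norm (k y * (p n y * p n y)) \<le> \<bar>k y\<bar> * 4" for n
    proof (rule AE_I2)
      fix y assume "y \<in> space torus"
      then have "\<bar>p n y\<bar> \<le> 2" using p2 by simp
      then have "\<bar>p n y\<bar> * \<bar>p n y\<bar> \<le> 2 * 2" by (intro mult_mono) auto
      then show "norm (k y * (p n y * p n y)) \<le> \<bar>k y\<bar> * 4"
        by (simp add: abs_mult mult_left_mono)
    qed
  qed (use ki in auto)
  then have "0 \<le> (LINT y|torus. k y * ((if k y < 0 then 1 else 0) * (if k y < 0 then 1 else 0)))"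
    using pos by (intro LIMSEQ_le_const) auto
  moreover have "k y * ((if k y < 0 then 1 else 0) * (if k y < 0 then 1 else 0)) = - (max 0 (- k y))" for y
    by simp
  ultimately have "(LINT y|torus. max 0 (- k y)) \<le> 0"
    by simp
  moreover have "0 \<le> (LINT y|torus. max 0 (- k y))" by simp
  ultimately have "(LINT y|torus. max 0 (- k y)) = 0" by linarith
  moreover have "integrable torus (\<lambda>y. max 0 (- k y))" using ki by simp
  ultimately have "AE y in torus. max 0 (- k y) = 0"
    using integral_nonneg_eq_0_iff_AE[of torus "\<lambda>y. max 0 (- k y)"] by auto
  then show "AE y in torus. 0 \<le> Re (K y)"
    by eventually_elim (auto simp: k_def max_def split: if_splits)
qed

section \<open>The heat semigroup on cubically integrable functions\<close>

definition heat_op :: "real \<Rightarrow> (real^3 \<Rightarrow> real) \<Rightarrow> real^3 \<Rightarrow> complex" where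
  "heat_op s f = fseries (\<lambda>k. complex_of_real (heat_symbol s k) * fourier_coeff f k)"

lemma integrable_heat_coeff:
  "s > 0 \<Longrightarrow> integrable lattice (\<lambda>k. complex_of_real (heat_symbol s k) * fourier_coeff f k)"
  unfolding fourier_coeff_eq_coef by (rule integrable_heat_symbol_mult[OF _ norm_coef_le])

lemma heat_op_kernel:
  assumes s: "s > 0" and f: "integrable torus f"
  shows "heat_op s f x = (LINT y|torus. complex_of_real (f y) *
      fseries (\<lambda>k. complex_of_real (heat_symbol s k) * character (- k) x) y) / complex_of_real ((2 * pi) ^ 3)"
proof -
  have c: "integrable lattice (\<lambda>k. complex_of_real (heat_symbol s k) * character (- k) x)"
    by (rule integrable_heat_symbol_mult[OF s, of _ 1]) simp
  have "(LINT y|torus. complex_of_real (f y) *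
      fseries (\<lambda>k. complex_of_real (heat_symbol s k) * character (- k) x) y)
    = (LINT k|lattice. complex_of_real (heat_symbol s k) * character (- k) x * (LINT y|torus. complex_of_real (f y) * character k y))"
    by (rule integral_mult_fseries[OF _ c]) (use f in simp)
  also have "\<dots> = (LINT k|lattice. complex_of_real (heat_symbol s k) * character k x * (LINT y|torus. complex_of_real (f y) * character (- k) y))"
    by (rule integral_bij_count_space[where g = uminus, symmetric, THEN trans])
      (auto simp: bij_betw_def inj_on_def surj_def intro: exI[of _ "- _"])
  also have "\<dots> = (LINT k|lattice. complex_of_real (heat_symbol s k) * fourier_coeff f k * character k x) * complex_of_real ((2 * pi) ^ 3)"
    by (subst Bochner_Integration.integral_mult_left_zero[symmetric], intro Bochner_Integration.integral_cong refl)
      (simp add: fourier_coeff_eq_coef coef_def)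
  finally show ?thesis by (simp add: heat_op_def fseries_def)
qed

lemma heat_op_nonneg:
  assumes s: "s > 0" and f: "integrable torus f" and nn: "\<And>x. x \<in> cube \<Longrightarrow> 0 \<le> f x"
  shows "0 \<le> Re (heat_op s f x)"
proof -
  let ?K = "fseries (\<lambda>k. complex_of_real (heat_symbol s k) * character (- k) x)"
  have K: "AE y in torus. 0 \<le> Re (?K y)" "\<And>y. cnj (?K y) = ?K y"
    using heat_kernel_nonneg[OF s] by blast+
  have Kr: "?K y = complex_of_real (Re (?K y))" for y
    using K(2)[of y] by (simp add: complex_eq_iff)
  have "Re (LINT y|torus. complex_of_real (f y) * ?K y) = (LINT y|torus. f y * Re (?K y))"
    by (subst Kr) (subst of_real_mult[symmetric], subst integral_complex_of_real, simp)
  moreover have "0 \<le> (LINT y|torus. f y * Re (?K y))"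
  proof (rule integral_nonneg_AE)
    from K(1) AE_space show "AE y in torus. 0 \<le> f y * Re (?K y)"
      by eventually_elim (use nn in auto)
  qed
  ultimately show ?thesis
    unfolding heat_op_kernel[OF s f] by (simp add: Re_divide_of_real)
qed

text \<open>
  The graph of the convex function \<open>|u|\<^sup>3\<close> lies above its tangent at \<open>c\<close>.
\<close>

lemma cube_tangent:
  fixes u c :: real
  shows "\<bar>c\<bar> ^ 3 + 3 * \<bar>c\<bar> * c * (u - c) \<le> \<bar>u\<bar> ^ 3"
proof -
  have pos: "c ^ 3 + 3 * c * c * (u - c) \<le> \<bar>u\<bar> ^ 3" if "c \<ge> 0" for u c :: real
  proof (cases "u \<ge> 0")
    case True
    have "0 \<le> (u - c)\<^sup>2 * (u + 2 * c)" using True that by simp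
    then show ?thesis using True by (simp add: power2_eq_square power3_eq_cube algebra_simps)
  next
    case False
    have "3 * c * c * u \<le> 0" using False by (intro mult_nonneg_nonpos) auto
    moreover have "0 \<le> c ^ 3" "0 \<le> \<bar>u\<bar> ^ 3" using that by auto
    ultimately show ?thesis by (simp add: algebra_simps power3_eq_cube)
  qed
  show ?thesis
  proof (cases "c \<ge> 0")
    case True then show ?thesis using pos[of c u] by simp
  next
    case False then show ?thesis using pos[of "- c" "- u"] by (simp add: algebra_simps)
  qed
qed

text \<open>Convexity of \<open>|u|\<^sup>3\<close>, applied at the mean of the three numbers.\<close>

lemma cube_sum3_le:
  fixes a b c :: real
  shows "\<bar>a + b + c\<bar> ^ 3 \<le> 9 * (\<bar>a\<bar> ^ 3 + \<bar>b\<bar> ^ 3 + \<bar>c\<bar> ^ 3)"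
proof -
  define m where "m = (a + b + c) / 3"
  have "3 * \<bar>m\<bar> ^ 3 \<le> \<bar>a\<bar> ^ 3 + \<bar>b\<bar> ^ 3 + \<bar>c\<bar> ^ 3"
  proof -
    have "3 * \<bar>m\<bar> * m * (a - m) + 3 * \<bar>m\<bar> * m * (b - m) + 3 * \<bar>m\<bar> * m * (c - m) = 3 * \<bar>m\<bar> * m * (a + b + c - 3 * m)"
      by (simp add: algebra_simps)
    also have "\<dots> = 0" by (simp add: m_def)
    finally show ?thesis using cube_tangent[of m a] cube_tangent[of m b] cube_tangent[of m c] by linarith
  qed
  moreover have "\<bar>a + b + c\<bar> ^ 3 = 27 * \<bar>m\<bar> ^ 3"
    by (simp add: m_def abs_divide power_divide)
  ultimately show ?thesis by simp
qed

definition L3 :: "(real^3 \<Rightarrow> real) \<Rightarrow> bool" where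
  "L3 f \<longleftrightarrow> f \<in> borel_measurable torus \<and> integrable torus (\<lambda>x. \<bar>f x\<bar> ^ 3)"

lemma L3_integrable:
  assumes "L3 f" shows "integrable torus f"
proof (rule Bochner_Integration.integrable_bound[of _ "\<lambda>x. 1 + \<bar>f x\<bar> ^ 3"])
  have "\<bar>u\<bar> \<le> 1 + \<bar>u\<bar> ^ 3" for u :: real
  proof -
    have "0 \<le> \<bar>u\<bar> ^ 3" by simp
    moreover have "3 * \<bar>u\<bar> - 2 \<le> \<bar>u\<bar> ^ 3" using cube_tangent[of 1 "\<bar>u\<bar>"] by simp
    ultimately show ?thesis by linarith
  qed
  then show "AE x in torus. norm (f x) \<le> norm (1 + \<bar>f x\<bar> ^ 3)"
    by (intro AE_I2) (simp add: abs_of_nonneg)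
qed (use assms in \<open>auto simp: L3_def\<close>)

lemma fourier_coeff_linear:
  assumes "integrable torus f" "integrable torus g"
  shows "fourier_coeff (\<lambda>x. f x + g x) k = fourier_coeff f k + fourier_coeff g k"
    "fourier_coeff (\<lambda>x. f x - g x) k = fourier_coeff f k - fourier_coeff g k"
    "fourier_coeff (\<lambda>x. r * f x) k = complex_of_real r * fourier_coeff f k"
  using assms by (simp_all add: fourier_coeff_eq_coef coef_add coef_diff coef_cmult)

lemma heat_op_linear:
  assumes s: "s > 0" and "integrable torus f" "integrable torus g"
  shows "heat_op s (\<lambda>x. f x + g x) x = heat_op s f x + heat_op s g x"
    "heat_op s (\<lambda>x. f x - g x) x = heat_op s f x - heat_op s g x"
    "heat_op s (\<lambda>x. r * f x) x = complex_of_real r * heat_op s f x"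
    "heat_op s (\<lambda>x. r) x = complex_of_real r"
proof -
  note I = integrable_heat_coeff[OF s]
  show "heat_op s (\<lambda>x. f x + g x) x = heat_op s f x + heat_op s g x"
    using fseries_add[OF I[of f] I[of g]] assms by (simp add: heat_op_def fourier_coeff_linear distrib_left)
  show "heat_op s (\<lambda>x. f x - g x) x = heat_op s f x - heat_op s g x"
    using fseries_diff[OF I[of f] I[of g]] assms by (simp add: heat_op_def fourier_coeff_linear right_diff_distrib)
  have "heat_op s (\<lambda>x. r * f x) x = (LINT k|lattice. complex_of_real r * (complex_of_real (heat_symbol s k) * fourier_coeff f k * character k x))"
    unfolding heat_op_def fseries_def using assms by (simp add: fourier_coeff_linear mult_ac)
  then show "heat_op s (\<lambda>x. r * f x) x = complex_of_real r * heat_op s f x"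
    by (simp add: heat_op_def fseries_def)
  have "heat_op s (\<lambda>x. r) x = (LINT k|lattice. (if k = 0 then complex_of_real r else 0))"
    unfolding heat_op_def fseries_def
    by (intro Bochner_Integration.integral_cong refl) (simp add: fourier_coeff_eq_coef coef_const)
  then show "heat_op s (\<lambda>x. r) x = complex_of_real r"
    by (simp add: lattice_integral_delta)
qed

text \<open>
  Jensen's inequality for the positive operator that preserves constants: apply it to the tangent
  inequality of \<open>|u|\<^sup>3\<close> at the value of \<open>heat_op s f\<close> at the point \<open>x\<close>.
\<close>

lemma heat_op_cube_le:
  assumes s: "s > 0" and f: "L3 f"
  shows "\<bar>Re (heat_op s f x)\<bar> ^ 3 \<le> Re (heat_op s (\<lambda>y. \<bar>f y\<bar> ^ 3) x)"
proof -
  define c where "c = Re (heat_op s f x)"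
  have i1: "integrable torus f" by (rule L3_integrable[OF f])
  have i3: "integrable torus (\<lambda>y. \<bar>f y\<bar> ^ 3)" using f by (simp add: L3_def)
  \<comment> \<open>\<open>r y + b\<close> is the tangent of \<open>|y|\<^sup>3\<close> at \<open>c\<close>.\<close>
  define r where "r = 3 * \<bar>c\<bar> * c"
  define b where "b = \<bar>c\<bar> ^ 3 - r * c"
  have ib: "integrable torus (\<lambda>y. r * f y + b)" using i1 by simp
  have "0 \<le> Re (heat_op s (\<lambda>y. \<bar>f y\<bar> ^ 3 - (r * f y + b)) x)"
  proof (rule heat_op_nonneg[OF s])
    show "integrable torus (\<lambda>y. \<bar>f y\<bar> ^ 3 - (r * f y + b))" using i3 ib by simp
    show "0 \<le> \<bar>f y\<bar> ^ 3 - (r * f y + b)" for y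
      using cube_tangent[of c "f y"] by (simp add: r_def b_def algebra_simps)
  qed
  moreover have "heat_op s (\<lambda>y. \<bar>f y\<bar> ^ 3 - (r * f y + b)) x
      = heat_op s (\<lambda>y. \<bar>f y\<bar> ^ 3) x - (complex_of_real r * heat_op s f x + complex_of_real b)"
  proof -
    have "heat_op s (\<lambda>y. r * f y + b) x = heat_op s (\<lambda>y. r * f y) x + heat_op s (\<lambda>y. b) x"
      using i1 by (intro heat_op_linear[OF s]) auto
    then show ?thesis
      using heat_op_linear(2)[OF s i3 ib] heat_op_linear(3)[OF s i1 i1] heat_op_linear(4)[OF s i1 i1] by simp
  qed
  ultimately have "r * c + b \<le> Re (heat_op s (\<lambda>y. \<bar>f y\<bar> ^ 3) x)"
    by (simp add: c_def)
  then show ?thesis by (simp add: b_def c_def)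
qed

lemma heat_op_integrable: "s > 0 \<Longrightarrow> integrable torus (heat_op s f)"
  unfolding heat_op_def by (intro fseries_integrable integrable_heat_coeff)

lemma integral_heat_op:
  assumes s: "s > 0" and f: "integrable torus f"
  shows "(LINT x|torus. Re (heat_op s f x)) = (LINT x|torus. f x)"
proof -
  have "coef (heat_op s f) 0 = fourier_coeff f 0"
    unfolding heat_op_def by (subst coef_fseries[OF integrable_heat_coeff[OF s]]) simp
  then have "(LINT x|torus. heat_op s f x) = (LINT x|torus. complex_of_real (f x))"
    by (simp add: coef_def fourier_coeff_eq_coef)
  then show ?thesis
    using integral_Re[OF heat_op_integrable[OF s, of f]] by (simp add: integral_complex_of_real)
qed

text \<open>Integrate Jensen's inequality; the heat semigroup preserves integrals.\<close>

lemma heat_op_L3_contraction: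
  assumes s: "s > 0" and f: "L3 f"
  shows "L3 (\<lambda>x. Re (heat_op s f x))"
    and "(LINT x|torus. \<bar>Re (heat_op s f x)\<bar> ^ 3) \<le> (LINT x|torus. \<bar>f x\<bar> ^ 3)"
proof -
  have i3: "integrable torus (\<lambda>y. \<bar>f y\<bar> ^ 3)" using f by (simp add: L3_def)
  have iG: "integrable torus (\<lambda>x. Re (heat_op s (\<lambda>y. \<bar>f y\<bar> ^ 3) x))"
    by (rule integrable_Re[OF heat_op_integrable[OF s]])
  have m[measurable]: "(\<lambda>x. Re (heat_op s f x)) \<in> borel_measurable torus"
    using integrable_Re[OF heat_op_integrable[OF s, of f]] by auto
  have int: "integrable torus (\<lambda>x. \<bar>Re (heat_op s f x)\<bar> ^ 3)"
    by (rule Bochner_Integration.integrable_bound[OF iG])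
      (auto intro!: AE_I2 order_trans[OF heat_op_cube_le[OF s f]])
  then show "L3 (\<lambda>x. Re (heat_op s f x))" by (simp add: L3_def m)
  have "(LINT x|torus. \<bar>Re (heat_op s f x)\<bar> ^ 3) \<le> (LINT x|torus. Re (heat_op s (\<lambda>y. \<bar>f y\<bar> ^ 3) x))"
    by (intro integral_mono int iG heat_op_cube_le s f)
  also have "\<dots> = (LINT x|torus. \<bar>f x\<bar> ^ 3)"
    by (rule integral_heat_op[OF s i3])
  finally show "(LINT x|torus. \<bar>Re (heat_op s f x)\<bar> ^ 3) \<le> (LINT x|torus. \<bar>f x\<bar> ^ 3)" .
qed


lemma trig_poly_real_measurable:
  assumes "trig_poly (\<lambda>x. complex_of_real (p x))"
  shows "p \<in> borel_measurable torus"
proof -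
  have "(\<lambda>x. Re (complex_of_real (p x))) \<in> borel_measurable torus"
    using trig_poly_measurable[OF assms] by measurable
  then show ?thesis by simp
qed

text \<open>
  Truncate \<open>f\<close> at height \<open>n\<close> and approximate the bounded truncation almost everywhere by
  trigonometric polynomials of size at most \<open>2 n\<close>.
\<close>

lemma trig_poly_dense_L3:
  assumes f: "L3 f" and "\<delta> > 0"
  obtains p where "trig_poly (\<lambda>x. complex_of_real (p x))" "L3 p" "L3 (\<lambda>x. f x - p x)"
    "(LINT x|torus. \<bar>f x - p x\<bar> ^ 3) < \<delta>"
proof -
  have [measurable]: "f \<in> borel_measurable torus" and f3: "integrable torus (\<lambda>x. \<bar>f x\<bar> ^ 3)"
    using f by (auto simp: L3_def)
  define g where "g n x = max (- real n) (min (real n) (f x))" for n x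
  have [measurable]: "g n \<in> borel_measurable torus" for n
    unfolding g_def by measurable
  have gb: "\<bar>g n x\<bar> \<le> real n" for n x by (auto simp: g_def)
  have fg: "\<bar>f x - g n x\<bar> \<le> \<bar>f x\<bar>" for n x by (auto simp: g_def max_def min_def)
  have fg3: "\<bar>f x - g n x\<bar> ^ 3 \<le> \<bar>f x\<bar> ^ 3" for n x
    using fg by (intro power_mono) auto
  have ifg: "integrable torus (\<lambda>x. \<bar>f x - g n x\<bar> ^ 3)" for n
    by (rule Bochner_Integration.integrable_bound[OF f3]) (auto intro!: AE_I2 fg3 fg)
  have "(\<lambda>n. LINT x|torus. \<bar>f x - g n x\<bar> ^ 3) \<longlonglongrightarrow> (LINT x|torus. 0)"
  proof (rule integral_dominated_convergence[OF _ _ f3])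
    show "AE x in torus. (\<lambda>n. \<bar>f x - g n x\<bar> ^ 3) \<longlonglongrightarrow> 0"
    proof (rule AE_I2)
      fix x
      have "\<forall>\<^sub>F n in sequentially. \<bar>f x\<bar> \<le> real n"
        using filterlim_real_sequentially unfolding filterlim_at_top by blast
      then have "\<forall>\<^sub>F n in sequentially. \<bar>f x - g n x\<bar> ^ 3 = 0"
        by eventually_elim (auto simp: g_def)
      then show "(\<lambda>n. \<bar>f x - g n x\<bar> ^ 3) \<longlonglongrightarrow> 0" by (rule tendsto_eventually)
    qed
  qed (auto intro!: AE_I2 fg3 fg)
  \<comment> \<open>The sum of the two errors costs a factor 9, and \<open>9 (1/18 + 1/18) = 1\<close>.\<close>
  then have "\<forall>\<^sub>F n in sequentially. (LINT x|torus. \<bar>f x - g n x\<bar> ^ 3) < \<delta> / 18"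
    using \<open>\<delta> > 0\<close> by (intro order_tendstoD) auto
  moreover have "\<forall>\<^sub>F n in sequentially. n \<ge> 1" by (rule eventually_ge_at_top)
  ultimately have "\<forall>\<^sub>F n in sequentially. (LINT x|torus. \<bar>f x - g n x\<bar> ^ 3) < \<delta> / 18 \<and> n \<ge> 1"
    by (rule eventually_conj)
  then obtain n where n: "(LINT x|torus. \<bar>f x - g n x\<bar> ^ 3) < \<delta> / 18" "n \<ge> 1"
    using eventually_happens'[OF sequentially_bot] by blast
  obtain q where q: "\<And>m. trig_poly (\<lambda>x. complex_of_real (q m x))"
    and q2: "\<And>m x. x \<in> cube \<Longrightarrow> \<bar>q m x\<bar> \<le> 2"
    and lim: "AE x in torus. (\<lambda>m. q m x) \<longlonglongrightarrow> g n x / real n"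
    by (rule trig_poly_AE_approx[of "\<lambda>x. g n x / real n"]) (use gb n in \<open>auto simp: abs_divide divide_le_eq\<close>)
  have [measurable]: "q m \<in> borel_measurable torus" for m
    by (rule trig_poly_real_measurable[OF q])
  have "(\<lambda>m. LINT x|torus. \<bar>g n x - real n * q m x\<bar> ^ 3) \<longlonglongrightarrow> (LINT x|torus. 0)"
  proof (rule integral_dominated_convergence[where w = "\<lambda>_. (3 * real n) ^ 3"])
    show "AE x in torus. (\<lambda>m. \<bar>g n x - real n * q m x\<bar> ^ 3) \<longlonglongrightarrow> 0"
      using lim
    proof eventually_elim
      case (elim x)
      have "(\<lambda>m. \<bar>g n x - real n * q m x\<bar> ^ 3) \<longlonglongrightarrow> \<bar>g n x - real n * (g n x / real n)\<bar> ^ 3"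
        by (intro tendsto_intros elim)
      then show ?case using n(2) by simp
    qed
    show "AE x in torus. norm (\<bar>g n x - real n * q m x\<bar> ^ 3) \<le> (3 * real n) ^ 3" for m
    proof (rule AE_I2)
      fix x assume "x \<in> space torus"
      then have "\<bar>real n * q m x\<bar> \<le> real n * 2" using q2[of x m] by (simp add: abs_mult mult_left_mono)
      then have "\<bar>g n x - real n * q m x\<bar> \<le> 3 * real n" using gb[of n x] by linarith
      then show "norm (\<bar>g n x - real n * q m x\<bar> ^ 3) \<le> (3 * real n) ^ 3"
        using power_mono[of "\<bar>g n x - real n * q m x\<bar>" "3 * real n" 3] by simp
    qed
  qed auto
  then have "\<forall>\<^sub>F m in sequentially. (LINT x|torus. \<bar>g n x - real n * q m x\<bar> ^ 3) < \<delta> / 18"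
    using \<open>\<delta> > 0\<close> by (intro order_tendstoD) auto
  then obtain m where m: "(LINT x|torus. \<bar>g n x - real n * q m x\<bar> ^ 3) < \<delta> / 18"
    using eventually_happens'[OF sequentially_bot] by blast
  define p where "p x = real n * q m x" for x
  have [measurable]: "p \<in> borel_measurable torus" unfolding p_def by measurable
  have pt: "trig_poly (\<lambda>x. complex_of_real (p x))"
    using trig_poly_mult[OF trig_poly_const[of "of_nat n"] q[of m]] by (simp add: p_def)
  have pb: "\<bar>p x\<bar> \<le> 2 * real n" if "x \<in> cube" for x
    using q2[OF that, of m] by (simp add: p_def abs_mult mult_left_mono mult.commute)
  have p3: "integrable torus (\<lambda>x. \<bar>p x\<bar> ^ 3)"
    by (rule torus.integrable_const_bound[of _ "(2 * real n) ^ 3"])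
      (use power_mono[OF pb, of _ 3] in \<open>auto intro!: AE_I2 simp del: power_mult_distrib\<close>)
  have gp3: "integrable torus (\<lambda>x. \<bar>g n x - p x\<bar> ^ 3)"
  proof (rule torus.integrable_const_bound[of _ "(3 * real n) ^ 3"])
    show "AE x in torus. norm (\<bar>g n x - p x\<bar> ^ 3) \<le> (3 * real n) ^ 3"
    proof (rule AE_I2)
      fix x assume "x \<in> space torus"
      then have "\<bar>g n x - p x\<bar> \<le> 3 * real n" using gb[of n x] pb[of x] by simp
      then show "norm (\<bar>g n x - p x\<bar> ^ 3) \<le> (3 * real n) ^ 3"
        using power_mono[of "\<bar>g n x - p x\<bar>" "3 * real n" 3] by simp
    qed
  qed simp
  have le: "\<bar>f x - p x\<bar> ^ 3 \<le> 9 * (\<bar>f x - g n x\<bar> ^ 3 + \<bar>g n x - p x\<bar> ^ 3)" for x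
    using cube_sum3_le[of "f x - g n x" "g n x - p x" 0] by simp
  have rhs: "integrable torus (\<lambda>x. 9 * (\<bar>f x - g n x\<bar> ^ 3 + \<bar>g n x - p x\<bar> ^ 3))"
    using ifg gp3 by simp
  have fp3: "integrable torus (\<lambda>x. \<bar>f x - p x\<bar> ^ 3)"
    by (rule Bochner_Integration.integrable_bound[OF rhs]) (auto intro!: AE_I2 order_trans[OF le])
  have "(LINT x|torus. \<bar>f x - p x\<bar> ^ 3) \<le> (LINT x|torus. 9 * (\<bar>f x - g n x\<bar> ^ 3 + \<bar>g n x - p x\<bar> ^ 3))"
    by (intro integral_mono fp3 rhs le)
  also have "\<dots> = 9 * ((LINT x|torus. \<bar>f x - g n x\<bar> ^ 3) + (LINT x|torus. \<bar>g n x - p x\<bar> ^ 3))"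
    using ifg gp3 by simp
  also have "\<dots> < \<delta>" using n(1) m by (simp add: p_def)
  finally have "(LINT x|torus. \<bar>f x - p x\<bar> ^ 3) < \<delta>" .
  then show ?thesis
    by (intro that[OF pt]) (auto simp: L3_def p3 fp3)
qed

text \<open>Only finitely many frequencies occur, and each factor of the heat symbol tends to 1.\<close>

lemma heat_op_trig_poly_uniform:
  assumes p: "trig_poly (\<lambda>x. complex_of_real (p x))" and ip: "integrable torus p" and "e > 0"
  shows "\<forall>\<^sub>F s in at_right 0. \<forall>x. \<bar>Re (heat_op s p x) - p x\<bar> < e"
proof -
  obtain F a where F: "finite F" and pa: "(\<lambda>x. complex_of_real (p x)) = (\<lambda>x. \<Sum>k\<in>F. a k * character k x)"
    using trig_poly_finite_sum[OF p] by blast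
  define c where "c k = (if k \<in> F then a k else 0)" for k
  have supp: "integrable lattice d" if "\<And>k. k \<notin> F \<Longrightarrow> d k = 0" for d :: "int^3 \<Rightarrow> complex"
    unfolding integrable_lattice_iff
    by (rule finite_nonzero_values_imp_summable_on, rule finite_subset[OF _ F]) (use that in auto)
  have fin: "(LINT k|lattice. d k) = (\<Sum>k\<in>F. d k)" if "\<And>k. k \<notin> F \<Longrightarrow> d k = 0" for d :: "int^3 \<Rightarrow> complex"
  proof -
    have "(LINT k|lattice. d k) = (\<Sum>\<^sub>\<infinity>k. d k)"
      using infsum_eq_lattice_integral[OF supp[of d]] that by simp
    also have "\<dots> = (\<Sum>\<^sub>\<infinity>k\<in>F. d k)" using that by (intro infsum_cong_neutral) auto
    finally show ?thesis using F by simp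
  qed
  have pc: "complex_of_real (p x) = fseries c x" for x
    unfolding fseries_def using fun_cong[OF pa, of x] by (subst fin) (auto simp: c_def)
  have fc: "fourier_coeff p k = c k" for k
    unfolding fourier_coeff_eq_coef pc by (rule coef_fseries[OF supp]) (simp add: c_def)
  have bound: "\<bar>Re (heat_op s p x) - p x\<bar> \<le> (\<Sum>k\<in>F. \<bar>heat_symbol s k - 1\<bar> * cmod (a k))" if "s > 0" for s x
  proof -
    have "heat_op s p x - complex_of_real (p x) = fseries (\<lambda>k. complex_of_real (heat_symbol s k) * c k - c k) x"
      unfolding heat_op_def fc pc
      by (rule fseries_diff[symmetric]) (auto intro!: supp simp: c_def)
    also have "\<dots> = (\<Sum>k\<in>F. (complex_of_real (heat_symbol s k - 1) * a k) * character k x)"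
      unfolding fseries_def by (subst fin) (auto simp: c_def algebra_simps intro!: sum.cong)
    finally have "cmod (heat_op s p x - complex_of_real (p x)) \<le> (\<Sum>k\<in>F. cmod ((complex_of_real (heat_symbol s k - 1) * a k) * character k x))"
      by (simp only: norm_sum)
    also have "\<dots> = (\<Sum>k\<in>F. \<bar>heat_symbol s k - 1\<bar> * cmod (a k))"
      by (simp only: norm_mult norm_of_real norm_cis mult_1_right)
    finally have "cmod (heat_op s p x - complex_of_real (p x)) \<le> (\<Sum>k\<in>F. \<bar>heat_symbol s k - 1\<bar> * cmod (a k))" .
    moreover have "\<bar>Re (heat_op s p x) - p x\<bar> \<le> cmod (heat_op s p x - complex_of_real (p x))"
      using abs_Re_le_cmod[of "heat_op s p x - complex_of_real (p x)"] by simp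
    ultimately show ?thesis by linarith
  qed
  have "((\<lambda>s. \<Sum>k\<in>F. \<bar>heat_symbol s k - 1\<bar> * cmod (a k)) \<longlongrightarrow> (\<Sum>k\<in>F. \<bar>exp (- 0 * (norm (freq k))\<^sup>2) - 1\<bar> * cmod (a k))) (at_right 0)"
    unfolding heat_symbol_def by (intro tendsto_intros)
  then have "((\<lambda>s. \<Sum>k\<in>F. \<bar>heat_symbol s k - 1\<bar> * cmod (a k)) \<longlongrightarrow> 0) (at_right 0)"
    by simp
  from order_tendstoD(2)[OF this \<open>e > 0\<close>] eventually_at_right_less[of 0]
  show ?thesis
    by eventually_elim (use bound in \<open>auto intro: le_less_trans\<close>)
qed

text \<open>
  For a trigonometric polynomial the convergence is uniform. The contraction property carries it
  over to the \<open>L\<^sup>3\<close> closure.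
\<close>

lemma heat_op_tendsto_L3:
  assumes f: "L3 f"
  shows "((\<lambda>s. LINT x|torus. \<bar>Re (heat_op s f x) - f x\<bar> ^ 3) \<longlongrightarrow> 0) (at_right 0)"
proof (rule order_tendstoI)
  fix e :: real assume "e < 0"
  then have "e < (LINT x|torus. \<bar>Re (heat_op s f x) - f x\<bar> ^ 3)" for s
    by (rule less_le_trans) simp
  then show "\<forall>\<^sub>F s in at_right 0. e < (LINT x|torus. \<bar>Re (heat_op s f x) - f x\<bar> ^ 3)" by simp
next
  fix e :: real assume e: "0 < e"
  \<comment> \<open>The sum of the three errors costs a factor 9, and \<open>9 (3/36) < 1\<close>.\<close>
  obtain p where p: "trig_poly (\<lambda>x. complex_of_real (p x))" "L3 p" and fp: "L3 (\<lambda>x. f x - p x)"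
    and small: "(LINT x|torus. \<bar>f x - p x\<bar> ^ 3) < e / 36"
    using trig_poly_dense_L3[OF f, of "e / 36"] e by auto
  define V where "V = (2 * pi) ^ 3"
  define r where "r = min 1 (e / (36 * V))"
  have V: "V > 0" by (simp add: V_def)
  have r: "r > 0" using e V by (simp add: r_def)
  have r3: "r ^ 3 * V \<le> e / 36"
  proof -
    have "r ^ 3 \<le> r" using r power_decreasing[of 1 3 r] by (simp add: r_def)
    also have "r \<le> e / (36 * V)" by (simp add: r_def)
    finally show ?thesis using V by (simp add: field_simps)
  qed
  have [measurable]: "f \<in> borel_measurable torus" "p \<in> borel_measurable torus"
    using f p(2) by (auto simp: L3_def)
  have ip: "integrable torus p" and ifp: "integrable torus (\<lambda>x. f x - p x)" and i_f: "integrable torus f"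
    using p fp f L3_integrable by auto
  from heat_op_trig_poly_uniform[OF p(1) ip r] eventually_at_right_less[of 0]
  show "\<forall>\<^sub>F s in at_right 0. (LINT x|torus. \<bar>Re (heat_op s f x) - f x\<bar> ^ 3) < e"
  proof eventually_elim
    case (elim s)
    then have s: "s > 0" by simp
    have [measurable]: "(\<lambda>x. Re (heat_op s h x)) \<in> borel_measurable torus" for h
      using integrable_Re[OF heat_op_integrable[OF s, of h]] by auto
    define A where "A x = \<bar>Re (heat_op s (\<lambda>x. f x - p x) x)\<bar> ^ 3" for x
    define C where "C x = \<bar>f x - p x\<bar> ^ 3" for x
    have iA: "integrable torus A" and A: "integral\<^sup>L torus A \<le> e / 36"
      using heat_op_L3_contraction[OF s fp] small by (auto simp: A_def[abs_def] L3_def)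
    have iC: "integrable torus C" and C: "integral\<^sup>L torus C \<le> e / 36"
      using fp small by (auto simp: C_def[abs_def] L3_def)
    have le: "\<bar>Re (heat_op s f x) - f x\<bar> ^ 3 \<le> 9 * (A x + r ^ 3 + C x)" for x
    proof -
      have eq: "Re (heat_op s f x) - f x = Re (heat_op s (\<lambda>x. f x - p x) x) + (Re (heat_op s p x) - p x) + (p x - f x)"
        using heat_op_linear(2)[OF s i_f ip] by simp
      have "\<bar>Re (heat_op s p x) - p x\<bar> ^ 3 \<le> r ^ 3"
        using elim(1) by (intro power_mono) (auto intro: less_imp_le)
      moreover have "\<bar>p x - f x\<bar> ^ 3 = C x" by (simp add: C_def abs_minus_commute)
      ultimately show ?thesis
        unfolding eq using cube_sum3_le[of "Re (heat_op s (\<lambda>x. f x - p x) x)" "Re (heat_op s p x) - p x" "p x - f x"]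
        by (simp add: A_def)
    qed
    have irhs: "integrable torus (\<lambda>x. 9 * (A x + r ^ 3 + C x))" using iA iC by simp
    have "(LINT x|torus. \<bar>Re (heat_op s f x) - f x\<bar> ^ 3) \<le> (LINT x|torus. 9 * (A x + r ^ 3 + C x))"
      by (rule integral_mono_AE[OF Bochner_Integration.integrable_bound[OF irhs] irhs])
        (auto intro!: AE_I2 le order_trans[OF le])
    also have "\<dots> = 9 * (integral\<^sup>L torus A + r ^ 3 * V + integral\<^sup>L torus C)"
    proof -
      have "(LINT x|torus. r ^ 3) = r ^ 3 * V"
        by (simp add: measure_torus V_def)
      then show ?thesis using iA iC by simp
    qed
    also have "\<dots> \<le> 9 * (e / 36 + e / 36 + e / 36)" using A C r3 by simp
    also have "\<dots> < e" using e by simp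
    finally show ?case .
  qed
qed

section \<open>The Hilbert space of square summable coefficients\<close>

lemma lattice_bounded_sums:
  fixes f :: "int^3 \<Rightarrow> real"
  assumes nn: "\<And>k. 0 \<le> f k" and fin: "\<And>F. finite F \<Longrightarrow> (\<Sum>k\<in>F. f k) \<le> B"
  shows "integrable lattice f" "(LINT k|lattice. f k) \<le> B"
proof -
  have "f summable_on UNIV"
    by (rule nonneg_bdd_above_summable_on) (use nn fin in \<open>auto intro!: bdd_aboveI[of _ B]\<close>)
  then show i: "integrable lattice f"
    using nn by (simp add: integrable_lattice_iff)
  have "(\<Sum>\<^sub>\<infinity>k. f k) \<le> B"
    using \<open>f summable_on UNIV\<close> fin by (intro infsum_le_finite_sums) auto
  then show "(LINT k|lattice. f k) \<le> B"
    using infsum_eq_lattice_integral[OF i] by simp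
qed

lemma sum_le_lattice_integral:
  fixes f :: "int^3 \<Rightarrow> real"
  assumes "integrable lattice f" "\<And>k. 0 \<le> f k" "finite F"
  shows "(\<Sum>k\<in>F. f k) \<le> (LINT k|lattice. f k)"
proof -
  have "(\<Sum>k\<in>F. f k) \<le> (\<Sum>\<^sub>\<infinity>k. f k)"
    using assms by (intro finite_sum_le_infsum) (auto simp: integrable_lattice_iff)
  then show ?thesis
    using infsum_eq_lattice_integral[OF assms(1)] by simp
qed

text \<open>
  Introduced as a type because Banach's fixed point theorem and bounded bilinear maps are stated
  for type classes.
\<close>

typedef l2 = "{a :: int^3 \<Rightarrow> complex. integrable lattice (\<lambda>k. (cmod (a k))\<^sup>2)}"
  morphisms l2_nth Abs_l2
  by (rule exI[of _ "\<lambda>_. 0"]) simp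

lemma l2_nth_integrable: "integrable lattice (\<lambda>k. (cmod (l2_nth a k))\<^sup>2)"
  using l2_nth[of a] by simp

lemma l2_nth_Abs: "integrable lattice (\<lambda>k. (cmod (a k))\<^sup>2) \<Longrightarrow> l2_nth (Abs_l2 a) = a"
  by (simp add: Abs_l2_inverse)

lemma l2_eqI: "(\<And>k. l2_nth a k = l2_nth b k) \<Longrightarrow> a = b"
  by (metis ext l2_nth_inject)

lemma mult_le_sum_squares: "x * y \<le> x\<^sup>2 + y\<^sup>2" for x y :: real
  using sum_power2_ge_zero[of x y] sum_squares_bound[of x y] by linarith

lemma norm_add_sq_le: "(norm (x + y))\<^sup>2 \<le> 2 * (norm x)\<^sup>2 + 2 * (norm y)\<^sup>2"
  for x y :: "'a :: real_normed_vector"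
proof -
  have "(norm (x + y))\<^sup>2 \<le> (norm x + norm y)\<^sup>2"
    by (intro power_mono norm_triangle_ineq) simp
  also have "\<dots> \<le> 2 * (norm x)\<^sup>2 + 2 * (norm y)\<^sup>2"
    using zero_le_power2[of "norm x - norm y"] by (simp add: power2_eq_square algebra_simps)
  finally show ?thesis .
qed

lemma integrable_square_add:
  assumes "integrable lattice (\<lambda>k. (cmod (a k))\<^sup>2)" "integrable lattice (\<lambda>k. (cmod (b k))\<^sup>2)"
  shows "integrable lattice (\<lambda>k. (cmod (a k + b k))\<^sup>2)"
  by (rule Bochner_Integration.integrable_bound[of _ "\<lambda>k. 2 * (cmod (a k))\<^sup>2 + 2 * (cmod (b k))\<^sup>2"])
    (use assms norm_add_sq_le in \<open>auto intro!: AE_I2\<close>)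

instantiation l2 :: real_vector
begin

definition "zero_l2 = Abs_l2 (\<lambda>_. 0)"
definition "plus_l2 a b = Abs_l2 (\<lambda>k. l2_nth a k + l2_nth b k)"
definition "uminus_l2 a = Abs_l2 (\<lambda>k. - l2_nth a k)"
definition "minus_l2 a b = Abs_l2 (\<lambda>k. l2_nth a k - l2_nth b k)"
definition "scaleR_l2 r a = Abs_l2 (\<lambda>k. r *\<^sub>R l2_nth a k)" for a :: l2

lemma l2_nth_zero: "l2_nth 0 k = 0"
  by (simp add: zero_l2_def l2_nth_Abs)

lemma l2_nth_add: "l2_nth (a + b) k = l2_nth a k + l2_nth b k"
  by (simp add: plus_l2_def l2_nth_Abs integrable_square_add l2_nth_integrable)

lemma l2_nth_uminus: "l2_nth (- a) k = - l2_nth a k"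
  by (simp add: uminus_l2_def l2_nth_Abs l2_nth_integrable)

lemma l2_nth_diff: "l2_nth (a - b) k = l2_nth a k - l2_nth b k"
  using integrable_square_add[of "l2_nth a" "\<lambda>k. - l2_nth b k"]
  by (simp add: minus_l2_def l2_nth_Abs l2_nth_integrable)

lemma l2_nth_scaleR: "l2_nth (r *\<^sub>R a) k = r *\<^sub>R l2_nth a k"
  by (simp add: scaleR_l2_def l2_nth_Abs power_mult_distrib l2_nth_integrable)

instance
  by standard
    (auto intro!: l2_eqI simp: l2_nth_zero l2_nth_add l2_nth_uminus l2_nth_diff l2_nth_scaleR algebra_simps)

end

lemmas l2_nth_simps [simp] = l2_nth_zero l2_nth_add l2_nth_uminus l2_nth_diff l2_nth_scaleR

instantiation l2 :: real_inner
begin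

definition "inner_l2 a b = (LINT k|lattice. inner (l2_nth a k) (l2_nth b k))" for a b :: l2
definition "norm_l2 a = sqrt (inner a a)" for a :: l2
definition "sgn_l2 a = a /\<^sub>R norm a" for a :: l2
definition "dist_l2 a b = norm (a - b)" for a b :: l2
definition [code del]: "(uniformity :: (l2 \<times> l2) filter) = (INF e\<in>{0 <..}. principal {(x, y). dist x y < e})"
definition [code del]: "open (U :: l2 set) = (\<forall>x\<in>U. \<forall>\<^sub>F (x', y) in uniformity. x' = x \<longrightarrow> y \<in> U)"

lemma integrable_l2_inner: "integrable lattice (\<lambda>k. inner (l2_nth a k) (l2_nth b k))"
proof (rule Bochner_Integration.integrable_bound)
  show "integrable lattice (\<lambda>k. (cmod (l2_nth a k))\<^sup>2 + (cmod (l2_nth b k))\<^sup>2)"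
    by (simp add: l2_nth_integrable)
  show "AE k in lattice. norm (inner (l2_nth a k) (l2_nth b k)) \<le> norm ((cmod (l2_nth a k))\<^sup>2 + (cmod (l2_nth b k))\<^sup>2)"
  proof (rule AE_I2)
    fix k
    have "\<bar>inner (l2_nth a k) (l2_nth b k)\<bar> \<le> cmod (l2_nth a k) * cmod (l2_nth b k)"
      by (rule Cauchy_Schwarz_ineq2)
    also have "\<dots> \<le> (cmod (l2_nth a k))\<^sup>2 + (cmod (l2_nth b k))\<^sup>2"
      by (rule mult_le_sum_squares)
    finally show "norm (inner (l2_nth a k) (l2_nth b k)) \<le> norm ((cmod (l2_nth a k))\<^sup>2 + (cmod (l2_nth b k))\<^sup>2)"
      by simp
  qed
qed simp

instance
proof
  fix x y z :: l2 and r :: real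
  show "inner x y = inner y x" by (simp add: inner_l2_def inner_commute)
  show "inner (x + y) z = inner x z + inner y z"
    by (simp add: inner_l2_def inner_add_left integrable_l2_inner)
  show "inner (r *\<^sub>R x) y = r * inner x y" by (simp add: inner_l2_def)
  show "0 \<le> inner x x" by (simp add: inner_l2_def)
  show "inner x x = 0 \<longleftrightarrow> x = 0"
  proof
    assume "inner x x = 0"
    then have "AE k in lattice. inner (l2_nth x k) (l2_nth x k) = 0"
      unfolding inner_l2_def by (subst (asm) integral_nonneg_eq_0_iff_AE) (auto intro: integrable_l2_inner)
    then show "x = 0" by (intro l2_eqI) (simp add: AE_count_space)
  qed (simp add: inner_l2_def)
  show "norm x = sqrt (inner x x)" by (simp add: norm_l2_def)
qed (simp_all add: sgn_l2_def dist_l2_def uniformity_l2_def open_l2_def)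

end

lemma l2_norm_sq: "(norm a)\<^sup>2 = (LINT k|lattice. (cmod (l2_nth a k))\<^sup>2)"
  by (simp add: power2_norm_eq_inner inner_l2_def)

lemma l2_norm_sq_ennreal: "ennreal ((norm a)\<^sup>2) = (\<integral>\<^sup>+k. ennreal ((cmod (l2_nth a k))\<^sup>2) \<partial>lattice)"
  unfolding l2_norm_sq by (rule nn_integral_eq_integral[symmetric]) (auto intro: l2_nth_integrable)

lemma sum_le_l2_norm_sq: "finite F \<Longrightarrow> (\<Sum>k\<in>F. (cmod (l2_nth a k))\<^sup>2) \<le> (norm a)\<^sup>2"
  unfolding l2_norm_sq by (intro sum_le_lattice_integral l2_nth_integrable) auto

lemma norm_l2_nth_le: "cmod (l2_nth a k) \<le> norm a"
  by (rule power2_le_imp_le) (use sum_le_l2_norm_sq[of "{k}" a] in auto)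

lemma l2_norm_leI:
  assumes "\<And>F. finite F \<Longrightarrow> (\<Sum>k\<in>F. (cmod (l2_nth a k))\<^sup>2) \<le> B\<^sup>2" "0 \<le> B"
  shows "norm a \<le> B"
  using lattice_bounded_sums(2)[of "\<lambda>k. (cmod (l2_nth a k))\<^sup>2" "B\<^sup>2"] assms
  by (auto simp: l2_norm_sq[symmetric] intro: power2_le_imp_le)

lemma bounded_linear_l2_nth: "bounded_linear (\<lambda>a. l2_nth a k)"
  by (rule bounded_linear_intro[of _ 1]) (auto simp: norm_l2_nth_le)

lemmas tendsto_l2_nth = bounded_linear.tendsto[OF bounded_linear_l2_nth]
lemmas continuous_on_l2_nth [continuous_intros] = bounded_linear.continuous_on[OF bounded_linear_l2_nth]

instance l2 :: complete_space
proof
  fix X :: "nat \<Rightarrow> l2" assume X: "Cauchy X"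
  have "Cauchy (\<lambda>n. l2_nth (X n) k)" for k
    by (rule bounded_linear.Cauchy[OF bounded_linear_l2_nth X])
  then obtain x where x: "\<And>k. (\<lambda>n. l2_nth (X n) k) \<longlonglongrightarrow> x k"
    unfolding Cauchy_convergent_iff convergent_def by metis
  have tail: "\<exists>N. \<forall>n\<ge>N. \<forall>F. finite F \<longrightarrow> (\<Sum>k\<in>F. (cmod (l2_nth (X n) k - x k))\<^sup>2) \<le> e\<^sup>2" if "e > 0" for e
  proof -
    obtain N where N: "\<And>m n. m \<ge> N \<Longrightarrow> n \<ge> N \<Longrightarrow> norm (X m - X n) < e"
      using X \<open>e > 0\<close> unfolding Cauchy_iff by blast
    have "(\<Sum>k\<in>F. (cmod (l2_nth (X n) k - x k))\<^sup>2) \<le> e\<^sup>2" if "n \<ge> N" "finite F" for n F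
    proof (rule LIMSEQ_le_const2)
      show "(\<lambda>m. \<Sum>k\<in>F. (cmod (l2_nth (X n) k - l2_nth (X m) k))\<^sup>2) \<longlonglongrightarrow> (\<Sum>k\<in>F. (cmod (l2_nth (X n) k - x k))\<^sup>2)"
        by (intro tendsto_intros x)
      show "\<exists>M. \<forall>m\<ge>M. (\<Sum>k\<in>F. (cmod (l2_nth (X n) k - l2_nth (X m) k))\<^sup>2) \<le> e\<^sup>2"
      proof (intro exI allI impI)
        fix m assume "m \<ge> N"
        have "(\<Sum>k\<in>F. (cmod (l2_nth (X n - X m) k))\<^sup>2) \<le> (norm (X n - X m))\<^sup>2"
          by (rule sum_le_l2_norm_sq) fact
        also have "\<dots> \<le> e\<^sup>2"
          using N[OF \<open>n \<ge> N\<close> \<open>m \<ge> N\<close>] by (intro power_mono) auto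
        finally show "(\<Sum>k\<in>F. (cmod (l2_nth (X n) k - l2_nth (X m) k))\<^sup>2) \<le> e\<^sup>2" by simp
      qed
    qed
    then show ?thesis by blast
  qed
  obtain N where N: "\<And>F. finite F \<Longrightarrow> (\<Sum>k\<in>F. (cmod (l2_nth (X N) k - x k))\<^sup>2) \<le> 1\<^sup>2"
    using tail[of 1] by auto
  have "integrable lattice (\<lambda>k. (cmod (l2_nth (X N) k - x k))\<^sup>2)"
    by (rule lattice_bounded_sums[OF _ N]) auto
  then have "integrable lattice (\<lambda>k. (cmod (x k - l2_nth (X N) k))\<^sup>2)"
    by (simp add: norm_minus_commute)
  from integrable_square_add[OF this l2_nth_integrable[of "X N"]]
  have "integrable lattice (\<lambda>k. (cmod (x k))\<^sup>2)" by simp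
  then have nth: "l2_nth (Abs_l2 x) = x" by (rule l2_nth_Abs)
  have "X \<longlonglongrightarrow> Abs_l2 x"
  proof (rule LIMSEQ_I)
    fix e :: real assume "0 < e"
    then obtain M where M: "\<And>n F. n \<ge> M \<Longrightarrow> finite F \<Longrightarrow> (\<Sum>k\<in>F. (cmod (l2_nth (X n) k - x k))\<^sup>2) \<le> (e / 2)\<^sup>2"
      using tail[of "e / 2"] by auto
    have "norm (X n - Abs_l2 x) \<le> e / 2" if "n \<ge> M" for n
      using M[OF that] \<open>0 < e\<close> by (intro l2_norm_leI) (auto simp: nth)
    then show "\<exists>M. \<forall>n\<ge>M. norm (X n - Abs_l2 x) < e"
      using \<open>0 < e\<close> by (intro exI[of _ M]) (smt (verit) field_sum_of_halves)
  qed
  then show "convergent X" by (rule convergentI)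
qed

section \<open>The quadratic nonlinearity\<close>

definition weight_sum :: real where
  "weight_sum = (LINT k|lattice. 1 / norm (freq k) ^ 4)"

lemma nn_integral_weight: "(\<integral>\<^sup>+k. ennreal (1 / norm (freq k) ^ 4) \<partial>lattice) = ennreal weight_sum"
  unfolding weight_sum_def by (intro nn_integral_eq_integral integrable_lattice_weight) auto

lemma weight_sum_nonneg: "0 \<le> weight_sum"
  by (simp add: weight_sum_def)

lemma nn_integral_lattice_shift: "(\<integral>\<^sup>+k. f (k - l) \<partial>lattice) = (\<integral>\<^sup>+k. f k \<partial>lattice)"
  for f :: "int^3 \<Rightarrow> ennreal"
  by (rule nn_integral_bij_count_space)
    (auto simp: bij_betw_def inj_on_def surj_def intro: exI[of _ "_ + l"])

lemma nn_integral_lattice_reflect: "(\<integral>\<^sup>+l. f (k - l) \<partial>lattice) = (\<integral>\<^sup>+l. f l \<partial>lattice)"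
  for f :: "int^3 \<Rightarrow> ennreal"
  by (rule nn_integral_bij_count_space)
    (auto simp: bij_betw_def inj_on_def surj_def intro: exI[of _ "k - _"])

lemma nn_integral_lattice_swap:
  fixes f :: "int^3 \<Rightarrow> int^3 \<Rightarrow> ennreal"
  shows "(\<integral>\<^sup>+k. \<integral>\<^sup>+l. f k l \<partial>lattice \<partial>lattice) = (\<integral>\<^sup>+l. \<integral>\<^sup>+k. f k l \<partial>lattice \<partial>lattice)"
proof -
  interpret pair_sigma_finite lattice lattice
    by (intro pair_sigma_finite.intro sigma_finite_lattice)
  have "(\<lambda>(k, l). f k l) \<in> borel_measurable (lattice \<Otimes>\<^sub>M lattice)"
    by (rule measurable_pair_lattice) simp
  from Fubini'[OF this] show ?thesis by simp
qed

definition conv_sq :: "(int^3 \<Rightarrow> complex) \<Rightarrow> (int^3 \<Rightarrow> complex) \<Rightarrow> int^3 \<Rightarrow> ennreal" where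
  "conv_sq a b k = (\<integral>\<^sup>+l. ennreal ((cmod (a l))\<^sup>2) * ennreal ((cmod (b (k - l)))\<^sup>2) \<partial>lattice)"

lemma nn_integral_conv:
  fixes f g :: "int^3 \<Rightarrow> ennreal"
  shows "(\<integral>\<^sup>+k. \<integral>\<^sup>+l. f l * g (k - l) \<partial>lattice \<partial>lattice) = (\<integral>\<^sup>+k. f k \<partial>lattice) * (\<integral>\<^sup>+k. g k \<partial>lattice)"
proof -
  have "(\<integral>\<^sup>+k. \<integral>\<^sup>+l. f l * g (k - l) \<partial>lattice \<partial>lattice) = (\<integral>\<^sup>+l. \<integral>\<^sup>+k. f l * g (k - l) \<partial>lattice \<partial>lattice)"
    by (rule nn_integral_lattice_swap)
  also have "\<dots> = (\<integral>\<^sup>+l. f l * (\<integral>\<^sup>+k. g k \<partial>lattice) \<partial>lattice)"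
  proof (intro nn_integral_cong)
    fix l
    have "(\<integral>\<^sup>+k. f l * g (k - l) \<partial>lattice) = f l * (\<integral>\<^sup>+k. g (k - l) \<partial>lattice)"
      by (rule nn_integral_cmult) simp
    also have "(\<integral>\<^sup>+k. g (k - l) \<partial>lattice) = (\<integral>\<^sup>+k. g k \<partial>lattice)"
      by (rule nn_integral_lattice_shift)
    finally show "(\<integral>\<^sup>+k. f l * g (k - l) \<partial>lattice) = f l * (\<integral>\<^sup>+k. g k \<partial>lattice)" .
  qed
  also have "\<dots> = (\<integral>\<^sup>+k. f k \<partial>lattice) * (\<integral>\<^sup>+k. g k \<partial>lattice)"
    by (rule nn_integral_multc) simp
  finally show ?thesis .
qed

text \<open>
  The properties of the velocity symbol on which the whole argument rests: the gain of two
  derivatives, a divergence free velocity, and evenness, by which real functions have real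
  velocities.
\<close>

locale drift_symbol =
  fixes m :: "int^3 \<Rightarrow> real^3" and C :: real
  assumes C_nonneg: "0 \<le> C"
    and m_bound: "norm (m l) \<le> C / (norm (freq l))\<^sup>2"
    and div_free: "freq l \<bullet> m l = 0"
    and m_even: "m (- l) = m l"
begin

text \<open>
  The unit vector \<open>sgn (freq k)\<close> is what remains of the divergence once the factor \<open>|k|\<close> has been
  split off; that factor is paid for by the dissipation.
\<close>

definition kernel :: "int^3 \<Rightarrow> int^3 \<Rightarrow> complex" where
  "kernel k l = complex_of_real (sgn (freq k) \<bullet> m l)"

lemma norm_mult_kernel: "of_real (norm (freq k)) * kernel k l = of_real (freq k \<bullet> m l)"
proof -
  have "norm (freq k) * (sgn (freq k) \<bullet> m l) = freq k \<bullet> m l"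
    by (cases "k = 0") (simp_all add: sgn_div_norm)
  then show ?thesis by (simp only: kernel_def of_real_mult[symmetric])
qed

lemma norm_kernel_le: "cmod (kernel k l) \<le> C / (norm (freq l))\<^sup>2"
proof -
  have "\<bar>sgn (freq k) \<bullet> m l\<bar> \<le> norm (sgn (freq k)) * norm (m l)"
    by (rule Cauchy_Schwarz_ineq2)
  also have "\<dots> \<le> 1 * norm (m l)"
    by (intro mult_right_mono) (auto simp: norm_sgn)
  finally show ?thesis using m_bound[of l] by (simp add: kernel_def)
qed

lemma norm_kernel_le_C: "cmod (kernel k l) \<le> C"
proof (cases "l = 0")
  case True
  then show ?thesis using norm_kernel_le[of k l] C_nonneg by simp
next
  case False
  then have "1 \<le> (norm (freq l))\<^sup>2" using norm_freq_ge_1[OF False] by simp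
  then have "C / (norm (freq l))\<^sup>2 \<le> C / 1" using C_nonneg by (intro divide_left_mono) auto
  then show ?thesis using norm_kernel_le[of k l] by simp
qed

definition quad_coeff :: "(int^3 \<Rightarrow> complex) \<Rightarrow> (int^3 \<Rightarrow> complex) \<Rightarrow> int^3 \<Rightarrow> complex" where
  "quad_coeff a b k = (LINT l|lattice. kernel k l * a l * b (k - l))"

lemma integrable_lattice_reflect:
  fixes f :: "int^3 \<Rightarrow> real"
  shows "integrable lattice (\<lambda>l. f (k - l)) \<longleftrightarrow> integrable lattice f"
proof -
  have "(\<integral>\<^sup>+l. ennreal (norm (f (k - l))) \<partial>lattice) = (\<integral>\<^sup>+l. ennreal (norm (f l)) \<partial>lattice)"
    by (rule nn_integral_lattice_reflect)
  then show ?thesis by (simp add: integrable_iff_bounded)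
qed

lemma integrable_quad:
  "integrable lattice (\<lambda>l. kernel k l * l2_nth a l * l2_nth b (k - l))"
proof (rule Bochner_Integration.integrable_bound)
  have "integrable lattice (\<lambda>l. (cmod (l2_nth b (k - l)))\<^sup>2)"
    using integrable_lattice_reflect[of "\<lambda>l. (cmod (l2_nth b l))\<^sup>2" k] l2_nth_integrable by simp
  then show "integrable lattice (\<lambda>l. C * ((cmod (l2_nth a l))\<^sup>2 + (cmod (l2_nth b (k - l)))\<^sup>2))"
    using l2_nth_integrable[of a] by simp
  show "AE l in lattice. norm (kernel k l * l2_nth a l * l2_nth b (k - l))
      \<le> norm (C * ((cmod (l2_nth a l))\<^sup>2 + (cmod (l2_nth b (k - l)))\<^sup>2))"
  proof (rule AE_I2)
    fix l
    let ?x = "cmod (l2_nth a l)" and ?y = "cmod (l2_nth b (k - l))"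
    have "?x * ?y \<le> ?x\<^sup>2 + ?y\<^sup>2"
      by (rule mult_le_sum_squares)
    then have "cmod (kernel k l) * (?x * ?y) \<le> C * (?x\<^sup>2 + ?y\<^sup>2)"
      using norm_kernel_le_C C_nonneg by (intro mult_mono) auto
    then show "norm (kernel k l * l2_nth a l * l2_nth b (k - l)) \<le> norm (C * (?x\<^sup>2 + ?y\<^sup>2))"
      using C_nonneg by (simp add: norm_mult mult.assoc)
  qed
qed simp

text \<open>
  Cauchy-Schwarz with the factors \<open>C |l|^(-2)\<close> and \<open>|a\<^sub>l b_(k-l)|\<close>.
\<close>

lemma quad_abs_sq_le:
  "(\<integral>\<^sup>+l. ennreal (cmod (kernel k l * a l * b (k - l))) \<partial>lattice)\<^sup>2 \<le> ennreal (C\<^sup>2 * weight_sum) * conv_sq a b k"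
proof -
  have "(\<integral>\<^sup>+l. ennreal (cmod (kernel k l * a l * b (k - l))) \<partial>lattice) \<le> (\<integral>\<^sup>+l. ennreal (C / (norm (freq l))\<^sup>2) * ennreal (cmod (a l) * cmod (b (k - l))) \<partial>lattice)"
  proof (intro nn_integral_mono)
    fix l
    have "cmod (kernel k l * a l * b (k - l)) \<le> C / (norm (freq l))\<^sup>2 * (cmod (a l) * cmod (b (k - l)))"
      unfolding norm_mult mult.assoc by (intro mult_right_mono norm_kernel_le) auto
    then show "ennreal (cmod (kernel k l * a l * b (k - l)))
        \<le> ennreal (C / (norm (freq l))\<^sup>2) * ennreal (cmod (a l) * cmod (b (k - l)))"
      using C_nonneg by (subst ennreal_mult[symmetric]) (auto intro!: ennreal_leI)
  qed
  then have "(\<integral>\<^sup>+l. ennreal (cmod (kernel k l * a l * b (k - l))) \<partial>lattice)\<^sup>2 \<le>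
      (\<integral>\<^sup>+l. ennreal (C / (norm (freq l))\<^sup>2) * ennreal (cmod (a l) * cmod (b (k - l))) \<partial>lattice)\<^sup>2"
    by (rule power_mono) simp
  also have "\<dots> \<le> (\<integral>\<^sup>+l. (ennreal (C / (norm (freq l))\<^sup>2))\<^sup>2 \<partial>lattice) * (\<integral>\<^sup>+l. (ennreal (cmod (a l) * cmod (b (k - l))))\<^sup>2 \<partial>lattice)"
    by (rule Cauchy_Schwarz_nn_integral) auto
  also have "(\<integral>\<^sup>+l. (ennreal (C / (norm (freq l))\<^sup>2))\<^sup>2 \<partial>lattice) = (\<integral>\<^sup>+l. ennreal (C\<^sup>2) * ennreal (1 / norm (freq l) ^ 4) \<partial>lattice)"
    using C_nonneg by (intro nn_integral_cong) (simp add: ennreal_power ennreal_mult[symmetric] power_divide power_mult[symmetric])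
  also have "\<dots> = ennreal (C\<^sup>2 * weight_sum)"
    using weight_sum_nonneg by (simp add: nn_integral_cmult nn_integral_weight ennreal_mult)
  also have "(\<integral>\<^sup>+l. (ennreal (cmod (a l) * cmod (b (k - l))))\<^sup>2 \<partial>lattice) = conv_sq a b k"
    unfolding conv_sq_def by (intro nn_integral_cong) (simp add: ennreal_power ennreal_mult[symmetric] power_mult_distrib)
  finally show ?thesis .
qed

lemma quad_coeff_sq_le:
  "ennreal ((cmod (quad_coeff a b k))\<^sup>2) \<le> ennreal (C\<^sup>2 * weight_sum) * conv_sq a b k"
proof -
  have "ennreal (cmod (quad_coeff a b k)) \<le> (\<integral>\<^sup>+l. ennreal (cmod (kernel k l * a l * b (k - l))) \<partial>lattice)"
    unfolding quad_coeff_def by (cases "integrable lattice (\<lambda>l. kernel k l * a l * b (k - l))")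
      (auto simp: integral_norm_bound_ennreal not_integrable_integral_eq)
  then have "(ennreal (cmod (quad_coeff a b k)))\<^sup>2 \<le> (\<integral>\<^sup>+l. ennreal (cmod (kernel k l * a l * b (k - l))) \<partial>lattice)\<^sup>2"
    by (rule power_mono) simp
  also note quad_abs_sq_le
  finally show ?thesis by (simp add: ennreal_power)
qed

text \<open>
  Summing over \<open>k\<close> turns the convolution of the squares into the product of their sums.
\<close>

lemma nn_integral_quad_coeff:
  "(\<integral>\<^sup>+k. ennreal ((cmod (quad_coeff (l2_nth a) (l2_nth b) k))\<^sup>2) \<partial>lattice)
    \<le> ennreal (C\<^sup>2 * weight_sum * (norm a)\<^sup>2 * (norm b)\<^sup>2)"
proof -
  have "(\<integral>\<^sup>+k. ennreal ((cmod (quad_coeff (l2_nth a) (l2_nth b) k))\<^sup>2) \<partial>lattice)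
    \<le> (\<integral>\<^sup>+k. ennreal (C\<^sup>2 * weight_sum) * conv_sq (l2_nth a) (l2_nth b) k \<partial>lattice)"
    by (intro nn_integral_mono quad_coeff_sq_le)
  also have "\<dots> = ennreal (C\<^sup>2 * weight_sum) * (ennreal ((norm a)\<^sup>2) * ennreal ((norm b)\<^sup>2))"
    unfolding conv_sq_def l2_norm_sq_ennreal
    by (subst nn_integral_conv[symmetric], subst nn_integral_cmult) simp_all
  also have "\<dots> = ennreal (C\<^sup>2 * weight_sum * (norm a)\<^sup>2 * (norm b)\<^sup>2)"
    using weight_sum_nonneg by (simp add: ennreal_mult[symmetric] mult.assoc)
  finally show ?thesis .
qed

lemma integrable_quad_coeff_sq:
  "integrable lattice (\<lambda>k. (cmod (quad_coeff (l2_nth a) (l2_nth b) k))\<^sup>2)"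
  using nn_integral_quad_coeff[of a b] by (auto simp: integrable_iff_bounded intro: le_less_trans)

definition quad :: "l2 \<Rightarrow> l2 \<Rightarrow> l2" where
  "quad a b = Abs_l2 (quad_coeff (l2_nth a) (l2_nth b))"

lemma l2_nth_quad: "l2_nth (quad a b) k = (LINT l|lattice. kernel k l * l2_nth a l * l2_nth b (k - l))"
  unfolding quad_def by (subst l2_nth_Abs[OF integrable_quad_coeff_sq]) (simp add: quad_coeff_def)

lemma l2_nth_quad_coeff: "l2_nth (quad a b) k = quad_coeff (l2_nth a) (l2_nth b) k"
  by (simp add: l2_nth_quad quad_coeff_def)

definition quad_bound :: real where
  "quad_bound = C\<^sup>2 * weight_sum"

lemma quad_bound_nonneg: "0 \<le> quad_bound"
  using weight_sum_nonneg by (simp add: quad_bound_def)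

lemma norm_quad_sq_le: "(norm (quad a b))\<^sup>2 \<le> quad_bound * (norm a)\<^sup>2 * (norm b)\<^sup>2"
proof -
  have "ennreal ((norm (quad a b))\<^sup>2) \<le> ennreal (quad_bound * (norm a)\<^sup>2 * (norm b)\<^sup>2)"
    unfolding l2_norm_sq_ennreal l2_nth_quad_coeff quad_bound_def by (rule nn_integral_quad_coeff)
  then show ?thesis
    using quad_bound_nonneg by (subst (asm) ennreal_le_iff) auto
qed

lemma norm_quad_le: "norm (quad a b) \<le> norm a * norm b * sqrt quad_bound"
proof (rule power2_le_imp_le)
  have "(norm a * norm b * sqrt quad_bound)\<^sup>2 = quad_bound * (norm a)\<^sup>2 * (norm b)\<^sup>2"
    using quad_bound_nonneg by (simp add: power_mult_distrib)
  then show "(norm (quad a b))\<^sup>2 \<le> (norm a * norm b * sqrt quad_bound)\<^sup>2"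
    using norm_quad_sq_le[of a b] by simp
qed (use quad_bound_nonneg in simp)

lemma bounded_bilinear_quad: "bounded_bilinear quad"
proof
  fix a a' b b' :: l2 and r :: real
  show "quad (a + a') b = quad a b + quad a' b"
    by (intro l2_eqI) (simp add: l2_nth_quad distrib_left distrib_right integrable_quad)
  show "quad a (b + b') = quad a b + quad a b'"
    by (intro l2_eqI) (simp add: l2_nth_quad distrib_left distrib_right integrable_quad)
  have "kernel k l * l2_nth (r *\<^sub>R a) l * l2_nth b (k - l) = r *\<^sub>R (kernel k l * l2_nth a l * l2_nth b (k - l))" for k l
    by (simp add: scaleR_conv_of_real)
  then show "quad (r *\<^sub>R a) b = r *\<^sub>R quad a b"
    by (intro l2_eqI) (simp only: l2_nth_quad l2_nth_scaleR[of _ "quad a b"] integral_scaleR_right)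
  have "kernel k l * l2_nth a l * l2_nth (r *\<^sub>R b) (k - l) = r *\<^sub>R (kernel k l * l2_nth a l * l2_nth b (k - l))" for k l
    by (simp add: scaleR_conv_of_real)
  then show "quad a (r *\<^sub>R b) = r *\<^sub>R quad a b"
    by (intro l2_eqI) (simp only: l2_nth_quad l2_nth_scaleR[of _ "quad a b"] integral_scaleR_right)
  show "\<exists>K. \<forall>a b. norm (quad a b) \<le> norm a * norm b * K"
    using norm_quad_le by blast
qed

sublocale quad: bounded_bilinear quad
  by (rule bounded_bilinear_quad)

end

text \<open>The squared homogeneous Sobolev norm of order \<open>n\<close>, possibly infinite.\<close>

definition sobolev_sq :: "nat \<Rightarrow> l2 \<Rightarrow> ennreal" where
  "sobolev_sq n a = (\<integral>\<^sup>+k. ennreal (norm (freq k) ^ (2 * n) * (cmod (l2_nth a k))\<^sup>2) \<partial>lattice)"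

lemma sobolev_sq_0: "sobolev_sq 0 a = ennreal ((norm a)\<^sup>2)"
  by (simp add: sobolev_sq_def l2_norm_sq_ennreal)

context drift_symbol
begin

text \<open>
  By \<open>|k|^(2n) \<le> 4\<^sup>n (|l|^(2n) + |k - l|^(2n))\<close> the derivatives fall on one of the two factors, so
  that the bound is linear in the high norm. This is what lets the smoothing induction run with
  constants that depend only on the low norm.
\<close>

lemma sobolev_sq_quad:
  "sobolev_sq n (quad a a) \<le> ennreal (quad_bound * (2 * 4 ^ n) * (norm a)\<^sup>2) * sobolev_sq n a"
proof -
  let ?w = "\<lambda>k. norm (freq k) ^ (2 * n)"
  let ?f = "\<lambda>l. ennreal ((cmod (l2_nth a l))\<^sup>2)"
  let ?g = "\<lambda>l. ennreal (?w l * (cmod (l2_nth a l))\<^sup>2)"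
  have w: "?w k \<le> 4 ^ n * (?w l + ?w (k - l))" for k l
  proof -
    define M where "M = max (norm (freq l)) (norm (freq (k - l)))"
    have "norm (freq k) \<le> norm (freq l) + norm (freq (k - l))"
      using norm_triangle_ineq[of "freq l" "freq (k - l)"] by (simp add: freq_add[symmetric])
    then have "norm (freq k) \<le> 2 * M" by (simp add: M_def)
    then have "?w k \<le> (2 * M) ^ (2 * n)" by (intro power_mono) auto
    also have "\<dots> = 4 ^ n * M ^ (2 * n)" by (simp add: power_mult_distrib power_mult)
    also have "M ^ (2 * n) \<le> ?w l + ?w (k - l)" by (auto simp: M_def max_def)
    finally show ?thesis by (simp add: mult_left_mono)
  qed
  have "ennreal (?w k * (cmod (l2_nth (quad a a) k))\<^sup>2)
      \<le> ennreal (quad_bound * 4 ^ n) * (\<integral>\<^sup>+l. ?g l * ?f (k - l) + ?f l * ?g (k - l) \<partial>lattice)" for k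
  proof -
    have "ennreal (?w k * (cmod (l2_nth (quad a a) k))\<^sup>2) \<le> ennreal (?w k) * (ennreal quad_bound * conv_sq (l2_nth a) (l2_nth a) k)"
      using quad_coeff_sq_le[of "l2_nth a" "l2_nth a" k]
      by (simp add: ennreal_mult l2_nth_quad_coeff quad_bound_def mult_left_mono)
    also have "\<dots> = ennreal quad_bound * (\<integral>\<^sup>+l. ennreal (?w k) * (?f l * ?f (k - l)) \<partial>lattice)"
      unfolding conv_sq_def mult.left_commute[of "ennreal (?w k)" "ennreal quad_bound"]
      by (subst nn_integral_cmult) simp_all
    also have "\<dots> \<le> ennreal quad_bound * (\<integral>\<^sup>+l. ennreal (4 ^ n) * (?g l * ?f (k - l) + ?f l * ?g (k - l)) \<partial>lattice)"
    proof (intro mult_left_mono nn_integral_mono)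
      fix l
      have "?w k * ((cmod (l2_nth a l))\<^sup>2 * (cmod (l2_nth a (k - l)))\<^sup>2)
        \<le> 4 ^ n * (?w l + ?w (k - l)) * ((cmod (l2_nth a l))\<^sup>2 * (cmod (l2_nth a (k - l)))\<^sup>2)"
        by (intro mult_right_mono w) auto
      also have "\<dots> = 4 ^ n * ((?w l * (cmod (l2_nth a l))\<^sup>2) * (cmod (l2_nth a (k - l)))\<^sup>2
          + (cmod (l2_nth a l))\<^sup>2 * (?w (k - l) * (cmod (l2_nth a (k - l)))\<^sup>2))"
        by (simp add: algebra_simps)
      finally show "ennreal (?w k) * (?f l * ?f (k - l)) \<le> ennreal (4 ^ n) * (?g l * ?f (k - l) + ?f l * ?g (k - l))"
        by (simp add: ennreal_mult[symmetric] ennreal_plus[symmetric] ennreal_leI del: ennreal_plus)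
    qed simp
    also have "\<dots> = ennreal (quad_bound * 4 ^ n) * (\<integral>\<^sup>+l. ?g l * ?f (k - l) + ?f l * ?g (k - l) \<partial>lattice)"
      using quad_bound_nonneg by (simp add: nn_integral_cmult ennreal_mult mult.assoc)
    finally show ?thesis .
  qed
  then have "sobolev_sq n (quad a a) \<le> (\<integral>\<^sup>+k. ennreal (quad_bound * 4 ^ n) * (\<integral>\<^sup>+l. ?g l * ?f (k - l) + ?f l * ?g (k - l) \<partial>lattice) \<partial>lattice)"
    unfolding sobolev_sq_def by (intro nn_integral_mono) auto
  also have "\<dots> = ennreal (quad_bound * 4 ^ n) * (sobolev_sq n a * ennreal ((norm a)\<^sup>2) + ennreal ((norm a)\<^sup>2) * sobolev_sq n a)"
    unfolding sobolev_sq_def l2_norm_sq_ennreal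
    by (subst (1 2) nn_integral_conv[symmetric], subst nn_integral_cmult, simp,
        subst nn_integral_add[symmetric], simp_all add: nn_integral_add)
  also have "\<dots> = ennreal (quad_bound * (2 * 4 ^ n) * (norm a)\<^sup>2) * sobolev_sq n a"
  proof -
    have "ennreal (quad_bound * (2 * 4 ^ n) * (norm a)\<^sup>2) = ennreal (quad_bound * 4 ^ n) * (2 * ennreal ((norm a)\<^sup>2))"
    proof -
      have "2 * ennreal ((norm a)\<^sup>2) = ennreal (2 * (norm a)\<^sup>2)" by (simp add: ennreal_mult)
      then show ?thesis
        using quad_bound_nonneg by (simp add: ennreal_mult[symmetric] mult_ac)
    qed
    moreover have "x * (s * y + y * s) = x * (2 * y) * s" for x y s :: ennreal
      by (simp add: mult.commute[of s y] mult_2 distrib_right mult.assoc)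
    ultimately show ?thesis by simp
  qed
  finally show ?thesis .
qed

end

section \<open>Integration over a time interval\<close>

abbreviation time :: "real \<Rightarrow> real measure" where
  "time t \<equiv> restrict_space lborel {0..t}"

lemma borel_measurable_time:
  "f \<in> borel_measurable borel \<Longrightarrow> f \<in> borel_measurable (time t)"
  by (rule measurable_restrict_space1) simp

lemma borel_measurable_time_cont:
  fixes f :: "real \<Rightarrow> 'b :: topological_space"
  shows "continuous_on UNIV f \<Longrightarrow> f \<in> borel_measurable (time t)"
  by (intro borel_measurable_time borel_measurable_continuous_onI)

lemma sigma_finite_time: "sigma_finite_measure (time t)"
  by (rule sigma_finite_measure_restrict_space) (auto intro: lborel.sigma_finite_measure_axioms)

lemma nn_integral_time_continuous:
  assumes cont: "continuous_on UNIV h" and nn: "\<And>\<tau>. 0 \<le> \<tau> \<Longrightarrow> \<tau> \<le> t \<Longrightarrow> 0 \<le> h \<tau>"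
  shows "(\<integral>\<^sup>+\<tau>. ennreal (h \<tau>) \<partial>time t) = ennreal (integral {0..t} h)"
proof -
  have "(\<integral>\<^sup>+\<tau>. ennreal (h \<tau>) \<partial>time t) = (\<integral>\<^sup>+\<tau>. ennreal (h \<tau>) * indicator {0..t} \<tau> \<partial>lborel)"
    by (subst nn_integral_restrict_space) auto
  also have "\<dots> = ennreal (integral {0..t} h)"
    by (rule nn_integral_has_integral_lebesgue')
      (use nn cont in \<open>auto intro!: integrable_integral integrable_continuous_real intro: continuous_on_subset\<close>)
  finally show ?thesis .
qed

lemma nn_integral_time_lattice_swap:
  assumes "\<And>k. (\<lambda>\<tau>. f \<tau> k) \<in> borel_measurable (time t)"
  shows "(\<integral>\<^sup>+k. \<integral>\<^sup>+\<tau>. f \<tau> k \<partial>time t \<partial>lattice) = (\<integral>\<^sup>+\<tau>. \<integral>\<^sup>+k. f \<tau> k \<partial>lattice \<partial>time t)"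
proof -
  interpret pair_sigma_finite "time t" lattice
    by (intro pair_sigma_finite.intro sigma_finite_lattice sigma_finite_time)
  have "(\<lambda>(\<tau>, k). f \<tau> k) \<in> borel_measurable (time t \<Otimes>\<^sub>M lattice)"
    by (rule measurable_pair_lattice_swap) (rule assms)
  from Fubini'[OF this] show ?thesis by simp
qed

lemma borel_measurable_lattice_nn_integral:
  assumes "\<And>k. (\<lambda>\<tau>. f \<tau> k) \<in> borel_measurable M"
  shows "(\<lambda>\<tau>. \<integral>\<^sup>+k. f \<tau> k \<partial>lattice) \<in> borel_measurable M"
proof -
  interpret sigma_finite_measure lattice by (rule sigma_finite_lattice)
  have "(\<lambda>(\<tau>, k). f \<tau> k) \<in> borel_measurable (M \<Otimes>\<^sub>M lattice)"
    by (rule measurable_pair_lattice_swap) (rule assms)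
  then show ?thesis by (rule borel_measurable_nn_integral)
qed

section \<open>A Gronwall inequality\<close>

lemma exp_integral_le:
  assumes "t \<ge> 0" "K > 0"
  shows "(\<integral>\<^sup>+\<tau>. ennreal (exp (K * \<tau>)) \<partial>time t) \<le> ennreal (exp (K * t) / K)"
proof -
  have "((\<lambda>\<tau>. exp (K * \<tau>)) has_integral (exp (K * t) / K - exp (K * 0) / K)) {0..t}"
    using assms by (intro fundamental_theorem_of_calculus)
      (auto intro!: derivative_eq_intros simp flip: has_real_derivative_iff_has_vector_derivative)
  then have "integral {0..t} (\<lambda>\<tau>. exp (K * \<tau>)) \<le> exp (K * t) / K"
    using assms by (simp add: integral_unique)
  then show ?thesis
    by (subst nn_integral_time_continuous) (auto intro!: continuous_intros ennreal_leI)
qed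

text \<open>
  The supremum \<open>S\<close> of \<open>exp (- L t) y(t)\<close> satisfies \<open>S \<le> (K / L) S\<close>, hence vanishes for \<open>L > K\<close>.
  Time zero is excluded because the functions of the uniqueness proof are not controlled there.
\<close>

lemma gronwall_zero:
  fixes y :: "real \<Rightarrow> real"
  assumes bound: "\<And>t. 0 < t \<Longrightarrow> t \<le> T \<Longrightarrow> y t \<le> B" and nn: "\<And>t. 0 < t \<Longrightarrow> t \<le> T \<Longrightarrow> 0 \<le> y t"
    and K: "0 \<le> K"
    and le: "\<And>t. 0 < t \<Longrightarrow> t \<le> T \<Longrightarrow> ennreal (y t) \<le> ennreal K * (\<integral>\<^sup>+\<tau>. ennreal (y \<tau>) \<partial>time t)"
    and t: "0 < t" "t \<le> T"
  shows "y t = 0"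
proof -
  \<comment> \<open>Any \<open>L > K\<close> would do; this one gives the ratio \<open>1/2\<close> and is positive also for \<open>K = 0\<close>.\<close>
  define L where "L = 2 * (K + 1)"
  have L: "L > 0" "K / L \<le> 1 / 2" using K by (auto simp: L_def field_simps)
  define S where "S = (SUP t\<in>{0<..T}. exp (- L * t) * y t)"
  have T: "{0<..T} \<noteq> {}" using t by auto
  have bdd: "bdd_above ((\<lambda>t. exp (- L * t) * y t) ` {0<..T})"
  proof (rule bdd_aboveI2)
    fix u assume u: "u \<in> {0<..T}"
    have "exp (- L * u) * y u \<le> 1 * B"
      using u L bound[of u] nn[of u] by (intro mult_mono) auto
    then show "exp (- L * u) * y u \<le> B" by simp
  qed
  have up: "y u \<le> exp (L * u) * S" if "0 < u" "u \<le> T" for u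
  proof -
    have "exp (- L * u) * y u \<le> S"
      unfolding S_def using that by (intro cSUP_upper bdd) auto
    then have "exp (L * u) * (exp (- L * u) * y u) \<le> exp (L * u) * S"
      by (intro mult_left_mono) auto
    then show ?thesis by (simp add: mult.assoc[symmetric] exp_add[symmetric])
  qed
  have S0: "0 \<le> S"
  proof -
    have "0 \<le> exp (- L * t) * y t" using nn t by auto
    also have "\<dots> \<le> S" unfolding S_def using t by (intro cSUP_upper bdd) auto
    finally show ?thesis .
  qed
  have "exp (- L * u) * y u \<le> S / 2" if u: "0 < u" "u \<le> T" for u
  proof -
    have "ennreal (y u) \<le> ennreal K * (\<integral>\<^sup>+\<tau>. ennreal (y \<tau>) \<partial>time u)" by (rule le[OF u])
    also have "\<dots> \<le> ennreal K * (\<integral>\<^sup>+\<tau>. ennreal S * ennreal (exp (L * \<tau>)) \<partial>time u)"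
    proof (intro mult_left_mono nn_integral_mono_AE)
      \<comment> \<open>The bound by \<open>S\<close> is not available at \<open>\<tau> = 0\<close>.\<close>
      have "AE \<tau> in lborel. \<tau> \<noteq> (0::real)" by (rule AE_lborel_singleton)
      then have "AE \<tau> in time u. \<tau> \<noteq> 0"
        by (subst AE_restrict_space_iff) auto
      then show "AE \<tau> in time u. ennreal (y \<tau>) \<le> ennreal S * ennreal (exp (L * \<tau>))"
        using AE_space
      proof eventually_elim
        case (elim \<tau>)
        then have "0 < \<tau>" "\<tau> \<le> T" using u by (auto simp: space_restrict_space)
        from up[OF this] show ?case
          using S0 by (simp add: ennreal_mult[symmetric] mult.commute ennreal_leI)
      qed
    qed simp
    also have "\<dots> = ennreal K * (ennreal S * (\<integral>\<^sup>+\<tau>. ennreal (exp (L * \<tau>)) \<partial>time u))"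
      by (subst nn_integral_cmult) (auto intro!: borel_measurable_time)
    also have "\<dots> \<le> ennreal K * (ennreal S * ennreal (exp (L * u) / L))"
      using u L by (intro mult_left_mono exp_integral_le) auto
    also have "\<dots> = ennreal (K * (S * (exp (L * u) / L)))"
      using K S0 L by (simp add: ennreal_mult[symmetric])
    finally have "y u \<le> K * (S * (exp (L * u) / L))"
      using K S0 L by (subst (asm) ennreal_le_iff) auto
    also have "\<dots> = (K / L) * (S * exp (L * u))" by simp
    also have "\<dots> \<le> (1 / 2) * (S * exp (L * u))"
      using L S0 by (intro mult_right_mono) auto
    finally have "exp (- L * u) * y u \<le> exp (- L * u) * ((1 / 2) * (S * exp (L * u)))"
      by (intro mult_left_mono) auto
    also have "\<dots> = S / 2" by (simp add: exp_minus field_simps)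
    finally show ?thesis .
  qed
  then have "S \<le> S / 2"
    unfolding S_def[of] using T by (intro cSUP_least) (auto simp: S_def)
  then have "S = 0" using S0 by simp
  then show ?thesis using up[OF t] nn[OF t] by simp
qed

section \<open>The forced heat equation for Fourier coefficients\<close>

text \<open>
  Differentiate \<open>\<tau>\<^sup>n |x|\<^sup>2\<close> and absorb the forcing by \<open>2 |x| |f| \<le> \<mu> |x|\<^sup>2 + |f|\<^sup>2 / \<mu>\<close>. The
  hypothesis \<open>|f|\<^sup>2 \<le> \<mu> g\<close> avoids the division, so that \<open>\<mu> = 0\<close>, the zero frequency, is included.
\<close>

lemma damped_ode_energy:
  fixes x f :: "real \<Rightarrow> complex" and g :: "real \<Rightarrow> real"
  assumes der: "\<And>\<tau>. 0 \<le> \<tau> \<Longrightarrow> (x has_vector_derivative (- (of_real \<mu> * x \<tau>) - \<i> * f \<tau>)) (at \<tau> within {0..})"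
    and contx: "continuous_on UNIV x" and contg: "continuous_on UNIV g"
    and fg: "\<And>\<tau>. (cmod (f \<tau>))\<^sup>2 \<le> \<mu> * g \<tau>" and g0: "\<And>\<tau>. 0 \<le> g \<tau>" and \<mu>: "0 \<le> \<mu>" and t: "0 \<le> t"
  shows "t ^ n * (cmod (x t))\<^sup>2 + integral {0..t} (\<lambda>\<tau>. \<mu> * \<tau> ^ n * (cmod (x \<tau>))\<^sup>2)
    \<le> 0 ^ n * (cmod (x 0))\<^sup>2 + integral {0..t} (\<lambda>\<tau>. real n * \<tau> ^ (n - 1) * (cmod (x \<tau>))\<^sup>2)
       + integral {0..t} (\<lambda>\<tau>. \<tau> ^ n * g \<tau>)"
proof -
  define x' where "x' \<tau> = - (of_real \<mu> * x \<tau>) - \<i> * f \<tau>" for \<tau>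
  define p where "p \<tau> = \<tau> ^ n * (x \<tau> \<bullet> x \<tau>)" for \<tau>
  define p' where "p' \<tau> = real n * \<tau> ^ (n - 1) * (x \<tau> \<bullet> x \<tau>) + \<tau> ^ n * (2 * (x \<tau> \<bullet> x' \<tau>))" for \<tau>
  have dp: "(p has_vector_derivative p' \<tau>) (at \<tau> within {0..t})" if "\<tau> \<in> {0..t}" for \<tau>
  proof -
    have dx: "(x has_derivative (\<lambda>h. h *\<^sub>R x' \<tau>)) (at \<tau> within {0..t})"
      using der[of \<tau>] that unfolding x'_def has_vector_derivative_def
      by (auto intro: has_derivative_subset)
    show ?thesis
      unfolding has_vector_derivative_def p_def p'_def
      by (rule has_derivative_eq_rhs, rule has_derivative_mult, rule has_derivative_power[OF has_derivative_ident],
          rule has_derivative_inner[OF dx dx]) (auto simp: fun_eq_iff algebra_simps inner_commute)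
  qed
  from fundamental_theorem_of_calculus[OF t dp]
  have 1: "(p' has_integral (p t - p 0)) {0..t}" by simp
  have x2: "x \<tau> \<bullet> x \<tau> = (cmod (x \<tau>))\<^sup>2" for \<tau> by (simp add: power2_norm_eq_inner)
  have ci: "continuous_on {0..t} x" "continuous_on {0..t} g"
    using contx contg by (auto intro: continuous_on_subset)
  have I1: "(\<lambda>\<tau>. real n * \<tau> ^ (n - 1) * (cmod (x \<tau>))\<^sup>2) integrable_on {0..t}"
    and I2: "(\<lambda>\<tau>. \<mu> * \<tau> ^ n * (cmod (x \<tau>))\<^sup>2) integrable_on {0..t}"
    and I3: "(\<lambda>\<tau>. \<tau> ^ n * g \<tau>) integrable_on {0..t}"
    by (intro integrable_continuous_real continuous_intros ci)+
  have 2: "((\<lambda>\<tau>. real n * \<tau> ^ (n - 1) * (cmod (x \<tau>))\<^sup>2 - \<mu> * \<tau> ^ n * (cmod (x \<tau>))\<^sup>2 + \<tau> ^ n * g \<tau>) has_integral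
      (integral {0..t} (\<lambda>\<tau>. real n * \<tau> ^ (n - 1) * (cmod (x \<tau>))\<^sup>2)
       - integral {0..t} (\<lambda>\<tau>. \<mu> * \<tau> ^ n * (cmod (x \<tau>))\<^sup>2) + integral {0..t} (\<lambda>\<tau>. \<tau> ^ n * g \<tau>))) {0..t}"
    by (intro has_integral_add has_integral_diff integrable_integral I1 I2 I3)
  have "p t - p 0 \<le> integral {0..t} (\<lambda>\<tau>. real n * \<tau> ^ (n - 1) * (cmod (x \<tau>))\<^sup>2)
       - integral {0..t} (\<lambda>\<tau>. \<mu> * \<tau> ^ n * (cmod (x \<tau>))\<^sup>2) + integral {0..t} (\<lambda>\<tau>. \<tau> ^ n * g \<tau>)"
  proof (rule has_integral_le[OF 1 2])
    fix \<tau> assume \<tau>: "\<tau> \<in> {0..t}"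
    have "2 * (x \<tau> \<bullet> x' \<tau>) = - 2 * \<mu> * (cmod (x \<tau>))\<^sup>2 + 2 * (x \<tau> \<bullet> (- (\<i> * f \<tau>)))"
      by (simp add: x'_def inner_diff_right x2[symmetric] flip: scaleR_conv_of_real)
    also have "x \<tau> \<bullet> (- (\<i> * f \<tau>)) \<le> cmod (x \<tau>) * cmod (f \<tau>)"
      using norm_cauchy_schwarz[of "x \<tau>" "- (\<i> * f \<tau>)"] by (simp add: norm_mult)
    also have "2 * (cmod (x \<tau>) * cmod (f \<tau>)) \<le> \<mu> * (cmod (x \<tau>))\<^sup>2 + g \<tau>"
    proof (cases "\<mu> = 0")
      case True
      then show ?thesis using fg[of \<tau>] g0[of \<tau>] by simp
    next
      case False
      then have l: "\<mu> > 0" using \<mu> by simp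
      have "0 \<le> (\<mu> * cmod (x \<tau>) - cmod (f \<tau>))\<^sup>2" by simp
      then have "\<mu> * (2 * (cmod (x \<tau>) * cmod (f \<tau>))) \<le> \<mu> * (\<mu> * (cmod (x \<tau>))\<^sup>2) + (cmod (f \<tau>))\<^sup>2"
        by (simp add: power2_eq_square algebra_simps)
      also have "\<dots> \<le> \<mu> * (\<mu> * (cmod (x \<tau>))\<^sup>2 + g \<tau>)"
        using fg[of \<tau>] by (simp add: algebra_simps)
      finally show ?thesis using l by (simp add: mult_le_cancel_left)
    qed
    finally have "2 * (x \<tau> \<bullet> x' \<tau>) \<le> - \<mu> * (cmod (x \<tau>))\<^sup>2 + g \<tau>" by (simp add: algebra_simps)
    then have "\<tau> ^ n * (2 * (x \<tau> \<bullet> x' \<tau>)) \<le> \<tau> ^ n * (- \<mu> * (cmod (x \<tau>))\<^sup>2 + g \<tau>)"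
      using \<tau> by (intro mult_left_mono) auto
    then show "p' \<tau> \<le> real n * \<tau> ^ (n - 1) * (cmod (x \<tau>))\<^sup>2 - \<mu> * \<tau> ^ n * (cmod (x \<tau>))\<^sup>2 + \<tau> ^ n * g \<tau>"
      by (simp add: p'_def x2 algebra_simps)
  qed
  then show ?thesis by (simp add: p_def x2 algebra_simps)
qed

text \<open>
  The coefficient equation with the nonlinearity replaced by a given forcing \<open>W\<close>. Equations hold
  for nonnegative times only; continuity on the whole line is a convenient extension, which the
  solutions constructed below have by being constant for negative times.
\<close>

definition forced :: "real \<Rightarrow> (real \<Rightarrow> l2) \<Rightarrow> (real \<Rightarrow> l2) \<Rightarrow> bool" where
  "forced \<epsilon> a W \<longleftrightarrow> continuous_on UNIV a \<and> continuous_on UNIV W \<and>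
     (\<forall>k t. 0 \<le> t \<longrightarrow> ((\<lambda>t. l2_nth (a t) k) has_vector_derivative
        (- (of_real (\<epsilon> * (norm (freq k))\<^sup>2) * l2_nth (a t) k) - \<i> * (of_real (norm (freq k)) * l2_nth (W t) k)))
        (at t within {0..}))"

lemma forced_diff:
  assumes "forced \<epsilon> a W" "forced \<epsilon> b V"
  shows "forced \<epsilon> (\<lambda>t. a t - b t) (\<lambda>t. W t - V t)"
  unfolding forced_def
proof (intro conjI allI impI)
  show "continuous_on UNIV (\<lambda>t. a t - b t)" "continuous_on UNIV (\<lambda>t. W t - V t)"
    using assms by (auto simp: forced_def intro!: continuous_intros)
  fix k and t :: real assume t: "0 \<le> t"
  have "((\<lambda>t. l2_nth (a t) k - l2_nth (b t) k) has_vector_derivative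
      (- (of_real (\<epsilon> * (norm (freq k))\<^sup>2) * l2_nth (a t) k) - \<i> * (of_real (norm (freq k)) * l2_nth (W t) k))
      - (- (of_real (\<epsilon> * (norm (freq k))\<^sup>2) * l2_nth (b t) k) - \<i> * (of_real (norm (freq k)) * l2_nth (V t) k)))
      (at t within {0..})"
    using assms t by (intro has_vector_derivative_diff) (auto simp: forced_def)
  then show "((\<lambda>t. l2_nth (a t - b t) k) has_vector_derivative
      (- (of_real (\<epsilon> * (norm (freq k))\<^sup>2) * l2_nth (a t - b t) k) - \<i> * (of_real (norm (freq k)) * l2_nth (W t - V t) k)))
      (at t within {0..})"
    by (simp add: algebra_simps)
qed

lemma forced_shift:
  assumes "forced \<epsilon> a W" "0 \<le> s"
  shows "forced \<epsilon> (\<lambda>t. a (s + t)) (\<lambda>t. W (s + t))"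
  unfolding forced_def
proof (intro conjI allI impI)
  have *: "continuous_on UNIV (\<lambda>t. f (s + t))" if "continuous_on UNIV f" for f :: "real \<Rightarrow> l2"
    by (rule continuous_on_compose2[OF that, of UNIV "\<lambda>t. s + t"]) (intro continuous_intros, simp)
  show "continuous_on UNIV (\<lambda>t. a (s + t))" "continuous_on UNIV (\<lambda>t. W (s + t))"
    using assms by (simp_all add: forced_def *)
  fix k and t :: real assume t: "0 \<le> t"
  let ?D = "\<lambda>t. - (of_real (\<epsilon> * (norm (freq k))\<^sup>2) * l2_nth (a t) k) - \<i> * (of_real (norm (freq k)) * l2_nth (W t) k)"
  have "((\<lambda>t. l2_nth (a t) k) has_vector_derivative ?D (s + t)) (at (s + t) within {0..})"
    using assms t by (auto simp: forced_def)
  then have "((\<lambda>t. l2_nth (a t) k) has_vector_derivative ?D (s + t)) (at (s + t) within (\<lambda>t. s + t) ` {0..})"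
    by (rule has_vector_derivative_within_subset) (use assms in auto)
  moreover have "((\<lambda>t. s + t) has_vector_derivative 1) (at t within {0..})"
    by (auto intro!: derivative_eq_intros simp flip: has_real_derivative_iff_has_vector_derivative)
  ultimately show "((\<lambda>t. l2_nth (a (s + t)) k) has_vector_derivative ?D (s + t)) (at t within {0..})"
    using vector_diff_chain_within[of "\<lambda>t. s + t" 1 t "{0..}" "\<lambda>t. l2_nth (a t) k" "?D (s + t)"] by (simp add: o_def)
qed

lemma ennreal_combine:
  "\<lbrakk>0 \<le> a; 0 \<le> b; 0 \<le> c; 0 \<le> d; 0 \<le> e; 0 \<le> f; 0 \<le> g; a * b + c \<le> d * e + f + g\<rbrakk>
    \<Longrightarrow> ennreal a * ennreal b + ennreal c \<le> ennreal d * ennreal e + ennreal f + ennreal g"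
  by (simp add: ennreal_mult[symmetric] ennreal_plus[symmetric] ennreal_leI del: ennreal_plus)

text \<open>
  The scalar estimate for each frequency, with \<open>\<mu> = \<epsilon> |k|\<^sup>2\<close> and forcing \<open>|k| W\<^sub>k\<close>, multiplied by
  \<open>|k|^(2n)\<close> and summed. The factor \<open>|k|\<close> of the forcing is exactly what \<open>|f|\<^sup>2 / \<mu>\<close> cancels, so
  no derivative falls on \<open>W\<close>.
\<close>

lemma forced_energy:
  assumes F: "forced \<epsilon> a W" and \<epsilon>: "0 < \<epsilon>" and t: "0 \<le> t"
  shows "ennreal (t ^ n) * sobolev_sq n (a t) + ennreal \<epsilon> * (\<integral>\<^sup>+\<tau>. ennreal (\<tau> ^ n) * sobolev_sq (Suc n) (a \<tau>) \<partial>time t)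
    \<le> ennreal (0 ^ n) * sobolev_sq n (a 0) + ennreal (real n) * (\<integral>\<^sup>+\<tau>. ennreal (\<tau> ^ (n - 1)) * sobolev_sq n (a \<tau>) \<partial>time t)
      + ennreal (1 / \<epsilon>) * (\<integral>\<^sup>+\<tau>. ennreal (\<tau> ^ n) * sobolev_sq n (W \<tau>) \<partial>time t)"
proof -
  have ca: "continuous_on UNIV a" and cW: "continuous_on UNIV W" using F by (auto simp: forced_def)
  define w where "w k = norm (freq k) ^ (2 * n)" for k :: "int^3"
  define X where "X \<tau> k = (cmod (l2_nth (a \<tau>) k))\<^sup>2" for \<tau> k
  define Y where "Y \<tau> k = (cmod (l2_nth (W \<tau>) k))\<^sup>2" for \<tau> k
  have XY0: "0 \<le> X \<tau> k" "0 \<le> Y \<tau> k" for \<tau> k by (auto simp: X_def Y_def)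
  have cX: "continuous_on UNIV (\<lambda>\<tau>. X \<tau> k)" and cY: "continuous_on UNIV (\<lambda>\<tau>. Y \<tau> k)" for k
    unfolding X_def Y_def by (intro continuous_intros ca cW)+
  have w0: "w k \<ge> 0" "w (k) * (norm (freq k))\<^sup>2 = norm (freq k) ^ (2 * Suc n)" for k
    by (auto simp: w_def power_add[symmetric] power2_eq_square)
  have scalar: "t ^ n * (w k * X t k) + integral {0..t} (\<lambda>\<tau>. \<epsilon> * (\<tau> ^ n * (norm (freq k) ^ (2 * Suc n) * X \<tau> k)))
     \<le> 0 ^ n * (w k * X 0 k) + integral {0..t} (\<lambda>\<tau>. real n * (\<tau> ^ (n - 1) * (w k * X \<tau> k)))
        + integral {0..t} (\<lambda>\<tau>. (1 / \<epsilon>) * (\<tau> ^ n * (w k * Y \<tau> k)))" for k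
  proof -
    have "t ^ n * X t k + integral {0..t} (\<lambda>\<tau>. (\<epsilon> * (norm (freq k))\<^sup>2) * \<tau> ^ n * X \<tau> k)
      \<le> 0 ^ n * X 0 k + integral {0..t} (\<lambda>\<tau>. real n * \<tau> ^ (n - 1) * X \<tau> k) + integral {0..t} (\<lambda>\<tau>. \<tau> ^ n * (Y \<tau> k / \<epsilon>))"
      unfolding X_def
    proof (rule damped_ode_energy[where f = "\<lambda>\<tau>. of_real (norm (freq k)) * l2_nth (W \<tau>) k"])
      show "((\<lambda>t. l2_nth (a t) k) has_vector_derivative
         (- (of_real (\<epsilon> * (norm (freq k))\<^sup>2) * l2_nth (a \<tau>) k) - \<i> * (of_real (norm (freq k)) * l2_nth (W \<tau>) k))) (at \<tau> within {0..})"
        if "0 \<le> \<tau>" for \<tau> using F that by (auto simp: forced_def)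
      show "continuous_on UNIV (\<lambda>\<tau>. Y \<tau> k / \<epsilon>)" using \<epsilon> by (intro continuous_intros cY) auto
      show "(cmod (of_real (norm (freq k)) * l2_nth (W \<tau>) k))\<^sup>2 \<le> \<epsilon> * (norm (freq k))\<^sup>2 * (Y \<tau> k / \<epsilon>)" for \<tau>
        using \<epsilon> by (simp add: Y_def norm_mult power_mult_distrib)
      show "continuous_on UNIV (\<lambda>\<tau>. l2_nth (a \<tau>) k)" by (rule continuous_on_l2_nth[OF ca])
    qed (use \<epsilon> t in \<open>auto simp: Y_def\<close>)
    then have "w k * (t ^ n * X t k + integral {0..t} (\<lambda>\<tau>. (\<epsilon> * (norm (freq k))\<^sup>2) * \<tau> ^ n * X \<tau> k))
      \<le> w k * (0 ^ n * X 0 k + integral {0..t} (\<lambda>\<tau>. real n * \<tau> ^ (n - 1) * X \<tau> k) + integral {0..t} (\<lambda>\<tau>. \<tau> ^ n * (Y \<tau> k / \<epsilon>)))"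
      by (rule mult_left_mono) (rule w0)
    moreover have "w k * integral {0..t} (\<lambda>\<tau>. (\<epsilon> * (norm (freq k))\<^sup>2) * \<tau> ^ n * X \<tau> k)
        = integral {0..t} (\<lambda>\<tau>. \<epsilon> * (\<tau> ^ n * (norm (freq k) ^ (2 * Suc n) * X \<tau> k)))"
      unfolding integral_mult_right[symmetric] w0(2)[symmetric] by (intro integral_cong) (simp only: mult_ac)
    moreover have "w k * integral {0..t} (\<lambda>\<tau>. real n * \<tau> ^ (n - 1) * X \<tau> k)
        = integral {0..t} (\<lambda>\<tau>. real n * (\<tau> ^ (n - 1) * (w k * X \<tau> k)))"
      unfolding integral_mult_right[symmetric] by (intro integral_cong) (simp only: mult_ac)
    moreover have "w k * integral {0..t} (\<lambda>\<tau>. \<tau> ^ n * (Y \<tau> k / \<epsilon>))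
        = integral {0..t} (\<lambda>\<tau>. (1 / \<epsilon>) * (\<tau> ^ n * (w k * Y \<tau> k)))"
      unfolding integral_mult_right[symmetric] by (intro integral_cong) simp
    ultimately show ?thesis by (simp only: distrib_left mult.left_commute[of "w k"])
  qed
  let ?A = "\<lambda>\<tau> k. ennreal \<epsilon> * (ennreal (\<tau> ^ n) * ennreal (norm (freq k) ^ (2 * Suc n) * X \<tau> k))"
  let ?B = "\<lambda>\<tau> k. ennreal (real n) * (ennreal (\<tau> ^ (n - 1)) * ennreal (w k * X \<tau> k))"
  let ?C = "\<lambda>\<tau> k. ennreal (1 / \<epsilon>) * (ennreal (\<tau> ^ n) * ennreal (w k * Y \<tau> k))"
  have meas: "(\<lambda>\<tau>. ennreal (r * X \<tau> k)) \<in> borel_measurable (time t)" "(\<lambda>\<tau>. ennreal (r * Y \<tau> k)) \<in> borel_measurable (time t)"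
    "(\<lambda>\<tau>. ennreal (\<tau> ^ j)) \<in> borel_measurable (time t)" for r k j
    by (intro measurable_compose[OF _ measurable_ennreal] borel_measurable_time_cont continuous_intros cX cY)+
  have sm: "(\<lambda>\<tau>. sobolev_sq j (a \<tau>)) \<in> borel_measurable (time t)" "(\<lambda>\<tau>. sobolev_sq j (W \<tau>)) \<in> borel_measurable (time t)" for j
    unfolding sobolev_sq_def X_def[symmetric] Y_def[symmetric] by (intro borel_measurable_lattice_nn_integral meas)+
  have nnA: "(\<integral>\<^sup>+\<tau>. ?A \<tau> k \<partial>time t) = ennreal (integral {0..t} (\<lambda>\<tau>. \<epsilon> * (\<tau> ^ n * (norm (freq k) ^ (2 * Suc n) * X \<tau> k))))" for k
    using \<epsilon> by (subst nn_integral_time_continuous[symmetric])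
      (auto intro!: continuous_intros cX nn_integral_cong simp: ennreal_mult XY0 space_restrict_space)
  have nnB: "(\<integral>\<^sup>+\<tau>. ?B \<tau> k \<partial>time t) = ennreal (integral {0..t} (\<lambda>\<tau>. real n * (\<tau> ^ (n - 1) * (w k * X \<tau> k))))" for k
    using w0(1) by (subst nn_integral_time_continuous[symmetric])
      (auto intro!: continuous_intros cX nn_integral_cong simp: ennreal_mult XY0 space_restrict_space)
  have nnC: "(\<integral>\<^sup>+\<tau>. ?C \<tau> k \<partial>time t) = ennreal (integral {0..t} (\<lambda>\<tau>. (1 / \<epsilon>) * (\<tau> ^ n * (w k * Y \<tau> k))))" for k
    using w0(1) \<epsilon> by (subst nn_integral_time_continuous[symmetric])
      (auto intro!: continuous_intros cY nn_integral_cong simp: ennreal_mult[symmetric] XY0 space_restrict_space)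
  have pos: "0 \<le> integral {0..t} (\<lambda>\<tau>. \<epsilon> * (\<tau> ^ n * (norm (freq k) ^ (2 * Suc n) * X \<tau> k)))"
    "0 \<le> integral {0..t} (\<lambda>\<tau>. real n * (\<tau> ^ (n - 1) * (w k * X \<tau> k)))"
    "0 \<le> integral {0..t} (\<lambda>\<tau>. (1 / \<epsilon>) * (\<tau> ^ n * (w k * Y \<tau> k)))" for k
  proof -
    have *: "0 \<le> integral {0..t} h" if "\<And>\<tau>. 0 \<le> \<tau> \<Longrightarrow> 0 \<le> h \<tau>" for h :: "real \<Rightarrow> real"
      by (cases "h integrable_on {0..t}") (auto intro!: integral_nonneg that simp: not_integrable_integral)
    show "0 \<le> integral {0..t} (\<lambda>\<tau>. \<epsilon> * (\<tau> ^ n * (norm (freq k) ^ (2 * Suc n) * X \<tau> k)))"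
      "0 \<le> integral {0..t} (\<lambda>\<tau>. real n * (\<tau> ^ (n - 1) * (w k * X \<tau> k)))"
      "0 \<le> integral {0..t} (\<lambda>\<tau>. (1 / \<epsilon>) * (\<tau> ^ n * (w k * Y \<tau> k)))"
      by (rule *, use \<epsilon> w0(1)[of k] XY0 in simp)+
  qed
  have term_le: "ennreal (t ^ n) * ennreal (w k * X t k) + (\<integral>\<^sup>+\<tau>. ?A \<tau> k \<partial>time t)
     \<le> ennreal (0 ^ n) * ennreal (w k * X 0 k) + (\<integral>\<^sup>+\<tau>. ?B \<tau> k \<partial>time t) + (\<integral>\<^sup>+\<tau>. ?C \<tau> k \<partial>time t)" for k
    unfolding nnA nnB nnC
    by (rule ennreal_combine[OF _ _ _ _ _ _ _ scalar]) (use t w0(1)[of k] XY0 pos[of k] in auto)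
  have "(\<integral>\<^sup>+k. ennreal (t ^ n) * ennreal (w k * X t k) + (\<integral>\<^sup>+\<tau>. ?A \<tau> k \<partial>time t) \<partial>lattice)
    \<le> (\<integral>\<^sup>+k. ennreal (0 ^ n) * ennreal (w k * X 0 k) + (\<integral>\<^sup>+\<tau>. ?B \<tau> k \<partial>time t) + (\<integral>\<^sup>+\<tau>. ?C \<tau> k \<partial>time t) \<partial>lattice)"
    by (intro nn_integral_mono term_le)
  also have "(\<integral>\<^sup>+k. ennreal (t ^ n) * ennreal (w k * X t k) + (\<integral>\<^sup>+\<tau>. ?A \<tau> k \<partial>time t) \<partial>lattice)
     = ennreal (t ^ n) * sobolev_sq n (a t) + ennreal \<epsilon> * (\<integral>\<^sup>+\<tau>. ennreal (\<tau> ^ n) * sobolev_sq (Suc n) (a \<tau>) \<partial>time t)"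
  proof -
    have "(\<integral>\<^sup>+k. \<integral>\<^sup>+\<tau>. ?A \<tau> k \<partial>time t \<partial>lattice) = (\<integral>\<^sup>+\<tau>. \<integral>\<^sup>+k. ?A \<tau> k \<partial>lattice \<partial>time t)"
      by (intro nn_integral_time_lattice_swap borel_measurable_times_ennreal borel_measurable_const meas)
    also have "\<dots> = (\<integral>\<^sup>+\<tau>. ennreal \<epsilon> * (ennreal (\<tau> ^ n) * sobolev_sq (Suc n) (a \<tau>)) \<partial>time t)"
      by (simp add: nn_integral_cmult sobolev_sq_def X_def)
    also have "\<dots> = ennreal \<epsilon> * (\<integral>\<^sup>+\<tau>. ennreal (\<tau> ^ n) * sobolev_sq (Suc n) (a \<tau>) \<partial>time t)"
      by (intro nn_integral_cmult borel_measurable_times_ennreal meas sm)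
    finally show ?thesis
      by (simp add: nn_integral_add nn_integral_cmult sobolev_sq_def[of n] w_def X_def)
  qed
  also have "(\<integral>\<^sup>+k. ennreal (0 ^ n) * ennreal (w k * X 0 k) + (\<integral>\<^sup>+\<tau>. ?B \<tau> k \<partial>time t) + (\<integral>\<^sup>+\<tau>. ?C \<tau> k \<partial>time t) \<partial>lattice)
     = ennreal (0 ^ n) * sobolev_sq n (a 0) + ennreal (real n) * (\<integral>\<^sup>+\<tau>. ennreal (\<tau> ^ (n - 1)) * sobolev_sq n (a \<tau>) \<partial>time t)
      + ennreal (1 / \<epsilon>) * (\<integral>\<^sup>+\<tau>. ennreal (\<tau> ^ n) * sobolev_sq n (W \<tau>) \<partial>time t)"
  proof -
    have "(\<integral>\<^sup>+k. \<integral>\<^sup>+\<tau>. ?B \<tau> k \<partial>time t \<partial>lattice) = (\<integral>\<^sup>+\<tau>. \<integral>\<^sup>+k. ?B \<tau> k \<partial>lattice \<partial>time t)"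
      by (intro nn_integral_time_lattice_swap borel_measurable_times_ennreal borel_measurable_const meas)
    also have "\<dots> = (\<integral>\<^sup>+\<tau>. ennreal (real n) * (ennreal (\<tau> ^ (n - 1)) * sobolev_sq n (a \<tau>)) \<partial>time t)"
      by (simp add: nn_integral_cmult sobolev_sq_def w_def X_def)
    also have "\<dots> = ennreal (real n) * (\<integral>\<^sup>+\<tau>. ennreal (\<tau> ^ (n - 1)) * sobolev_sq n (a \<tau>) \<partial>time t)"
      by (intro nn_integral_cmult borel_measurable_times_ennreal meas sm)
    finally have B: "(\<integral>\<^sup>+k. \<integral>\<^sup>+\<tau>. ?B \<tau> k \<partial>time t \<partial>lattice) = \<dots>" .
    have "(\<integral>\<^sup>+k. \<integral>\<^sup>+\<tau>. ?C \<tau> k \<partial>time t \<partial>lattice) = (\<integral>\<^sup>+\<tau>. \<integral>\<^sup>+k. ?C \<tau> k \<partial>lattice \<partial>time t)"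
      by (intro nn_integral_time_lattice_swap borel_measurable_times_ennreal borel_measurable_const meas)
    also have "\<dots> = (\<integral>\<^sup>+\<tau>. ennreal (1 / \<epsilon>) * (ennreal (\<tau> ^ n) * sobolev_sq n (W \<tau>)) \<partial>time t)"
      by (simp add: nn_integral_cmult sobolev_sq_def w_def Y_def)
    also have "\<dots> = ennreal (1 / \<epsilon>) * (\<integral>\<^sup>+\<tau>. ennreal (\<tau> ^ n) * sobolev_sq n (W \<tau>) \<partial>time t)"
      by (intro nn_integral_cmult borel_measurable_times_ennreal meas sm)
    finally have C: "(\<integral>\<^sup>+k. \<integral>\<^sup>+\<tau>. ?C \<tau> k \<partial>time t \<partial>lattice) = \<dots>" .
    have Z: "(\<integral>\<^sup>+k. ennreal (0 ^ n) * ennreal (w k * X 0 k) \<partial>lattice) = ennreal (0 ^ n) * sobolev_sq n (a 0)"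
      by (subst nn_integral_cmult) (simp_all add: sobolev_sq_def w_def X_def)
    show ?thesis
      by (subst nn_integral_add, simp, simp, subst nn_integral_add, simp, simp) (simp only: B C Z)
  qed
  finally show ?thesis .
qed

lemma forced_norm_le:
  assumes "forced \<epsilon> a W" "0 < \<epsilon>" "0 \<le> t"
  shows "ennreal ((norm (a t))\<^sup>2) \<le> ennreal ((norm (a 0))\<^sup>2) + ennreal (1 / \<epsilon>) * (\<integral>\<^sup>+\<tau>. ennreal ((norm (W \<tau>))\<^sup>2) \<partial>time t)"
proof -
  have "ennreal ((norm (a t))\<^sup>2) \<le> ennreal ((norm (a t))\<^sup>2) + ennreal \<epsilon> * (\<integral>\<^sup>+\<tau>. ennreal (\<tau> ^ 0) * sobolev_sq (Suc 0) (a \<tau>) \<partial>time t)"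
    by simp
  also have "\<dots> \<le> ennreal ((norm (a 0))\<^sup>2) + ennreal (1 / \<epsilon>) * (\<integral>\<^sup>+\<tau>. ennreal ((norm (W \<tau>))\<^sup>2) \<partial>time t)"
    using forced_energy[OF assms, of 0] by (simp add: sobolev_sq_0)
  finally show ?thesis .
qed

section \<open>Solving the forced equation\<close>

text \<open>Dominated convergence in the sum over the frequencies.\<close>

lemma l2_continuous_dominated:
  fixes X :: "real \<Rightarrow> l2"
  assumes cont: "\<And>k. continuous_on S (\<lambda>t. l2_nth (X t) k)"
    and dom: "\<And>t k. t \<in> S \<Longrightarrow> (cmod (l2_nth (X t) k))\<^sup>2 \<le> B k" and B: "integrable lattice B"
  shows "continuous_on S X"
proof (rule continuous_on_sequentiallyI)
  fix u :: "nat \<Rightarrow> real" and a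
  assume u: "\<forall>n. u n \<in> S" and a: "a \<in> S" and lim: "u \<longlonglongrightarrow> a"
  have "(\<lambda>n. LINT k|lattice. (cmod (l2_nth (X (u n)) k - l2_nth (X a) k))\<^sup>2) \<longlonglongrightarrow> (LINT k|lattice. 0)"
  proof (rule integral_dominated_convergence[where w = "\<lambda>k. 4 * B k"])
    show "AE k in lattice. (\<lambda>n. (cmod (l2_nth (X (u n)) k - l2_nth (X a) k))\<^sup>2) \<longlonglongrightarrow> 0"
    proof (rule AE_I2)
      fix k
      have "(\<lambda>n. l2_nth (X (u n)) k) \<longlonglongrightarrow> l2_nth (X a) k"
        using cont[of k] u a lim unfolding continuous_on_sequentially by (auto simp: o_def)
      then have "(\<lambda>n. (cmod (l2_nth (X (u n)) k - l2_nth (X a) k))\<^sup>2) \<longlonglongrightarrow> (cmod (l2_nth (X a) k - l2_nth (X a) k))\<^sup>2"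
        by (intro tendsto_intros)
      then show "(\<lambda>n. (cmod (l2_nth (X (u n)) k - l2_nth (X a) k))\<^sup>2) \<longlonglongrightarrow> 0" by simp
    qed
    show "AE k in lattice. norm ((cmod (l2_nth (X (u n)) k - l2_nth (X a) k))\<^sup>2) \<le> 4 * B k" for n
    proof (rule AE_I2)
      fix k
      have "(cmod (l2_nth (X (u n)) k - l2_nth (X a) k))\<^sup>2 \<le> 2 * (cmod (l2_nth (X (u n)) k))\<^sup>2 + 2 * (cmod (l2_nth (X a) k))\<^sup>2"
        using norm_add_sq_le[of "l2_nth (X (u n)) k" "- l2_nth (X a) k"] by simp
      also have "\<dots> \<le> 4 * B k" using dom[of "u n" k] dom[of a k] u a by simp
      finally show "norm ((cmod (l2_nth (X (u n)) k - l2_nth (X a) k))\<^sup>2) \<le> 4 * B k" by simp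
    qed
  qed (use B in auto)
  then have "(\<lambda>n. (norm (X (u n) - X a))\<^sup>2) \<longlonglongrightarrow> 0"
    by (simp add: l2_norm_sq)
  from tendsto_real_sqrt[OF this] have "(\<lambda>n. norm (X (u n) - X a)) \<longlonglongrightarrow> 0" by simp
  then show "(\<lambda>n. X (u n)) \<longlonglongrightarrow> X a"
    by (simp add: LIM_zero_iff tendsto_norm_zero_iff)
qed

text \<open>Variation of constants.\<close>

lemma ode_solution:
  fixes w :: "real \<Rightarrow> complex" and x0 :: complex and \<mu> :: real
  assumes w: "continuous_on UNIV w"
  defines "x \<equiv> \<lambda>t. exp (- \<mu> * t) *\<^sub>R (x0 - \<i> * integral {0..t} (\<lambda>\<tau>. exp (\<mu> * \<tau>) *\<^sub>R w \<tau>))"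
  assumes t: "0 \<le> t"
  shows "(x has_vector_derivative (- (of_real \<mu> * x t) - \<i> * w t)) (at t within {0..})"
proof -
  let ?h = "\<lambda>\<tau>. exp (\<mu> * \<tau>) *\<^sub>R w \<tau>"
  have "((\<lambda>u. integral {0..u} ?h) has_vector_derivative ?h t) (at t within {0..t + 1})"
    using t by (intro integral_has_vector_derivative continuous_intros continuous_on_subset[OF w]) auto
  moreover have "at t within {0..t + 1} = at t within {0..}"
    by (rule at_within_nhd[of _ "{..<t + 1}"]) auto
  ultimately have I: "((\<lambda>u. integral {0..u} ?h) has_vector_derivative ?h t) (at t within {0..})" by simp
  have E: "((\<lambda>t. exp (- \<mu> * t)) has_field_derivative (- \<mu> * exp (- \<mu> * t))) (at t within {0..})"
    by (auto intro!: derivative_eq_intros)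
  have I2: "((\<lambda>u. x0 - \<i> * integral {0..u} ?h) has_vector_derivative (0 - \<i> * ?h t)) (at t within {0..})"
    by (intro has_vector_derivative_diff has_vector_derivative_const has_vector_derivative_mult_right I)
  have "(x has_vector_derivative (exp (- \<mu> * t) *\<^sub>R (0 - \<i> * ?h t) + (- \<mu> * exp (- \<mu> * t)) *\<^sub>R (x0 - \<i> * integral {0..t} ?h))) (at t within {0..})"
    unfolding x_def by (rule has_vector_derivative_scaleR[OF E I2])
  moreover have "exp (- \<mu> * t) *\<^sub>R (0 - \<i> * ?h t) = - \<i> * w t"
  proof -
    have "exp (- \<mu> * t) *\<^sub>R (0 - \<i> * ?h t) = - \<i> * ((exp (- \<mu> * t) * exp (\<mu> * t)) *\<^sub>R w t)"
      by (simp add: scaleR_conv_of_real)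
    also have "exp (- \<mu> * t) * exp (\<mu> * t) = 1" by (simp add: exp_add[symmetric])
    finally show ?thesis by simp
  qed
  moreover have "(- \<mu> * exp (- \<mu> * t)) *\<^sub>R (x0 - \<i> * integral {0..t} ?h) = - (of_real \<mu> * x t)"
    unfolding x_def by (simp add: scaleR_conv_of_real)
  ultimately have "(x has_vector_derivative (- \<i> * w t + - (of_real \<mu> * x t))) (at t within {0..})"
    by (simp only:)
  moreover have "- \<i> * w t + - (of_real \<mu> * x t) = - (of_real \<mu> * x t) - \<i> * w t" by simp
  ultimately show ?thesis by (simp only:)
qed

lemma continuous_UNIV_from_nonneg:
  fixes f :: "real \<Rightarrow> 'b :: topological_space"
  assumes "continuous_on {0..} f"
  shows "continuous_on UNIV (\<lambda>t. f (max 0 t))"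
  by (rule continuous_on_compose2[OF assms, of UNIV "\<lambda>t. max 0 t"]) (auto intro!: continuous_intros)

text \<open>
  Each frequency is solved by variation of constants. The energy inequality dominates the squares
  of the coefficients by a summable sequence, locally uniformly in time, which gives continuity in
  \<open>\<ell>\<^sup>2\<close>.
\<close>

lemma forced_solve:
  assumes \<epsilon>: "0 < \<epsilon>" and W: "continuous_on UNIV W"
  obtains a where "forced \<epsilon> a W" "a 0 = a0" "\<And>t. t \<le> 0 \<Longrightarrow> a t = a0"
proof -
  define \<mu> where "\<mu> k = \<epsilon> * (norm (freq k))\<^sup>2" for k
  define w where "w k \<tau> = of_real (norm (freq k)) * l2_nth (W \<tau>) k" for k \<tau>
  define x where "x k t = exp (- \<mu> k * t) *\<^sub>R (l2_nth a0 k - \<i> * integral {0..t} (\<lambda>\<tau>. exp (\<mu> k * \<tau>) *\<^sub>R w k \<tau>))" for k t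
  define Y where "Y \<tau> k = (cmod (l2_nth (W \<tau>) k))\<^sup>2" for \<tau> k
  have Y0: "0 \<le> Y \<tau> k" for \<tau> k by (simp add: Y_def)
  have cw: "continuous_on UNIV (w k)" for k
    unfolding w_def by (intro continuous_intros W)
  have cY: "continuous_on UNIV (\<lambda>\<tau>. Y \<tau> k)" for k
    unfolding Y_def by (intro continuous_intros W)
  have iY: "(\<lambda>\<tau>. Y \<tau> k) integrable_on {0..t}" for k t
    by (intro integrable_continuous_real continuous_on_subset[OF cY]) auto
  have dx: "(x k has_vector_derivative (- (of_real (\<mu> k) * x k t) - \<i> * w k t)) (at t within {0..})" if "0 \<le> t" for k t
    unfolding x_def[abs_def] by (rule ode_solution[OF cw that])
  have x0: "x k 0 = l2_nth a0 k" for k by (simp add: x_def)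
  \<comment> \<open>Continuation by the initial value to negative times.\<close>
  define z where "z k t = x k (max 0 t)" for k t
  have z_eq: "z k t = x k t" if "0 \<le> t" for k t using that by (simp add: z_def)
  have cx: "continuous_on {0..} (x k)" for k
    by (rule continuous_on_vector_derivative) (use dx in auto)
  then have cz: "continuous_on UNIV (z k)" for k
    unfolding z_def[abs_def] by (rule continuous_UNIV_from_nonneg)
  have dz: "(z k has_vector_derivative (- (of_real (\<mu> k) * z k t) - \<i> * w k t)) (at t within {0..})" if "0 \<le> t" for k t
  proof (rule has_vector_derivative_transform[of _ _ _ "x k"])
    show "(x k has_vector_derivative (- (of_real (\<mu> k) * z k t) - \<i> * w k t)) (at t within {0..})"
      using dx[OF that, of k] z_eq[OF that] by simp
  qed (use that z_eq in auto)
  have bound: "(cmod (z k t))\<^sup>2 \<le> (cmod (l2_nth a0 k))\<^sup>2 + integral {0..t} (\<lambda>\<tau>. Y \<tau> k) / \<epsilon>" if t: "0 \<le> t" for k t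
  proof -
    have "t ^ 0 * (cmod (z k t))\<^sup>2 + integral {0..t} (\<lambda>\<tau>. \<mu> k * \<tau> ^ 0 * (cmod (z k \<tau>))\<^sup>2)
      \<le> 0 ^ 0 * (cmod (z k 0))\<^sup>2 + integral {0..t} (\<lambda>\<tau>. real 0 * \<tau> ^ (0 - 1) * (cmod (z k \<tau>))\<^sup>2)
        + integral {0..t} (\<lambda>\<tau>. \<tau> ^ 0 * (Y \<tau> k / \<epsilon>))"
    proof (rule damped_ode_energy[where f = "w k"])
      show "continuous_on UNIV (\<lambda>\<tau>. Y \<tau> k / \<epsilon>)" using \<epsilon> by (intro continuous_intros cY) auto
      show "(cmod (w k \<tau>))\<^sup>2 \<le> \<mu> k * (Y \<tau> k / \<epsilon>)" for \<tau>
        using \<epsilon> by (simp add: w_def Y_def \<mu>_def norm_mult power_mult_distrib)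
    qed (use dz cz \<epsilon> t in \<open>auto simp: Y_def \<mu>_def\<close>)
    moreover have "0 \<le> integral {0..t} (\<lambda>\<tau>. \<mu> k * \<tau> ^ 0 * (cmod (z k \<tau>))\<^sup>2)"
    proof (rule integral_nonneg)
      show "(\<lambda>\<tau>. \<mu> k * \<tau> ^ 0 * (cmod (z k \<tau>))\<^sup>2) integrable_on {0..t}"
        by (intro integrable_continuous_real continuous_intros continuous_on_subset[OF cz]) auto
    qed (use \<epsilon> in \<open>auto simp: \<mu>_def\<close>)
    ultimately show ?thesis by (simp add: z_def x0)
  qed
  define B where "B T k = (cmod (l2_nth a0 k))\<^sup>2 + integral {0..T} (\<lambda>\<tau>. Y \<tau> k) / \<epsilon>" for T k
  have B: "integrable lattice (B T)" if T: "0 \<le> T" for T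
  proof -
    have "(\<Sum>k\<in>F. integral {0..T} (\<lambda>\<tau>. Y \<tau> k)) \<le> integral {0..T} (\<lambda>\<tau>. (norm (W \<tau>))\<^sup>2)" if "finite F" for F
    proof -
      have "(\<Sum>k\<in>F. integral {0..T} (\<lambda>\<tau>. Y \<tau> k)) = integral {0..T} (\<lambda>\<tau>. \<Sum>k\<in>F. Y \<tau> k)"
        by (rule integral_sum[symmetric]) (use that iY in auto)
      also have "\<dots> \<le> integral {0..T} (\<lambda>\<tau>. (norm (W \<tau>))\<^sup>2)"
      proof (rule integral_le)
        show "(\<lambda>\<tau>. \<Sum>k\<in>F. Y \<tau> k) integrable_on {0..T}" using that iY by (intro integrable_sum) auto
        show "(\<lambda>\<tau>. (norm (W \<tau>))\<^sup>2) integrable_on {0..T}"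
          by (intro integrable_continuous_real continuous_intros continuous_on_subset[OF W]) auto
      qed (use that in \<open>auto simp: Y_def intro: sum_le_l2_norm_sq\<close>)
      finally show ?thesis .
    qed
    then have "integrable lattice (\<lambda>k. integral {0..T} (\<lambda>\<tau>. Y \<tau> k))"
      by (rule lattice_bounded_sums(1)[rotated]) (auto intro!: integral_nonneg iY Y0)
    then show ?thesis unfolding B_def by (simp add: l2_nth_integrable)
  qed
  have zB: "(cmod (z k t))\<^sup>2 \<le> B T k" if "t \<le> T" "0 \<le> T" for k t T
  proof -
    have "(cmod (z k t))\<^sup>2 = (cmod (z k (max 0 t)))\<^sup>2" by (simp add: z_def)
    also have "\<dots> \<le> (cmod (l2_nth a0 k))\<^sup>2 + integral {0..max 0 t} (\<lambda>\<tau>. Y \<tau> k) / \<epsilon>"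
      by (rule bound) simp
    also have "integral {0..max 0 t} (\<lambda>\<tau>. Y \<tau> k) \<le> integral {0..T} (\<lambda>\<tau>. Y \<tau> k)"
      by (rule integral_subset_le) (use that iY Y0 in auto)
    finally show ?thesis using \<epsilon> by (simp add: B_def divide_right_mono)
  qed
  define a where "a t = Abs_l2 (\<lambda>k. z k t)" for t
  have nth: "l2_nth (a t) = (\<lambda>k. z k t)" for t
    unfolding a_def
  proof (rule l2_nth_Abs, rule Bochner_Integration.integrable_bound[OF B[of "max 0 t"]])
    show "AE k in lattice. norm ((cmod (z k t))\<^sup>2) \<le> norm (B (max 0 t) k)"
    proof (rule AE_I2)
      fix k
      have "(cmod (z k t))\<^sup>2 \<le> B (max 0 t) k" by (rule zB) auto
      then show "norm ((cmod (z k t))\<^sup>2) \<le> norm (B (max 0 t) k)" by simp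
    qed
  qed auto
  have ca': "continuous_on {..<T} a" for T
    by (rule l2_continuous_dominated[where B = "B (max 0 T)"])
      (use zB[of _ "max 0 T"] B[of "max 0 T"] in \<open>auto simp: nth intro: continuous_on_subset[OF cz]\<close>)
  have ca: "continuous_on UNIV a"
    unfolding continuous_on_eq_continuous_at[OF open_UNIV]
  proof
    fix t :: real
    have "t \<in> {..<t + 1}" by simp
    then show "isCont a t"
      using ca'[of "t + 1"] continuous_on_eq_continuous_at[of "{..<t + 1}" a] open_lessThan[of "t + 1"] by blast
  qed
  show ?thesis
  proof (rule that[of a])
    show "forced \<epsilon> a W"
      unfolding forced_def nth using ca W dz by (simp add: \<mu>_def w_def)
    show "a t = a0" if "t \<le> 0" for t
      using that by (intro l2_eqI) (simp add: nth z_def x0)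
    then show "a 0 = a0" by simp
  qed
qed

lemma time_nn_integral_le_const:
  assumes "0 \<le> t" "\<And>\<tau>. 0 \<le> \<tau> \<Longrightarrow> \<tau> \<le> t \<Longrightarrow> f \<tau> \<le> c"
  shows "(\<integral>\<^sup>+\<tau>. f \<tau> \<partial>time t) \<le> c * ennreal t"
proof -
  have "(\<integral>\<^sup>+\<tau>. f \<tau> \<partial>time t) \<le> (\<integral>\<^sup>+\<tau>. c \<partial>time t)"
    by (intro nn_integral_mono) (use assms in \<open>auto simp: space_restrict_space\<close>)
  also have "\<dots> = c * ennreal t"
    using assms by (simp add: emeasure_restrict_space space_restrict_space)
  finally show ?thesis .
qed

text \<open>
  Banach's fixed point theorem for bounded continuous functions \<open>u\<close>, where \<open>u(t)\<close> stands for
  \<open>exp (- \<kappa> t) a(t)\<close>: by the energy inequality the solution map is Lipschitz with squared constant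
  \<open>L\<^sup>2 / (2 \<epsilon> \<kappa>)\<close>, which the choice of \<open>\<kappa>\<close> makes at most \<open>1/4\<close>.
\<close>

theorem forced_fixed_point:
  fixes V :: "l2 \<Rightarrow> l2"
  assumes \<epsilon>: "0 < \<epsilon>" and L: "0 \<le> L" and lip: "\<And>a b. norm (V a - V b) \<le> L * norm (a - b)" and bd: "\<And>a. norm (V a) \<le> M"
  obtains a where "forced \<epsilon> a (\<lambda>t. V (a t))" "a 0 = a0"
proof -
  have cV: "continuous_on UNIV V"
  proof (rule lipschitz_on_continuous_on[of L])
    show "L-lipschitz_on UNIV V" using lip L by (auto intro!: lipschitz_onI simp: dist_norm)
  qed
  \<comment> \<open>The weight exponent for which \<open>L\<^sup>2 / (2 \<epsilon> \<kappa>) \<le> 1/4\<close>; the summand 1 keeps it positive for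
    \<open>L = 0\<close>.\<close>
  define \<kappa> where "\<kappa> = 2 * (L\<^sup>2 + 1) / \<epsilon>"
  have \<kappa>: "\<kappa> > 0" using \<epsilon> by (auto simp: \<kappa>_def intro!: divide_pos_pos add_nonneg_pos)
  \<comment> \<open>\<open>A\<close> removes the weight from a function, \<open>S\<close> solves with the resulting forcing, and \<open>Tf\<close> puts
    the weight back.\<close>
  define A where "A u t = exp (\<kappa> * max 0 t) *\<^sub>R apply_bcontfun u t" for u :: "real \<Rightarrow>\<^sub>C l2" and t
  have cA: "continuous_on UNIV (A u)" for u
    unfolding A_def by (intro continuous_intros) simp
  then have cVA: "continuous_on UNIV (\<lambda>t. V (A u t))" for u
    by (rule continuous_on_compose2[OF cV]) auto
  have "\<exists>a. forced \<epsilon> a (\<lambda>t. V (A u t)) \<and> a 0 = a0 \<and> (\<forall>t\<le>0. a t = a0)" for u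
    using forced_solve[OF \<epsilon> cVA[of u], of a0] by metis
  then obtain S where S: "\<And>u. forced \<epsilon> (S u) (\<lambda>t. V (A u t))" "\<And>u. S u 0 = a0" "\<And>u t. t \<le> 0 \<Longrightarrow> S u t = a0"
    by metis
  have M: "0 \<le> M" using bd[of 0] norm_ge_zero order_trans by blast
  have Sbound: "(norm (S u t))\<^sup>2 \<le> (norm a0)\<^sup>2 + M\<^sup>2 * t / \<epsilon>" if t: "0 \<le> t" for u t
  proof -
    have "(\<integral>\<^sup>+\<tau>. ennreal ((norm (V (A u \<tau>)))\<^sup>2) \<partial>time t) \<le> ennreal (M\<^sup>2) * ennreal t"
      using bd by (intro time_nn_integral_le_const t ennreal_leI power_mono) auto
    then have le: "ennreal (1 / \<epsilon>) * (\<integral>\<^sup>+\<tau>. ennreal ((norm (V (A u \<tau>)))\<^sup>2) \<partial>time t) \<le> ennreal (1 / \<epsilon>) * (ennreal (M\<^sup>2) * ennreal t)"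
      by (rule mult_left_mono) simp
    have "ennreal ((norm (S u t))\<^sup>2) \<le> ennreal ((norm a0)\<^sup>2) + ennreal (1 / \<epsilon>) * (\<integral>\<^sup>+\<tau>. ennreal ((norm (V (A u \<tau>)))\<^sup>2) \<partial>time t)"
      using forced_norm_le[OF S(1) \<epsilon> t, of u] S(2) by simp
    also note add_left_mono[OF le]
    finally have "ennreal ((norm (S u t))\<^sup>2) \<le> ennreal ((norm a0)\<^sup>2) + ennreal (1 / \<epsilon>) * (ennreal (M\<^sup>2) * ennreal t)" .
    also have "ennreal ((norm a0)\<^sup>2) + ennreal (1 / \<epsilon>) * (ennreal (M\<^sup>2) * ennreal t) = ennreal ((norm a0)\<^sup>2 + (1 / \<epsilon>) * (M\<^sup>2 * t))"
      using \<epsilon> t by (simp add: ennreal_mult[symmetric] ennreal_plus[symmetric] del: ennreal_plus)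
    finally have "(norm (S u t))\<^sup>2 \<le> (norm a0)\<^sup>2 + (1 / \<epsilon>) * (M\<^sup>2 * t)"
      using \<epsilon> t by (subst (asm) ennreal_le_iff) auto
    then show ?thesis by simp
  qed
  define Tf where "Tf u t = exp (- \<kappa> * max 0 t) *\<^sub>R S u t" for u t
  have cT: "continuous_on UNIV (Tf u)" for u
    unfolding Tf_def using S(1)[of u] by (intro continuous_intros) (auto simp: forced_def)
  have Tbound: "norm (Tf u t) \<le> sqrt ((norm a0)\<^sup>2 + M\<^sup>2 / (\<epsilon> * \<kappa>))" for u t
  proof (rule power2_le_imp_le)
    show "(norm (Tf u t))\<^sup>2 \<le> (sqrt ((norm a0)\<^sup>2 + M\<^sup>2 / (\<epsilon> * \<kappa>)))\<^sup>2"
    proof (cases "0 \<le> t")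
      case True
      have e: "exp (- 2 * \<kappa> * t) \<le> 1" "exp (- 2 * \<kappa> * t) * t \<le> 1 / \<kappa>"
      proof -
        show "exp (- 2 * \<kappa> * t) \<le> 1" using True \<kappa> by simp
        have "\<kappa> * t \<le> exp (2 * \<kappa> * t)"
          using exp_ge_add_one_self[of "2 * \<kappa> * t"] True \<kappa> mult_nonneg_nonneg[of \<kappa> t] by linarith
        then show "exp (- 2 * \<kappa> * t) * t \<le> 1 / \<kappa>"
          using \<kappa> by (simp add: exp_minus field_simps)
      qed
      have "(norm (Tf u t))\<^sup>2 = exp (- 2 * \<kappa> * t) * (norm (S u t))\<^sup>2"
        using True by (simp add: Tf_def power_mult_distrib exp_double[symmetric] mult.assoc)
      also have "\<dots> \<le> exp (- 2 * \<kappa> * t) * ((norm a0)\<^sup>2 + M\<^sup>2 * t / \<epsilon>)"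
        by (intro mult_left_mono Sbound True) auto
      also have "\<dots> = exp (- 2 * \<kappa> * t) * (norm a0)\<^sup>2 + (M\<^sup>2 / \<epsilon>) * (exp (- 2 * \<kappa> * t) * t)"
        by (simp add: algebra_simps)
      also have "\<dots> \<le> 1 * (norm a0)\<^sup>2 + (M\<^sup>2 / \<epsilon>) * (1 / \<kappa>)"
        using \<epsilon> by (intro add_mono mult_right_mono mult_left_mono e) auto
      finally show ?thesis using \<epsilon> \<kappa> by simp
    next
      case False
      then show ?thesis using S(3)[of t u] \<epsilon> \<kappa> by (simp add: Tf_def)
    qed
  qed (use \<epsilon> \<kappa> in simp)
  have Tb: "Tf u \<in> bcontfun" for u
    by (rule bcontfun_normI[OF cT Tbound])
  define T where "T u = Bcontfun (Tf u)" for u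
  have Tapp: "apply_bcontfun (T u) = Tf u" for u
    unfolding T_def by (rule Bcontfun_inverse[OF Tb])
  have contr: "dist (T u) (T v) \<le> 1 / 2 * dist u v" for u v
  proof (rule dist_bound)
    fix t
    show "dist (apply_bcontfun (T u) t) (apply_bcontfun (T v) t) \<le> 1 / 2 * dist u v"
    proof (cases "0 \<le> t")
      case False
      then show ?thesis unfolding Tapp using S(3)[of t] by (simp add: Tf_def)
    next
      case True
      let ?d = "dist u v"
      have WA: "(norm (V (A u \<tau>) - V (A v \<tau>)))\<^sup>2 \<le> L\<^sup>2 * ?d\<^sup>2 * exp (2 * \<kappa> * \<tau>)" if "0 \<le> \<tau>" for \<tau>
      proof -
        have "norm (A u \<tau> - A v \<tau>) = exp (\<kappa> * \<tau>) * dist (apply_bcontfun u \<tau>) (apply_bcontfun v \<tau>)"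
          using that by (simp add: A_def dist_norm scaleR_diff_right[symmetric])
        also have "\<dots> \<le> exp (\<kappa> * \<tau>) * ?d" by (intro mult_left_mono dist_bounded) auto
        finally have "norm (V (A u \<tau>) - V (A v \<tau>)) \<le> L * (exp (\<kappa> * \<tau>) * ?d)"
          using lip[of "A u \<tau>" "A v \<tau>"] L by (meson mult_left_mono order_trans)
        then have "(norm (V (A u \<tau>) - V (A v \<tau>)))\<^sup>2 \<le> (L * (exp (\<kappa> * \<tau>) * ?d))\<^sup>2"
          by (intro power_mono) auto
        also have "\<dots> = L\<^sup>2 * ?d\<^sup>2 * exp (2 * \<kappa> * \<tau>)"
          by (simp add: power_mult_distrib exp_double[symmetric] mult.assoc)
        finally show ?thesis .
      qed
      have "ennreal ((norm (S u t - S v t))\<^sup>2) \<le> ennreal (1 / \<epsilon>) * (\<integral>\<^sup>+\<tau>. ennreal ((norm (V (A u \<tau>) - V (A v \<tau>)))\<^sup>2) \<partial>time t)"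
        using forced_norm_le[OF forced_diff[OF S(1) S(1)] \<epsilon> True, of u v] S(2) by simp
      also have "(\<integral>\<^sup>+\<tau>. ennreal ((norm (V (A u \<tau>) - V (A v \<tau>)))\<^sup>2) \<partial>time t)
          \<le> (\<integral>\<^sup>+\<tau>. ennreal (L\<^sup>2 * ?d\<^sup>2) * ennreal (exp (2 * \<kappa> * \<tau>)) \<partial>time t)"
        using WA by (intro nn_integral_mono) (auto simp: space_restrict_space ennreal_mult[symmetric] intro!: ennreal_leI)
      also have "\<dots> = ennreal (L\<^sup>2 * ?d\<^sup>2) * (\<integral>\<^sup>+\<tau>. ennreal (exp (2 * \<kappa> * \<tau>)) \<partial>time t)"
        by (rule nn_integral_cmult) (auto intro!: borel_measurable_time)
      also have "(\<integral>\<^sup>+\<tau>. ennreal (exp (2 * \<kappa> * \<tau>)) \<partial>time t) \<le> ennreal (exp (2 * \<kappa> * t) / (2 * \<kappa>))"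
        by (rule exp_integral_le) (use True \<kappa> in auto)
      finally have "ennreal ((norm (S u t - S v t))\<^sup>2)
          \<le> ennreal (1 / \<epsilon>) * (ennreal (L\<^sup>2 * ?d\<^sup>2) * ennreal (exp (2 * \<kappa> * t) / (2 * \<kappa>)))"
        by (simp add: mult_left_mono)
      also have "\<dots> = ennreal ((1 / \<epsilon>) * (L\<^sup>2 * ?d\<^sup>2 * (exp (2 * \<kappa> * t) / (2 * \<kappa>))))"
        using \<epsilon> \<kappa> by (simp add: ennreal_mult[symmetric])
      finally have le: "(norm (S u t - S v t))\<^sup>2 \<le> (1 / \<epsilon>) * (L\<^sup>2 * ?d\<^sup>2 * (exp (2 * \<kappa> * t) / (2 * \<kappa>)))"
        using \<epsilon> \<kappa> by (subst (asm) ennreal_le_iff) auto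
      have ratio: "L\<^sup>2 / (\<epsilon> * (2 * \<kappa>)) \<le> 1 / 4"
      proof -
        have "\<epsilon> * (2 * \<kappa>) = 4 * (L\<^sup>2 + 1)" using \<epsilon> by (simp add: \<kappa>_def)
        moreover have "0 < 4 * (L\<^sup>2 + 1)" by (intro mult_pos_pos add_nonneg_pos) auto
        ultimately show ?thesis by (simp only: divide_le_eq if_True) simp
      qed
      have "(norm (Tf u t - Tf v t))\<^sup>2 = exp (- 2 * \<kappa> * t) * (norm (S u t - S v t))\<^sup>2"
        using True by (simp add: Tf_def scaleR_diff_right[symmetric] power_mult_distrib exp_double[symmetric] mult.assoc)
      also have "\<dots> \<le> exp (- 2 * \<kappa> * t) * ((1 / \<epsilon>) * (L\<^sup>2 * ?d\<^sup>2 * (exp (2 * \<kappa> * t) / (2 * \<kappa>))))"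
        by (intro mult_left_mono le) auto
      also have "\<dots> = L\<^sup>2 / (\<epsilon> * (2 * \<kappa>)) * ?d\<^sup>2 * (exp (- 2 * \<kappa> * t) * exp (2 * \<kappa> * t))"
      proof -
        have "e * ((1 / \<epsilon>) * (l * d * (f / (2 * \<kappa>)))) = l / (\<epsilon> * (2 * \<kappa>)) * d * (e * f)" for e l d f :: real
          using \<epsilon> \<kappa> by (simp add: field_simps)
        then show ?thesis .
      qed
      also have "exp (- 2 * \<kappa> * t) * exp (2 * \<kappa> * t) = 1" by (simp add: exp_add[symmetric])
      also have "L\<^sup>2 / (\<epsilon> * (2 * \<kappa>)) * ?d\<^sup>2 * 1 \<le> 1 / 4 * ?d\<^sup>2"
        using ratio by (simp only: mult_1_right) (intro mult_right_mono, auto)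
      also have "\<dots> = (1 / 2 * ?d)\<^sup>2" by (simp add: power2_eq_square)
      finally have "norm (Tf u t - Tf v t) \<le> 1 / 2 * ?d"
        by (rule power2_le_imp_le) simp
      then show ?thesis
        unfolding Tapp by (simp only: dist_norm[of "Tf u t" "Tf v t"])
    qed
  qed
  obtain u where u: "T u = u"
    using banach_fix_type[of "1/2" T] contr by auto
  define a where "a = S u"
  have aA: "a t = A u t" if "0 \<le> t" for t
  proof -
    have "apply_bcontfun u t = Tf u t" using Tapp[of u] u by simp
    then have "A u t = (exp (\<kappa> * t) * exp (- \<kappa> * t)) *\<^sub>R S u t"
      using that by (simp add: A_def Tf_def)
    also have "exp (\<kappa> * t) * exp (- \<kappa> * t) = 1" by (simp add: exp_add[symmetric])
    finally show ?thesis by (simp add: a_def)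
  qed
  have ca: "continuous_on UNIV a" using S(1)[of u] by (simp add: a_def forced_def)
  have "forced \<epsilon> a (\<lambda>t. V (a t))"
    unfolding forced_def
  proof (intro conjI allI impI)
    show "continuous_on UNIV a" by (rule ca)
    show "continuous_on UNIV (\<lambda>t. V (a t))"
      by (rule continuous_on_compose2[OF cV ca]) auto
    show "((\<lambda>t. l2_nth (a t) k) has_vector_derivative
        (- (of_real (\<epsilon> * (norm (freq k))\<^sup>2) * l2_nth (a t) k) - \<i> * (of_real (norm (freq k)) * l2_nth (V (a t)) k)))
        (at t within {0..})" if "0 \<le> t" for k t
      using S(1)[of u] that unfolding forced_def aA[OF that] a_def[symmetric] by (metis aA that)
  qed
  then show ?thesis by (rule that) (simp add: a_def S(2))
qed

text \<open>The energy inequality for the difference, followed by Gronwall.\<close>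

lemma forced_unique:
  fixes V :: "l2 \<Rightarrow> l2"
  assumes \<epsilon>: "0 < \<epsilon>" and lip: "\<And>a b. norm (V a - V b) \<le> L * norm (a - b)"
    and a: "forced \<epsilon> a (\<lambda>t. V (a t))" and b: "forced \<epsilon> b (\<lambda>t. V (b t))" and eq: "a 0 = b 0" and t: "0 \<le> t"
  shows "a t = b t"
proof (cases "t = 0")
  case True then show ?thesis using eq by simp
next
  case False
  then have t: "0 < t" using t by simp
  define y where "y \<tau> = (norm (a \<tau> - b \<tau>))\<^sup>2" for \<tau>
  have cy: "continuous_on UNIV y"
    unfolding y_def using a b unfolding forced_def by (intro continuous_intros) blast+
  have "compact (y ` {0..t})"
    by (intro compact_continuous_image continuous_on_subset[OF cy]) auto
  then have "bounded (y ` {0..t})" by (rule compact_imp_bounded)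
  then obtain B where "\<forall>x\<in>y ` {0..t}. norm x \<le> B"
    unfolding bounded_iff by blast
  then have B: "norm (y \<tau>) \<le> B" if "\<tau> \<in> {0..t}" for \<tau> using that by blast
  have "y t = 0"
  proof (rule gronwall_zero[where y = y and t = t and T = t and K = "(1 / \<epsilon>) * L\<^sup>2" and B = B])
    fix s assume s: "0 < s" "s \<le> t"
    show "y s \<le> B" using B[of s] s by auto
    show "0 \<le> y s" by (simp add: y_def)
    have "ennreal (y s) \<le> ennreal (1 / \<epsilon>) * (\<integral>\<^sup>+\<tau>. ennreal ((norm (V (a \<tau>) - V (b \<tau>)))\<^sup>2) \<partial>time s)"
      using forced_norm_le[OF forced_diff[OF a b] \<epsilon>, of s] s eq by (simp add: y_def)
    also have "(\<integral>\<^sup>+\<tau>. ennreal ((norm (V (a \<tau>) - V (b \<tau>)))\<^sup>2) \<partial>time s) \<le> (\<integral>\<^sup>+\<tau>. ennreal (L\<^sup>2) * ennreal (y \<tau>) \<partial>time s)"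
    proof (intro nn_integral_mono)
      fix \<tau>
      have "(norm (V (a \<tau>) - V (b \<tau>)))\<^sup>2 \<le> (L * norm (a \<tau> - b \<tau>))\<^sup>2" by (intro power_mono lip) auto
      then show "ennreal ((norm (V (a \<tau>) - V (b \<tau>)))\<^sup>2) \<le> ennreal (L\<^sup>2) * ennreal (y \<tau>)"
        by (simp add: y_def ennreal_mult[symmetric] power_mult_distrib ennreal_leI)
    qed
    also have "\<dots> = ennreal (L\<^sup>2) * (\<integral>\<^sup>+\<tau>. ennreal (y \<tau>) \<partial>time s)"
      by (intro nn_integral_cmult measurable_compose[OF _ measurable_ennreal] borel_measurable_time_cont cy)
    finally have fin: "ennreal (y s) \<le> ennreal (1 / \<epsilon>) * (ennreal (L\<^sup>2) * (\<integral>\<^sup>+\<tau>. ennreal (y \<tau>) \<partial>time s))"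
      by (simp add: mult_left_mono)
    show "ennreal (y s) \<le> ennreal ((1 / \<epsilon>) * L\<^sup>2) * (\<integral>\<^sup>+\<tau>. ennreal (y \<tau>) \<partial>time s)"
    proof -
      have "ennreal ((1 / \<epsilon>) * L\<^sup>2) = ennreal (1 / \<epsilon>) * ennreal (L\<^sup>2)"
        using \<epsilon> by (intro ennreal_mult) auto
      with fin show ?thesis by (simp only: mult.assoc)
    qed
  qed (use \<epsilon> t in auto)
  then show ?thesis by (simp add: y_def)
qed

section \<open>Energy identity\<close>

lemma nn_integral_time_continuous_finite:
  assumes "continuous_on UNIV h"
  shows "(\<integral>\<^sup>+\<tau>. ennreal (h \<tau>) \<partial>time t) < \<infinity>"
proof -
  have "(\<integral>\<^sup>+\<tau>. ennreal (h \<tau>) \<partial>time t) \<le> (\<integral>\<^sup>+\<tau>. ennreal \<bar>h \<tau>\<bar> \<partial>time t)"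
    by (intro nn_integral_mono ennreal_leI) auto
  also have "\<dots> = ennreal (integral {0..t} (\<lambda>\<tau>. \<bar>h \<tau>\<bar>))"
    by (rule nn_integral_time_continuous) (intro continuous_intros assms, simp)
  finally show ?thesis by (simp add: le_less_trans)
qed

lemma integral_time_continuous:
  fixes h :: "real \<Rightarrow> real"
  assumes "continuous_on UNIV h"
  shows "integrable (time t) h" "(LINT \<tau>|time t. h \<tau>) = integral {0..t} h"
proof -
  have s: "set_integrable lborel {0..t} h"
    unfolding set_integrable_def by (rule borel_integrable_compact) (auto intro: continuous_on_subset[OF assms])
  then show "integrable (time t) h"
    by (simp add: integrable_restrict_space set_integrable_def)
  have "(LINT \<tau>|time t. h \<tau>) = (LINT \<tau>:{0..t}|lborel. h \<tau>)"
    by (simp add: integral_restrict_space set_lebesgue_integral_def)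
  also have "\<dots> = integral {0..t} h"
    by (rule set_borel_integral_eq_integral(2)[OF s])
  finally show "(LINT \<tau>|time t. h \<tau>) = integral {0..t} h" .
qed

text \<open>
  The identity \<open>(|x|\<^sup>2)' = 2 x \<bullet> x'\<close> in integrated form, in contrast to the inequality above
  without estimating the forcing.
\<close>

lemma damped_ode_identity:
  fixes x f :: "real \<Rightarrow> complex"
  assumes der: "\<And>\<tau>. 0 \<le> \<tau> \<Longrightarrow> (x has_vector_derivative (- (of_real \<mu> * x \<tau>) - \<i> * f \<tau>)) (at \<tau> within {0..})"
    and t: "0 \<le> t"
  shows "((\<lambda>\<tau>. - (2 * \<mu> * (cmod (x \<tau>))\<^sup>2) + 2 * (x \<tau> \<bullet> (- (\<i> * f \<tau>)))) has_integral ((cmod (x t))\<^sup>2 - (cmod (x 0))\<^sup>2)) {0..t}"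
proof -
  define x' where "x' \<tau> = - (of_real \<mu> * x \<tau>) - \<i> * f \<tau>" for \<tau>
  have dp: "((\<lambda>\<tau>. x \<tau> \<bullet> x \<tau>) has_vector_derivative (2 * (x \<tau> \<bullet> x' \<tau>))) (at \<tau> within {0..t})" if "\<tau> \<in> {0..t}" for \<tau>
  proof -
    have dx: "(x has_derivative (\<lambda>h. h *\<^sub>R x' \<tau>)) (at \<tau> within {0..t})"
      using der[of \<tau>] that unfolding x'_def has_vector_derivative_def
      by (auto intro: has_derivative_subset)
    show ?thesis
      unfolding has_vector_derivative_def
      by (rule has_derivative_eq_rhs, rule has_derivative_inner[OF dx dx]) (auto simp: fun_eq_iff algebra_simps inner_commute)
  qed
  have x2: "x \<tau> \<bullet> x \<tau> = (cmod (x \<tau>))\<^sup>2" for \<tau> by (simp add: power2_norm_eq_inner)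
  have eq: "2 * (x \<tau> \<bullet> x' \<tau>) = - (2 * \<mu> * (cmod (x \<tau>))\<^sup>2) + 2 * (x \<tau> \<bullet> (- (\<i> * f \<tau>)))" for \<tau>
    by (simp add: x'_def inner_diff_right x2[symmetric] flip: scaleR_conv_of_real)
  show ?thesis
    using fundamental_theorem_of_calculus[OF t dp] unfolding eq x2 by simp
qed

text \<open>The coefficients of real functions.\<close>

definition symmetric_coeffs :: "l2 \<Rightarrow> bool" where
  "symmetric_coeffs a \<longleftrightarrow> (\<forall>k. l2_nth a (- k) = cnj (l2_nth a k))"

lemma pair_lattice_eq: "lattice \<Otimes>\<^sub>M lattice = count_space (UNIV :: ((int^3) \<times> (int^3)) set)"
  by (simp add: pair_measure_countable)

context drift_symbol
begin

text \<open>
  The nonlinear contribution to the energy is the imaginary part of the double sum of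
  \<open>cnj a\<^sub>k (k \<bullet> m\<^sub>l) a\<^sub>l a_(k-l)\<close>. The involution \<open>(k, l) \<mapsto> (k - l, - l)\<close> conjugates each term:
  \<open>(k - l) \<bullet> m\<^sub>l = k \<bullet> m\<^sub>l\<close> as the velocity is divergence free, \<open>m\<close> is even, and the coefficients
  are symmetric. So the sum is real. The first Sobolev norm serves absolute convergence.
\<close>

lemma advection_cancels:
  assumes sym: "symmetric_coeffs a" and fin: "sobolev_sq 1 a < \<infinity>"
  shows "(LINT k|lattice. norm (freq k) * (l2_nth a k \<bullet> (- (\<i> * l2_nth (quad a a) k)))) = 0"
proof -
  define G where "G = (\<lambda>(k, l). cnj (l2_nth a k) * of_real (norm (freq k)) * (kernel k l * l2_nth a l * l2_nth a (k - l)))"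
  \<comment> \<open>The involution under which the summands are conjugated.\<close>
  define \<phi> :: "(int^3) \<times> (int^3) \<Rightarrow> (int^3) \<times> (int^3)" where "\<phi> = (\<lambda>(k, l). (k - l, - l))"
  interpret P: pair_sigma_finite lattice lattice
    by (intro pair_sigma_finite.intro sigma_finite_lattice)
  have Gm: "G \<in> borel_measurable (lattice \<Otimes>\<^sub>M lattice)"
    unfolding pair_lattice_eq by simp
  define R where "R k = (LINT l|lattice. cmod (kernel k l * l2_nth a l * l2_nth a (k - l)))" for k
  have R0: "0 \<le> R k" for k by (simp add: R_def)
  have R2: "ennreal ((R k)\<^sup>2) \<le> ennreal quad_bound * conv_sq (l2_nth a) (l2_nth a) k" for k
  proof -
    have "ennreal (R k) = (\<integral>\<^sup>+l. ennreal (cmod (kernel k l * l2_nth a l * l2_nth a (k - l))) \<partial>lattice)"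
      unfolding R_def by (intro nn_integral_eq_integral[symmetric] integrable_norm integrable_quad) auto
    then show ?thesis
      using quad_abs_sq_le[of k "l2_nth a" "l2_nth a"] R0[of k] by (simp add: quad_bound_def ennreal_power[symmetric])
  qed
  have iR: "integrable lattice (\<lambda>k. cmod (l2_nth a k) * norm (freq k) * R k)"
  proof (rule integrableI_bounded)
    have "(\<integral>\<^sup>+k. ennreal (norm (cmod (l2_nth a k) * norm (freq k) * R k)) \<partial>lattice)
      \<le> (\<integral>\<^sup>+k. ennreal (norm (freq k) ^ (2 * 1) * (cmod (l2_nth a k))\<^sup>2) + ennreal quad_bound * conv_sq (l2_nth a) (l2_nth a) k \<partial>lattice)"
    proof (intro nn_integral_mono)
      fix k
      have "cmod (l2_nth a k) * norm (freq k) * R k \<le> (cmod (l2_nth a k) * norm (freq k))\<^sup>2 + (R k)\<^sup>2"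
        by (rule mult_le_sum_squares)
      then have "ennreal (norm (cmod (l2_nth a k) * norm (freq k) * R k)) \<le> ennreal (norm (freq k) ^ (2 * 1) * (cmod (l2_nth a k))\<^sup>2 + (R k)\<^sup>2)"
        using R0[of k] by (intro ennreal_leI) (simp add: abs_mult power_mult_distrib mult.commute)
      also have "\<dots> = ennreal (norm (freq k) ^ (2 * 1) * (cmod (l2_nth a k))\<^sup>2) + ennreal ((R k)\<^sup>2)"
        by (rule ennreal_plus) auto
      also note add_left_mono[OF R2]
      finally show "ennreal (norm (cmod (l2_nth a k) * norm (freq k) * R k))
        \<le> ennreal (norm (freq k) ^ (2 * 1) * (cmod (l2_nth a k))\<^sup>2) + ennreal quad_bound * conv_sq (l2_nth a) (l2_nth a) k" .
    qed
    also have "\<dots> = sobolev_sq 1 a + ennreal quad_bound * (ennreal ((norm a)\<^sup>2) * ennreal ((norm a)\<^sup>2))"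
    proof -
      have "(\<integral>\<^sup>+k. ennreal quad_bound * conv_sq (l2_nth a) (l2_nth a) k \<partial>lattice)
        = ennreal quad_bound * (ennreal ((norm a)\<^sup>2) * ennreal ((norm a)\<^sup>2))"
        unfolding conv_sq_def l2_norm_sq_ennreal
        by (subst nn_integral_conv[symmetric], subst nn_integral_cmult) simp_all
      then show ?thesis by (subst nn_integral_add) (simp_all add: sobolev_sq_def)
    qed
    also have "\<dots> < \<infinity>" using fin by (simp add: ennreal_mult_less_top ennreal_add_less_top)
    finally show "(\<integral>\<^sup>+k. ennreal (norm (cmod (l2_nth a k) * norm (freq k) * R k)) \<partial>lattice) < \<infinity>" .
  qed simp
  have Gi: "integrable (lattice \<Otimes>\<^sub>M lattice) G"
  proof (rule P.Fubini_integrable[OF Gm])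
    have "(\<lambda>k. LINT l|lattice. norm (G (k, l))) = (\<lambda>k. cmod (l2_nth a k) * norm (freq k) * R k)"
      by (simp add: G_def R_def norm_mult mult.assoc)
    then show "integrable lattice (\<lambda>k. LINT l|lattice. norm (G (k, l)))" using iR by simp
    show "AE k in lattice. integrable lattice (\<lambda>l. G (k, l))"
      unfolding G_def prod.case by (intro AE_I2 Bochner_Integration.integrable_mult_right integrable_quad)
  qed
  define Z where "Z = integral\<^sup>L (lattice \<Otimes>\<^sub>M lattice) G"
  have inner: "(LINT l|lattice. G (k, l)) = cnj (l2_nth a k) * of_real (norm (freq k)) * l2_nth (quad a a) k" for k
    by (simp add: G_def l2_nth_quad)
  have Z1: "Z = (LINT k|lattice. cnj (l2_nth a k) * of_real (norm (freq k)) * l2_nth (quad a a) k)"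
    and i1: "integrable lattice (\<lambda>k. cnj (l2_nth a k) * of_real (norm (freq k)) * l2_nth (quad a a) k)"
    using P.integral_fst'[OF Gi] P.integrable_fst'[OF Gi] unfolding inner Z_def by auto
  have Geq: "G (k, l) = cnj (l2_nth a k) * (of_real (freq k \<bullet> m l) * l2_nth a l * l2_nth a (k - l))" for k l
  proof -
    have "of_real (norm (freq k)) * kernel k l = of_real (freq k \<bullet> m l)" by (rule norm_mult_kernel)
    then show ?thesis by (simp add: G_def mult.assoc[symmetric])
  qed
  have G\<phi>: "G (\<phi> p) = cnj (G p)" for p
  proof -
    obtain k l where p: "p = (k, l)" by (cases p)
    have "(freq k - freq l) \<bullet> m l = freq k \<bullet> m l" using div_free[of l] by (simp add: inner_diff_left)
    moreover have "l2_nth a (- l) = cnj (l2_nth a l)" "l2_nth a (k - l - - l) = l2_nth a k"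
      using sym by (auto simp: symmetric_coeffs_def)
    ultimately show ?thesis by (simp add: p \<phi>_def Geq freq_diff m_even mult_ac)
  qed
  have bij: "bij \<phi>"
    by (rule involuntory_imp_bij) (auto simp: \<phi>_def)
  have Z_eq: "Z = (LINT p|count_space UNIV. G p)" by (simp add: Z_def pair_lattice_eq)
  also have "\<dots> = (LINT p|count_space UNIV. G (\<phi> p))"
    by (rule integral_bij_count_space[OF bij, symmetric])
  also have "\<dots> = cnj (LINT p|count_space UNIV. G p)"
    unfolding G\<phi> by (rule Bochner_Integration.integral_cnj)
  finally have "Z = cnj Z" unfolding Z_eq[symmetric] .
  from arg_cong[OF this, of Im] have "Im Z = 0" by simp
  moreover have "Im Z = (LINT k|lattice. Im (cnj (l2_nth a k) * of_real (norm (freq k)) * l2_nth (quad a a) k))"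
    unfolding Z1 by (rule integral_Im[OF i1, symmetric])
  moreover have "Im (cnj x * of_real r * y) = r * (x \<bullet> (- (\<i> * y)))" for x y :: complex and r
    by (simp add: inner_complex_def algebra_simps)
  ultimately show ?thesis by simp
qed

text \<open>
  Sum the scalar identities over the frequencies. The forcing may carry a scalar factor \<open>c(t)\<close>,
  which accounts for the truncated equation. The energy inequality provides the finite first
  Sobolev norm, for almost every time, under which the nonlinear terms cancel.
\<close>

theorem energy_identity:
  assumes F: "forced \<epsilon> a (\<lambda>t. c t *\<^sub>R quad (a t) (a t))" and \<epsilon>: "0 < \<epsilon>"
    and sym: "\<And>t. 0 \<le> t \<Longrightarrow> symmetric_coeffs (a t)" and t: "0 \<le> t"
  shows "ennreal ((norm (a t))\<^sup>2) + ennreal (2 * \<epsilon>) * (\<integral>\<^sup>+\<tau>. sobolev_sq 1 (a \<tau>) \<partial>time t) = ennreal ((norm (a 0))\<^sup>2)"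
proof -
  define W where "W t = c t *\<^sub>R quad (a t) (a t)" for t
  have ca: "continuous_on UNIV a" and cW: "continuous_on UNIV W"
    using F by (auto simp: forced_def W_def[abs_def])
  define \<mu> where "\<mu> k = \<epsilon> * (norm (freq k))\<^sup>2" for k
  define h where "h k \<tau> = l2_nth (a \<tau>) k \<bullet> (- (\<i> * (of_real (norm (freq k)) * l2_nth (W \<tau>) k)))" for k \<tau>
  define X where "X k \<tau> = (cmod (l2_nth (a \<tau>) k))\<^sup>2" for k \<tau>
  have ch: "continuous_on UNIV (h k)" for k
    unfolding h_def by (intro continuous_intros ca cW)
  have cX: "continuous_on UNIV (X k)" for k
    unfolding X_def by (intro continuous_intros ca)
  have wfin: "(\<integral>\<^sup>+\<tau>. ennreal ((norm (W \<tau>))\<^sup>2) \<partial>time t) < \<infinity>"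
    by (rule nn_integral_time_continuous_finite) (intro continuous_intros cW)
  have sfin: "(\<integral>\<^sup>+\<tau>. sobolev_sq 1 (a \<tau>) \<partial>time t) < \<infinity>"
  proof -
    have "ennreal \<epsilon> * (\<integral>\<^sup>+\<tau>. sobolev_sq 1 (a \<tau>) \<partial>time t) \<le> ennreal ((norm (a t))\<^sup>2) + ennreal \<epsilon> * (\<integral>\<^sup>+\<tau>. sobolev_sq 1 (a \<tau>) \<partial>time t)"
      by simp
    also have "\<dots> \<le> ennreal ((norm (a 0))\<^sup>2) + ennreal (1 / \<epsilon>) * (\<integral>\<^sup>+\<tau>. ennreal ((norm (W \<tau>))\<^sup>2) \<partial>time t)"
      using forced_energy[OF F \<epsilon> t, of 0] by (simp add: sobolev_sq_0 W_def)
    also have "\<dots> < \<infinity>"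
      using wfin by (simp add: ennreal_add_less_top ennreal_mult_less_top)
    finally show ?thesis using \<epsilon> by (auto simp: ennreal_mult_less_top)
  qed
  have hle: "\<bar>h k \<tau>\<bar> \<le> norm (freq k) ^ (2 * 1) * X k \<tau> + (cmod (l2_nth (W \<tau>) k))\<^sup>2" for k \<tau>
  proof -
    have "\<bar>h k \<tau>\<bar> \<le> (cmod (l2_nth (a \<tau>) k) * norm (freq k)) * cmod (l2_nth (W \<tau>) k)"
      using Cauchy_Schwarz_ineq2[of "l2_nth (a \<tau>) k" "- (\<i> * (of_real (norm (freq k)) * l2_nth (W \<tau>) k))"]
      by (simp add: h_def norm_mult mult.assoc)
    also have "\<dots> \<le> (cmod (l2_nth (a \<tau>) k) * norm (freq k))\<^sup>2 + (cmod (l2_nth (W \<tau>) k))\<^sup>2"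
      by (rule mult_le_sum_squares)
    finally show ?thesis by (simp add: X_def power_mult_distrib mult.commute)
  qed
  interpret P: pair_sigma_finite "time t" lattice
    by (intro pair_sigma_finite.intro sigma_finite_lattice sigma_finite_time)
  have hm: "(\<lambda>(\<tau>, k). h k \<tau>) \<in> borel_measurable (time t \<Otimes>\<^sub>M lattice)"
    by (rule measurable_pair_lattice_swap) (rule borel_measurable_time_cont[OF ch])
  have hsum: "(\<integral>\<^sup>+k. ennreal \<bar>h k \<tau>\<bar> \<partial>lattice) \<le> sobolev_sq 1 (a \<tau>) + ennreal ((norm (W \<tau>))\<^sup>2)" for \<tau>
  proof -
    have "(\<integral>\<^sup>+k. ennreal \<bar>h k \<tau>\<bar> \<partial>lattice) \<le> (\<integral>\<^sup>+k. ennreal (norm (freq k) ^ (2 * 1) * X k \<tau>) + ennreal ((cmod (l2_nth (W \<tau>) k))\<^sup>2) \<partial>lattice)"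
    proof (intro nn_integral_mono)
      fix k
      have "ennreal \<bar>h k \<tau>\<bar> \<le> ennreal (norm (freq k) ^ (2 * 1) * X k \<tau> + (cmod (l2_nth (W \<tau>) k))\<^sup>2)"
        by (intro ennreal_leI hle)
      then show "ennreal \<bar>h k \<tau>\<bar> \<le> ennreal (norm (freq k) ^ (2 * 1) * X k \<tau>) + ennreal ((cmod (l2_nth (W \<tau>) k))\<^sup>2)"
        by (subst ennreal_plus[symmetric]) (auto simp: X_def)
    qed
    also have "\<dots> = sobolev_sq 1 (a \<tau>) + ennreal ((norm (W \<tau>))\<^sup>2)"
      by (subst nn_integral_add) (simp_all add: sobolev_sq_def l2_norm_sq_ennreal X_def)
    finally show ?thesis .
  qed
  have sm: "(\<lambda>\<tau>. sobolev_sq 1 (a \<tau>)) \<in> borel_measurable (time t)"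
    unfolding sobolev_sq_def
    by (intro borel_measurable_lattice_nn_integral measurable_compose[OF _ measurable_ennreal] borel_measurable_time_cont continuous_intros ca)
  have wm: "(\<lambda>\<tau>. ennreal ((norm (W \<tau>))\<^sup>2)) \<in> borel_measurable (time t)"
    by (intro measurable_compose[OF _ measurable_ennreal] borel_measurable_time_cont continuous_intros cW)
  have hi: "integrable (time t \<Otimes>\<^sub>M lattice) (\<lambda>(\<tau>, k). h k \<tau>)"
  proof (rule integrableI_bounded[OF hm])
    have "(\<integral>\<^sup>+p. ennreal (norm ((\<lambda>(\<tau>, k). h k \<tau>) p)) \<partial>(time t \<Otimes>\<^sub>M lattice)) = (\<integral>\<^sup>+\<tau>. \<integral>\<^sup>+k. ennreal \<bar>h k \<tau>\<bar> \<partial>lattice \<partial>time t)"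
    proof -
      have "(\<lambda>p. ennreal (norm ((\<lambda>(\<tau>, k). h k \<tau>) p))) \<in> borel_measurable (time t \<Otimes>\<^sub>M lattice)"
        using hm by measurable
      from P.M2.nn_integral_fst[OF this] show ?thesis by simp
    qed
    also have "\<dots> \<le> (\<integral>\<^sup>+\<tau>. sobolev_sq 1 (a \<tau>) + ennreal ((norm (W \<tau>))\<^sup>2) \<partial>time t)"
      by (intro nn_integral_mono hsum)
    also have "\<dots> = (\<integral>\<^sup>+\<tau>. sobolev_sq 1 (a \<tau>) \<partial>time t) + (\<integral>\<^sup>+\<tau>. ennreal ((norm (W \<tau>))\<^sup>2) \<partial>time t)"
      by (rule nn_integral_add[OF sm wm])
    also have "\<dots> < \<infinity>"
      using sfin wfin by (simp add: ennreal_add_less_top)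
    finally show "(\<integral>\<^sup>+p. ennreal (norm ((\<lambda>(\<tau>, k). h k \<tau>) p)) \<partial>(time t \<Otimes>\<^sub>M lattice)) < \<infinity>" .
  qed
  have H: "(LINT \<tau>|time t. h k \<tau>) = integral {0..t} (h k)" for k
    by (rule integral_time_continuous[OF ch])
  have iH: "integrable lattice (\<lambda>k. integral {0..t} (h k))"
    using P.integrable_snd[OF hi] by (simp add: H)
  have "(LINT k|lattice. integral {0..t} (h k)) = (LINT \<tau>|time t. LINT k|lattice. h k \<tau>)"
    using P.Fubini_integral[OF hi] by (simp add: H)
  also have "\<dots> = (LINT \<tau>|time t. 0)"
  proof (rule integral_cong_AE)
    show "(\<lambda>\<tau>. LINT k|lattice. h k \<tau>) \<in> borel_measurable (time t)"
      using P.M2.borel_measurable_lebesgue_integral[OF hm] .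
    have "AE \<tau> in time t. sobolev_sq 1 (a \<tau>) \<noteq> \<infinity>"
      by (rule nn_integral_PInf_AE[OF sm]) (use sfin in auto)
    then show "AE \<tau> in time t. (LINT k|lattice. h k \<tau>) = 0"
      using AE_space
    proof eventually_elim
      case (elim \<tau>)
      then have \<tau>: "0 \<le> \<tau>" by (simp add: space_restrict_space)
      have "h k \<tau> = c \<tau> * (norm (freq k) * (l2_nth (a \<tau>) k \<bullet> (- (\<i> * l2_nth (quad (a \<tau>) (a \<tau>)) k))))" for k
        by (simp add: h_def W_def inner_complex_def algebra_simps)
      then show ?case
        using advection_cancels[OF sym[OF \<tau>]] elim(1) by (simp add: top.not_eq_extremum)
    qed
  qed simp
  finally have H0: "(LINT k|lattice. integral {0..t} (h k)) = 0" by simp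
  define d where "d k = integral {0..t} (\<lambda>\<tau>. 2 * \<mu> k * X k \<tau>)" for k
  have d: "d k = X k 0 - X k t + 2 * integral {0..t} (h k)" for k
  proof -
    have "((\<lambda>\<tau>. - (2 * \<mu> k * X k \<tau>) + 2 * h k \<tau>) has_integral (X k t - X k 0)) {0..t}"
      unfolding X_def h_def
    proof (rule damped_ode_identity[OF _ t])
      show "((\<lambda>t. l2_nth (a t) k) has_vector_derivative
         (- (of_real (\<mu> k) * l2_nth (a \<tau>) k) - \<i> * (of_real (norm (freq k)) * l2_nth (W \<tau>) k))) (at \<tau> within {0..})"
        if "0 \<le> \<tau>" for \<tau> using F that by (simp add: forced_def \<mu>_def W_def)
    qed
    moreover have "((\<lambda>\<tau>. - (2 * \<mu> k * X k \<tau>) + 2 * h k \<tau>) has_integral (- d k + 2 * integral {0..t} (h k))) {0..t}"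
      unfolding d_def
      by (intro has_integral_add has_integral_neg has_integral_mult_right integrable_integral integrable_continuous_real
          continuous_intros continuous_on_subset[OF cX] continuous_on_subset[OF ch]) auto
    ultimately have "X k t - X k 0 = - d k + 2 * integral {0..t} (h k)" by (rule has_integral_unique)
    then show ?thesis by simp
  qed
  have iX: "integrable lattice (\<lambda>k. X k s)" "(LINT k|lattice. X k s) = (norm (a s))\<^sup>2" for s
    by (simp_all add: X_def l2_nth_integrable l2_norm_sq)
  have id: "integrable lattice d" and dint: "(LINT k|lattice. d k) = (norm (a 0))\<^sup>2 - (norm (a t))\<^sup>2"
    unfolding d using iX iH H0 by simp_all
  have d0: "0 \<le> d k" for k
    unfolding d_def using \<epsilon>
    by (intro integral_nonneg integrable_continuous_real continuous_intros continuous_on_subset[OF cX])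
      (auto simp: X_def \<mu>_def)
  have "ennreal (LINT k|lattice. d k) = (\<integral>\<^sup>+k. ennreal (d k) \<partial>lattice)"
    by (rule nn_integral_eq_integral[symmetric, OF id]) (auto intro: d0)
  also have "\<dots> = (\<integral>\<^sup>+k. \<integral>\<^sup>+\<tau>. ennreal (2 * \<epsilon>) * ennreal (norm (freq k) ^ (2 * 1) * X k \<tau>) \<partial>time t \<partial>lattice)"
  proof (intro nn_integral_cong)
    fix k
    have "ennreal (d k) = (\<integral>\<^sup>+\<tau>. ennreal (2 * \<mu> k * X k \<tau>) \<partial>time t)"
      unfolding d_def using \<epsilon>
      by (intro nn_integral_time_continuous[symmetric] continuous_intros cX) (auto simp: \<mu>_def X_def)
    then show "ennreal (d k) = (\<integral>\<^sup>+\<tau>. ennreal (2 * \<epsilon>) * ennreal (norm (freq k) ^ (2 * 1) * X k \<tau>) \<partial>time t)"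
      using \<epsilon> by (simp add: ennreal_mult[symmetric] \<mu>_def X_def mult.assoc)
  qed
  also have "\<dots> = (\<integral>\<^sup>+\<tau>. \<integral>\<^sup>+k. ennreal (2 * \<epsilon>) * ennreal (norm (freq k) ^ (2 * 1) * X k \<tau>) \<partial>lattice \<partial>time t)"
    by (intro nn_integral_time_lattice_swap borel_measurable_times_ennreal borel_measurable_const
        measurable_compose[OF _ measurable_ennreal] borel_measurable_time_cont continuous_intros cX)
  also have "\<dots> = (\<integral>\<^sup>+\<tau>. ennreal (2 * \<epsilon>) * sobolev_sq 1 (a \<tau>) \<partial>time t)"
    by (subst nn_integral_cmult) (simp_all add: sobolev_sq_def X_def)
  also have "\<dots> = ennreal (2 * \<epsilon>) * (\<integral>\<^sup>+\<tau>. sobolev_sq 1 (a \<tau>) \<partial>time t)"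
    by (rule nn_integral_cmult[OF sm])
  finally have D: "ennreal (2 * \<epsilon>) * (\<integral>\<^sup>+\<tau>. sobolev_sq 1 (a \<tau>) \<partial>time t) = ennreal ((norm (a 0))\<^sup>2 - (norm (a t))\<^sup>2)"
    by (simp add: dint)
  have le: "0 \<le> (norm (a 0))\<^sup>2 - (norm (a t))\<^sup>2"
  proof -
    have "0 \<le> (LINT k|lattice. d k)" by (rule Bochner_Integration.integral_nonneg) (auto intro: d0)
    then show ?thesis using dint by simp
  qed
  show ?thesis
    unfolding D by (subst ennreal_plus[symmetric]) (use le in auto)
qed

end

lemma forced_zero_mode:
  assumes F: "forced \<epsilon> a W" and t: "0 \<le> t"
  shows "cmod (l2_nth (a t) 0) = cmod (l2_nth (a 0) 0)"
proof -
  have "((\<lambda>\<tau>. - (2 * 0 * (cmod (l2_nth (a \<tau>) 0))\<^sup>2) + 2 * (l2_nth (a \<tau>) 0 \<bullet> (- (\<i> * 0)))) has_integral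
      ((cmod (l2_nth (a t) 0))\<^sup>2 - (cmod (l2_nth (a 0) 0))\<^sup>2)) {0..t}"
  proof (rule damped_ode_identity[OF _ t])
    show "((\<lambda>t. l2_nth (a t) 0) has_vector_derivative (- (of_real 0 * l2_nth (a \<tau>) 0) - \<i> * 0)) (at \<tau> within {0..})"
      if "0 \<le> \<tau>" for \<tau>
    proof -
      have "((\<lambda>t. l2_nth (a t) 0) has_vector_derivative
        (- (of_real (\<epsilon> * (norm (freq 0))\<^sup>2) * l2_nth (a \<tau>) 0) - \<i> * (of_real (norm (freq 0)) * l2_nth (W \<tau>) 0))) (at \<tau> within {0..})"
        using F that unfolding forced_def by blast
      then show ?thesis by simp
    qed
  qed
  then have "(cmod (l2_nth (a t) 0))\<^sup>2 - (cmod (l2_nth (a 0) 0))\<^sup>2 = 0"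
    by (intro has_integral_unique[OF _ has_integral_0]) simp
  then show ?thesis by (simp add: power2_eq_iff_nonneg)
qed

lemma norm_sq_le_sobolev_sq:
  assumes "l2_nth a 0 = 0"
  shows "ennreal ((norm a)\<^sup>2) \<le> sobolev_sq n a"
  unfolding l2_norm_sq_ennreal sobolev_sq_def
proof (intro nn_integral_mono ennreal_leI)
  fix k
  show "(cmod (l2_nth a k))\<^sup>2 \<le> norm (freq k) ^ (2 * n) * (cmod (l2_nth a k))\<^sup>2"
  proof (cases "k = 0")
    case False
    then have "1 \<le> norm (freq k) ^ (2 * n)" using norm_freq_ge_1 by (intro one_le_power) auto
    then show ?thesis using mult_right_mono[of 1 "norm (freq k) ^ (2 * n)" "(cmod (l2_nth a k))\<^sup>2"] by simp
  qed (use assms in simp)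
qed

context drift_symbol
begin

lemma norm_antimono:
  assumes F: "forced \<epsilon> a (\<lambda>t. c t *\<^sub>R quad (a t) (a t))" and \<epsilon>: "0 < \<epsilon>"
    and sym: "\<And>t. 0 \<le> t \<Longrightarrow> symmetric_coeffs (a t)" and s: "0 \<le> s" "s \<le> t"
  shows "norm (a t) \<le> norm (a s)"
proof -
  have "forced \<epsilon> (\<lambda>u. a (s + u)) (\<lambda>u. c (s + u) *\<^sub>R quad (a (s + u)) (a (s + u)))"
    by (rule forced_shift[OF F s(1)])
  from energy_identity[OF this \<epsilon>, of "t - s"] sym s
  have "ennreal ((norm (a t))\<^sup>2) + ennreal (2 * \<epsilon>) * (\<integral>\<^sup>+\<tau>. sobolev_sq 1 (a (s + \<tau>)) \<partial>time (t - s)) = ennreal ((norm (a s))\<^sup>2)"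
    by simp
  then have "ennreal ((norm (a t))\<^sup>2) \<le> ennreal ((norm (a s))\<^sup>2)"
    by (metis le_iff_add)
  then have "(norm (a t))\<^sup>2 \<le> (norm (a s))\<^sup>2" by (simp add: ennreal_le_iff)
  then show ?thesis by (rule power2_le_imp_le) simp
qed

text \<open>
  On functions of mean zero the norm is at most the first Sobolev norm, and the norm is
  decreasing, so the dissipation up to time \<open>t\<close> is at least \<open>2 \<epsilon> t |a(t)|\<^sup>2\<close>.
\<close>

lemma norm_decay:
  assumes F: "forced \<epsilon> a (\<lambda>t. c t *\<^sub>R quad (a t) (a t))" and \<epsilon>: "0 < \<epsilon>"
    and sym: "\<And>t. 0 \<le> t \<Longrightarrow> symmetric_coeffs (a t)" and z: "l2_nth (a 0) 0 = 0" and t: "0 \<le> t"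
  shows "(1 + 2 * \<epsilon> * t) * (norm (a t))\<^sup>2 \<le> (norm (a 0))\<^sup>2"
proof -
  have "ennreal ((norm (a t))\<^sup>2) * ennreal t = (\<integral>\<^sup>+\<tau>. ennreal ((norm (a t))\<^sup>2) \<partial>time t)"
    using t by (simp add: emeasure_restrict_space space_restrict_space)
  also have "\<dots> \<le> (\<integral>\<^sup>+\<tau>. sobolev_sq 1 (a \<tau>) \<partial>time t)"
  proof (intro nn_integral_mono)
    fix \<tau> assume "\<tau> \<in> space (time t)"
    then have \<tau>: "0 \<le> \<tau>" "\<tau> \<le> t" by (auto simp: space_restrict_space)
    have "ennreal ((norm (a t))\<^sup>2) \<le> ennreal ((norm (a \<tau>))\<^sup>2)"
      by (intro ennreal_leI power_mono norm_antimono[OF F \<epsilon> sym] \<tau>) auto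
    also have "\<dots> \<le> sobolev_sq 1 (a \<tau>)"
      using forced_zero_mode[OF F \<tau>(1)] z by (intro norm_sq_le_sobolev_sq) simp
    finally show "ennreal ((norm (a t))\<^sup>2) \<le> sobolev_sq 1 (a \<tau>)" .
  qed
  finally have "ennreal ((norm (a t))\<^sup>2) + ennreal (2 * \<epsilon>) * (ennreal ((norm (a t))\<^sup>2) * ennreal t) \<le> ennreal ((norm (a 0))\<^sup>2)"
    using energy_identity[OF F \<epsilon> sym t] by (auto intro: order_trans[OF add_left_mono[OF mult_left_mono]])
  then have "ennreal ((norm (a t))\<^sup>2 + 2 * \<epsilon> * ((norm (a t))\<^sup>2 * t)) \<le> ennreal ((norm (a 0))\<^sup>2)"
    using \<epsilon> t by (simp add: ennreal_mult[symmetric] ennreal_plus[symmetric] del: ennreal_plus)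
  then show ?thesis
    by (subst (asm) ennreal_le_iff) (auto simp: algebra_simps)
qed

section \<open>Smoothing\<close>

text \<open>
  Induction on the order: the time weighted energy inequality of order \<open>n + 1\<close> is driven by
  \<open>\<integral> \<tau>\<^sup>n |a|\<^sup>2\<close> in the norm of order \<open>n + 1\<close>, which the dissipation at order \<open>n\<close> controls. The
  weight removes the initial value, and the nonlinearity costs the same integral with a factor
  \<open>\<tau> \<le> 1\<close>.
\<close>

theorem smoothing:
  assumes \<epsilon>: "0 < \<epsilon>"
  shows "\<exists>A\<ge>0. \<forall>a t. forced \<epsilon> a (\<lambda>t. quad (a t) (a t)) \<longrightarrow> (\<forall>\<tau>\<ge>0. norm (a \<tau>) \<le> R \<and> norm (a \<tau>) \<le> norm (a 0)) \<longrightarrow> 0 \<le> t \<longrightarrow> t \<le> 1 \<longrightarrow>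
     ennreal (t ^ n) * sobolev_sq n (a t) + ennreal \<epsilon> * (\<integral>\<^sup>+\<tau>. ennreal (\<tau> ^ n) * sobolev_sq (Suc n) (a \<tau>) \<partial>time t)
     \<le> ennreal (A * (norm (a 0))\<^sup>2)"
proof (induction n)
  case 0
  show ?case
  proof (intro exI[of _ "1 + (1 / \<epsilon>) * (quad_bound * R\<^sup>2)"] conjI allI impI)
    show "0 \<le> 1 + (1 / \<epsilon>) * (quad_bound * R\<^sup>2)" using \<epsilon> quad_bound_nonneg by auto
    fix a and t :: real
    assume F: "forced \<epsilon> a (\<lambda>t. quad (a t) (a t))" and R: "\<forall>\<tau>\<ge>0. norm (a \<tau>) \<le> R \<and> norm (a \<tau>) \<le> norm (a 0)"
      and t: "0 \<le> t" "t \<le> 1"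
    have "(\<integral>\<^sup>+\<tau>. ennreal (\<tau> ^ 0) * sobolev_sq 0 (quad (a \<tau>) (a \<tau>)) \<partial>time t) \<le> ennreal (quad_bound * R\<^sup>2 * (norm (a 0))\<^sup>2) * ennreal t"
    proof (rule time_nn_integral_le_const[OF t(1)])
      fix \<tau> :: real assume \<tau>: "0 \<le> \<tau>"
      have "(norm (quad (a \<tau>) (a \<tau>)))\<^sup>2 \<le> quad_bound * (norm (a \<tau>))\<^sup>2 * (norm (a \<tau>))\<^sup>2" by (rule norm_quad_sq_le)
      also have "\<dots> \<le> quad_bound * R\<^sup>2 * (norm (a 0))\<^sup>2"
        using R \<tau> quad_bound_nonneg by (intro mult_mono power_mono) auto
      finally show "ennreal (\<tau> ^ 0) * sobolev_sq 0 (quad (a \<tau>) (a \<tau>)) \<le> ennreal (quad_bound * R\<^sup>2 * (norm (a 0))\<^sup>2)"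
        by (simp add: sobolev_sq_0 ennreal_leI)
    qed
    also have "\<dots> \<le> ennreal (quad_bound * R\<^sup>2 * (norm (a 0))\<^sup>2) * ennreal 1"
      using t by (intro mult_left_mono ennreal_leI) auto
    finally have "ennreal (1 / \<epsilon>) * (\<integral>\<^sup>+\<tau>. ennreal (\<tau> ^ 0) * sobolev_sq 0 (quad (a \<tau>) (a \<tau>)) \<partial>time t)
      \<le> ennreal (1 / \<epsilon>) * ennreal (quad_bound * R\<^sup>2 * (norm (a 0))\<^sup>2)"
      by (intro mult_left_mono) auto
    then have "ennreal (0 ^ 0) * sobolev_sq 0 (a 0) + ennreal (real 0) * (\<integral>\<^sup>+\<tau>. ennreal (\<tau> ^ (0 - 1)) * sobolev_sq 0 (a \<tau>) \<partial>time t)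
       + ennreal (1 / \<epsilon>) * (\<integral>\<^sup>+\<tau>. ennreal (\<tau> ^ 0) * sobolev_sq 0 (quad (a \<tau>) (a \<tau>)) \<partial>time t)
       \<le> ennreal ((norm (a 0))\<^sup>2) + ennreal (1 / \<epsilon>) * ennreal (quad_bound * R\<^sup>2 * (norm (a 0))\<^sup>2)"
      by (simp add: sobolev_sq_0)
    also have "\<dots> = ennreal ((norm (a 0))\<^sup>2 + (1 / \<epsilon>) * (quad_bound * R\<^sup>2 * (norm (a 0))\<^sup>2))"
      using \<epsilon> quad_bound_nonneg by (subst ennreal_mult[symmetric], simp, simp, subst ennreal_plus[symmetric]) auto
    also have "(norm (a 0))\<^sup>2 + (1 / \<epsilon>) * (quad_bound * R\<^sup>2 * (norm (a 0))\<^sup>2) = (1 + (1 / \<epsilon>) * (quad_bound * R\<^sup>2)) * (norm (a 0))\<^sup>2"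
      by (simp add: algebra_simps)
    finally show "ennreal (t ^ 0) * sobolev_sq 0 (a t) + ennreal \<epsilon> * (\<integral>\<^sup>+\<tau>. ennreal (\<tau> ^ 0) * sobolev_sq (Suc 0) (a \<tau>) \<partial>time t)
      \<le> ennreal ((1 + (1 / \<epsilon>) * (quad_bound * R\<^sup>2)) * (norm (a 0))\<^sup>2)"
      by (rule order_trans[OF forced_energy[OF F \<epsilon> t(1), of 0]])
  qed
next
  case (Suc n)
  then obtain A where A: "A \<ge> 0" and IH: "\<And>a t. forced \<epsilon> a (\<lambda>t. quad (a t) (a t)) \<Longrightarrow> (\<And>\<tau>. 0 \<le> \<tau> \<Longrightarrow> norm (a \<tau>) \<le> R \<and> norm (a \<tau>) \<le> norm (a 0)) \<Longrightarrow> 0 \<le> t \<Longrightarrow> t \<le> 1 \<Longrightarrow>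
     ennreal (t ^ n) * sobolev_sq n (a t) + ennreal \<epsilon> * (\<integral>\<^sup>+\<tau>. ennreal (\<tau> ^ n) * sobolev_sq (Suc n) (a \<tau>) \<partial>time t)
     \<le> ennreal (A * (norm (a 0))\<^sup>2)"
    by blast
  define Q where "Q = quad_bound * (2 * 4 ^ Suc n) * R\<^sup>2"
  have Q: "0 \<le> Q" using quad_bound_nonneg by (simp add: Q_def)
  define A' where "A' = (real (Suc n) + (1 / \<epsilon>) * Q) * (A / \<epsilon>)"
  show ?case
  proof (intro exI[of _ A'] conjI allI impI)
    show "0 \<le> A'" using \<epsilon> Q A by (auto simp: A'_def intro!: mult_nonneg_nonneg add_nonneg_nonneg)
    fix a and t :: real
    assume F: "forced \<epsilon> a (\<lambda>t. quad (a t) (a t))" and R: "\<forall>\<tau>\<ge>0. norm (a \<tau>) \<le> R \<and> norm (a \<tau>) \<le> norm (a 0)"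
      and t: "0 \<le> t" "t \<le> 1"
    have ca: "continuous_on UNIV a" using F by (simp add: forced_def)
    define I where "I = (\<integral>\<^sup>+\<tau>. ennreal (\<tau> ^ n) * sobolev_sq (Suc n) (a \<tau>) \<partial>time t)"
    have sm: "(\<lambda>\<tau>. ennreal (\<tau> ^ n) * sobolev_sq (Suc n) (a \<tau>)) \<in> borel_measurable (time t)"
      unfolding sobolev_sq_def
      by (intro borel_measurable_times_ennreal borel_measurable_lattice_nn_integral measurable_compose[OF _ measurable_ennreal]
          borel_measurable_time_cont continuous_intros ca)
    have I: "I \<le> ennreal (A / \<epsilon> * (norm (a 0))\<^sup>2)"
    proof -
      have "ennreal \<epsilon> * I \<le> ennreal (t ^ n) * sobolev_sq n (a t) + ennreal \<epsilon> * I" by simp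
      also have "\<dots> \<le> ennreal (A * (norm (a 0))\<^sup>2)"
        unfolding I_def by (rule IH[OF F]) (use R t in auto)
      finally have "ennreal (1 / \<epsilon>) * (ennreal \<epsilon> * I) \<le> ennreal (1 / \<epsilon>) * ennreal (A * (norm (a 0))\<^sup>2)"
        by (rule mult_left_mono) simp
      moreover have "ennreal (1 / \<epsilon>) * (ennreal \<epsilon> * I) = I"
        using \<epsilon> by (simp add: mult.assoc[symmetric] ennreal_mult[symmetric])
      moreover have "ennreal (1 / \<epsilon>) * ennreal (A * (norm (a 0))\<^sup>2) = ennreal (A / \<epsilon> * (norm (a 0))\<^sup>2)"
        using \<epsilon> A by (simp add: ennreal_mult[symmetric])
      ultimately show ?thesis by simp
    qed
    have J: "(\<integral>\<^sup>+\<tau>. ennreal (\<tau> ^ Suc n) * sobolev_sq (Suc n) (quad (a \<tau>) (a \<tau>)) \<partial>time t) \<le> ennreal Q * I"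
    proof -
      have "(\<integral>\<^sup>+\<tau>. ennreal (\<tau> ^ Suc n) * sobolev_sq (Suc n) (quad (a \<tau>) (a \<tau>)) \<partial>time t)
        \<le> (\<integral>\<^sup>+\<tau>. ennreal Q * (ennreal (\<tau> ^ n) * sobolev_sq (Suc n) (a \<tau>)) \<partial>time t)"
      proof (intro nn_integral_mono)
        fix \<tau> assume "\<tau> \<in> space (time t)"
        then have \<tau>: "0 \<le> \<tau>" "\<tau> \<le> 1" using t by (auto simp: space_restrict_space)
        have "sobolev_sq (Suc n) (quad (a \<tau>) (a \<tau>)) \<le> ennreal (quad_bound * (2 * 4 ^ Suc n) * (norm (a \<tau>))\<^sup>2) * sobolev_sq (Suc n) (a \<tau>)"
          by (rule sobolev_sq_quad)
        also have "\<dots> \<le> ennreal Q * sobolev_sq (Suc n) (a \<tau>)"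
          unfolding Q_def using R \<tau> quad_bound_nonneg by (intro mult_right_mono ennreal_leI mult_left_mono power_mono) auto
        finally have "ennreal (\<tau> ^ Suc n) * sobolev_sq (Suc n) (quad (a \<tau>) (a \<tau>)) \<le> ennreal (\<tau> ^ n) * (ennreal Q * sobolev_sq (Suc n) (a \<tau>))"
          using \<tau> by (intro mult_mono ennreal_leI power_decreasing) auto
        then show "ennreal (\<tau> ^ Suc n) * sobolev_sq (Suc n) (quad (a \<tau>) (a \<tau>)) \<le> ennreal Q * (ennreal (\<tau> ^ n) * sobolev_sq (Suc n) (a \<tau>))"
          by (simp only: mult.left_commute)
      qed
      also have "\<dots> = ennreal Q * I" unfolding I_def by (rule nn_integral_cmult[OF sm])
      finally show ?thesis .
    qed
    have "ennreal (t ^ Suc n) * sobolev_sq (Suc n) (a t) + ennreal \<epsilon> * (\<integral>\<^sup>+\<tau>. ennreal (\<tau> ^ Suc n) * sobolev_sq (Suc (Suc n)) (a \<tau>) \<partial>time t)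
      \<le> ennreal (0 ^ Suc n) * sobolev_sq (Suc n) (a 0) + ennreal (real (Suc n)) * (\<integral>\<^sup>+\<tau>. ennreal (\<tau> ^ (Suc n - 1)) * sobolev_sq (Suc n) (a \<tau>) \<partial>time t)
        + ennreal (1 / \<epsilon>) * (\<integral>\<^sup>+\<tau>. ennreal (\<tau> ^ Suc n) * sobolev_sq (Suc n) (quad (a \<tau>) (a \<tau>)) \<partial>time t)"
      by (rule forced_energy[OF F \<epsilon> t(1)])
    also have "\<dots> \<le> ennreal (real (Suc n)) * I + ennreal (1 / \<epsilon>) * (ennreal Q * I)"
      using mult_left_mono[OF J, of "ennreal (1 / \<epsilon>)"] by (simp add: I_def[symmetric] add_left_mono del: of_nat_Suc)
    also have "\<dots> = ennreal (real (Suc n) + (1 / \<epsilon>) * Q) * I"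
    proof -
      have "ennreal (real (Suc n) + (1 / \<epsilon>) * Q) = ennreal (real (Suc n)) + ennreal (1 / \<epsilon>) * ennreal Q"
        using \<epsilon> Q by (subst ennreal_plus) (auto simp: ennreal_mult[symmetric])
      then show ?thesis by (simp only: distrib_right mult.assoc)
    qed
    also have "\<dots> \<le> ennreal (real (Suc n) + (1 / \<epsilon>) * Q) * ennreal (A / \<epsilon> * (norm (a 0))\<^sup>2)"
      by (intro mult_left_mono I) simp
    also have "\<dots> = ennreal (A' * (norm (a 0))\<^sup>2)"
      unfolding A'_def using \<epsilon> Q A by (subst ennreal_mult[symmetric]) (auto simp: mult.assoc)
    finally show "ennreal (t ^ Suc n) * sobolev_sq (Suc n) (a t) + ennreal \<epsilon> * (\<integral>\<^sup>+\<tau>. ennreal (\<tau> ^ Suc n) * sobolev_sq (Suc (Suc n)) (a \<tau>) \<partial>time t)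
      \<le> ennreal (A' * (norm (a 0))\<^sup>2)" .
  qed
qed

end

section \<open>Global solution for the coefficients\<close>

text \<open>The radial retraction onto the ball of radius \<open>R\<close>.\<close>

definition ball_proj :: "real \<Rightarrow> 'a :: real_normed_vector \<Rightarrow> 'a" where
  "ball_proj R a = (R / max R (norm a)) *\<^sub>R a"

lemma norm_ball_proj_le:
  assumes "0 < R" shows "norm (ball_proj R a) \<le> R"
proof -
  have "norm a \<le> max R (norm a)" by simp
  then have "R * norm a \<le> R * max R (norm a)" using assms by (intro mult_left_mono) auto
  moreover have "0 < max R (norm a)" using assms by simp
  ultimately show ?thesis using assms by (simp add: ball_proj_def divide_le_eq)
qed

text \<open>
  Moving the point and moving the scaling factor each cost at most \<open>|a - b|\<close>, which gives the
  constant 2 in every normed space.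
\<close>

lemma ball_proj_lipschitz:
  assumes R: "0 < R" shows "norm (ball_proj R a - ball_proj R b) \<le> 2 * norm (a - b)"
proof -
  define s t where "s = max R (norm a)" and "t = max R (norm b)"
  have st: "0 < s" "0 < t" "R \<le> s" "norm b \<le> t" using R by (auto simp: s_def t_def)
  have "ball_proj R a - ball_proj R b = (R / s) *\<^sub>R (a - b) + (R / s - R / t) *\<^sub>R b"
    by (simp add: ball_proj_def s_def t_def algebra_simps)
  then have "norm (ball_proj R a - ball_proj R b) \<le> norm ((R / s) *\<^sub>R (a - b)) + norm ((R / s - R / t) *\<^sub>R b)"
    by (simp only: norm_triangle_ineq)
  also have "\<dots> = R / s * norm (a - b) + \<bar>R / s - R / t\<bar> * norm b"
    using R st by simp
  also have "\<bar>R / s - R / t\<bar> * norm b \<le> norm (a - b)"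
  proof -
    have "R / s - R / t = (R / s) * ((t - s) / t)" using st by (simp add: field_simps)
    then have "\<bar>R / s - R / t\<bar> = (R / s) * (\<bar>t - s\<bar> / t)"
      using R st by (simp add: abs_mult abs_divide)
    also have "\<dots> \<le> 1 * (\<bar>t - s\<bar> / t)" using R st by (intro mult_right_mono) auto
    finally have "\<bar>R / s - R / t\<bar> * norm b \<le> (\<bar>t - s\<bar> / t) * norm b" by (intro mult_right_mono) auto
    also have "\<dots> = \<bar>t - s\<bar> * (norm b / t)" by simp
    also have "\<dots> \<le> \<bar>t - s\<bar> * 1" using st by (intro mult_left_mono) auto
    also have "\<bar>t - s\<bar> \<le> \<bar>norm b - norm a\<bar>" by (auto simp: s_def t_def max_def)
    also have "\<dots> \<le> norm (a - b)" using norm_triangle_ineq3[of b a] by (simp add: norm_minus_commute)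
    finally show ?thesis by simp
  qed
  also have "R / s * norm (a - b) \<le> 1 * norm (a - b)" using R st by (intro mult_right_mono) auto
  finally show ?thesis by simp
qed

text \<open>The coefficients of the complex conjugate function.\<close>

definition reflect :: "l2 \<Rightarrow> l2" where
  "reflect a = Abs_l2 (\<lambda>k. cnj (l2_nth a (- k)))"

lemma bij_uminus_lattice: "bij (uminus :: int^3 \<Rightarrow> int^3)"
  by (rule involuntory_imp_bij) simp

lemma l2_nth_reflect [simp]: "l2_nth (reflect a) k = cnj (l2_nth a (- k))"
proof -
  have "(\<integral>\<^sup>+k. ennreal ((cmod (l2_nth a (- k)))\<^sup>2) \<partial>lattice) = (\<integral>\<^sup>+k. ennreal ((cmod (l2_nth a k))\<^sup>2) \<partial>lattice)"
    by (rule nn_integral_bij_count_space[OF bij_uminus_lattice])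
  then have "(\<integral>\<^sup>+k. ennreal ((cmod (l2_nth a (- k)))\<^sup>2) \<partial>lattice) < \<infinity>"
    by (simp add: l2_norm_sq_ennreal[symmetric])
  then have "integrable lattice (\<lambda>k. (cmod (cnj (l2_nth a (- k))))\<^sup>2)"
    by (simp add: integrable_iff_bounded)
  then show ?thesis by (simp add: reflect_def l2_nth_Abs)
qed

lemma norm_reflect [simp]: "norm (reflect a) = norm a"
proof -
  have "(norm (reflect a))\<^sup>2 = (LINT k|lattice. (cmod (l2_nth a (- k)))\<^sup>2)"
    by (simp add: l2_norm_sq)
  also have "\<dots> = (norm a)\<^sup>2"
    unfolding l2_norm_sq by (rule integral_bij_count_space[OF bij_uminus_lattice])
  finally show ?thesis by simp
qed

lemma bounded_linear_reflect: "bounded_linear reflect"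
  by (rule bounded_linear_intro[of _ 1]) (auto intro!: l2_eqI simp: scaleR_conv_of_real)

context drift_symbol
begin

text \<open>
  The kernel is real and odd in \<open>k\<close>. The resulting sign compensates the conjugation of the factor
  \<open>i\<close> in the coefficient equation, so that \<open>reflect\<close> maps solutions to solutions.
\<close>

lemma quad_reflect: "quad (reflect a) (reflect b) = - reflect (quad a b)"
proof (rule l2_eqI)
  fix k
  have "l2_nth (quad (reflect a) (reflect b)) k = (LINT l|lattice. kernel k (- l) * l2_nth (reflect a) (- l) * l2_nth (reflect b) (k - - l))"
    unfolding l2_nth_quad by (rule integral_bij_count_space[OF bij_uminus_lattice, symmetric])
  also have "\<dots> = (LINT l|lattice. - cnj (kernel (- k) l * l2_nth a l * l2_nth b (- k - l)))"
    by (intro Bochner_Integration.integral_cong refl) (simp add: kernel_def freq_minus sgn_minus m_even)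
  also have "\<dots> = - cnj (l2_nth (quad a b) (- k))"
    unfolding l2_nth_quad Bochner_Integration.integral_cnj[symmetric]
    by (rule Bochner_Integration.integral_minus)
  finally show "l2_nth (quad (reflect a) (reflect b)) k = l2_nth (- reflect (quad a b)) k" by simp
qed

text \<open>
  Solve the equation with truncated nonlinearity. By uniqueness its solution is invariant under
  \<open>reflect\<close>, hence symmetric, so the energy identity applies and the norm never exceeds that of
  the data. Therefore the truncation at a larger radius is the identity along the solution.
\<close>

theorem global_coefficients:
  assumes \<epsilon>: "0 < \<epsilon>" and sym: "symmetric_coeffs a0" and z: "l2_nth a0 0 = 0"
  obtains a where "forced \<epsilon> a (\<lambda>t. quad (a t) (a t))" "a 0 = a0"
    "\<And>t. 0 \<le> t \<Longrightarrow> symmetric_coeffs (a t)" "\<And>t. 0 \<le> t \<Longrightarrow> l2_nth (a t) 0 = 0"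
    "\<And>s t. 0 \<le> s \<Longrightarrow> s \<le> t \<Longrightarrow> norm (a t) \<le> norm (a s)"
proof -
  \<comment> \<open>A ball that contains the data; the summand 1 makes the radius positive.\<close>
  define R where "R = norm a0 + 1"
  have R: "0 < R" by (simp add: R_def add_nonneg_pos)
  define V where "V a = quad (ball_proj R a) (ball_proj R a)" for a
  define c where "c a = (R / max R (norm a))\<^sup>2" for a :: l2
  have Vc: "V a = c a *\<^sub>R quad a a" for a
    by (simp add: V_def c_def ball_proj_def quad.scaleR_left quad.scaleR_right power2_eq_square)
  define q where "q = sqrt quad_bound"
  have q: "0 \<le> q" using quad_bound_nonneg by (simp add: q_def)
  have bd: "norm (V a) \<le> R * R * q" for a
  proof -
    have "norm (V a) \<le> norm (ball_proj R a) * norm (ball_proj R a) * q"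
      unfolding V_def q_def by (rule norm_quad_le)
    also have "\<dots> \<le> R * R * q"
      using norm_ball_proj_le[OF R, of a] q R by (intro mult_mono) auto
    finally show ?thesis .
  qed
  have lip: "norm (V a - V b) \<le> (4 * R * q) * norm (a - b)" for a b
  proof -
    let ?a = "ball_proj R a" and ?b = "ball_proj R b"
    have "V a - V b = quad (?a - ?b) ?a + quad ?b (?a - ?b)"
      by (simp add: V_def quad.diff_left quad.diff_right)
    then have "norm (V a - V b) \<le> norm (quad (?a - ?b) ?a) + norm (quad ?b (?a - ?b))"
      by (simp only: norm_triangle_ineq)
    also have "\<dots> \<le> norm (?a - ?b) * norm ?a * q + norm ?b * norm (?a - ?b) * q"
      unfolding q_def by (intro add_mono norm_quad_le)
    also have "\<dots> \<le> (2 * norm (a - b)) * R * q + R * (2 * norm (a - b)) * q"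
      using ball_proj_lipschitz[OF R, of a b] norm_ball_proj_le[OF R] q R
      by (intro add_mono mult_mono) auto
    finally show ?thesis by (simp add: algebra_simps)
  qed
  obtain a where F: "forced \<epsilon> a (\<lambda>t. V (a t))" and a0: "a 0 = a0"
    by (rule forced_fixed_point[OF \<epsilon> _ lip bd, of a0]) (use R q in auto)
  have Fc: "forced \<epsilon> a (\<lambda>t. c (a t) *\<^sub>R quad (a t) (a t))"
    using F by (simp only: Vc)
  have Vr: "V (reflect b) = - reflect (V b)" for b
  proof -
    have "c (reflect b) = c b" by (simp add: c_def)
    then show ?thesis
      unfolding Vc quad_reflect using linear_cmul[OF bounded_linear.linear[OF bounded_linear_reflect]] by simp
  qed
  have "forced \<epsilon> (\<lambda>t. reflect (a t)) (\<lambda>t. V (reflect (a t)))"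
    unfolding forced_def
  proof (intro conjI allI impI)
    show "continuous_on UNIV (\<lambda>t. reflect (a t))"
      using F by (intro bounded_linear.continuous_on[OF bounded_linear_reflect]) (simp add: forced_def)
    have "continuous_on UNIV (\<lambda>t. V (a t))" using F by (simp add: forced_def)
    then show "continuous_on UNIV (\<lambda>t. V (reflect (a t)))"
      unfolding Vr by (intro continuous_intros bounded_linear.continuous_on[OF bounded_linear_reflect])
    fix k and t :: real assume t: "0 \<le> t"
    have "((\<lambda>t. l2_nth (a t) (- k)) has_vector_derivative
        (- (of_real (\<epsilon> * (norm (freq (- k)))\<^sup>2) * l2_nth (a t) (- k)) - \<i> * (of_real (norm (freq (- k))) * l2_nth (V (a t)) (- k))))
        (at t within {0..})"
      using F t unfolding forced_def by blast
    from bounded_linear.has_vector_derivative[OF bounded_linear_cnj this]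
    show "((\<lambda>t. l2_nth (reflect (a t)) k) has_vector_derivative
        (- (of_real (\<epsilon> * (norm (freq k))\<^sup>2) * l2_nth (reflect (a t)) k) - \<i> * (of_real (norm (freq k)) * l2_nth (V (reflect (a t))) k)))
        (at t within {0..})"
      by (simp add: Vr freq_minus)
  qed
  moreover have "a 0 = reflect (a 0)"
    using sym by (intro l2_eqI) (simp add: a0 symmetric_coeffs_def)
  ultimately have refl: "a t = reflect (a t)" if "0 \<le> t" for t
    using forced_unique[OF \<epsilon> lip F _ _ that] by blast
  have sa: "symmetric_coeffs (a t)" if "0 \<le> t" for t
    unfolding symmetric_coeffs_def
  proof
    fix k
    have "l2_nth (a t) (- k) = l2_nth (reflect (a t)) (- k)" using refl[OF that] by simp
    then show "l2_nth (a t) (- k) = cnj (l2_nth (a t) k)" by simp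
  qed
  have mono: "norm (a t) \<le> norm (a s)" if "0 \<le> s" "s \<le> t" for s t
    by (rule norm_antimono[OF Fc \<epsilon> sa that])
  have c1: "V (a t) = quad (a t) (a t)" if "0 \<le> t" for t
  proof -
    have "max R (norm (a t)) = R" using mono[of 0 t] that by (simp add: R_def a0)
    then show ?thesis using R by (simp add: Vc c_def)
  qed
  have "forced \<epsilon> a (\<lambda>t. quad (a t) (a t))"
    unfolding forced_def
  proof (intro conjI allI impI)
    show ca: "continuous_on UNIV a" using F by (simp add: forced_def)
    show "continuous_on UNIV (\<lambda>t. quad (a t) (a t))" by (intro quad.continuous_on ca)
    show "((\<lambda>t. l2_nth (a t) k) has_vector_derivative
        (- (of_real (\<epsilon> * (norm (freq k))\<^sup>2) * l2_nth (a t) k) - \<i> * (of_real (norm (freq k)) * l2_nth (quad (a t) (a t)) k)))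
        (at t within {0..})" if "0 \<le> t" for k t
      using F that unfolding forced_def c1[OF that, symmetric] by blast
  qed
  then show ?thesis
    using a0 sa mono forced_zero_mode[OF F] z by (intro that[of a]) auto
qed

lemma sobolev_sq_coeff: "ennreal (norm (freq k) ^ (2 * n) * (cmod (l2_nth a k))\<^sup>2) \<le> sobolev_sq n a"
proof -
  have "ennreal (norm (freq k) ^ (2 * n) * (cmod (l2_nth a k))\<^sup>2)
    = (\<integral>\<^sup>+j. ennreal (norm (freq j) ^ (2 * n) * (cmod (l2_nth a j))\<^sup>2) * indicator {k} j \<partial>lattice)"
    by (subst nn_integral_indicator_singleton) auto
  also have "\<dots> \<le> sobolev_sq n a"
    unfolding sobolev_sq_def by (intro nn_integral_mono) (auto simp: indicator_def)
  finally show ?thesis .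
qed

text \<open>Smoothing on the unit interval, started at time \<open>t - min t 1\<close>.\<close>

lemma smoothing_global:
  assumes \<epsilon>: "0 < \<epsilon>" and F: "forced \<epsilon> a (\<lambda>t. quad (a t) (a t))"
    and mono: "\<And>s t. 0 \<le> s \<Longrightarrow> s \<le> t \<Longrightarrow> norm (a t) \<le> norm (a s)"
  obtains A where "0 \<le> A"
    "\<And>t. 0 < t \<Longrightarrow> sobolev_sq n (a t) \<le> ennreal (A * (norm (a (t - min t 1)))\<^sup>2 / min t 1 ^ n)"
proof -
  obtain A where A: "A \<ge> 0" and S: "\<And>b t. forced \<epsilon> b (\<lambda>t. quad (b t) (b t)) \<Longrightarrow>
      (\<And>\<tau>. 0 \<le> \<tau> \<Longrightarrow> norm (b \<tau>) \<le> norm (a 0) \<and> norm (b \<tau>) \<le> norm (b 0)) \<Longrightarrow> 0 \<le> t \<Longrightarrow> t \<le> 1 \<Longrightarrow>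
     ennreal (t ^ n) * sobolev_sq n (b t) + ennreal \<epsilon> * (\<integral>\<^sup>+\<tau>. ennreal (\<tau> ^ n) * sobolev_sq (Suc n) (b \<tau>) \<partial>time t)
     \<le> ennreal (A * (norm (b 0))\<^sup>2)"
    using smoothing[OF \<epsilon>, of "norm (a 0)" n] by blast
  show ?thesis
  proof (rule that[OF A])
    fix t :: real assume t: "0 < t"
    define u where "u = min t 1"
    have u: "0 < u" "u \<le> 1" "u \<le> t" using t by (auto simp: u_def)
    define b where "b \<tau> = a (t - u + \<tau>)" for \<tau>
    have "forced \<epsilon> b (\<lambda>t. quad (b t) (b t))"
      unfolding b_def by (rule forced_shift[OF F]) (use u in simp)
    moreover have "norm (b \<tau>) \<le> norm (a 0) \<and> norm (b \<tau>) \<le> norm (b 0)" if "0 \<le> \<tau>" for \<tau>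
      unfolding b_def using that u by (intro conjI mono) auto
    ultimately have "ennreal (u ^ n) * sobolev_sq n (b u) + ennreal \<epsilon> * (\<integral>\<^sup>+\<tau>. ennreal (\<tau> ^ n) * sobolev_sq (Suc n) (b \<tau>) \<partial>time u)
       \<le> ennreal (A * (norm (b 0))\<^sup>2)"
      using u by (intro S) auto
    then have "ennreal (u ^ n) * sobolev_sq n (a t) \<le> ennreal (A * (norm (a (t - u)))\<^sup>2)"
      by (auto simp: b_def intro: order_trans[rotated])
    then have "ennreal (1 / u ^ n) * (ennreal (u ^ n) * sobolev_sq n (a t)) \<le> ennreal (1 / u ^ n) * ennreal (A * (norm (a (t - u)))\<^sup>2)"
      by (rule mult_left_mono) simp
    moreover have "ennreal (1 / u ^ n) * (ennreal (u ^ n) * sobolev_sq n (a t)) = sobolev_sq n (a t)"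
      using u by (simp add: mult.assoc[symmetric] ennreal_mult[symmetric])
    moreover have "ennreal (1 / u ^ n) * ennreal (A * (norm (a (t - u)))\<^sup>2) = ennreal (A * (norm (a (t - u)))\<^sup>2 / u ^ n)"
      using u A by (simp add: ennreal_mult[symmetric])
    ultimately show "sobolev_sq n (a t) \<le> ennreal (A * (norm (a (t - min t 1)))\<^sup>2 / min t 1 ^ n)"
      by (simp add: u_def)
  qed
qed

text \<open>
  A single coefficient is bounded by the Sobolev norm of order 6. The sixth power leaves room for
  \<open>|k|\<^sup>2 |a\<^sub>k|\<close> to be summed against \<open>|k|^(-4)\<close>.
\<close>

lemma coeff_decay:
  assumes \<epsilon>: "0 < \<epsilon>" and F: "forced \<epsilon> a (\<lambda>t. quad (a t) (a t))"
    and mono: "\<And>s t. 0 \<le> s \<Longrightarrow> s \<le> t \<Longrightarrow> norm (a t) \<le> norm (a s)"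
  obtains A where "0 \<le> A"
    "\<And>t k. 0 < t \<Longrightarrow> norm (freq k) ^ 6 * cmod (l2_nth (a t) k) \<le> A * norm (a (t - min t 1)) / min t 1 ^ 3"
proof -
  obtain B where B: "0 \<le> B" and S: "\<And>t. 0 < t \<Longrightarrow> sobolev_sq 6 (a t) \<le> ennreal (B * (norm (a (t - min t 1)))\<^sup>2 / min t 1 ^ 6)"
    by (rule smoothing_global[OF \<epsilon> F mono, of 6]) auto
  show ?thesis
  proof (rule that[of "sqrt B"])
    fix t :: real and k assume t: "0 < t"
    define u where "u = min t 1"
    have u: "0 < u" using t by (simp add: u_def)
    have "ennreal (norm (freq k) ^ (2 * 6) * (cmod (l2_nth (a t) k))\<^sup>2) \<le> ennreal (B * (norm (a (t - u)))\<^sup>2 / u ^ 6)"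
      using order_trans[OF sobolev_sq_coeff S[OF t]] by (simp add: u_def)
    then have "norm (freq k) ^ (2 * 6) * (cmod (l2_nth (a t) k))\<^sup>2 \<le> B * (norm (a (t - u)))\<^sup>2 / u ^ 6"
      using B u by (subst (asm) ennreal_le_iff) auto
    moreover have "norm (freq k) ^ (2 * 6) * (cmod (l2_nth (a t) k))\<^sup>2 = (norm (freq k) ^ 6 * cmod (l2_nth (a t) k))\<^sup>2"
      by (simp add: power_mult_distrib flip: power_mult)
    moreover have "B * (norm (a (t - u)))\<^sup>2 / u ^ 6 = (sqrt B * norm (a (t - u)) / u ^ 3)\<^sup>2"
      using B by (simp add: power_mult_distrib power_divide flip: power_mult)
    ultimately have "(norm (freq k) ^ 6 * cmod (l2_nth (a t) k))\<^sup>2 \<le> (sqrt B * norm (a (t - u)) / u ^ 3)\<^sup>2"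
      by simp
    then have "norm (freq k) ^ 6 * cmod (l2_nth (a t) k) \<le> sqrt B * norm (a (t - u)) / u ^ 3"
      by (rule power2_le_imp_le) (use B u in simp)
    then show "norm (freq k) ^ 6 * cmod (l2_nth (a t) k) \<le> sqrt B * norm (a (t - min t 1)) / min t 1 ^ 3"
      by (simp add: u_def)
  qed (use B in simp)
qed

end

section \<open>Duhamel formula for the coefficients\<close>

text \<open>Variation of constants for each coefficient, in the form of the mild equation.\<close>

lemma forced_duhamel:
  assumes F: "forced \<epsilon> a W" and t: "0 \<le> t"
  shows "l2_nth (a t) k = of_real (heat_symbol (\<epsilon> * t) k) * l2_nth (a 0) k
    - integral {0..t} (\<lambda>\<tau>. of_real (heat_symbol (\<epsilon> * (t - \<tau>)) k) * (\<i> * (of_real (norm (freq k)) * l2_nth (W \<tau>) k)))"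
proof -
  define \<mu> where "\<mu> = \<epsilon> * (norm (freq k))\<^sup>2"
  define x where "x \<tau> = l2_nth (a \<tau>) k" for \<tau>
  define f where "f \<tau> = of_real (norm (freq k)) * l2_nth (W \<tau>) k" for \<tau>
  have der: "((\<lambda>s. exp (\<mu> * s) *\<^sub>R x s) has_vector_derivative (exp (\<mu> * s) *\<^sub>R (- \<i> * f s))) (at s within {0..t})" if "s \<in> {0..t}" for s
  proof -
    have "(x has_vector_derivative (- (of_real \<mu> * x s) - \<i> * f s)) (at s within {0..})"
      using F that unfolding forced_def x_def[abs_def] f_def \<mu>_def by auto
    then have dx: "(x has_vector_derivative (- (of_real \<mu> * x s) - \<i> * f s)) (at s within {0..t})"
      by (rule has_vector_derivative_within_subset) auto
    have "((\<lambda>s. exp (\<mu> * s)) has_field_derivative (\<mu> * exp (\<mu> * s))) (at s within {0..t})"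
      by (auto intro!: derivative_eq_intros)
    from has_vector_derivative_scaleR[OF this dx]
    show ?thesis by (simp add: scaleR_conv_of_real algebra_simps)
  qed
  have "((\<lambda>s. exp (\<mu> * s) *\<^sub>R (- \<i> * f s)) has_integral (exp (\<mu> * t) *\<^sub>R x t - exp (\<mu> * 0) *\<^sub>R x 0)) {0..t}"
    by (rule fundamental_theorem_of_calculus[OF t der])
  then have "((\<lambda>s. of_real (- exp (- \<mu> * t)) * (exp (\<mu> * s) *\<^sub>R (- \<i> * f s))) has_integral
      (of_real (- exp (- \<mu> * t)) * (exp (\<mu> * t) *\<^sub>R x t - exp (\<mu> * 0) *\<^sub>R x 0))) {0..t}"
    by (rule has_integral_mult_right)
  moreover have "of_real (- exp (- \<mu> * t)) * (exp (\<mu> * s) *\<^sub>R (- \<i> * f s)) = of_real (heat_symbol (\<epsilon> * (t - s)) k) * (\<i> * f s)" for s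
  proof -
    have "exp (- \<mu> * t) * exp (\<mu> * s) = heat_symbol (\<epsilon> * (t - s)) k"
      by (simp add: heat_symbol_def \<mu>_def exp_add[symmetric] algebra_simps)
    then have "complex_of_real (exp (- \<mu> * t)) * complex_of_real (exp (\<mu> * s)) = of_real (heat_symbol (\<epsilon> * (t - s)) k)"
      by (simp only: of_real_mult[symmetric])
    then show ?thesis by (simp add: scaleR_conv_of_real mult.assoc[symmetric])
  qed
  moreover have "of_real (- exp (- \<mu> * t)) * (exp (\<mu> * t) *\<^sub>R x t - exp (\<mu> * 0) *\<^sub>R x 0) = of_real (heat_symbol (\<epsilon> * t) k) * x 0 - x t"
  proof -
    have "exp (- \<mu> * t) * exp (\<mu> * t) = 1" by (simp add: exp_add[symmetric])
    then have "complex_of_real (exp (- \<mu> * t)) * complex_of_real (exp (\<mu> * t)) = 1"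
      by (simp only: of_real_mult[symmetric] of_real_1)
    moreover have "exp (- \<mu> * t) = heat_symbol (\<epsilon> * t) k"
      by (simp add: heat_symbol_def \<mu>_def mult_ac)
    ultimately show ?thesis
      by (simp add: scaleR_conv_of_real right_diff_distrib mult.assoc[symmetric])
  qed
  ultimately have "((\<lambda>s. of_real (heat_symbol (\<epsilon> * (t - s)) k) * (\<i> * f s)) has_integral (of_real (heat_symbol (\<epsilon> * t) k) * x 0 - x t)) {0..t}"
    by simp
  from integral_unique[OF this] show ?thesis by (simp add: x_def f_def)
qed

section \<open>The Duhamel part near the initial time\<close>

lemma sobolev_sq_diff_le: "sobolev_sq n (a - b) \<le> 2 * sobolev_sq n a + 2 * sobolev_sq n b"
proof -
  let ?w = "\<lambda>k. norm (freq k) ^ (2 * n)"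
  have "sobolev_sq n (a - b) \<le> (\<integral>\<^sup>+k. 2 * ennreal (?w k * (cmod (l2_nth a k))\<^sup>2) + 2 * ennreal (?w k * (cmod (l2_nth b k))\<^sup>2) \<partial>lattice)"
    unfolding sobolev_sq_def
  proof (intro nn_integral_mono)
    fix k
    have "(cmod (l2_nth (a - b) k))\<^sup>2 \<le> 2 * (cmod (l2_nth a k))\<^sup>2 + 2 * (cmod (l2_nth b k))\<^sup>2"
      using norm_add_sq_le[of "l2_nth a k" "- l2_nth b k"] by simp
    then have "?w k * (cmod (l2_nth (a - b) k))\<^sup>2 \<le> ?w k * (2 * (cmod (l2_nth a k))\<^sup>2 + 2 * (cmod (l2_nth b k))\<^sup>2)"
      by (rule mult_left_mono) simp
    also have "\<dots> = 2 * (?w k * (cmod (l2_nth a k))\<^sup>2) + 2 * (?w k * (cmod (l2_nth b k))\<^sup>2)"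
      by (simp add: algebra_simps)
    finally have "ennreal (?w k * (cmod (l2_nth (a - b) k))\<^sup>2) \<le> ennreal (2 * (?w k * (cmod (l2_nth a k))\<^sup>2) + 2 * (?w k * (cmod (l2_nth b k))\<^sup>2))"
      by (rule ennreal_leI)
    also have "\<dots> = 2 * ennreal (?w k * (cmod (l2_nth a k))\<^sup>2) + 2 * ennreal (?w k * (cmod (l2_nth b k))\<^sup>2)"
      by (subst ennreal_plus) (auto simp: ennreal_mult)
    finally show "ennreal (?w k * (cmod (l2_nth (a - b) k))\<^sup>2) \<le> \<dots>" .
  qed
  also have "\<dots> = 2 * sobolev_sq n a + 2 * sobolev_sq n b"
    by (subst nn_integral_add) (simp_all add: nn_integral_cmult sobolev_sq_def)
  finally show ?thesis .
qed

lemma heat_symbol_pow4: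
  assumes "0 < s"
  shows "norm (freq k) ^ 8 * (heat_symbol s k)\<^sup>2 \<le> 16 / s ^ 4"
proof -
  define y where "y = 2 * s * (norm (freq k))\<^sup>2"
  have y: "0 \<le> y" using assms by (simp add: y_def)
  have "(y / 4) ^ 4 \<le> exp (y / 4) ^ 4"
    using exp_ge_add_one_self[of "y / 4"] y by (intro power_mono) linarith+
  also have "\<dots> = exp y" using exp_of_nat_mult[of 4 "y / 4"] by simp
  finally have "y ^ 4 \<le> 256 * exp y" by (simp add: power_divide)
  then have "y ^ 4 * exp (- y) \<le> 256" by (simp add: exp_minus field_simps)
  moreover have "(heat_symbol s k)\<^sup>2 = exp (- y)"
    by (simp add: heat_symbol_def y_def power2_eq_square exp_add[symmetric])
  moreover have "y ^ 4 = 16 * s ^ 4 * norm (freq k) ^ 8"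
    by (simp add: y_def power_mult_distrib flip: power_mult)
  ultimately have "16 * s ^ 4 * (norm (freq k) ^ 8 * (heat_symbol s k)\<^sup>2) \<le> 256" by (simp add: mult.assoc)
  then show ?thesis using assms by (simp add: field_simps)
qed


text \<open>
  An additive Cauchy-Schwarz inequality: integrated with a suitable \<open>u\<close> it bounds an \<open>L\<^sup>1\<close> norm in
  terms of an \<open>L\<^sup>2\<close> norm.
\<close>

lemma weighted_am_gm: "0 < u \<Longrightarrow> r \<le> 1 / u + u * r\<^sup>2" for r u :: real
proof (cases "r * u \<le> 1")
  case True
  assume "0 < u"
  then have "r \<le> 1 / u" using True by (simp add: le_divide_eq)
  moreover have "0 \<le> u * r\<^sup>2" using \<open>0 < u\<close> by simp
  ultimately show ?thesis by linarith
next
  case False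
  assume u: "0 < u"
  then have "0 < r" using False by (metis mult_nonpos_nonneg less_imp_le not_le zero_le_one order_trans)
  then have "r * 1 \<le> r * (r * u)" using False by (intro mult_left_mono) auto
  then have "r \<le> u * r\<^sup>2" by (simp add: power2_eq_square mult_ac)
  moreover have "0 \<le> 1 / u" using u by simp
  ultimately show ?thesis by linarith
qed

context drift_symbol
begin

text \<open>
  Let \<open>D\<close> be the difference of the solution and the heat evolution of its data. The energy
  inequality with zero data gives \<open>|D|\<^sup>2 \<le> C t\<close>, and smoothing of both parts gives \<open>C t^(-4)\<close> for
  the square of the norm of order 4. The sum of \<open>|D\<^sub>k|\<close> interpolates between the two: it is
  controlled by the norm of order 2, whose square is at most the product
  \<open>(C t)^(1/2) (C t^(-4))^(1/2)\<close>, and so it is of order \<open>t^(-3/4)\<close>. The product of the two sums in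
  the conclusion bounds the integral of the third power of the Duhamel part.
\<close>

lemma duhamel_near_zero:
  assumes \<epsilon>: "0 < \<epsilon>" and F: "forced \<epsilon> a (\<lambda>t. quad (a t) (a t))"
    and mono: "\<And>s t. 0 \<le> s \<Longrightarrow> s \<le> t \<Longrightarrow> norm (a t) \<le> norm (a s)"
    and z: "\<And>t. 0 \<le> t \<Longrightarrow> l2_nth (a t) 0 = 0"
  defines "d \<equiv> \<lambda>t k. l2_nth (a t) k - of_real (heat_symbol (\<epsilon> * t) k) * l2_nth (a 0) k"
  obtains C0 where "0 \<le> C0" "\<And>t. 0 < t \<Longrightarrow> t \<le> 1 \<Longrightarrow> integrable lattice (d t)"
    "\<And>t. 0 < t \<Longrightarrow> t \<le> 1 \<Longrightarrow> (LINT k|lattice. cmod (d t k)) * (LINT k|lattice. (cmod (d t k))\<^sup>2) \<le> C0 * t powr (1 / 4)"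
proof -
  have c0: "continuous_on UNIV (\<lambda>t::real. 0 :: l2)" by simp
  obtain h where h: "forced \<epsilon> h (\<lambda>t. 0)" "h 0 = a 0"
    by (rule forced_solve[OF \<epsilon> c0, of "a 0"])
  have hk: "l2_nth (h t) k = of_real (heat_symbol (\<epsilon> * t) k) * l2_nth (a 0) k" if "0 \<le> t" for t k
    using forced_duhamel[OF h(1) that, of k] h(2) by simp
  obtain B where B: "0 \<le> B" and S: "\<And>t. 0 < t \<Longrightarrow> sobolev_sq 4 (a t) \<le> ennreal (B * (norm (a (t - min t 1)))\<^sup>2 / min t 1 ^ 4)"
    by (rule smoothing_global[OF \<epsilon> F mono, of 4]) auto
  define N where "N = (norm (a 0))\<^sup>2"
  have N: "0 \<le> N" by (simp add: N_def)
  define C1 where "C1 = (1 / \<epsilon>) * (quad_bound * N * N)"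
  define C2 where "C2 = 2 * (B * N) + 2 * (16 / \<epsilon> ^ 4 * N)"
  have C12: "0 \<le> C1" "0 \<le> C2" using \<epsilon> quad_bound_nonneg N B by (auto simp: C1_def C2_def)
  have main: "integrable lattice (d t) \<and> (LINT k|lattice. cmod (d t k)) * (LINT k|lattice. (cmod (d t k))\<^sup>2) \<le> (weight_sum + C1 + C2) * C1 * t powr (1 / 4)"
    if t: "0 < t" "t \<le> 1" for t
  proof -
    define D where "D = a t - h t"
    have dD: "d t k = l2_nth D k" for k using t by (simp add: d_def D_def hk)
    have D2: "(norm D)\<^sup>2 \<le> C1 * t"
    proof -
      have "ennreal ((norm D)\<^sup>2) \<le> ennreal (1 / \<epsilon>) * (\<integral>\<^sup>+\<tau>. ennreal ((norm (quad (a \<tau>) (a \<tau>)))\<^sup>2) \<partial>time t)"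
        using forced_norm_le[OF forced_diff[OF F h(1)] \<epsilon>, of t] t h(2) by (simp add: D_def)
      also have "(\<integral>\<^sup>+\<tau>. ennreal ((norm (quad (a \<tau>) (a \<tau>)))\<^sup>2) \<partial>time t) \<le> ennreal (quad_bound * N * N) * ennreal t"
      proof (rule time_nn_integral_le_const)
        fix \<tau> :: real assume "0 \<le> \<tau>"
        have "(norm (quad (a \<tau>) (a \<tau>)))\<^sup>2 \<le> quad_bound * (norm (a \<tau>))\<^sup>2 * (norm (a \<tau>))\<^sup>2" by (rule norm_quad_sq_le)
        also have "\<dots> \<le> quad_bound * N * N"
          unfolding N_def using mono[of 0 \<tau>] \<open>0 \<le> \<tau>\<close> quad_bound_nonneg by (intro mult_mono power_mono) auto
        finally show "ennreal ((norm (quad (a \<tau>) (a \<tau>)))\<^sup>2) \<le> ennreal (quad_bound * N * N)" by (rule ennreal_leI)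
      qed (use t in simp)
      finally have "ennreal ((norm D)\<^sup>2) \<le> ennreal (1 / \<epsilon>) * (ennreal (quad_bound * N * N) * ennreal t)"
        by (simp add: mult_left_mono)
      also have "\<dots> = ennreal (C1 * t)"
        unfolding C1_def using \<epsilon> quad_bound_nonneg N t by (simp add: ennreal_mult[symmetric])
      finally show ?thesis using C12 t by (subst (asm) ennreal_le_iff) auto
    qed
    have sa: "sobolev_sq 4 (a t) \<le> ennreal (B * N / t ^ 4)"
      using S[OF t(1)] t by (simp add: N_def min_def)
    have sh: "sobolev_sq 4 (h t) \<le> ennreal (16 / \<epsilon> ^ 4 * N / t ^ 4)"
    proof -
      have "sobolev_sq 4 (h t) \<le> (\<integral>\<^sup>+k. ennreal (16 / (\<epsilon> * t) ^ 4) * ennreal ((cmod (l2_nth (a 0) k))\<^sup>2) \<partial>lattice)"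
        unfolding sobolev_sq_def
      proof (intro nn_integral_mono)
        fix k
        have "norm (freq k) ^ (2 * 4) * (cmod (l2_nth (h t) k))\<^sup>2 = norm (freq k) ^ 8 * (heat_symbol (\<epsilon> * t) k)\<^sup>2 * (cmod (l2_nth (a 0) k))\<^sup>2"
          using t by (simp add: hk norm_mult power_mult_distrib)
        also have "\<dots> \<le> 16 / (\<epsilon> * t) ^ 4 * (cmod (l2_nth (a 0) k))\<^sup>2"
          using \<epsilon> t by (intro mult_right_mono heat_symbol_pow4) auto
        finally show "ennreal (norm (freq k) ^ (2 * 4) * (cmod (l2_nth (h t) k))\<^sup>2) \<le> ennreal (16 / (\<epsilon> * t) ^ 4) * ennreal ((cmod (l2_nth (a 0) k))\<^sup>2)"
          using \<epsilon> t by (simp add: ennreal_mult[symmetric] ennreal_leI)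
      qed
      also have "\<dots> = ennreal (16 / (\<epsilon> * t) ^ 4) * ennreal N"
        by (simp add: nn_integral_cmult N_def l2_norm_sq_ennreal)
      also have "\<dots> = ennreal (16 / \<epsilon> ^ 4 * N / t ^ 4)"
        using \<epsilon> t N by (simp add: ennreal_mult[symmetric] power_mult_distrib)
      finally show ?thesis .
    qed
    have sD: "sobolev_sq 4 D \<le> ennreal (C2 / t ^ 4)"
    proof -
      have "sobolev_sq 4 D \<le> 2 * sobolev_sq 4 (a t) + 2 * sobolev_sq 4 (h t)"
        unfolding D_def by (rule sobolev_sq_diff_le)
      also have "\<dots> \<le> 2 * ennreal (B * N / t ^ 4) + 2 * ennreal (16 / \<epsilon> ^ 4 * N / t ^ 4)"
        by (intro add_mono mult_left_mono sa sh) auto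
      also have "\<dots> = ennreal (2 * (B * N / t ^ 4) + 2 * (16 / \<epsilon> ^ 4 * N / t ^ 4))"
      proof -
        have "2 * ennreal x + 2 * ennreal y = ennreal (2 * x + 2 * y)" if "0 \<le> x" "0 \<le> y" for x y
          using that by (simp add: ennreal_mult)
        then show ?thesis using \<epsilon> B N t by simp
      qed
      also have "2 * (B * N / t ^ 4) + 2 * (16 / \<epsilon> ^ 4 * N / t ^ 4) = C2 / t ^ 4"
        by (simp add: C2_def add_divide_distrib)
      finally show ?thesis .
    qed
    define g where "g k = norm (freq k) ^ 8 * (cmod (l2_nth D k))\<^sup>2" for k
    have gs: "(\<integral>\<^sup>+k. ennreal (g k) \<partial>lattice) \<le> ennreal (C2 / t ^ 4)"
      using sD by (simp add: sobolev_sq_def g_def)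
    have gi: "integrable lattice g"
      by (rule integrableI_bounded) (use gs in \<open>auto simp: g_def intro: le_less_trans\<close>)
    have gint: "(LINT k|lattice. g k) \<le> C2 / t ^ 4"
    proof -
      have "ennreal (LINT k|lattice. g k) \<le> ennreal (C2 / t ^ 4)"
        using gs by (subst nn_integral_eq_integral[symmetric, OF gi]) (auto simp: g_def)
      then show ?thesis using C12 t by (subst (asm) ennreal_le_iff) auto
    qed
    \<comment> \<open>All exponents of \<open>t\<close> are multiples of \<open>1/4\<close>, so they become integral powers of \<open>q\<close>.\<close>
    define q where "q = t powr (1 / 4)"
    have q: "0 < q" using t by (simp add: q_def)
    have q4: "q ^ 4 = t" using t by (simp add: q_def powr_power)
    \<comment> \<open>A majorant of \<open>|D\<^sub>k|\<close> each of whose three parts has a sum of order \<open>q^(-3) = t^(-3/4)\<close>: the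
      powers of \<open>q\<close> balance the bounds \<open>q\<^sup>4\<close> and \<open>q^(-16)\<close> of the two square norms.\<close>
    define G where "G k = 1 / q ^ 3 * (1 / norm (freq k) ^ 4) + 1 / q ^ 7 * (cmod (l2_nth D k))\<^sup>2 + q ^ 13 * g k" for k
    have le: "cmod (d t k) \<le> G k" for k
    proof (cases "k = 0")
      case True
      then have "d t k = 0" using z[of t] z[of 0] t by (simp add: d_def)
      then show ?thesis using q by (simp add: G_def g_def)
    next
      case False
      define r where "r = norm (freq k) ^ 4"
      define x where "x = cmod (l2_nth D k)"
      have r: "0 < r" using False by (simp add: r_def)
      \<comment> \<open>The additive Cauchy-Schwarz inequality twice: first to split off the summable weight \<open>1/r\<close>,
        then to split \<open>r\<close> into \<open>1\<close> and \<open>r\<^sup>2\<close>.\<close>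
      have "x \<le> 1 / (q ^ 3 * r) + (q ^ 3 * r) * x\<^sup>2"
        by (rule weighted_am_gm) (use q r in simp)
      also have "(q ^ 3 * r) * x\<^sup>2 \<le> (q ^ 3 * (1 / q ^ 10 + q ^ 10 * r\<^sup>2)) * x\<^sup>2"
        using weighted_am_gm[of "q ^ 10" r] q by (intro mult_right_mono mult_left_mono) auto
      also have "(q ^ 3 * (1 / q ^ 10 + q ^ 10 * r\<^sup>2)) * x\<^sup>2 = 1 / q ^ 7 * x\<^sup>2 + q ^ 13 * (r\<^sup>2 * x\<^sup>2)"
      proof -
        have "q ^ 3 * (1 / q ^ 10) = 1 / q ^ 7"
          using q power_add[of q 3 7] by (simp add: field_simps)
        moreover have "q ^ 3 * q ^ 10 = q ^ 13" by (simp flip: power_add)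
        ultimately show ?thesis by (simp only: distrib_left distrib_right mult.assoc[symmetric])
      qed
      also have "r\<^sup>2 = norm (freq k) ^ 8" by (simp add: r_def flip: power_mult)
      finally show ?thesis by (simp add: dD G_def g_def x_def r_def add.assoc)
    qed
    have iD2: "integrable lattice (\<lambda>k. (cmod (l2_nth D k))\<^sup>2)" by (rule l2_nth_integrable)
    have iG: "integrable lattice G"
      unfolding G_def by (intro Bochner_Integration.integrable_add Bochner_Integration.integrable_mult_right integrable_lattice_weight iD2 gi)
    have id: "integrable lattice (d t)"
      by (rule Bochner_Integration.integrable_bound[OF iG]) (auto intro!: AE_I2 order_trans[OF le])
    have "(LINT k|lattice. cmod (d t k)) \<le> (LINT k|lattice. G k)"
      by (intro integral_mono integrable_norm id iG le)
    also have "\<dots> = 1 / q ^ 3 * weight_sum + 1 / q ^ 7 * (norm D)\<^sup>2 + q ^ 13 * (LINT k|lattice. g k)"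
    proof -
      have "(LINT k|lattice. c1 * f1 k + c2 * f2 k + c3 * f3 k) = c1 * integral\<^sup>L lattice f1 + c2 * integral\<^sup>L lattice f2 + c3 * integral\<^sup>L lattice f3"
        if "integrable lattice f1" "integrable lattice f2" "integrable lattice f3" for f1 f2 f3 :: "int^3 \<Rightarrow> real" and c1 c2 c3
        using that by simp
      from this[OF integrable_lattice_weight iD2 gi, of "1 / q ^ 3" "1 / q ^ 7" "q ^ 13"]
      show ?thesis unfolding G_def weight_sum_def l2_norm_sq .
    qed
    also have "\<dots> \<le> 1 / q ^ 3 * weight_sum + 1 / q ^ 7 * (C1 * q ^ 4) + q ^ 13 * (C2 / q ^ 16)"
    proof -
      have "t ^ 4 = q ^ 16" by (simp add: q4[symmetric] flip: power_mult)
      then show ?thesis using D2 gint q by (intro add_mono mult_left_mono) (auto simp: q4)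
    qed
    also have "\<dots> = (weight_sum + C1 + C2) / q ^ 3"
    proof -
      have "1 / q ^ 7 * q ^ 4 = 1 / q ^ 3" "q ^ 13 / q ^ 16 = 1 / q ^ 3"
        using q power_add[of q 3 4] power_add[of q 13 3] by (simp_all add: field_simps)
      then show ?thesis by (simp add: add_divide_distrib) (simp add: divide_inverse mult_ac)
    qed
    finally have L1: "(LINT k|lattice. cmod (d t k)) \<le> (weight_sum + C1 + C2) / q ^ 3" .
    have L2: "(LINT k|lattice. (cmod (d t k))\<^sup>2) \<le> C1 * q ^ 4"
      using D2 by (simp add: dD l2_norm_sq q4)
    have "(LINT k|lattice. cmod (d t k)) * (LINT k|lattice. (cmod (d t k))\<^sup>2) \<le> ((weight_sum + C1 + C2) / q ^ 3) * (C1 * q ^ 4)"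
      using L1 L2 C12 q weight_sum_nonneg by (intro mult_mono) auto
    also have "\<dots> = (weight_sum + C1 + C2) * C1 * q"
      using q power_add[of q 3 1] by (simp add: field_simps)
    finally show ?thesis using id by (simp add: q_def)
  qed
  show ?thesis
    by (rule that[of "(weight_sum + C1 + C2) * C1"]) (use main C12 weight_sum_nonneg in auto)
qed

end

section \<open>The velocity operator\<close>

definition drift :: "real \<Rightarrow> real \<Rightarrow> int^3 \<Rightarrow> real^3" where
  "drift N \<epsilon>\<^sub>\<nu> k = M_symbol N \<epsilon>\<^sub>\<nu> (freq k)"

text \<open>
  The numerators of the symbol are of order 6 and the denominator is at least \<open>\<epsilon>\<^sup>2 |k|\<^sup>8\<close>.
\<close>

lemma drift_component_bound:
  fixes n d r :: real
  assumes "\<bar>n\<bar> \<le> K * r ^ 6" "e\<^sup>2 * r ^ 8 \<le> d" "0 < e" "0 < r" "0 \<le> K"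
  shows "\<bar>n / d\<bar> \<le> (K / e\<^sup>2) / r\<^sup>2"
proof -
  have p: "0 < e\<^sup>2 * r ^ 8" using assms by simp
  have "\<bar>n / d\<bar> \<le> (K * r ^ 6) / (e\<^sup>2 * r ^ 8)"
    unfolding abs_divide using assms p by (intro frac_le) auto
  also have "\<dots> = (K / e\<^sup>2) / r\<^sup>2"
    using assms power_add[of r 6 2] by (simp add: field_simps)
  finally show ?thesis .
qed

text \<open>
  The term \<open>(\<epsilon>\<^sub>\<nu> |k|\<^sup>4)\<^sup>2\<close> of the denominator dominates. It gives the decay \<open>|k|^(-2)\<close>, with a
  factor 3 for the number of components; the other properties are read off from the formulas.
\<close>

lemma drift_symbol_drift:
  assumes N: "0 < N" and e: "0 < \<epsilon>\<^sub>\<nu>"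
  shows "drift_symbol (drift N \<epsilon>\<^sub>\<nu>) (3 * ((N ^ 4 + N\<^sup>2 * (1 + \<epsilon>\<^sub>\<nu>)) / \<epsilon>\<^sub>\<nu>\<^sup>2))"
proof
  define K where "K = N ^ 4 + N\<^sup>2 * (1 + \<epsilon>\<^sub>\<nu>)"
  have K: "0 \<le> K" using N e by (simp add: K_def)
  show "0 \<le> 3 * ((N ^ 4 + N\<^sup>2 * (1 + \<epsilon>\<^sub>\<nu>)) / \<epsilon>\<^sub>\<nu>\<^sup>2)" using K by (simp add: K_def[symmetric])
  fix l :: "int^3"
  define x where "x = freq l"
  define r where "r = norm x"
  define S where "S = (x$2)\<^sup>2 + \<epsilon>\<^sub>\<nu> * r ^ 4"
  define d where "d = D_symbol N \<epsilon>\<^sub>\<nu> x"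
  have d_eq: "d = N ^ 4 * r\<^sup>2 * (x$3)\<^sup>2 + S\<^sup>2"
    by (simp add: d_def D_symbol_def S_def r_def add.commute)
  have comp: "\<bar>x $ i\<bar> \<le> r" for i unfolding r_def by (rule component_le_norm_cart)
  have S0: "0 \<le> S" using e by (simp add: S_def)
  have drift_eq: "drift N \<epsilon>\<^sub>\<nu> l = (if x$3 = 0 then 0 else vector
     [(N^4 * x$2 * x$3 * r\<^sup>2 - N\<^sup>2 * x$1 * x$3 * S) / d,
      (- (N^4) * x$1 * x$3 * r\<^sup>2 - N\<^sup>2 * x$2 * x$3 * S) / d,
      (N\<^sup>2 * ((x$1)\<^sup>2 + (x$2)\<^sup>2) * S) / d])"
    by (simp add: drift_def M_symbol_def x_def[symmetric] r_def[symmetric] S_def[symmetric] d_def[symmetric])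
  show "norm (drift N \<epsilon>\<^sub>\<nu> l) \<le> 3 * ((N ^ 4 + N\<^sup>2 * (1 + \<epsilon>\<^sub>\<nu>)) / \<epsilon>\<^sub>\<nu>\<^sup>2) / (norm (freq l))\<^sup>2"
  proof (cases "x$3 = 0")
    case True
    then show ?thesis using K by (simp add: drift_eq K_def[symmetric])
  next
    case False
    then have "l \<noteq> 0" by (auto simp: x_def)
    then have r1: "1 \<le> r" unfolding r_def x_def by (rule norm_freq_ge_1)
    have x2r: "(x $ i)\<^sup>2 \<le> r\<^sup>2" for i using power_mono[OF comp[of i], of 2] by simp
    have Sr: "S \<le> (1 + \<epsilon>\<^sub>\<nu>) * r ^ 4"
    proof -
      have "(x$2)\<^sup>2 \<le> r ^ 4" using x2r[of 2] power_increasing[of 2 4 r] r1 by simp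
      then show ?thesis by (simp add: S_def algebra_simps)
    qed
    have dS: "\<epsilon>\<^sub>\<nu>\<^sup>2 * r ^ 8 \<le> d"
    proof -
      have "(\<epsilon>\<^sub>\<nu> * r ^ 4)\<^sup>2 \<le> S\<^sup>2" using e r1 by (intro power_mono) (auto simp: S_def)
      moreover have "0 \<le> N ^ 4 * r\<^sup>2 * (x$3)\<^sup>2" using N by simp
      moreover have "(\<epsilon>\<^sub>\<nu> * r ^ 4)\<^sup>2 = \<epsilon>\<^sub>\<nu>\<^sup>2 * r ^ 8" by (simp add: power_mult_distrib flip: power_mult)
      ultimately show ?thesis unfolding d_eq by linarith
    qed
    have xx: "\<bar>x $ i * x $ j\<bar> \<le> r\<^sup>2" for i j
      unfolding abs_mult power2_eq_square using comp[of i] comp[of j] r1 by (intro mult_mono) auto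
    have A: "\<bar>N ^ 4 * (x $ i * x $ j) * r\<^sup>2\<bar> \<le> N ^ 4 * r ^ 6" for i j
    proof -
      have "\<bar>N ^ 4 * (x $ i * x $ j) * r\<^sup>2\<bar> = N ^ 4 * \<bar>x $ i * x $ j\<bar> * r\<^sup>2" using N by (simp add: abs_mult)
      also have "\<dots> \<le> N ^ 4 * r\<^sup>2 * r\<^sup>2" using xx[of i j] N by (intro mult_right_mono mult_left_mono) auto
      also have "\<dots> = N ^ 4 * r ^ 4" by (simp add: mult.assoc flip: power_add)
      also have "\<dots> \<le> N ^ 4 * r ^ 6" using r1 N by (intro mult_left_mono power_increasing) auto
      finally show ?thesis .
    qed
    have Bb: "\<bar>N\<^sup>2 * y * S\<bar> \<le> c * (N\<^sup>2 * (1 + \<epsilon>\<^sub>\<nu>) * r ^ 6)" if "\<bar>y\<bar> \<le> c * r\<^sup>2" "0 \<le> c" for y c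
    proof -
      have "\<bar>N\<^sup>2 * y * S\<bar> = N\<^sup>2 * (\<bar>y\<bar> * S)" using S0 by (simp add: abs_mult)
      also have "\<dots> \<le> N\<^sup>2 * ((c * r\<^sup>2) * ((1 + \<epsilon>\<^sub>\<nu>) * r ^ 4))"
        using that Sr S0 by (intro mult_left_mono mult_mono) auto
      also have "\<dots> = c * (N\<^sup>2 * (1 + \<epsilon>\<^sub>\<nu>) * (r\<^sup>2 * r ^ 4))" by (simp add: mult_ac)
      also have "r\<^sup>2 * r ^ 4 = r ^ 6" by (simp flip: power_add)
      finally show ?thesis .
    qed
    have B: "\<bar>N\<^sup>2 * (x $ i * x $ j) * S\<bar> \<le> N\<^sup>2 * (1 + \<epsilon>\<^sub>\<nu>) * r ^ 6" for i j
      using Bb[of "x $ i * x $ j" 1] xx[of i j] by simp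
    have Kr: "K * r ^ 6 = N ^ 4 * r ^ 6 + N\<^sup>2 * (1 + \<epsilon>\<^sub>\<nu>) * r ^ 6" by (simp add: K_def algebra_simps)
    have c1: "\<bar>N^4 * x$2 * x$3 * r\<^sup>2 - N\<^sup>2 * x$1 * x$3 * S\<bar> \<le> K * r ^ 6"
      using A[of 2 3] B[of 1 3] unfolding Kr mult.assoc by linarith
    have c2: "\<bar>- (N^4) * x$1 * x$3 * r\<^sup>2 - N\<^sup>2 * x$2 * x$3 * S\<bar> \<le> K * r ^ 6"
      using A[of 1 3] B[of 2 3] unfolding Kr mult.assoc by (simp add: abs_le_iff)
    have c3: "\<bar>N\<^sup>2 * ((x$1)\<^sup>2 + (x$2)\<^sup>2) * S\<bar> \<le> K * r ^ 6"
    proof -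
      have "(x$1)\<^sup>2 + (x$2)\<^sup>2 \<le> (\<Sum>i\<in>UNIV. (x$i)\<^sup>2)" by (simp add: sum_3)
      also have "\<dots> = r\<^sup>2" by (simp add: r_def norm_vec_def L2_set_def sum_nonneg)
      finally have "\<bar>N\<^sup>2 * ((x$1)\<^sup>2 + (x$2)\<^sup>2) * S\<bar> \<le> 1 * (N\<^sup>2 * (1 + \<epsilon>\<^sub>\<nu>) * r ^ 6)"
        by (intro Bb) auto
      moreover have "0 \<le> N ^ 4 * r ^ 6" using N r1 by simp
      ultimately show ?thesis unfolding Kr by linarith
    qed
    have r0: "0 < r" using r1 by simp
    have "norm (drift N \<epsilon>\<^sub>\<nu> l) \<le> (\<Sum>i\<in>UNIV. \<bar>drift N \<epsilon>\<^sub>\<nu> l $ i\<bar>)" by (rule norm_le_l1_cart)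
    also have "\<dots> \<le> (K / \<epsilon>\<^sub>\<nu>\<^sup>2) / r\<^sup>2 + (K / \<epsilon>\<^sub>\<nu>\<^sup>2) / r\<^sup>2 + (K / \<epsilon>\<^sub>\<nu>\<^sup>2) / r\<^sup>2"
      unfolding drift_eq sum_3 if_not_P[OF False] vector_3
      by (intro add_mono drift_component_bound[OF _ dS e r0 K] c1 c2 c3)
    also have "\<dots> = 3 * (K / \<epsilon>\<^sub>\<nu>\<^sup>2) / r\<^sup>2" by simp
    finally show ?thesis by (simp add: K_def r_def x_def)
  qed
  show "freq l \<bullet> drift N \<epsilon>\<^sub>\<nu> l = 0"
  proof (cases "x$3 = 0")
    case False
    have "x \<bullet> drift N \<epsilon>\<^sub>\<nu> l = (x$1 * (N^4 * x$2 * x$3 * r\<^sup>2 - N\<^sup>2 * x$1 * x$3 * S)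
       + x$2 * (- (N^4) * x$1 * x$3 * r\<^sup>2 - N\<^sup>2 * x$2 * x$3 * S) + x$3 * (N\<^sup>2 * ((x$1)\<^sup>2 + (x$2)\<^sup>2) * S)) / d"
      unfolding drift_eq if_not_P[OF False] inner_vec_def sum_3 vector_3 by (simp add: add_divide_distrib)
    also have "\<dots> = 0" by (simp add: algebra_simps power2_eq_square)
    finally show ?thesis by (simp add: x_def)
  qed (simp add: drift_eq)
  show "drift N \<epsilon>\<^sub>\<nu> (- l) = drift N \<epsilon>\<^sub>\<nu> l"
    by (simp add: drift_def M_symbol_def D_symbol_def freq_minus)
qed

lemma is_multiplier_unique:
  assumes "is_multiplier m f g" "is_multiplier m f h"
  shows "AE x in torus. g x = h x"
proof -
  have "AE x in torus. complex_of_real (g x) = complex_of_real (h x)"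
    by (rule AE_eq_if_coef_eq) (use assms in \<open>auto simp: is_multiplier_def fourier_coeff_eq_coef\<close>)
  then show ?thesis by simp
qed

text \<open>
  The function selected by the definition of \<open>multiplier\<close> has prescribed coefficients and is
  therefore known up to a null set as soon as one candidate is.
\<close>

lemma multiplier_AE_eq:
  assumes "is_multiplier m f g"
  shows "is_multiplier m f (multiplier m f)" "AE x in torus. multiplier m f x = g x"
proof -
  show *: "is_multiplier m f (multiplier m f)"
    unfolding multiplier_def by (rule someI[of _ g]) (rule assms)
  show "AE x in torus. multiplier m f x = g x" by (rule is_multiplier_unique[OF * assms])
qed

text \<open>
  For symmetric coefficients the series is real, and passing to the real part only changes the
  type.
\<close>

definition real_series :: "(int^3 \<Rightarrow> complex) \<Rightarrow> real^3 \<Rightarrow> real" where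
  "real_series c x = Re (fseries c x)"

lemma of_real_real_series:
  assumes "\<And>k. c (- k) = cnj (c k)"
  shows "complex_of_real (real_series c x) = fseries c x"
proof -
  have "Im (fseries c x) = 0"
    using arg_cong[OF fseries_cnj[of c x, OF assms], of Im] by simp
  then show ?thesis by (simp add: real_series_def complex_eq_iff)
qed

lemma real_series_integrable: "integrable lattice c \<Longrightarrow> integrable torus (real_series c)"
  unfolding real_series_def[abs_def] by (rule integrable_Re[OF fseries_integrable])

lemma fourier_coeff_real_series:
  assumes "\<And>k. c (- k) = cnj (c k)" "integrable lattice c"
  shows "fourier_coeff (real_series c) k = c k"
  unfolding fourier_coeff_eq_coef of_real_real_series[of c, OF assms(1)] by (rule coef_fseries[OF assms(2)])

lemma is_multiplier_real_series:
  assumes m: "\<And>k. m (- k) = m k" and f: "integrable torus f"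
    and c: "integrable lattice (\<lambda>k. complex_of_real (m k) * fourier_coeff f k)"
  shows "is_multiplier m f (real_series (\<lambda>k. complex_of_real (m k) * fourier_coeff f k))"
proof -
  show ?thesis
    unfolding is_multiplier_def using f c
    by (auto simp: real_series_integrable fourier_coeff_real_series fourier_coeff_minus m)
qed

text \<open>
  Meaningful for square integrable functions, in particular for those in \<open>L\<^sup>3\<close>.
\<close>

definition hat :: "(real^3 \<Rightarrow> real) \<Rightarrow> l2" where
  "hat f = Abs_l2 (fourier_coeff f)"

lemma L3_square_integrable:
  assumes "L3 f"
  shows "integrable torus (\<lambda>x. (f x)\<^sup>2)"
proof (rule Bochner_Integration.integrable_bound[of _ "\<lambda>x. 1 + \<bar>f x\<bar> ^ 3"])
  have "u\<^sup>2 \<le> 1 + \<bar>u\<bar> ^ 3" for u :: real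
  proof (cases "\<bar>u\<bar> \<le> 1")
    case True
    then have "u\<^sup>2 \<le> 1" by (simp add: abs_square_le_1)
    moreover have "0 \<le> \<bar>u\<bar> ^ 3" by simp
    ultimately show ?thesis by linarith
  next
    case False
    then have "\<bar>u\<bar>\<^sup>2 \<le> \<bar>u\<bar> ^ 3" by (intro power_increasing) auto
    then show ?thesis by simp
  qed
  then show "AE x in torus. norm ((f x)\<^sup>2) \<le> norm (1 + \<bar>f x\<bar> ^ 3)"
    by (intro AE_I2) (simp add: abs_of_nonneg)
qed (use assms in \<open>auto simp: L3_def\<close>)

lemma l2_nth_hat:
  assumes "L3 f"
  shows "l2_nth (hat f) = fourier_coeff f"
    and "(2 * pi) ^ 3 * (norm (hat f))\<^sup>2 \<le> (LINT x|torus. (f x)\<^sup>2)"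
proof -
  have m: "(\<lambda>x. complex_of_real (f x)) \<in> borel_measurable torus" using assms by (auto simp: L3_def)
  have i: "integrable torus (\<lambda>x. (cmod (complex_of_real (f x)))\<^sup>2)"
    using L3_square_integrable[OF assms] by simp
  note b = bessel[OF m i, folded fourier_coeff_eq_coef]
  show eq: "l2_nth (hat f) = fourier_coeff f"
    unfolding hat_def by (rule l2_nth_Abs[OF b(2)])
  show "(2 * pi) ^ 3 * (norm (hat f))\<^sup>2 \<le> (LINT x|torus. (f x)\<^sup>2)"
    using b(3) by (simp add: l2_norm_sq eq)
qed

context drift_symbol
begin

text \<open>
  The symbol and the coefficients are both square summable, so the Fourier series of the velocity
  converges absolutely.
\<close>

lemma integrable_velocity_coeffs:
  "integrable lattice (\<lambda>k. complex_of_real (m k $ j) * l2_nth a k)"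
proof (rule Bochner_Integration.integrable_bound)
  show "integrable lattice (\<lambda>k. C\<^sup>2 * (1 / norm (freq k) ^ 4) + (cmod (l2_nth a k))\<^sup>2)"
    by (intro Bochner_Integration.integrable_add Bochner_Integration.integrable_mult_right integrable_lattice_weight l2_nth_integrable)
  show "AE k in lattice. norm (complex_of_real (m k $ j) * l2_nth a k) \<le> norm (C\<^sup>2 * (1 / norm (freq k) ^ 4) + (cmod (l2_nth a k))\<^sup>2)"
  proof (rule AE_I2)
    fix k
    have "\<bar>m k $ j\<bar> \<le> C / (norm (freq k))\<^sup>2"
      using component_le_norm_cart[of "m k" j] m_bound[of k] by linarith
    then have "\<bar>m k $ j\<bar> * cmod (l2_nth a k) \<le> C / (norm (freq k))\<^sup>2 * cmod (l2_nth a k)"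
      by (intro mult_right_mono) auto
    also have "\<dots> \<le> (C / (norm (freq k))\<^sup>2)\<^sup>2 + (cmod (l2_nth a k))\<^sup>2"
      by (rule mult_le_sum_squares)
    also have "(C / (norm (freq k))\<^sup>2)\<^sup>2 = C\<^sup>2 * (1 / norm (freq k) ^ 4)"
      by (simp add: power_divide flip: power_mult)
    finally show "norm (complex_of_real (m k $ j) * l2_nth a k) \<le> norm (C\<^sup>2 * (1 / norm (freq k) ^ 4) + (cmod (l2_nth a k))\<^sup>2)"
      by (simp add: norm_mult)
  qed
qed simp

text \<open>
  The velocity is an absolutely convergent series, so the product with \<open>f\<close> has the convolution of
  the coefficients.
\<close>

lemma divergence_quad:
  assumes f: "L3 f" and u: "\<And>x j. u x $ j = multiplier (\<lambda>k. m k $ j) f x"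
  shows "divergence_coeff (\<lambda>x. f x *\<^sub>R u x) k = \<i> * (of_real (norm (freq k)) * l2_nth (quad (hat f) (hat f)) k)"
proof -
  let ?a = "l2_nth (hat f)"
  have a: "?a = fourier_coeff f" by (rule l2_nth_hat(1)[OF f])
  have i_f: "integrable torus f" by (rule L3_integrable[OF f])
  define v where "v j = (\<lambda>k. complex_of_real (m k $ j) * ?a k)" for j
  have vi: "integrable lattice (v j)" for j unfolding v_def by (rule integrable_velocity_coeffs)
  have vs: "v j (- k) = cnj (v j k)" for j k
    by (simp add: v_def a m_even fourier_coeff_minus)
  have M: "is_multiplier (\<lambda>k. m k $ j) f (real_series (v j))" for j
    unfolding v_def a by (rule is_multiplier_real_series) (use i_f vi in \<open>auto simp: m_even v_def a\<close>)
  have uv: "AE x in torus. u x $ j = real_series (v j) x" for j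
    unfolding u by (rule multiplier_AE_eq(2)[OF M])
  have um: "(\<lambda>x. u x $ j) \<in> borel_measurable torus" for j
    using multiplier_AE_eq(1)[OF M[of j]] unfolding u is_multiplier_def by auto
  have fm: "f \<in> borel_measurable torus" using i_f by auto
  have comp: "fourier_coeff (\<lambda>x. (f x *\<^sub>R u x) $ j) k = (LINT l|lattice. v j l * ?a (k - l))" for j
  proof -
    have "fourier_coeff (\<lambda>x. (f x *\<^sub>R u x) $ j) k = coef (\<lambda>x. complex_of_real (f x) * fseries (v j) x) k"
      unfolding fourier_coeff_eq_coef
    proof (rule coef_cong_AE)
      show "(\<lambda>x. complex_of_real ((f x *\<^sub>R u x) $ j)) \<in> borel_measurable torus"
        using fm um[of j] by simp
      show "(\<lambda>x. complex_of_real (f x) * fseries (v j) x) \<in> borel_measurable torus"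
        using fm by measurable
      show "AE x in torus. complex_of_real ((f x *\<^sub>R u x) $ j) = complex_of_real (f x) * fseries (v j) x"
        using uv[of j] by eventually_elim (simp add: of_real_real_series[of "v j", OF vs, symmetric])
    qed
    also have "\<dots> = (LINT l|lattice. v j l * coef (\<lambda>x. complex_of_real (f x)) (k - l))"
      by (rule coef_mult_fseries[OF _ vi]) (use i_f in simp)
    finally show ?thesis by (simp add: a fourier_coeff_eq_coef)
  qed
  have iv: "integrable lattice (\<lambda>l. v j l * ?a (k - l))" for j
  proof -
    have "integrable torus (\<lambda>x. complex_of_real (f x) * character (- k) x)"
      using i_f by (intro integrable_mult_character) simp
    from integral_mult_fseries(2)[OF this vi[of j]]
    have "integrable lattice (\<lambda>l. v j l * (LINT x|torus. complex_of_real (f x) * character (- k) x * character l x))" .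
    also have "(\<lambda>l. v j l * (LINT x|torus. complex_of_real (f x) * character (- k) x * character l x))
       = (\<lambda>l. (v j l * ?a (k - l)) * complex_of_real ((2 * pi) ^ 3))"
      by (simp add: a fourier_coeff_eq_coef coef_def mult.assoc character_add[symmetric] add.commute)
    finally have I: "integrable lattice (\<lambda>l. (v j l * ?a (k - l)) * complex_of_real ((2 * pi) ^ 3))" .
    have "integrable lattice g" if "integrable lattice (\<lambda>l. g l * c)" "c \<noteq> 0" for g :: "int^3 \<Rightarrow> complex" and c
      using Bochner_Integration.integrable_mult_left[OF that(1), of "inverse c"] that(2) by (simp add: mult.assoc)
    from this[OF I] show ?thesis by simp
  qed
  have "divergence_coeff (\<lambda>x. f x *\<^sub>R u x) k = (\<Sum>j\<in>UNIV. \<i> * complex_of_real (freq k $ j) * (LINT l|lattice. v j l * ?a (k - l)))"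
    by (simp only: divergence_coeff_def comp)
  also have "\<dots> = (LINT l|lattice. (\<Sum>j\<in>UNIV. \<i> * complex_of_real (freq k $ j) * (v j l * ?a (k - l))))"
    by (subst Bochner_Integration.integral_sum) (use iv in auto)
  also have "\<dots> = (LINT l|lattice. \<i> * of_real (norm (freq k)) * (kernel k l * ?a l * ?a (k - l)))"
  proof (intro Bochner_Integration.integral_cong refl)
    fix l
    have "of_real (norm (freq k)) * kernel k l = (\<Sum>j\<in>UNIV. complex_of_real (freq k $ j) * complex_of_real (m l $ j))"
      by (simp only: norm_mult_kernel of_real_mult[symmetric] of_real_sum[symmetric] inner_vec_def inner_real_def)
    then have ker: "(\<Sum>j\<in>UNIV. complex_of_real (freq k $ j) * complex_of_real (m l $ j)) = of_real (norm (freq k)) * kernel k l" ..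
    have "(\<Sum>j\<in>UNIV. \<i> * complex_of_real (freq k $ j) * (v j l * ?a (k - l)))
       = (\<Sum>j\<in>UNIV. \<i> * (complex_of_real (freq k $ j) * complex_of_real (m l $ j)) * (?a l * ?a (k - l)))"
      by (simp only: v_def mult_ac)
    also have "\<dots> = \<i> * (\<Sum>j\<in>UNIV. complex_of_real (freq k $ j) * complex_of_real (m l $ j)) * (?a l * ?a (k - l))"
      by (simp only: sum_distrib_left sum_distrib_right)
    also have "\<dots> = \<i> * of_real (norm (freq k)) * (kernel k l * ?a l * ?a (k - l))"
      by (simp only: ker mult_ac)
    finally show "(\<Sum>j\<in>UNIV. \<i> * complex_of_real (freq k $ j) * (v j l * ?a (k - l))) = \<dots>" .
  qed
  also have "\<dots> = \<i> * (of_real (norm (freq k)) * l2_nth (quad (hat f) (hat f)) k)"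
    by (simp add: l2_nth_quad mult.assoc)
  finally show ?thesis .
qed

end

section \<open>Mild solutions and the coefficient equation\<close>

text \<open>The Duhamel integrand is singular at the upper endpoint and uncontrolled at time zero.\<close>

abbreviation open_time :: "real \<Rightarrow> real measure" where
  "open_time t \<equiv> restrict_space lborel {0<..<t}"

lemma sigma_finite_open_time: "sigma_finite_measure (open_time t)"
  by (rule sigma_finite_measure_restrict_space) (auto intro: lborel.sigma_finite_measure_axioms)

lemma finite_measure_open_time: "finite_measure (open_time t)"
proof (rule finite_measureI)
  have "emeasure lborel {0<..<t} < \<infinity>"
    by (cases "0 \<le> t") auto
  then show "emeasure (open_time t) (space (open_time t)) \<noteq> \<infinity>"
    by (simp add: emeasure_restrict_space space_restrict_space)
qed

lemma borel_measurable_open_time: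
  fixes f :: "real \<Rightarrow> 'b :: topological_space"
  assumes "continuous_on {0<..<t} f"
  shows "f \<in> borel_measurable (open_time t)"
proof -
  have "f \<in> borel_measurable (restrict_space borel {0<..<t})"
    by (rule borel_measurable_continuous_on_restrict[OF assms])
  also have "borel_measurable (restrict_space borel {0<..<t}) = borel_measurable (open_time t)"
    by (intro measurable_cong_sets sets_restrict_space_cong) auto
  finally show ?thesis .
qed

lemma nn_integral_open_time_le:
  "(\<integral>\<^sup>+\<tau>. f \<tau> \<partial>open_time t) \<le> (\<integral>\<^sup>+\<tau>. f \<tau> \<partial>time t)"
  by (subst (1 2) nn_integral_restrict_space) (auto intro!: nn_integral_mono simp: indicator_def)

lemma nn_integral_inverse_sqrt: 
  assumes "0 < t"
  shows "(\<integral>\<^sup>+\<tau>. ennreal (1 / sqrt (t - \<tau>)) \<partial>open_time t) < \<infinity>"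
proof -
  have "((\<lambda>\<tau>. 1 / sqrt (t - \<tau>)) has_integral (- 2 * sqrt (t - t) - (- 2 * sqrt (t - 0)))) {0..t}"
  proof (rule fundamental_theorem_of_calculus_interior)
    show "continuous_on {0..t} (\<lambda>\<tau>. - 2 * sqrt (t - \<tau>))" by (intro continuous_intros)
    fix \<tau> assume "\<tau> \<in> {0<..<t}"
    then have \<tau>: "0 < t - \<tau>" by simp
    have "((\<lambda>\<tau>. - 2 * sqrt (t - \<tau>)) has_field_derivative - 2 * (inverse (sqrt (t - \<tau>)) / 2 * (0 - 1))) (at \<tau>)"
      by (intro DERIV_cmult DERIV_chain2[where f = sqrt and g = "\<lambda>\<tau>. t - \<tau>", OF DERIV_real_sqrt[OF \<tau>]] DERIV_diff DERIV_const DERIV_ident)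
    then have "((\<lambda>\<tau>. - 2 * sqrt (t - \<tau>)) has_field_derivative 1 / sqrt (t - \<tau>)) (at \<tau>)"
      by (simp add: inverse_eq_divide)
    then show "((\<lambda>\<tau>. - 2 * sqrt (t - \<tau>)) has_vector_derivative 1 / sqrt (t - \<tau>)) (at \<tau>)"
      by (simp add: has_real_derivative_iff_has_vector_derivative)
  qed (use assms in auto)
  from nn_integral_has_integral_lebesgue'[OF _ this]
  have "(\<integral>\<^sup>+\<tau>. ennreal (1 / sqrt (t - \<tau>)) * indicator {0..t} \<tau> \<partial>lborel) < \<infinity>"
    by (simp add: less_top[symmetric])
  then have "(\<integral>\<^sup>+\<tau>. ennreal (1 / sqrt (t - \<tau>)) \<partial>time t) < \<infinity>"
    by (subst nn_integral_restrict_space) auto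
  then show ?thesis using nn_integral_open_time_le le_less_trans by blast
qed

text \<open>
  The Fourier coefficients of the Duhamel integrand at time \<open>\<tau>\<close>, where \<open>q(\<tau>)\<close> are the coefficients
  of the quadratic term.
\<close>

definition duhamel_coeff :: "real \<Rightarrow> (real \<Rightarrow> l2) \<Rightarrow> real \<Rightarrow> real \<Rightarrow> int^3 \<Rightarrow> complex" where
  "duhamel_coeff \<epsilon> q t \<tau> k = of_real (heat_symbol (\<epsilon> * (t - \<tau>)) k) * (\<i> * (of_real (norm (freq k)) * l2_nth (q \<tau>) k))"

text \<open>The inequality \<open>y \<le> e\<^sup>y\<close> at \<open>y = 2 s |k|\<^sup>2\<close>.\<close>

lemma heat_symbol_gradient_sq:
  assumes "0 < s" shows "(heat_symbol s k * norm (freq k))\<^sup>2 \<le> 1 / (2 * s)"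
proof -
  define y where "y = 2 * s * (norm (freq k))\<^sup>2"
  have "1 + y \<le> exp y" by (rule exp_ge_add_one_self)
  then have "y \<le> exp y" by linarith
  then have "exp (- y) * y \<le> 1" by (simp add: exp_minus field_simps)
  moreover have "(heat_symbol s k)\<^sup>2 = exp (- y)"
    by (simp add: heat_symbol_def y_def power2_eq_square exp_add[symmetric])
  ultimately have "2 * s * (heat_symbol s k * norm (freq k))\<^sup>2 \<le> 1"
    by (simp add: power_mult_distrib y_def mult_ac)
  then show ?thesis using assms by (simp add: field_simps)
qed

lemma duhamel_coeff_bounds:
  assumes s: "\<tau> < t" "0 < \<epsilon>"
  shows "integrable lattice (duhamel_coeff \<epsilon> q t \<tau>)"
    and "(LINT k|lattice. (cmod (duhamel_coeff \<epsilon> q t \<tau> k))\<^sup>2) \<le> (norm (q \<tau>))\<^sup>2 / (2 * (\<epsilon> * (t - \<tau>)))"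
proof -
  define r where "r = \<epsilon> * (t - \<tau>)"
  have r: "0 < r" using s by (simp add: r_def)
  have n: "cmod (duhamel_coeff \<epsilon> q t \<tau> k) = heat_symbol r k * norm (freq k) * cmod (l2_nth (q \<tau>) k)" for k
    using heat_symbol_pos[of r k] by (simp add: duhamel_coeff_def r_def norm_mult)
  have regroup: "x / w * x * z = x * x * z / w" for x w z :: real
    by simp
  have product_le: "x * y \<le> X * Y" if "x \<le> X" "y \<le> Y" "0 \<le> X" "0 \<le> y" for x y X Y :: real
    using that by (rule mult_mono)
  show "integrable lattice (duhamel_coeff \<epsilon> q t \<tau>)"
  proof (rule integrable_lattice_decay)
    fix k :: "int^3" assume k: "k \<noteq> 0"
    have k1: "1 \<le> norm (freq k)" by (rule norm_freq_ge_1[OF k])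
    have r2: "0 < r / 2" using r by simp
    have "heat_symbol r k = heat_symbol (r / 2) k * heat_symbol (r / 2) k"
      by (simp add: heat_symbol_def exp_add[symmetric])
    moreover have "heat_symbol (r / 2) k * norm (freq k) \<le> 2 / (r / 2)\<^sup>2"
    proof -
      have "heat_symbol (r / 2) k * norm (freq k) \<le> (2 / (r / 2)\<^sup>2) / norm (freq k) ^ 4 * norm (freq k)"
        by (intro mult_right_mono heat_symbol_decay r2 k) auto
      also have "\<dots> \<le> 2 / (r / 2)\<^sup>2 * 1"
      proof -
        have "norm (freq k) / norm (freq k) ^ 4 \<le> 1"
          using k1 power_increasing[of 1 4 "norm (freq k)"] by (simp add: divide_le_eq)
        then have "2 / (r / 2)\<^sup>2 * (norm (freq k) / norm (freq k) ^ 4) \<le> 2 / (r / 2)\<^sup>2 * 1"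
          by (intro mult_left_mono) auto
        then show ?thesis by simp
      qed
      finally show ?thesis by simp
    qed
    ultimately have "heat_symbol r k * norm (freq k) \<le> ((2 / (r / 2)\<^sup>2) / norm (freq k) ^ 4) * (2 / (r / 2)\<^sup>2)"
      using product_le[OF heat_symbol_decay[OF r2 k], of "heat_symbol (r / 2) k * norm (freq k)" "2 / (r / 2)\<^sup>2"]
        heat_symbol_pos[of "r / 2" k] by (simp only: mult.assoc) simp
    from product_le[OF this norm_l2_nth_le[of "q \<tau>" k]]
    have "heat_symbol r k * norm (freq k) * cmod (l2_nth (q \<tau>) k) \<le> ((2 / (r / 2)\<^sup>2) / norm (freq k) ^ 4) * (2 / (r / 2)\<^sup>2) * norm (q \<tau>)"
      using r by auto
    also have "\<dots> = ((2 / (r / 2)\<^sup>2) * (2 / (r / 2)\<^sup>2) * norm (q \<tau>)) / norm (freq k) ^ 4"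
      by (rule regroup)
    finally show "norm (duhamel_coeff \<epsilon> q t \<tau> k) \<le> ((2 / (r / 2)\<^sup>2) * (2 / (r / 2)\<^sup>2) * norm (q \<tau>)) / norm (freq k) ^ 4"
      unfolding n .
  qed
  have r2: "\<bar>2 * r\<bar> = 2 * r" using r by simp
  have le: "(cmod (duhamel_coeff \<epsilon> q t \<tau> k))\<^sup>2 \<le> 1 / (2 * r) * (cmod (l2_nth (q \<tau>) k))\<^sup>2" for k
    unfolding n power_mult_distrib[of _ "cmod (l2_nth (q \<tau>) k)"]
    by (intro mult_right_mono heat_symbol_gradient_sq r) auto
  have "(LINT k|lattice. (cmod (duhamel_coeff \<epsilon> q t \<tau> k))\<^sup>2) \<le> (LINT k|lattice. 1 / (2 * r) * (cmod (l2_nth (q \<tau>) k))\<^sup>2)"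
  proof (rule integral_mono)
    have i: "integrable lattice (\<lambda>k. 1 / (2 * r) * (cmod (l2_nth (q \<tau>) k))\<^sup>2)"
      by (intro Bochner_Integration.integrable_mult_right l2_nth_integrable)
    then show "integrable lattice (\<lambda>k. (cmod (duhamel_coeff \<epsilon> q t \<tau> k))\<^sup>2)"
      by (rule Bochner_Integration.integrable_bound) (auto intro!: AE_I2 order_trans[OF le] simp: r2)
    show "integrable lattice (\<lambda>k. 1 / (2 * r) * (cmod (l2_nth (q \<tau>) k))\<^sup>2)" by (rule i)
  qed (rule le)
  then show "(LINT k|lattice. (cmod (duhamel_coeff \<epsilon> q t \<tau> k))\<^sup>2) \<le> (norm (q \<tau>))\<^sup>2 / (2 * (\<epsilon> * (t - \<tau>)))"
    by (simp add: l2_norm_sq r_def)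
qed

lemma duhamel_coeff_measurable:
  assumes "continuous_on {0<..} q"
  shows "(\<lambda>\<tau>. duhamel_coeff \<epsilon> q t \<tau> k) \<in> borel_measurable (open_time t)"
  unfolding duhamel_coeff_def heat_symbol_def
  by (intro borel_measurable_open_time continuous_intros continuous_on_subset[OF assms]) auto

text \<open>
  The \<open>L\<^sup>2\<close> norm of the integrand is of order \<open>u^(-1)\<close> with \<open>u = (t - \<tau>)^(1/2)\<close>. By
  \<open>r \<le> 1/u + u r\<^sup>2\<close> its \<open>L\<^sup>1\<close> norm is also of order \<open>u^(-1)\<close>, which is integrable in time. So the
  integrand is integrable over space and time together.
\<close>

lemma duhamel_fubini:
  assumes \<epsilon>: "0 < \<epsilon>" and q: "continuous_on {0<..} q" and Q: "\<And>\<tau>. 0 < \<tau> \<Longrightarrow> norm (q \<tau>) \<le> Q" and t: "0 < t"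
  shows "AE x in torus. integrable (open_time t) (\<lambda>\<tau>. fseries (duhamel_coeff \<epsilon> q t \<tau>) x)"
    and "integrable torus (\<lambda>x. LINT \<tau>|open_time t. fseries (duhamel_coeff \<epsilon> q t \<tau>) x)"
    and "coef (\<lambda>x. LINT \<tau>|open_time t. fseries (duhamel_coeff \<epsilon> q t \<tau>) x) k = (LINT \<tau>|open_time t. duhamel_coeff \<epsilon> q t \<tau> k)"
proof -
  interpret P: pair_sigma_finite torus "open_time t"
    by (intro pair_sigma_finite.intro sigma_finite_open_time torus.sigma_finite_measure_axioms)
  interpret L: sigma_finite_measure lattice by (rule sigma_finite_lattice)
  define H where "H = (\<lambda>(x, \<tau>). fseries (duhamel_coeff \<epsilon> q t \<tau>) x)"
  define V where "V = (2 * pi) ^ 3"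
  have V: "0 < V" by (simp add: V_def)
  have Hm: "H \<in> borel_measurable (torus \<Otimes>\<^sub>M open_time t)"
  proof -
    have "(\<lambda>p. duhamel_coeff \<epsilon> q t (snd p) k * character k (fst p)) \<in> borel_measurable (torus \<Otimes>\<^sub>M open_time t)" for k
      by (intro borel_measurable_times measurable_compose[OF measurable_snd duhamel_coeff_measurable[OF q]]
          measurable_compose[OF measurable_fst character_torus_measurable])
    from measurable_pair_lattice_swap[OF this] have "(\<lambda>(p, k). duhamel_coeff \<epsilon> q t (snd p) k * character k (fst p)) \<in> borel_measurable ((torus \<Otimes>\<^sub>M open_time t) \<Otimes>\<^sub>M lattice)" .
    from L.borel_measurable_lebesgue_integral[OF this] show ?thesis
      by (simp add: H_def fseries_def case_prod_beta')
  qed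
  have Hx: "(\<integral>\<^sup>+x. ennreal (norm (H (x, \<tau>))) \<partial>torus) \<le> ennreal (V * (1 + Q\<^sup>2 / (2 * \<epsilon>))) * ennreal (1 / sqrt (t - \<tau>))"
    if \<tau>: "0 < \<tau>" "\<tau> < t" for \<tau>
  proof -
    let ?c = "duhamel_coeff \<epsilon> q t \<tau>"
    define u where "u = sqrt (t - \<tau>)"
    have u: "0 < u" "u\<^sup>2 = t - \<tau>" using \<tau> by (auto simp: u_def)
    note b = duhamel_coeff_bounds[OF \<tau>(2) \<epsilon>, of q]
    note pv = parseval_fseries[OF b(1)]
    have int: "integrable torus (\<lambda>x. 1 / u + u * (cmod (fseries ?c x))\<^sup>2)" using pv(2) by simp
    have "(\<integral>\<^sup>+x. ennreal (norm (H (x, \<tau>))) \<partial>torus) \<le> (\<integral>\<^sup>+x. ennreal (1 / u + u * (cmod (fseries ?c x))\<^sup>2) \<partial>torus)"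
      unfolding H_def prod.case by (intro nn_integral_mono ennreal_leI weighted_am_gm u)
    also have "\<dots> = ennreal (LINT x|torus. 1 / u + u * (cmod (fseries ?c x))\<^sup>2)"
      by (rule nn_integral_eq_integral[OF int]) (use u in auto)
    also have "(LINT x|torus. 1 / u + u * (cmod (fseries ?c x))\<^sup>2) = V * (1 / u) + u * (V * (LINT k|lattice. (cmod (?c k))\<^sup>2))"
      using pv(2,3) by (simp add: measure_torus V_def)
    also have "\<dots> \<le> V * (1 / u) + u * (V * (Q\<^sup>2 / (2 * (\<epsilon> * u\<^sup>2))))"
    proof (intro add_left_mono mult_left_mono)
      have "(LINT k|lattice. (cmod (?c k))\<^sup>2) \<le> (norm (q \<tau>))\<^sup>2 / (2 * (\<epsilon> * u\<^sup>2))" using b(2) u by simp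
      also have "\<dots> \<le> Q\<^sup>2 / (2 * (\<epsilon> * u\<^sup>2))"
        using Q[OF \<tau>(1)] \<epsilon> u(1) by (intro divide_right_mono power_mono) auto
      finally show "(LINT k|lattice. (cmod (?c k))\<^sup>2) \<le> Q\<^sup>2 / (2 * (\<epsilon> * u\<^sup>2))" .
    qed (use u V in auto)
    also have "\<dots> = (V * (1 + Q\<^sup>2 / (2 * \<epsilon>))) * (1 / u)"
      using u \<epsilon> by (simp add: power2_eq_square field_simps)
    finally have "(\<integral>\<^sup>+x. ennreal (norm (H (x, \<tau>))) \<partial>torus) \<le> ennreal ((V * (1 + Q\<^sup>2 / (2 * \<epsilon>))) * (1 / u))"
      by (simp add: ennreal_leI)
    also have "\<dots> = ennreal (V * (1 + Q\<^sup>2 / (2 * \<epsilon>))) * ennreal (1 / u)"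
      using V \<epsilon> u by (intro ennreal_mult) (auto intro!: mult_nonneg_nonneg add_nonneg_nonneg)
    finally show ?thesis by (simp add: u_def)
  qed
  have Hi: "integrable (torus \<Otimes>\<^sub>M open_time t) H"
  proof (rule integrableI_bounded[OF Hm])
    have "(\<lambda>p. ennreal (norm (H p))) \<in> borel_measurable (torus \<Otimes>\<^sub>M open_time t)" using Hm by measurable
    from P.nn_integral_snd[OF this]
    have "(\<integral>\<^sup>+p. ennreal (norm (H p)) \<partial>(torus \<Otimes>\<^sub>M open_time t)) = (\<integral>\<^sup>+\<tau>. \<integral>\<^sup>+x. ennreal (norm (H (x, \<tau>))) \<partial>torus \<partial>open_time t)" by simp
    also have "\<dots> \<le> (\<integral>\<^sup>+\<tau>. ennreal (V * (1 + Q\<^sup>2 / (2 * \<epsilon>))) * ennreal (1 / sqrt (t - \<tau>)) \<partial>open_time t)"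
      by (intro nn_integral_mono Hx) (auto simp: space_restrict_space)
    also have "\<dots> = ennreal (V * (1 + Q\<^sup>2 / (2 * \<epsilon>))) * (\<integral>\<^sup>+\<tau>. ennreal (1 / sqrt (t - \<tau>)) \<partial>open_time t)"
      by (intro nn_integral_cmult measurable_compose[OF _ measurable_ennreal] borel_measurable_open_time continuous_intros) auto
    also have "\<dots> < \<infinity>" using nn_integral_inverse_sqrt[OF t] by (simp add: ennreal_mult_less_top)
    finally show "(\<integral>\<^sup>+p. ennreal (norm (H p)) \<partial>(torus \<Otimes>\<^sub>M open_time t)) < \<infinity>" .
  qed
  show "AE x in torus. integrable (open_time t) (\<lambda>\<tau>. fseries (duhamel_coeff \<epsilon> q t \<tau>) x)"
    using P.AE_integrable_fst'[OF Hi] by (simp add: H_def)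
  show "integrable torus (\<lambda>x. LINT \<tau>|open_time t. fseries (duhamel_coeff \<epsilon> q t \<tau>) x)"
    using P.integrable_fst'[OF Hi] by (simp add: H_def)
  define G where "G = (\<lambda>(x, \<tau>). fseries (duhamel_coeff \<epsilon> q t \<tau>) x * character (- k) x)"
  have Gi: "integrable (torus \<Otimes>\<^sub>M open_time t) G"
  proof (rule Bochner_Integration.integrable_bound[OF Hi])
    have "(\<lambda>p. H p * character (- k) (fst p)) \<in> borel_measurable (torus \<Otimes>\<^sub>M open_time t)"
      by (intro borel_measurable_times Hm measurable_compose[OF measurable_fst character_torus_measurable])
    then show "G \<in> borel_measurable (torus \<Otimes>\<^sub>M open_time t)"
      by (simp add: G_def H_def case_prod_beta')
  qed (auto simp: G_def H_def norm_mult)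
  have "(LINT x|torus. (LINT \<tau>|open_time t. fseries (duhamel_coeff \<epsilon> q t \<tau>) x) * character (- k) x)
     = (LINT x|torus. LINT \<tau>|open_time t. fseries (duhamel_coeff \<epsilon> q t \<tau>) x * character (- k) x)"
    by simp
  also have "\<dots> = (LINT \<tau>|open_time t. LINT x|torus. fseries (duhamel_coeff \<epsilon> q t \<tau>) x * character (- k) x)"
    using P.Fubini_integral[OF Gi[unfolded G_def]] by simp
  also have "\<dots> = (LINT \<tau>|open_time t. complex_of_real ((2 * pi) ^ 3) * duhamel_coeff \<epsilon> q t \<tau> k)"
  proof (intro Bochner_Integration.integral_cong refl)
    fix \<tau> assume "\<tau> \<in> space (open_time t)"
    then have "integrable lattice (duhamel_coeff \<epsilon> q t \<tau>)"
      by (intro duhamel_coeff_bounds \<epsilon>) (auto simp: space_restrict_space)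
    from coef_fseries[OF this, of k]
    show "(LINT x|torus. fseries (duhamel_coeff \<epsilon> q t \<tau>) x * character (- k) x) = complex_of_real ((2 * pi) ^ 3) * duhamel_coeff \<epsilon> q t \<tau> k"
      by (simp add: coef_def field_simps)
  qed
  also have "\<dots> = complex_of_real ((2 * pi) ^ 3) * (LINT \<tau>|open_time t. duhamel_coeff \<epsilon> q t \<tau> k)"
    by (rule integral_mult_right_zero)
  finally show "coef (\<lambda>x. LINT \<tau>|open_time t. fseries (duhamel_coeff \<epsilon> q t \<tau>) x) k = (LINT \<tau>|open_time t. duhamel_coeff \<epsilon> q t \<tau> k)"
    by (simp add: coef_def)
qed

lemma heat_eq_fseries:
  assumes "integrable lattice (\<lambda>k. complex_of_real (heat_symbol (\<epsilon> * s) k) * c k)"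
  shows "heat \<epsilon> s c x = fseries (\<lambda>k. complex_of_real (heat_symbol (\<epsilon> * s) k) * c k) x"
  unfolding heat_def fseries_def
  using infsum_eq_lattice_integral[OF integrable_fseries[OF assms], of x]
  by (simp add: heat_symbol_def)

text \<open>
  Both sides of the integral equation are integrable functions on the torus and are thus equal
  almost everywhere if and only if their coefficients are; those of the right-hand side come from
  Fubini. The integrability in time, also part of a mild solution, holds for almost every point by
  Fubini.
\<close>

lemma mild_iff_coefficients:
  fixes \<theta> :: "real \<Rightarrow> real^3 \<Rightarrow> real"
  assumes N: "0 < N" and \<nu>: "0 < \<epsilon>\<^sub>\<nu>" and \<epsilon>: "0 < \<epsilon>" and t: "0 < t"
    and \<theta>: "\<And>\<tau>. 0 < \<tau> \<Longrightarrow> L3 (\<theta> \<tau>)"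
    and q: "\<And>\<tau>. 0 < \<tau> \<Longrightarrow> q \<tau> = drift_symbol.quad (drift N \<epsilon>\<^sub>\<nu>) (hat (\<theta> \<tau>)) (hat (\<theta> \<tau>))"
    and qc: "continuous_on {0<..} q" and qb: "\<And>\<tau>. 0 < \<tau> \<Longrightarrow> norm (q \<tau>) \<le> Q"
  shows "(AE x in torus. set_integrable lborel {0<..<t} (duhamel_integrand N \<epsilon>\<^sub>\<nu> \<epsilon> \<theta> t x) \<and>
        complex_of_real (\<theta> t x) = heat \<epsilon> t (fourier_coeff \<theta>0) x
          - (LINT \<tau>:{0<..<t}|lborel. duhamel_integrand N \<epsilon>\<^sub>\<nu> \<epsilon> \<theta> t x \<tau>))
    \<longleftrightarrow> (\<forall>k. fourier_coeff (\<theta> t) k = of_real (heat_symbol (\<epsilon> * t) k) * fourier_coeff \<theta>0 k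
          - (LINT \<tau>|open_time t. duhamel_coeff \<epsilon> q t \<tau> k))"
proof -
  interpret D: drift_symbol "drift N \<epsilon>\<^sub>\<nu>" "3 * ((N ^ 4 + N\<^sup>2 * (1 + \<epsilon>\<^sub>\<nu>)) / \<epsilon>\<^sub>\<nu>\<^sup>2)"
    by (rule drift_symbol_drift[OF N \<nu>])
  note fub = duhamel_fubini[OF \<epsilon> qc qb t]
  have duh: "duhamel_integrand N \<epsilon>\<^sub>\<nu> \<epsilon> \<theta> t x \<tau> = fseries (duhamel_coeff \<epsilon> q t \<tau>) x" if \<tau>: "0 < \<tau>" "\<tau> < t" for x \<tau>
  proof -
    have div: "divergence_coeff (\<lambda>y. \<theta> \<tau> y *\<^sub>R velocity N \<epsilon>\<^sub>\<nu> (\<theta> \<tau>) y) = (\<lambda>k. \<i> * (of_real (norm (freq k)) * l2_nth (q \<tau>) k))"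
      unfolding q[OF \<tau>(1)]
      by (rule ext, rule D.divergence_quad[OF \<theta>[OF \<tau>(1)]]) (simp add: velocity_def drift_def)
    have eq: "duhamel_coeff \<epsilon> q t \<tau> = (\<lambda>k. complex_of_real (heat_symbol (\<epsilon> * (t - \<tau>)) k) * (\<i> * (of_real (norm (freq k)) * l2_nth (q \<tau>) k)))"
      by (simp add: duhamel_coeff_def fun_eq_iff)
    show ?thesis
      unfolding duhamel_integrand_def div eq
      by (rule heat_eq_fseries) (use duhamel_coeff_bounds(1)[OF \<tau>(2) \<epsilon>, of q] in \<open>simp add: eq\<close>)
  qed
  have si: "set_integrable lborel {0<..<t} (duhamel_integrand N \<epsilon>\<^sub>\<nu> \<epsilon> \<theta> t x) \<longleftrightarrow> integrable (open_time t) (\<lambda>\<tau>. fseries (duhamel_coeff \<epsilon> q t \<tau>) x)" for x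
  proof -
    have "set_integrable lborel {0<..<t} (duhamel_integrand N \<epsilon>\<^sub>\<nu> \<epsilon> \<theta> t x) \<longleftrightarrow> integrable (open_time t) (duhamel_integrand N \<epsilon>\<^sub>\<nu> \<epsilon> \<theta> t x)"
      by (simp add: set_integrable_def integrable_restrict_space)
    also have "\<dots> \<longleftrightarrow> integrable (open_time t) (\<lambda>\<tau>. fseries (duhamel_coeff \<epsilon> q t \<tau>) x)"
      by (intro Bochner_Integration.integrable_cong refl) (auto simp: space_restrict_space duh)
    finally show ?thesis .
  qed
  have li: "(LINT \<tau>:{0<..<t}|lborel. duhamel_integrand N \<epsilon>\<^sub>\<nu> \<epsilon> \<theta> t x \<tau>) = (LINT \<tau>|open_time t. fseries (duhamel_coeff \<epsilon> q t \<tau>) x)" for x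
  proof -
    have "(LINT \<tau>:{0<..<t}|lborel. duhamel_integrand N \<epsilon>\<^sub>\<nu> \<epsilon> \<theta> t x \<tau>) = (LINT \<tau>|open_time t. duhamel_integrand N \<epsilon>\<^sub>\<nu> \<epsilon> \<theta> t x \<tau>)"
      by (simp add: set_lebesgue_integral_def integral_restrict_space)
    also have "\<dots> = (LINT \<tau>|open_time t. fseries (duhamel_coeff \<epsilon> q t \<tau>) x)"
      by (intro Bochner_Integration.integral_cong refl) (auto simp: space_restrict_space duh)
    finally show ?thesis .
  qed
  have \<epsilon>t: "0 < \<epsilon> * t" using \<epsilon> t by simp
  have ht: "heat \<epsilon> t (fourier_coeff \<theta>0) x = heat_op (\<epsilon> * t) \<theta>0 x" for x
    unfolding heat_op_def by (rule heat_eq_fseries[OF integrable_heat_coeff[OF \<epsilon>t]])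
  define I where "I x = (LINT \<tau>|open_time t. fseries (duhamel_coeff \<epsilon> q t \<tau>) x)" for x
  have Ii: "integrable torus I" using fub(2) by (simp add: I_def[abs_def])
  have hi: "integrable torus (heat_op (\<epsilon> * t) \<theta>0)" by (rule heat_op_integrable[OF \<epsilon>t])
  have ti: "integrable torus (\<lambda>x. complex_of_real (\<theta> t x))" using L3_integrable[OF \<theta>[OF t]] by simp
  have ri: "integrable torus (\<lambda>x. heat_op (\<epsilon> * t) \<theta>0 x - I x)" using hi Ii by simp
  have cr: "coef (\<lambda>x. heat_op (\<epsilon> * t) \<theta>0 x - I x) k = of_real (heat_symbol (\<epsilon> * t) k) * fourier_coeff \<theta>0 k
          - (LINT \<tau>|open_time t. duhamel_coeff \<epsilon> q t \<tau> k)" for k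
  proof -
    have "coef (heat_op (\<epsilon> * t) \<theta>0) k = of_real (heat_symbol (\<epsilon> * t) k) * fourier_coeff \<theta>0 k"
      unfolding heat_op_def by (rule coef_fseries[OF integrable_heat_coeff[OF \<epsilon>t]])
    moreover have "coef I k = (LINT \<tau>|open_time t. duhamel_coeff \<epsilon> q t \<tau> k)"
      using fub(3)[of k] by (simp add: I_def[abs_def])
    ultimately show ?thesis by (simp add: coef_diff[OF hi Ii])
  qed
  have "(AE x in torus. set_integrable lborel {0<..<t} (duhamel_integrand N \<epsilon>\<^sub>\<nu> \<epsilon> \<theta> t x) \<and>
        complex_of_real (\<theta> t x) = heat \<epsilon> t (fourier_coeff \<theta>0) x
          - (LINT \<tau>:{0<..<t}|lborel. duhamel_integrand N \<epsilon>\<^sub>\<nu> \<epsilon> \<theta> t x \<tau>))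
    \<longleftrightarrow> (AE x in torus. complex_of_real (\<theta> t x) = heat_op (\<epsilon> * t) \<theta>0 x - I x)"
    unfolding si li ht I_def[symmetric] using fub(1) by (auto elim: eventually_elim2)
  also have "\<dots> \<longleftrightarrow> (\<forall>k. coef (\<lambda>x. complex_of_real (\<theta> t x)) k = coef (\<lambda>x. heat_op (\<epsilon> * t) \<theta>0 x - I x) k)"
  proof
    assume "AE x in torus. complex_of_real (\<theta> t x) = heat_op (\<epsilon> * t) \<theta>0 x - I x"
    then show "\<forall>k. coef (\<lambda>x. complex_of_real (\<theta> t x)) k = coef (\<lambda>x. heat_op (\<epsilon> * t) \<theta>0 x - I x) k"
      by (intro allI coef_cong_AE borel_measurable_integrable[OF ti] borel_measurable_integrable[OF ri])
  next
    assume "\<forall>k. coef (\<lambda>x. complex_of_real (\<theta> t x)) k = coef (\<lambda>x. heat_op (\<epsilon> * t) \<theta>0 x - I x) k"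
    then show "AE x in torus. complex_of_real (\<theta> t x) = heat_op (\<epsilon> * t) \<theta>0 x - I x"
      by (intro AE_eq_if_coef_eq ti ri) auto
  qed
  finally show ?thesis by (simp only: cr fourier_coeff_eq_coef[symmetric])
qed

section \<open>Uniqueness\<close>

text \<open>
  The integral of \<open>|k|\<^sup>2 exp (- 2 \<epsilon> |k|\<^sup>2 (s - \<tau>))\<close> is at most \<open>1 / (2 \<epsilon>)\<close>, uniformly in \<open>k\<close>: the
  heat semigroup gains one derivative in the square mean over time.
\<close>

lemma nn_integral_heat_gradient_le:
  assumes \<epsilon>: "0 < \<epsilon>" and s: "0 < s"
  shows "(\<integral>\<^sup>+\<tau>. (ennreal (heat_symbol (\<epsilon> * (s - \<tau>)) k * norm (freq k)))\<^sup>2 \<partial>open_time s) \<le> ennreal (1 / (2 * \<epsilon>))"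
proof (cases "k = 0")
  case False
  define K where "K = 2 * \<epsilon> * (norm (freq k))\<^sup>2"
  have K: "0 < K" using \<epsilon> False by (simp add: K_def)
  have eq: "(heat_symbol (\<epsilon> * (s - \<tau>)) k * norm (freq k))\<^sup>2 = (norm (freq k))\<^sup>2 * exp (- K * s) * exp (K * \<tau>)" for \<tau>
    by (simp add: heat_symbol_def K_def power_mult_distrib power2_eq_square[of "exp _"] exp_add[symmetric] algebra_simps)
  have "(\<integral>\<^sup>+\<tau>. (ennreal (heat_symbol (\<epsilon> * (s - \<tau>)) k * norm (freq k)))\<^sup>2 \<partial>open_time s)
     \<le> (\<integral>\<^sup>+\<tau>. (ennreal (heat_symbol (\<epsilon> * (s - \<tau>)) k * norm (freq k)))\<^sup>2 \<partial>time s)"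
    by (rule nn_integral_open_time_le)
  also have "\<dots> = (\<integral>\<^sup>+\<tau>. ennreal ((norm (freq k))\<^sup>2 * exp (- K * s)) * ennreal (exp (K * \<tau>)) \<partial>time s)"
    using heat_symbol_pos[THEN less_imp_le]
    by (intro nn_integral_cong) (simp add: ennreal_power ennreal_mult[symmetric] eq)
  also have "\<dots> = ennreal ((norm (freq k))\<^sup>2 * exp (- K * s)) * (\<integral>\<^sup>+\<tau>. ennreal (exp (K * \<tau>)) \<partial>time s)"
    by (rule nn_integral_cmult) (auto intro!: borel_measurable_time)
  also have "\<dots> \<le> ennreal ((norm (freq k))\<^sup>2 * exp (- K * s)) * ennreal (exp (K * s) / K)"
    using s K by (intro mult_left_mono exp_integral_le) auto
  also have "\<dots> = ennreal ((norm (freq k))\<^sup>2 * exp (- K * s) * (exp (K * s) / K))"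
    using K by (simp add: ennreal_mult[symmetric])
  also have "(norm (freq k))\<^sup>2 * exp (- K * s) * (exp (K * s) / K) = 1 / (2 * \<epsilon>)"
  proof -
    have "exp (- K * s) * exp (K * s) = 1" by (simp add: exp_add[symmetric])
    then have "(norm (freq k))\<^sup>2 * exp (- K * s) * (exp (K * s) / K) = (norm (freq k))\<^sup>2 / K"
      by (simp add: mult.assoc)
    then show ?thesis using False \<epsilon> by (simp add: K_def)
  qed
  finally show ?thesis .
qed simp

context drift_symbol
begin

text \<open>
  Cauchy-Schwarz in time against the gradient of the heat symbol bounds each coefficient of the
  difference by a time integral of the difference of the quadratic terms, with a constant uniform
  in \<open>k\<close>. Summation and boundedness lead to a Gronwall inequality for \<open>|a - b|\<^sup>2\<close>.
\<close>

lemma coefficient_equation_unique: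
  assumes \<epsilon>: "0 < \<epsilon>"
    and ca: "continuous_on {0<..} a" and cb: "continuous_on {0<..} b"
    and Ra: "\<And>t. 0 < t \<Longrightarrow> norm (a t) \<le> R" and Rb: "\<And>t. 0 < t \<Longrightarrow> norm (b t) \<le> R"
    and ea: "\<And>t k. 0 < t \<Longrightarrow> l2_nth (a t) k = c t k - (LINT \<tau>|open_time t. duhamel_coeff \<epsilon> (\<lambda>\<tau>. quad (a \<tau>) (a \<tau>)) t \<tau> k)"
    and eb: "\<And>t k. 0 < t \<Longrightarrow> l2_nth (b t) k = c t k - (LINT \<tau>|open_time t. duhamel_coeff \<epsilon> (\<lambda>\<tau>. quad (b \<tau>) (b \<tau>)) t \<tau> k)"
    and t: "0 < t"
  shows "a t = b t"
proof -
  define qa where "qa \<tau> = quad (a \<tau>) (a \<tau>)" for \<tau>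
  define qb where "qb \<tau> = quad (b \<tau>) (b \<tau>)" for \<tau>
  define \<delta> where "\<delta> \<tau> = qa \<tau> - qb \<tau>" for \<tau>
  have cqa: "continuous_on {0<..} qa" and cqb: "continuous_on {0<..} qb"
    unfolding qa_def qb_def by (intro quad.continuous_on ca cb)+
  have c\<delta>: "continuous_on {0<..} \<delta>" unfolding \<delta>_def by (intro continuous_intros cqa cqb)
  have R0: "0 \<le> R" using Ra[OF t] norm_ge_zero order_trans by blast
  define K where "K = 4 * quad_bound * R\<^sup>2"
  have K0: "0 \<le> K" using quad_bound_nonneg by (simp add: K_def)
  define y where "y \<tau> = (norm (a \<tau> - b \<tau>))\<^sup>2" for \<tau>
  have \<delta>le: "(norm (\<delta> \<tau>))\<^sup>2 \<le> K * y \<tau>" if "0 < \<tau>" for \<tau>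
  proof -
    have "\<delta> \<tau> = quad (a \<tau> - b \<tau>) (a \<tau>) + quad (b \<tau>) (a \<tau> - b \<tau>)"
      by (simp add: \<delta>_def qa_def qb_def quad.diff_left quad.diff_right)
    then have "(norm (\<delta> \<tau>))\<^sup>2 \<le> 2 * (norm (quad (a \<tau> - b \<tau>) (a \<tau>)))\<^sup>2 + 2 * (norm (quad (b \<tau>) (a \<tau> - b \<tau>)))\<^sup>2"
      by (simp only: norm_add_sq_le)
    also have "\<dots> \<le> 2 * (quad_bound * (norm (a \<tau> - b \<tau>))\<^sup>2 * (norm (a \<tau>))\<^sup>2) + 2 * (quad_bound * (norm (b \<tau>))\<^sup>2 * (norm (a \<tau> - b \<tau>))\<^sup>2)"
      by (intro add_mono mult_left_mono norm_quad_sq_le) auto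
    also have "\<dots> \<le> 2 * (quad_bound * (norm (a \<tau> - b \<tau>))\<^sup>2 * R\<^sup>2) + 2 * (quad_bound * R\<^sup>2 * (norm (a \<tau> - b \<tau>))\<^sup>2)"
      using Ra[OF that] Rb[OF that] quad_bound_nonneg by (intro add_mono mult_left_mono mult_right_mono power_mono mult_nonneg_nonneg) auto
    finally show ?thesis by (simp add: K_def y_def algebra_simps)
  qed
  have int: "integrable (open_time s) (\<lambda>\<tau>. duhamel_coeff \<epsilon> q s \<tau> k)"
    if "continuous_on {0<..} q" "\<And>\<tau>. 0 < \<tau> \<Longrightarrow> norm (q \<tau>) \<le> M" for q s k M
  proof (rule finite_measure.integrable_const_bound[OF finite_measure_open_time, of _ "norm (freq k) * M"])
    show "AE \<tau> in open_time s. norm (duhamel_coeff \<epsilon> q s \<tau> k) \<le> norm (freq k) * M"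
    proof (rule AE_I2)
      fix \<tau> assume "\<tau> \<in> space (open_time s)"
      then have \<tau>: "0 < \<tau>" "\<tau> < s" by (auto simp: space_restrict_space)
      have "cmod (l2_nth (q \<tau>) k) \<le> M" using norm_l2_nth_le[of "q \<tau>" k] that(2)[OF \<tau>(1)] by linarith
      moreover have "heat_symbol (\<epsilon> * (s - \<tau>)) k \<le> 1" using \<tau> \<epsilon> by (intro heat_symbol_le_1) simp
      ultimately have "heat_symbol (\<epsilon> * (s - \<tau>)) k * (norm (freq k) * cmod (l2_nth (q \<tau>) k)) \<le> 1 * (norm (freq k) * M)"
        by (intro mult_mono) auto
      then show "norm (duhamel_coeff \<epsilon> q s \<tau> k) \<le> norm (freq k) * M"
        using heat_symbol_pos[of "\<epsilon> * (s - \<tau>)" k] by (simp add: duhamel_coeff_def norm_mult)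
    qed
    show "(\<lambda>\<tau>. duhamel_coeff \<epsilon> q s \<tau> k) \<in> borel_measurable (open_time s)"
      by (rule duhamel_coeff_measurable[OF that(1)])
  qed
  have bq: "norm (quad x x) \<le> R * R * sqrt quad_bound" if "norm x \<le> R" for x
  proof -
    have "norm x * norm x \<le> R * R" using that by (intro mult_mono) (auto intro: R0)
    then have "norm x * norm x * sqrt quad_bound \<le> R * R * sqrt quad_bound"
      by (rule mult_right_mono) (simp add: quad_bound_nonneg)
    with norm_quad_le[of x x] show ?thesis by linarith
  qed
  have dk: "l2_nth (a s - b s) k = - (LINT \<tau>|open_time s. duhamel_coeff \<epsilon> \<delta> s \<tau> k)" if s: "0 < s" for s k
  proof -
    have "(LINT \<tau>|open_time s. duhamel_coeff \<epsilon> \<delta> s \<tau> k) = (LINT \<tau>|open_time s. duhamel_coeff \<epsilon> qa s \<tau> k - duhamel_coeff \<epsilon> qb s \<tau> k)"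
      by (intro Bochner_Integration.integral_cong refl) (simp add: duhamel_coeff_def \<delta>_def algebra_simps)
    also have "\<dots> = (LINT \<tau>|open_time s. duhamel_coeff \<epsilon> qa s \<tau> k) - (LINT \<tau>|open_time s. duhamel_coeff \<epsilon> qb s \<tau> k)"
      by (intro Bochner_Integration.integral_diff int[OF cqa, of "R * R * sqrt quad_bound"] int[OF cqb, of "R * R * sqrt quad_bound"])
        (auto simp: qa_def qb_def intro: bq Ra Rb)
    finally show ?thesis
      using ea[OF s, of k] eb[OF s, of k] by (simp add: qa_def[abs_def] qb_def[abs_def])
  qed
  have dk2: "ennreal ((cmod (l2_nth (a s - b s) k))\<^sup>2) \<le> ennreal (1 / (2 * \<epsilon>)) * (\<integral>\<^sup>+\<tau>. ennreal ((cmod (l2_nth (\<delta> \<tau>) k))\<^sup>2) \<partial>open_time s)"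
    if s: "0 < s" for s k
  proof -
    let ?E = "\<lambda>\<tau>. ennreal (heat_symbol (\<epsilon> * (s - \<tau>)) k * norm (freq k))"
    let ?d = "\<lambda>\<tau>. ennreal (cmod (l2_nth (\<delta> \<tau>) k))"
    have m1: "?E \<in> borel_measurable (open_time s)"
      unfolding heat_symbol_def
      by (intro measurable_compose[OF _ measurable_ennreal] borel_measurable_open_time continuous_intros)
    have m2: "?d \<in> borel_measurable (open_time s)"
      by (intro measurable_compose[OF _ measurable_ennreal] borel_measurable_open_time continuous_intros continuous_on_subset[OF c\<delta>]) auto
    have "ennreal (cmod (l2_nth (a s - b s) k)) \<le> (\<integral>\<^sup>+\<tau>. ennreal (cmod (duhamel_coeff \<epsilon> \<delta> s \<tau> k)) \<partial>open_time s)"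
      unfolding dk[OF s] norm_minus_cancel
      by (cases "integrable (open_time s) (\<lambda>\<tau>. duhamel_coeff \<epsilon> \<delta> s \<tau> k)")
        (auto simp: integral_norm_bound_ennreal not_integrable_integral_eq)
    also have "\<dots> = (\<integral>\<^sup>+\<tau>. ?E \<tau> * ?d \<tau> \<partial>open_time s)"
      using heat_symbol_pos[THEN less_imp_le]
      by (intro nn_integral_cong) (simp add: duhamel_coeff_def norm_mult ennreal_mult[symmetric] mult.assoc)
    finally have "(ennreal (cmod (l2_nth (a s - b s) k)))\<^sup>2 \<le> (\<integral>\<^sup>+\<tau>. ?E \<tau> * ?d \<tau> \<partial>open_time s)\<^sup>2"
      by (rule power_mono) simp
    also have "\<dots> \<le> (\<integral>\<^sup>+\<tau>. (?E \<tau>)\<^sup>2 \<partial>open_time s) * (\<integral>\<^sup>+\<tau>. (?d \<tau>)\<^sup>2 \<partial>open_time s)"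
      by (rule Cauchy_Schwarz_nn_integral[OF m1 m2])
    also have "\<dots> \<le> ennreal (1 / (2 * \<epsilon>)) * (\<integral>\<^sup>+\<tau>. (?d \<tau>)\<^sup>2 \<partial>open_time s)"
      by (intro mult_right_mono nn_integral_heat_gradient_le \<epsilon> s) auto
    finally show ?thesis by (simp add: ennreal_power)
  qed
  have "y t = 0"
  proof (rule gronwall_zero[where y = y and t = t and T = t and K = "1 / (2 * \<epsilon>) * K" and B = "(2 * R)\<^sup>2"])
    fix s assume s: "0 < s" "s \<le> t"
    have "norm (a s - b s) \<le> 2 * R" using norm_triangle_ineq4[of "a s" "b s"] Ra[OF s(1)] Rb[OF s(1)] by linarith
    then show "y s \<le> (2 * R)\<^sup>2" unfolding y_def by (intro power_mono) auto
    show "0 \<le> y s" by (simp add: y_def)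
    interpret P: pair_sigma_finite "open_time s" lattice
      by (intro pair_sigma_finite.intro sigma_finite_lattice sigma_finite_open_time)
    have m2: "(\<lambda>\<tau>. ennreal ((cmod (l2_nth (\<delta> \<tau>) k))\<^sup>2)) \<in> borel_measurable (open_time s)" for k
      by (intro measurable_compose[OF _ measurable_ennreal] borel_measurable_open_time continuous_intros continuous_on_subset[OF c\<delta>]) auto
    have pm: "(\<lambda>(\<tau>, k). ennreal ((cmod (l2_nth (\<delta> \<tau>) k))\<^sup>2)) \<in> borel_measurable (open_time s \<Otimes>\<^sub>M lattice)"
      by (rule measurable_pair_lattice_swap) (rule m2)
    have "ennreal (y s) = (\<integral>\<^sup>+k. ennreal ((cmod (l2_nth (a s - b s) k))\<^sup>2) \<partial>lattice)"
      by (simp only: y_def l2_norm_sq_ennreal)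
    also have "\<dots> \<le> (\<integral>\<^sup>+k. ennreal (1 / (2 * \<epsilon>)) * (\<integral>\<^sup>+\<tau>. ennreal ((cmod (l2_nth (\<delta> \<tau>) k))\<^sup>2) \<partial>open_time s) \<partial>lattice)"
      by (intro nn_integral_mono dk2 s)
    also have "\<dots> = ennreal (1 / (2 * \<epsilon>)) * (\<integral>\<^sup>+k. \<integral>\<^sup>+\<tau>. ennreal ((cmod (l2_nth (\<delta> \<tau>) k))\<^sup>2) \<partial>open_time s \<partial>lattice)"
      by (rule nn_integral_cmult) simp
    also have "(\<integral>\<^sup>+k. \<integral>\<^sup>+\<tau>. ennreal ((cmod (l2_nth (\<delta> \<tau>) k))\<^sup>2) \<partial>open_time s \<partial>lattice)
       = (\<integral>\<^sup>+\<tau>. ennreal ((norm (\<delta> \<tau>))\<^sup>2) \<partial>open_time s)"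
      using P.Fubini'[OF pm] by (simp add: l2_norm_sq_ennreal)
    also have "\<dots> \<le> (\<integral>\<^sup>+\<tau>. ennreal K * ennreal (y \<tau>) \<partial>open_time s)"
    proof (intro nn_integral_mono)
      fix \<tau> assume "\<tau> \<in> space (open_time s)"
      then have "ennreal ((norm (\<delta> \<tau>))\<^sup>2) \<le> ennreal (K * y \<tau>)"
        by (intro ennreal_leI \<delta>le) (simp add: space_restrict_space)
      then show "ennreal ((norm (\<delta> \<tau>))\<^sup>2) \<le> ennreal K * ennreal (y \<tau>)"
        using K0 by (simp add: ennreal_mult y_def)
    qed
    also have "\<dots> = ennreal K * (\<integral>\<^sup>+\<tau>. ennreal (y \<tau>) \<partial>open_time s)"
      unfolding y_def
      by (intro nn_integral_cmult measurable_compose[OF _ measurable_ennreal] borel_measurable_open_time continuous_intros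
          continuous_on_subset[OF ca] continuous_on_subset[OF cb]) auto
    also have "\<dots> \<le> ennreal K * (\<integral>\<^sup>+\<tau>. ennreal (y \<tau>) \<partial>time s)"
      by (intro mult_left_mono nn_integral_open_time_le) simp
    finally have "ennreal (y s) \<le> ennreal (1 / (2 * \<epsilon>)) * (ennreal K * (\<integral>\<^sup>+\<tau>. ennreal (y \<tau>) \<partial>time s))"
      by (simp add: mult_left_mono)
    moreover have "ennreal (1 / (2 * \<epsilon>) * K) = ennreal (1 / (2 * \<epsilon>)) * ennreal K"
      using \<epsilon> K0 by (intro ennreal_mult) auto
    ultimately show "ennreal (y s) \<le> ennreal (1 / (2 * \<epsilon>) * K) * (\<integral>\<^sup>+\<tau>. ennreal (y \<tau>) \<partial>time s)"
      by (simp only: mult.assoc)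
  qed (use \<epsilon> K0 t in auto)
  then show ?thesis by (simp add: y_def)
qed

end

section \<open>Fourier series in Lebesgue and Sobolev spaces\<close>

lemma in_Lp_3_iff: "in_Lp 3 f \<longleftrightarrow> L3 f"
  by (simp add: in_Lp_def L3_def)

lemma Lp_norm_3: "Lp_norm 3 f = (LINT x|torus. \<bar>f x\<bar> ^ 3) powr (1 / 3)"
  by (simp add: Lp_norm_def)

lemma Lp_norm_nonneg: "0 \<le> Lp_norm p f"
  by (simp add: Lp_norm_def)

lemma Lp_norm_3_cube: "Lp_norm 3 f ^ 3 = (LINT x|torus. \<bar>f x\<bar> ^ 3)"
proof -
  have "0 \<le> (LINT x|torus. \<bar>f x\<bar> ^ 3)" by (intro integral_nonneg_AE) simp
  then have "((LINT x|torus. \<bar>f x\<bar> ^ 3) powr (1 / 3)) powr 3 = (LINT x|torus. \<bar>f x\<bar> ^ 3)"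
    by (simp add: powr_powr del: powr_numeral)
  then show ?thesis by (simp add: Lp_norm_3)
qed

lemma L3_diff:
  assumes "L3 f" "L3 g" shows "L3 (\<lambda>x. f x - g x)"
  unfolding L3_def
proof
  show m: "(\<lambda>x. f x - g x) \<in> borel_measurable torus" using assms by (auto simp: L3_def)
  show "integrable torus (\<lambda>x. \<bar>f x - g x\<bar> ^ 3)"
  proof (rule Bochner_Integration.integrable_bound[of _ "\<lambda>x. 9 * (\<bar>f x\<bar> ^ 3 + \<bar>g x\<bar> ^ 3)"])
    show "integrable torus (\<lambda>x. 9 * (\<bar>f x\<bar> ^ 3 + \<bar>g x\<bar> ^ 3))" using assms by (auto simp: L3_def)
    show "AE x in torus. norm (\<bar>f x - g x\<bar> ^ 3) \<le> norm (9 * (\<bar>f x\<bar> ^ 3 + \<bar>g x\<bar> ^ 3))"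
    proof (rule AE_I2)
      fix x
      have "\<bar>f x - g x\<bar> ^ 3 \<le> 9 * (\<bar>f x\<bar> ^ 3 + \<bar>g x\<bar> ^ 3)"
        using cube_sum3_le[of "f x" "- g x" 0] by simp
      then show "norm (\<bar>f x - g x\<bar> ^ 3) \<le> norm (9 * (\<bar>f x\<bar> ^ 3 + \<bar>g x\<bar> ^ 3))" by simp
    qed
  qed (use m in measurable)
qed

lemma bounded_in_Lp:
  assumes m: "g \<in> borel_measurable torus" and b: "\<And>x. \<bar>g x\<bar> \<le> T" and p: "0 < p"
  shows "in_Lp p g" and "Lp_norm p g \<le> ((2 * pi) ^ 3) powr (1 / p) * T"
proof -
  have T: "0 \<le> T" using b[of 0] by linarith
  have le: "\<bar>g x\<bar> powr p \<le> T powr p" for x using b p by (intro powr_mono2) auto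
  have i: "integrable torus (\<lambda>x. \<bar>g x\<bar> powr p)"
    by (rule torus.integrable_const_bound[of _ "T powr p"]) (use le m in auto)
  then show "in_Lp p g" using m by (simp add: in_Lp_def)
  have "(LINT x|torus. \<bar>g x\<bar> powr p) \<le> (LINT x|torus. T powr p)"
    by (rule integral_mono[OF i]) (auto intro: le)
  then have "(LINT x|torus. \<bar>g x\<bar> powr p) \<le> (2 * pi) ^ 3 * T powr p" by (simp add: measure_torus)
  then have "Lp_norm p g \<le> ((2 * pi) ^ 3 * T powr p) powr (1 / p)"
    unfolding Lp_norm_def using p by (intro powr_mono2) auto
  also have "\<dots> = ((2 * pi) ^ 3) powr (1 / p) * (T powr p) powr (1 / p)"
    by (rule powr_mult)
  also have "(T powr p) powr (1 / p) = T" using p T by (simp add: powr_powr)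
  finally show "Lp_norm p g \<le> ((2 * pi) ^ 3) powr (1 / p) * T" .
qed

text \<open>
  On coefficients with mean zero it dominates the supremum norms of the series and of its
  derivatives of order at most 2.
\<close>

definition wiener_norm :: "(int^3 \<Rightarrow> complex) \<Rightarrow> real" where
  "wiener_norm c = (LINT k|lattice. (norm (freq k))\<^sup>2 * cmod (c k))"

text \<open>
  The bound provided by \<open>coeff_decay\<close>, together with zero mean and reality. The power 6 makes the
  sum of \<open>|k|\<^sup>2 |c\<^sub>k|\<close> converge with a dominating sequence \<open>B |k|^(-4)\<close> that depends on \<open>B\<close> only.
\<close>

definition rapid :: "real \<Rightarrow> (int^3 \<Rightarrow> complex) \<Rightarrow> bool" where
  "rapid B c \<longleftrightarrow> c 0 = 0 \<and> (\<forall>k. norm (freq k) ^ 6 * cmod (c k) \<le> B) \<and> (\<forall>k. c (- k) = cnj (c k))"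

lemma rapid_weighted_le:
  assumes "rapid B c"
  shows "(norm (freq k))\<^sup>2 * cmod (c k) \<le> B * (1 / norm (freq k) ^ 4)"
    and "cmod (c k) \<le> (norm (freq k))\<^sup>2 * cmod (c k)"
proof -
  show "(norm (freq k))\<^sup>2 * cmod (c k) \<le> B * (1 / norm (freq k) ^ 4)"
  proof (cases "k = 0")
    case False
    then have "0 < norm (freq k) ^ 4" by simp
    moreover have "(norm (freq k))\<^sup>2 * cmod (c k) * norm (freq k) ^ 4 = norm (freq k) ^ 6 * cmod (c k)"
      by (simp add: power_add[symmetric])
    moreover have "norm (freq k) ^ 6 * cmod (c k) \<le> B" using assms by (simp add: rapid_def)
    ultimately have "(norm (freq k))\<^sup>2 * cmod (c k) \<le> B / norm (freq k) ^ 4"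
      by (simp only: pos_le_divide_eq)
    then show ?thesis by simp
  qed simp
  show "cmod (c k) \<le> (norm (freq k))\<^sup>2 * cmod (c k)"
  proof (cases "k = 0")
    case False
    then have "1 \<le> (norm (freq k))\<^sup>2" using norm_freq_ge_1[of k] by (simp add: one_le_power)
    then show ?thesis using mult_right_mono[of 1 "(norm (freq k))\<^sup>2" "cmod (c k)"] by simp
  qed (use assms in \<open>simp add: rapid_def\<close>)
qed

lemma rapid_integrable:
  assumes "rapid B c"
  shows "integrable lattice (\<lambda>k. (norm (freq k))\<^sup>2 * cmod (c k))"
    and "integrable lattice c" and "wiener_norm c \<le> B * weight_sum"
    and "(LINT k|lattice. cmod (c k)) \<le> wiener_norm c"
proof -
  note le = rapid_weighted_le[OF assms]
  show i: "integrable lattice (\<lambda>k. (norm (freq k))\<^sup>2 * cmod (c k))"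
  proof (rule Bochner_Integration.integrable_bound)
    show i4: "integrable lattice (\<lambda>k. B * (1 / norm (freq k) ^ 4))"
      by (intro Bochner_Integration.integrable_mult_right integrable_lattice_weight)
    show "AE k in lattice. norm ((norm (freq k))\<^sup>2 * cmod (c k)) \<le> norm (B * (1 / norm (freq k) ^ 4))"
      using order_trans[OF le(1) abs_ge_self] by (intro AE_I2) (simp add: abs_mult)
  qed simp
  show ic: "integrable lattice c"
    by (rule Bochner_Integration.integrable_bound[OF i]) (use le(2) in \<open>auto simp: abs_mult\<close>)
  have "wiener_norm c \<le> (LINT k|lattice. B * (1 / norm (freq k) ^ 4))"
    unfolding wiener_norm_def
    by (rule integral_mono[OF i]) (intro Bochner_Integration.integrable_mult_right integrable_lattice_weight, rule le(1))
  also have "\<dots> = B * weight_sum" unfolding weight_sum_def by (rule integral_mult_right_zero)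
  finally show "wiener_norm c \<le> B * weight_sum" .
  show "(LINT k|lattice. cmod (c k)) \<le> wiener_norm c"
    unfolding wiener_norm_def by (rule integral_mono[OF integrable_norm[OF ic] i le(2)])
qed

lemma rapid_diff:
  assumes "rapid B c" "rapid B' d" shows "rapid (B + B') (\<lambda>k. c k - d k)"
  unfolding rapid_def
proof (intro conjI allI)
  fix k
  have "norm (freq k) ^ 6 * cmod (c k - d k) \<le> norm (freq k) ^ 6 * (cmod (c k) + cmod (d k))"
    by (intro mult_left_mono norm_triangle_ineq4) simp
  also have "\<dots> \<le> B + B'" using assms by (simp add: rapid_def distrib_left add_mono)
  finally show "norm (freq k) ^ 6 * cmod (c k - d k) \<le> B + B'" .
qed (use assms in \<open>auto simp: rapid_def\<close>)

text \<open>All nonzero frequencies have norm at least 1.\<close>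

lemma frac_laplacian_symbol_le:
  assumes "0 \<le> s" "s \<le> 2" "k \<noteq> 0"
  shows "\<bar>frac_laplacian_symbol s k\<bar> \<le> (norm (freq k))\<^sup>2"
proof -
  have 1: "1 \<le> norm (freq k)" by (rule norm_freq_ge_1[OF assms(3)])
  have "norm (freq k) powr s \<le> norm (freq k) powr 2" by (rule powr_mono[OF assms(2) 1])
  moreover have "1 \<le> (norm (freq k))\<^sup>2" using 1 by (simp add: one_le_power)
  ultimately show ?thesis using 1 by (simp add: frac_laplacian_symbol_def)
qed

lemma abs_real_series_le:
  assumes "integrable lattice c"
  shows "\<bar>real_series c x\<bar> \<le> (LINT k|lattice. cmod (c k))"
  unfolding real_series_def using abs_Re_le_cmod norm_fseries_le[OF assms] by (rule order_trans)

lemma real_series_measurable [measurable]: "real_series c \<in> borel_measurable torus"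
  unfolding real_series_def[abs_def] by measurable

lemma real_series_Lp:
  assumes r: "rapid B c" and p: "0 < p"
  shows "in_Lp p (real_series c)" "Lp_norm p (real_series c) \<le> ((2 * pi) ^ 3) powr (1 / p) * wiener_norm c"
proof -
  have "\<bar>real_series c x\<bar> \<le> wiener_norm c" for x
    using abs_real_series_le[OF rapid_integrable(2)[OF r]] rapid_integrable(4)[OF r] by (rule order_trans)
  from bounded_in_Lp[OF real_series_measurable this p]
  show "in_Lp p (real_series c)" "Lp_norm p (real_series c) \<le> ((2 * pi) ^ 3) powr (1 / p) * wiener_norm c" .
qed

text \<open>
  The fractional derivative is itself an absolutely convergent series bounded by the Wiener norm,
  and on a space of finite measure the supremum dominates every \<open>L\<^sup>p\<close> norm.
\<close>

lemma real_series_sobolev: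
  assumes r: "rapid B c" and s: "0 \<le> s" "s \<le> 2" and p: "0 < p"
  shows "in_sobolev s p (real_series c)"
    and "sobolev_norm s p (real_series c) \<le> ((2 * pi) ^ 3) powr (1 / p) * wiener_norm c"
proof -
  let ?m = "frac_laplacian_symbol s"
  have c: "integrable lattice c" by (rule rapid_integrable(2)[OF r])
  have fc: "fourier_coeff (real_series c) = c"
    by (rule ext, rule fourier_coeff_real_series[OF _ c]) (use r in \<open>simp add: rapid_def\<close>)
  have le: "cmod (complex_of_real (?m k) * c k) \<le> (norm (freq k))\<^sup>2 * cmod (c k)" for k
  proof (cases "k = 0")
    case False
    then show ?thesis using frac_laplacian_symbol_le[OF s, of k] by (simp add: norm_mult mult_right_mono)
  qed (use r in \<open>simp add: rapid_def\<close>)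
  note i = rapid_integrable(1)[OF r]
  have mi: "integrable lattice (\<lambda>k. complex_of_real (?m k) * c k)"
    by (rule Bochner_Integration.integrable_bound[OF i]) (use le in \<open>auto simp: abs_mult\<close>)
  define g where "g = real_series (\<lambda>k. complex_of_real (?m k) * c k)"
  have g: "is_multiplier ?m (real_series c) g"
    using is_multiplier_real_series[of ?m "real_series c", unfolded fc] mi real_series_integrable[OF c]
    by (simp add: g_def frac_laplacian_symbol_def freq_minus)
  have "\<bar>g x\<bar> \<le> wiener_norm c" for x
  proof -
    have "\<bar>g x\<bar> \<le> (LINT k|lattice. cmod (complex_of_real (?m k) * c k))"
      unfolding g_def by (rule abs_real_series_le[OF mi])
    also have "\<dots> \<le> wiener_norm c"
      unfolding wiener_norm_def by (rule integral_mono[OF integrable_norm[OF mi] i le])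
    finally show ?thesis .
  qed
  note b = bounded_in_Lp[OF _ this p]
  have gm: "g \<in> borel_measurable torus" unfolding g_def by measurable
  show "in_sobolev s p (real_series c)"
    unfolding in_sobolev_def using g b(1)[OF gm] by blast
  note ae = multiplier_AE_eq[OF g]
  have mm: "multiplier ?m (real_series c) \<in> borel_measurable torus"
    using ae(1) by (auto simp: is_multiplier_def)
  have "(LINT x|torus. \<bar>multiplier ?m (real_series c) x\<bar> powr p) = (LINT x|torus. \<bar>g x\<bar> powr p)"
  proof (rule integral_cong_AE)
    show "AE x in torus. \<bar>multiplier ?m (real_series c) x\<bar> powr p = \<bar>g x\<bar> powr p"
      using ae(2) by eventually_elim simp
  qed (use mm gm in measurable)
  then have "sobolev_norm s p (real_series c) = Lp_norm p g"
    by (simp add: sobolev_norm_def Lp_norm_def)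
  then show "sobolev_norm s p (real_series c) \<le> ((2 * pi) ^ 3) powr (1 / p) * wiener_norm c"
    using b(2)[OF gm] by simp
qed

text \<open>Dominated convergence along sequences.\<close>

lemma wiener_norm_tendsto_0:
  fixes d :: "real \<Rightarrow> int^3 \<Rightarrow> complex"
  assumes r: "\<forall>\<^sub>F t in at t0. rapid B (d t)" and lim: "\<And>k. ((\<lambda>t. d t k) \<longlongrightarrow> 0) (at t0)"
  shows "((\<lambda>t. wiener_norm (d t)) \<longlongrightarrow> 0) (at t0)"
proof -
  obtain S where S: "open S" "t0 \<in> S" and rS: "\<And>t. t \<in> S \<Longrightarrow> t \<noteq> t0 \<Longrightarrow> rapid B (d t)"
    using r unfolding eventually_at_topological by blast
  have "((\<lambda>t. wiener_norm (d t)) \<longlongrightarrow> 0) (at t0 within S)"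
    unfolding tendsto_at_iff_sequentially
  proof (intro allI impI)
    fix X assume X: "\<forall>i. X i \<in> S - {t0}" "X \<longlonglongrightarrow> t0"
    have rX: "rapid B (d (X i))" for i using X(1) rS by blast
    have Xat: "filterlim X (at t0) sequentially"
      using X by (intro filterlim_atI) (auto intro: always_eventually)
    have "(\<lambda>i. LINT k|lattice. (norm (freq k))\<^sup>2 * cmod (d (X i) k)) \<longlonglongrightarrow> (LINT k|lattice. (0::real))"
    proof (rule integral_dominated_convergence)
      show "integrable lattice (\<lambda>k. B * (1 / norm (freq k) ^ 4))"
        by (intro Bochner_Integration.integrable_mult_right integrable_lattice_weight)
      show "AE k in lattice. (\<lambda>i. (norm (freq k))\<^sup>2 * cmod (d (X i) k)) \<longlonglongrightarrow> 0"
      proof (rule AE_I2)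
        fix k
        have "(\<lambda>i. (norm (freq k))\<^sup>2 * cmod (d (X i) k)) \<longlonglongrightarrow> (norm (freq k))\<^sup>2 * cmod 0"
          by (intro tendsto_mult tendsto_const tendsto_norm filterlim_compose[OF lim Xat])
        then show "(\<lambda>i. (norm (freq k))\<^sup>2 * cmod (d (X i) k)) \<longlonglongrightarrow> 0" by simp
      qed
      show "AE k in lattice. norm ((norm (freq k))\<^sup>2 * cmod (d (X i) k)) \<le> B * (1 / norm (freq k) ^ 4)" for i
        using rapid_weighted_le(1)[OF rX] by (intro AE_I2) (simp add: abs_mult)
    qed simp_all
    then show "((\<lambda>t. wiener_norm (d t)) \<circ> X) \<longlonglongrightarrow> 0"
      by (simp add: wiener_norm_def[abs_def] comp_def)
  qed
  then show ?thesis by (simp only: at_within_open[OF S(2,1)])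
qed

text \<open>
  Continuity in any norm that the Wiener norm dominates follows from continuity of the single
  coefficients and a locally uniform decay bound. The lemma is applied to \<open>L\<^sup>3\<close> and to all the
  Sobolev norms.
\<close>

lemma C_pos_real_series:
  assumes r: "\<And>t0. 0 < t0 \<Longrightarrow> \<exists>B. (\<forall>\<^sub>F t in nhds t0. rapid B (c t))"
    and lim: "\<And>t0 k. 0 < t0 \<Longrightarrow> ((\<lambda>t. c t k) \<longlongrightarrow> c t0 k) (at t0)"
    and X: "\<And>B d. rapid B d \<Longrightarrow> X (real_series d)" 
    and n: "\<And>B d. rapid B d \<Longrightarrow> nrm (real_series d) \<le> C * wiener_norm d" "\<And>f. 0 \<le> nrm f"
  shows "C_pos X nrm (\<lambda>t. real_series (c t))"
  unfolding C_pos_def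
proof (intro conjI allI impI)
  fix t :: real assume t: "0 < t"
  then obtain B where B: "\<forall>\<^sub>F u in nhds t. rapid B (c u)" using r by blast
  have Bt: "rapid B (c t)" using eventually_nhds_x_imp_x[OF B] .
  then show "X (real_series (c t))" by (rule X)
  have B': "\<forall>\<^sub>F u in at t. rapid B (c u)" using B by (simp add: eventually_nhds_conv_at)
  have d: "\<forall>\<^sub>F u in at t. rapid (B + B) (\<lambda>k. c u k - c t k)"
    using B' by eventually_elim (rule rapid_diff[OF _ Bt])
  have "((\<lambda>u. wiener_norm (\<lambda>k. c u k - c t k)) \<longlongrightarrow> 0) (at t)"
    by (rule wiener_norm_tendsto_0[OF d]) (use lim[OF t] in \<open>simp add: LIM_zero\<close>)
  then have z: "((\<lambda>u. C * wiener_norm (\<lambda>k. c u k - c t k)) \<longlongrightarrow> 0) (at t)"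
    by (rule tendsto_mult_right_zero)
  show "((\<lambda>u. nrm (\<lambda>x. real_series (c u) x - real_series (c t) x)) \<longlongrightarrow> 0) (at t)"
  proof (rule Lim_null_comparison[OF _ z])
    show "\<forall>\<^sub>F u in at t. norm (nrm (\<lambda>x. real_series (c u) x - real_series (c t) x)) \<le> C * wiener_norm (\<lambda>k. c u k - c t k)"
      using B' d
    proof eventually_elim
      case (elim u)
      have "(\<lambda>x. real_series (c u) x - real_series (c t) x) = real_series (\<lambda>k. c u k - c t k)"
        using fseries_diff[OF rapid_integrable(2)[OF elim(1)] rapid_integrable(2)[OF Bt]]
        by (simp add: real_series_def fun_eq_iff)
      then show ?case using n(1)[OF elim(2)] n(2) by simp
    qed
  qed
qed

lemma real_series_cmult: "r * real_series c x = real_series (\<lambda>k. complex_of_real r * c k) x"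
  by (simp add: real_series_def fseries_def mult.assoc)

section \<open>Coefficients of functions in the solution class\<close>

lemma hat_diff:
  assumes "L3 f" "L3 g" shows "hat (\<lambda>x. f x - g x) = hat f - hat g"
proof (rule l2_eqI)
  fix k
  have "integrable torus (\<lambda>x. complex_of_real (f x))" "integrable torus (\<lambda>x. complex_of_real (g x))"
    using L3_integrable[OF assms(1)] L3_integrable[OF assms(2)] by simp_all
  from coef_diff[OF this] show "l2_nth (hat (\<lambda>x. f x - g x)) k = l2_nth (hat f - hat g) k"
    by (simp add: l2_nth_hat(1) assms L3_diff fourier_coeff_eq_coef)
qed

text \<open>
  On a space of finite measure \<open>L\<^sup>3\<close> embeds into \<open>L\<^sup>2\<close>. The inequality \<open>u\<^sup>2 \<le> \<delta>\<^sup>2 + |u|\<^sup>3 / \<delta>\<close>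
  with \<open>\<delta>\<close> slightly larger than the \<open>L\<^sup>3\<close> norm proves this with constant 2, the total mass being
  at least 1.
\<close>

lemma norm_hat_le:
  assumes f: "L3 f" shows "norm (hat f) \<le> 2 * Lp_norm 3 f"
proof (rule field_le_epsilon)
  fix e :: real assume e: "0 < e"
  define r where "r = Lp_norm 3 f"
  have r: "0 \<le> r" by (simp add: r_def Lp_norm_nonneg)
  \<comment> \<open>The \<open>L\<^sup>3\<close> norm may be zero, so it is enlarged to make \<open>\<delta>\<close> positive.\<close>
  define \<delta> where "\<delta> = r + e / 2"
  have \<delta>: "0 < \<delta>" "r \<le> \<delta>" using r e by (auto simp: \<delta>_def)
  have le: "u\<^sup>2 \<le> \<delta>\<^sup>2 + \<bar>u\<bar> ^ 3 / \<delta>" for u :: real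
  proof (cases "\<bar>u\<bar> \<le> \<delta>")
    case True
    then have "u\<^sup>2 \<le> \<delta>\<^sup>2" using power_mono[OF True, of 2] by simp
    moreover have "0 \<le> \<bar>u\<bar> ^ 3 / \<delta>" using \<delta> by simp
    ultimately show ?thesis by linarith
  next
    case False
    then have "\<bar>u\<bar>\<^sup>2 * \<delta> \<le> \<bar>u\<bar>\<^sup>2 * \<bar>u\<bar>" by (intro mult_left_mono) auto
    also have "\<dots> = \<bar>u\<bar> ^ 3" by (simp add: power2_eq_square power3_eq_cube)
    finally have "u\<^sup>2 \<le> \<bar>u\<bar> ^ 3 / \<delta>" using \<delta> by (simp add: pos_le_divide_eq)
    moreover have "0 \<le> \<delta>\<^sup>2" by simp
    ultimately show ?thesis by linarith
  qed
  define V :: real where "V = (2 * pi) ^ 3"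
  have V: "1 \<le> V" unfolding V_def using pi_gt3 by (intro one_le_power) simp
  have i3: "integrable torus (\<lambda>x. \<bar>f x\<bar> ^ 3)" using f by (simp add: L3_def)
  have "V * (norm (hat f))\<^sup>2 \<le> (LINT x|torus. (f x)\<^sup>2)"
    unfolding V_def by (rule l2_nth_hat(2)[OF f])
  also have "\<dots> \<le> (LINT x|torus. \<delta>\<^sup>2 + \<bar>f x\<bar> ^ 3 / \<delta>)"
    by (rule integral_mono[OF L3_square_integrable[OF f]]) (use i3 le in auto)
  also have "\<dots> = V * \<delta>\<^sup>2 + r ^ 3 / \<delta>"
    using i3 by (simp add: measure_torus V_def r_def Lp_norm_3_cube)
  finally have "V * (norm (hat f))\<^sup>2 \<le> V * \<delta>\<^sup>2 + r ^ 3 / \<delta>" .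
  moreover have "r ^ 3 / \<delta> \<le> \<delta>\<^sup>2"
  proof -
    have "r ^ 3 \<le> \<delta> ^ 3" by (rule power_mono[OF \<delta>(2) r])
    also have "\<dots> = \<delta>\<^sup>2 * \<delta>" by (simp add: power2_eq_square power3_eq_cube)
    finally show ?thesis using \<delta> by (simp add: pos_divide_le_eq)
  qed
  moreover have "\<delta>\<^sup>2 \<le> V * \<delta>\<^sup>2" using mult_right_mono[OF V, of "\<delta>\<^sup>2"] by simp
  ultimately have "V * (norm (hat f))\<^sup>2 \<le> V * \<delta>\<^sup>2 + V * \<delta>\<^sup>2" by linarith
  then have "V * (norm (hat f))\<^sup>2 \<le> V * (2 * \<delta>\<^sup>2)" by simp
  then have "(norm (hat f))\<^sup>2 \<le> 2 * \<delta>\<^sup>2" using V by (simp add: mult_le_cancel_left)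
  moreover have "(2 * \<delta>)\<^sup>2 = 4 * \<delta>\<^sup>2" by (simp add: power_mult_distrib)
  moreover have "0 \<le> \<delta>\<^sup>2" by simp
  ultimately have "(norm (hat f))\<^sup>2 \<le> (2 * \<delta>)\<^sup>2" by linarith
  then have "norm (hat f) \<le> 2 * \<delta>" by (rule power2_le_imp_le) (use \<delta> in simp)
  then show "norm (hat f) \<le> 2 * Lp_norm 3 f + e" by (simp add: \<delta>_def r_def)
qed

lemma hat_continuous:
  assumes "C_pos (in_Lp 3) (Lp_norm 3) \<theta>"
  shows "continuous_on {0<..} (\<lambda>t. hat (\<theta> t))"
  unfolding continuous_on_def
proof (intro ballI)
  fix t :: real assume "t \<in> {0<..}"
  then have t: "0 < t" by simp
  have L: "L3 (\<theta> u)" if "0 < u" for u using assms that by (simp add: C_pos_def in_Lp_3_iff)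
  have "((\<lambda>u. Lp_norm 3 (\<lambda>x. \<theta> u x - \<theta> t x)) \<longlongrightarrow> 0) (at t)"
    using assms t by (simp add: C_pos_def)
  then have z: "((\<lambda>u. 2 * Lp_norm 3 (\<lambda>x. \<theta> u x - \<theta> t x)) \<longlongrightarrow> 0) (at t)"
    by (rule tendsto_mult_right_zero)
  have "((\<lambda>u. hat (\<theta> u) - hat (\<theta> t)) \<longlongrightarrow> 0) (at t)"
  proof (rule Lim_null_comparison[OF _ z])
    have "\<forall>\<^sub>F u in at t. 0 < u"
      using order_tendstoD(1)[OF tendsto_ident_at t] .
    then show "\<forall>\<^sub>F u in at t. norm (hat (\<theta> u) - hat (\<theta> t)) \<le> 2 * Lp_norm 3 (\<lambda>x. \<theta> u x - \<theta> t x)"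
    proof eventually_elim
      case (elim u)
      then show ?case using norm_hat_le[OF L3_diff[OF L[OF elim] L[OF t]]] hat_diff[OF L[OF elim] L[OF t]] by simp
    qed
  qed
  then have "((\<lambda>u. hat (\<theta> u)) \<longlongrightarrow> hat (\<theta> t)) (at t)" by (simp add: LIM_zero_iff)
  then show "((\<lambda>u. hat (\<theta> u)) \<longlongrightarrow> hat (\<theta> t)) (at t within {0<..})"
    using tendsto_within_subset by blast
qed

section \<open>The constructed solution\<close>

lemma rapid_mono: "rapid B c \<Longrightarrow> B \<le> B' \<Longrightarrow> rapid B' c"
  by (auto simp: rapid_def intro: order_trans)

lemma rapid_cmult:
  assumes "rapid B c" "\<bar>r\<bar> \<le> R" "0 \<le> B" shows "rapid (R * B) (\<lambda>k. complex_of_real r * c k)"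
  unfolding rapid_def
proof (intro conjI allI)
  fix k
  have "\<bar>r\<bar> * (norm (freq k) ^ 6 * cmod (c k)) \<le> R * B"
    using assms by (intro mult_mono) (auto simp: rapid_def)
  then show "norm (freq k) ^ 6 * cmod (complex_of_real r * c k) \<le> R * B"
    by (simp add: norm_mult mult_ac)
qed (use assms in \<open>auto simp: rapid_def\<close>)

text \<open>
  The situation after \<open>global_coefficients\<close>: global coefficients \<open>a\<close> with data \<open>hat f\<close>. It remains
  to recover the statements about functions.
\<close>

locale transport_solution = drift_symbol +
  fixes \<epsilon> :: real and a :: "real \<Rightarrow> l2" and f :: "real^3 \<Rightarrow> real"
  assumes \<epsilon>: "0 < \<epsilon>" and f: "L3 f"
    and F: "forced \<epsilon> a (\<lambda>t. quad (a t) (a t))" and a_0: "a 0 = hat f"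
    and symmetric: "0 \<le> t \<Longrightarrow> symmetric_coeffs (a t)"
    and zero_mode: "0 \<le> t \<Longrightarrow> l2_nth (a t) 0 = 0"
    and mono: "0 \<le> s \<Longrightarrow> s \<le> t \<Longrightarrow> norm (a t) \<le> norm (a s)"
begin

definition solution :: "real \<Rightarrow> real^3 \<Rightarrow> real" where
  "solution t = real_series (l2_nth (a t))"

lemma solution_rapid:
  obtains A where "0 \<le> A" "\<And>t. 0 < t \<Longrightarrow> rapid (A * norm (a (t - min t 1)) / min t 1 ^ 3) (l2_nth (a t))"
proof -
  obtain A where A: "0 \<le> A"
    "\<And>t k. 0 < t \<Longrightarrow> norm (freq k) ^ 6 * cmod (l2_nth (a t) k) \<le> A * norm (a (t - min t 1)) / min t 1 ^ 3"
    by (rule coeff_decay[OF \<epsilon> F mono]) auto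
  show ?thesis
  proof (rule that[OF A(1)])
    fix t :: real assume t: "0 < t"
    show "rapid (A * norm (a (t - min t 1)) / min t 1 ^ 3) (l2_nth (a t))"
      unfolding rapid_def using A(2)[OF t] zero_mode[of t] symmetric[of t] t by (simp add: symmetric_coeffs_def)
  qed
qed

text \<open>
  The bound of \<open>coeff_decay\<close> deteriorates only as \<open>t \<rightarrow> 0\<close>.
\<close>

lemma solution_locally_rapid:
  assumes t0: "0 < t0" obtains B where "0 \<le> B" "\<forall>\<^sub>F t in nhds t0. rapid B (l2_nth (a t))"
proof -
  obtain A where A: "0 \<le> A" "\<And>t. 0 < t \<Longrightarrow> rapid (A * norm (a (t - min t 1)) / min t 1 ^ 3) (l2_nth (a t))"
    by (rule solution_rapid) auto
  define \<mu> where "\<mu> = min (t0 / 2) 1"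
  have \<mu>: "0 < \<mu>" using t0 by (simp add: \<mu>_def)
  have le: "A * norm (a (t - min t 1)) / min t 1 ^ 3 \<le> A * norm (a 0) / \<mu> ^ 3" if t: "t0 / 2 < t" for t
  proof -
    have "\<mu> ^ 3 \<le> min t 1 ^ 3" using t \<mu> by (intro power_mono) (auto simp: \<mu>_def)
    moreover have "A * norm (a (t - min t 1)) \<le> A * norm (a 0)" using t t0 by (intro mult_left_mono mono A(1)) auto
    ultimately show ?thesis using A(1) \<mu> by (intro frac_le) auto
  qed
  have "t0 / 2 < t0" using t0 by simp
  then have "\<forall>\<^sub>F t in nhds t0. t0 / 2 < t" by (rule order_tendstoD(1)[OF filterlim_ident])
  then have "\<forall>\<^sub>F t in nhds t0. rapid (A * norm (a 0) / \<mu> ^ 3) (l2_nth (a t))"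
  proof eventually_elim
    case (elim t)
    then have "0 < t" using t0 by simp
    from rapid_mono[OF A(2)[OF this] le[OF elim]] show ?case .
  qed
  moreover have "0 \<le> A * norm (a 0) / \<mu> ^ 3" using A(1) \<mu> by simp
  ultimately show ?thesis by (rule that[rotated])
qed

lemma solution_L3: assumes "0 < t" shows "L3 (solution t)" "hat (solution t) = a t"
proof -
  obtain A where A: "0 \<le> A" "\<And>t. 0 < t \<Longrightarrow> rapid (A * norm (a (t - min t 1)) / min t 1 ^ 3) (l2_nth (a t))"
    by (rule solution_rapid) auto
  note r = A(2)[OF assms]
  have "in_Lp 3 (real_series (l2_nth (a t)))" by (rule real_series_Lp(1)[OF r]) simp
  then show L: "L3 (solution t)" by (simp add: in_Lp_3_iff solution_def)
  show "hat (solution t) = a t"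
  proof (rule l2_eqI)
    fix k
    show "l2_nth (hat (solution t)) k = l2_nth (a t) k"
      unfolding l2_nth_hat(1)[OF L] unfolding solution_def
      by (rule fourier_coeff_real_series[OF _ rapid_integrable(2)[OF r]]) (use r in \<open>simp add: rapid_def\<close>)
  qed
qed

lemma coefficient_tendsto: "((\<lambda>t. l2_nth (a t) k) \<longlongrightarrow> l2_nth (a t0) k) (at t0)"
proof -
  have "continuous_on UNIV a" using F by (simp add: forced_def)
  then have "(a \<longlongrightarrow> a t0) (at t0)" by (simp add: continuous_on_def)
  then show ?thesis by (rule tendsto_l2_nth)
qed

lemma solution_C_pos_Lp: "C_pos (in_Lp 3) (Lp_norm 3) solution"
  unfolding solution_def
proof (rule C_pos_real_series[where c = "\<lambda>t. l2_nth (a t)"])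
  fix t0 :: real assume "0 < t0"
  then show "\<exists>B. \<forall>\<^sub>F t in nhds t0. rapid B (l2_nth (a t))" by (rule solution_locally_rapid) blast
qed (auto intro: coefficient_tendsto real_series_Lp Lp_norm_nonneg)

lemma solution_C_pos_sobolev:
  assumes s: "0 \<le> s" "s \<le> 2" and p: "0 < p"
  shows "C_pos (in_sobolev s p) (sobolev_norm s p) (\<lambda>t x. t powr w * solution t x)"
proof -
  have "C_pos (in_sobolev s p) (sobolev_norm s p) (\<lambda>t. real_series (\<lambda>k. complex_of_real (t powr w) * l2_nth (a t) k))"
  proof (rule C_pos_real_series)
    fix t0 :: real assume t0: "0 < t0"
    obtain B where B: "0 \<le> B" "\<forall>\<^sub>F t in nhds t0. rapid B (l2_nth (a t))" by (rule solution_locally_rapid[OF t0])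
    have lim: "((\<lambda>t. t powr w) \<longlongrightarrow> t0 powr w) (nhds t0)"
      using t0 by (intro tendsto_powr filterlim_ident tendsto_const) auto
    have "\<forall>\<^sub>F t in nhds t0. t powr w < t0 powr w + 1" by (rule order_tendstoD(2)[OF lim]) simp
    then have "\<forall>\<^sub>F t in nhds t0. rapid ((t0 powr w + 1) * B) (\<lambda>k. complex_of_real (t powr w) * l2_nth (a t) k)"
      using B(2) by eventually_elim (rule rapid_cmult, auto intro: B(1))
    then show "\<exists>B'. \<forall>\<^sub>F t in nhds t0. rapid B' (\<lambda>k. complex_of_real (t powr w) * l2_nth (a t) k)" by blast
    have "((\<lambda>t. t powr w) \<longlongrightarrow> t0 powr w) (at t0)"
      using t0 by (intro tendsto_powr tendsto_ident_at tendsto_const) auto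
    then show "((\<lambda>t. complex_of_real (t powr w) * l2_nth (a t) k) \<longlongrightarrow> complex_of_real (t0 powr w) * l2_nth (a t0) k) (at t0)" for k
      by (intro tendsto_mult tendsto_of_real coefficient_tendsto)
  next
    fix B d assume "rapid B d"
    from real_series_sobolev[OF this s p]
    show "in_sobolev s p (real_series d)" "sobolev_norm s p (real_series d) \<le> ((2 * pi) ^ 3) powr (1 / p) * wiener_norm d" .
  qed (simp add: sobolev_norm_def Lp_norm_nonneg)
  then show ?thesis by (simp add: solution_def real_series_cmult[abs_def])
qed

lemma solution_wiener_norm_le:
  obtains K where "0 \<le> K" "\<And>t. 1 \<le> t \<Longrightarrow> wiener_norm (l2_nth (a t)) \<le> K * norm (a (t - 1))"
    "\<And>t. 0 < t \<Longrightarrow> \<exists>B. rapid B (l2_nth (a t))"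
proof -
  obtain A where A: "0 \<le> A" "\<And>t. 0 < t \<Longrightarrow> rapid (A * norm (a (t - min t 1)) / min t 1 ^ 3) (l2_nth (a t))"
    by (rule solution_rapid) auto
  show ?thesis
  proof (rule that[of "A * weight_sum"])
    show "0 \<le> A * weight_sum" using A(1) weight_sum_nonneg by simp
    fix t :: real assume "1 \<le> t"
    then have "min t 1 = 1" "0 < t" by auto
    with rapid_integrable(3)[OF A(2)[of t]]
    show "wiener_norm (l2_nth (a t)) \<le> A * weight_sum * norm (a (t - 1))" by (simp add: mult_ac)
  qed (use A(2) in blast)
qed

text \<open>The square of the norm is at most \<open>|a(0)|\<^sup>2 / (1 + 2 \<epsilon> t)\<close>.\<close>

lemma norm_coeffs_tendsto_0: "((\<lambda>t. norm (a t)) \<longlongrightarrow> 0) at_top"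
proof -
  have "LIM t at_top. 1 + 2 * \<epsilon> * t :> at_top"
    by (intro filterlim_tendsto_add_at_top[OF tendsto_const] filterlim_tendsto_pos_mult_at_top[OF tendsto_const] filterlim_ident)
      (use \<epsilon> in simp)
  then have z: "((\<lambda>t. (norm (a 0))\<^sup>2 / (1 + 2 * \<epsilon> * t)) \<longlongrightarrow> 0) at_top"
    by (rule real_tendsto_divide_at_top[OF tendsto_const])
  have "((\<lambda>t. (norm (a t))\<^sup>2) \<longlongrightarrow> 0) at_top"
  proof (rule Lim_null_comparison[OF _ z])
    show "\<forall>\<^sub>F t in at_top. norm ((norm (a t))\<^sup>2) \<le> (norm (a 0))\<^sup>2 / (1 + 2 * \<epsilon> * t)"
      using eventually_ge_at_top[of 0]
    proof eventually_elim
      case (elim t)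
      have "forced \<epsilon> a (\<lambda>t. (\<lambda>_. 1) t *\<^sub>R quad (a t) (a t))" using F by simp
      from norm_decay[OF this \<epsilon> symmetric _ elim] have "(1 + 2 * \<epsilon> * t) * (norm (a t))\<^sup>2 \<le> (norm (a 0))\<^sup>2"
        by (simp add: zero_mode)
      moreover have "0 < 1 + 2 * \<epsilon> * t" using \<epsilon> elim by (simp add: add_pos_nonneg)
      ultimately show ?case by (simp add: pos_le_divide_eq mult.commute)
    qed
  qed
  from tendsto_real_sqrt[OF this] show ?thesis by simp
qed

text \<open>
  The Sobolev norm at time \<open>t\<close> is bounded by a multiple of the \<open>\<ell>\<^sup>2\<close> norm at time \<open>t - 1\<close>.
\<close>

lemma solution_sobolev_decay:
  assumes s: "0 \<le> s" "s \<le> 2" and p: "0 < p"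
  shows "((\<lambda>t. sobolev_norm s p (solution t)) \<longlongrightarrow> 0) at_top"
proof -
  obtain K where K: "0 \<le> K" "\<And>t. 1 \<le> t \<Longrightarrow> wiener_norm (l2_nth (a t)) \<le> K * norm (a (t - 1))"
    "\<And>t. 0 < t \<Longrightarrow> \<exists>B. rapid B (l2_nth (a t))" by (rule solution_wiener_norm_le) blast
  let ?V = "((2 * pi) ^ 3) powr (1 / p)"
  have "LIM t at_top. - 1 + t :> (at_top :: real filter)"
    by (rule filterlim_tendsto_add_at_top[OF tendsto_const filterlim_ident])
  from filterlim_compose[OF norm_coeffs_tendsto_0 this]
  have z: "((\<lambda>t. ?V * K * norm (a (- 1 + t))) \<longlongrightarrow> 0) at_top" by (rule tendsto_mult_right_zero)
  show ?thesis
  proof (rule Lim_null_comparison[OF _ z])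
    show "\<forall>\<^sub>F t in at_top. norm (sobolev_norm s p (solution t)) \<le> ?V * K * norm (a (- 1 + t))"
      using eventually_ge_at_top[of 1]
    proof eventually_elim
      case (elim t)
      then have "0 < t" by simp
      then obtain B where "rapid B (l2_nth (a t))" using K(3) by blast
      from real_series_sobolev(2)[OF this s p]
      have "sobolev_norm s p (solution t) \<le> ?V * wiener_norm (l2_nth (a t))" by (simp add: solution_def)
      also have "\<dots> \<le> ?V * (K * norm (a (t - 1)))" by (intro mult_left_mono K(2) elim) simp
      finally have "sobolev_norm s p (solution t) \<le> ?V * K * norm (a (- 1 + t))" by (simp add: mult.assoc)
      then show ?case by (simp add: sobolev_norm_def Lp_norm_nonneg)
    qed
  qed
qed

text \<open>
  The solution is the sum of the heat evolution of \<open>f\<close> and the series of the Duhamel part \<open>d\<close>, and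
  \<open>\<integral> |d|\<^sup>3 \<le> sup |d| \<cdot> \<integral> |d|\<^sup>2\<close>. The first estimate gives the initial condition, the second
  boundedness in \<open>L\<^sup>3\<close> up to time 1.
\<close>

lemma solution_near_zero:
  obtains C0 where "0 \<le> C0" "\<And>t. 0 < t \<Longrightarrow> t \<le> 1 \<Longrightarrow>
      (LINT x|torus. \<bar>solution t x - f x\<bar> ^ 3)
        \<le> 9 * (C0 * t powr (1 / 4) + (LINT x|torus. \<bar>Re (heat_op (\<epsilon> * t) f x) - f x\<bar> ^ 3))"
    "\<And>t. 0 < t \<Longrightarrow> t \<le> 1 \<Longrightarrow> (LINT x|torus. \<bar>solution t x\<bar> ^ 3) \<le> 9 * (C0 + (LINT x|torus. \<bar>f x\<bar> ^ 3))"
proof -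
  define d where "d t k = l2_nth (a t) k - of_real (heat_symbol (\<epsilon> * t) k) * l2_nth (a 0) k" for t k
  obtain C0 where C0: "0 \<le> C0" and di: "\<And>t. 0 < t \<Longrightarrow> t \<le> 1 \<Longrightarrow> integrable lattice (d t)"
    and dC: "\<And>t. 0 < t \<Longrightarrow> t \<le> 1 \<Longrightarrow> (LINT k|lattice. cmod (d t k)) * (LINT k|lattice. (cmod (d t k))\<^sup>2) \<le> C0 * t powr (1 / 4)"
    unfolding d_def[abs_def] by (rule duhamel_near_zero[OF \<epsilon> F mono zero_mode]) blast+
  define V :: real where "V = (2 * pi) ^ 3"
  have V: "0 < V" by (simp add: V_def)
  have main: "L3 (real_series (d t)) \<and> (LINT x|torus. \<bar>real_series (d t) x\<bar> ^ 3) \<le> V * C0 * t powr (1 / 4) \<and>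
      (\<forall>x. solution t x = real_series (d t) x + Re (heat_op (\<epsilon> * t) f x)) \<and> L3 (\<lambda>x. Re (heat_op (\<epsilon> * t) f x))"
    if t: "0 < t" "t \<le> 1" for t
  proof -
    have et: "0 < \<epsilon> * t" using \<epsilon> t by simp
    have h: "(\<lambda>k. l2_nth (a t) k) = (\<lambda>k. d t k + complex_of_real (heat_symbol (\<epsilon> * t) k) * fourier_coeff f k)"
      by (simp add: d_def a_0 l2_nth_hat(1)[OF f])
    have eq: "solution t x = real_series (d t) x + Re (heat_op (\<epsilon> * t) f x)" for x
      using fseries_add[OF di[OF t] integrable_heat_coeff[OF et]]
      by (simp add: solution_def real_series_def heat_op_def h)
    have L: "L3 (\<lambda>x. Re (heat_op (\<epsilon> * t) f x))" by (rule heat_op_L3_contraction(1)[OF et f])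
    have "real_series (d t) = (\<lambda>x. solution t x - Re (heat_op (\<epsilon> * t) f x))" by (simp add: fun_eq_iff eq)
    then have Ld: "L3 (real_series (d t))" using L3_diff[OF solution_L3(1)[OF t(1)] L] by simp
    note pv = parseval_fseries[OF di[OF t]]
    have "(LINT x|torus. \<bar>real_series (d t) x\<bar> ^ 3) \<le> (LINT x|torus. (LINT k|lattice. cmod (d t k)) * (cmod (fseries (d t) x))\<^sup>2)"
    proof (rule integral_mono)
      show "integrable torus (\<lambda>x. \<bar>real_series (d t) x\<bar> ^ 3)" using Ld by (simp add: L3_def)
      show "integrable torus (\<lambda>x. (LINT k|lattice. cmod (d t k)) * (cmod (fseries (d t) x))\<^sup>2)"
        by (intro Bochner_Integration.integrable_mult_right pv(2))
      fix x
      have "\<bar>real_series (d t) x\<bar>\<^sup>2 \<le> (cmod (fseries (d t) x))\<^sup>2"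
        unfolding real_series_def by (intro power_mono abs_Re_le_cmod) simp
      then have "\<bar>real_series (d t) x\<bar> * \<bar>real_series (d t) x\<bar>\<^sup>2 \<le> (LINT k|lattice. cmod (d t k)) * (cmod (fseries (d t) x))\<^sup>2"
        by (rule mult_mono[OF abs_real_series_le[OF di[OF t]]]) (auto intro: integral_nonneg_AE)
      then show "\<bar>real_series (d t) x\<bar> ^ 3 \<le> (LINT k|lattice. cmod (d t k)) * (cmod (fseries (d t) x))\<^sup>2"
        by (simp add: power3_eq_cube power2_eq_square mult.assoc)
    qed
    also have "\<dots> = (LINT k|lattice. cmod (d t k)) * (LINT x|torus. (cmod (fseries (d t) x))\<^sup>2)"
      by (rule integral_mult_right_zero)
    also have "\<dots> = V * ((LINT k|lattice. cmod (d t k)) * (LINT k|lattice. (cmod (d t k))\<^sup>2))"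
      unfolding pv(3) V_def by (rule mult.left_commute)
    also have "\<dots> \<le> V * (C0 * t powr (1 / 4))" using V by (intro mult_left_mono dC t) simp
    finally show ?thesis using Ld L eq by (simp add: mult.assoc)
  qed
  have bound: "(LINT x|torus. \<bar>u x + v x\<bar> ^ 3) \<le> 9 * (U + (LINT x|torus. \<bar>v x\<bar> ^ 3))"
    if "L3 u" "L3 v" "L3 (\<lambda>x. u x + v x)" "(LINT x|torus. \<bar>u x\<bar> ^ 3) \<le> U" for u v :: "real^3 \<Rightarrow> real" and U
  proof -
    have i: "integrable torus (\<lambda>x. \<bar>u x\<bar> ^ 3)" "integrable torus (\<lambda>x. \<bar>v x\<bar> ^ 3)" "integrable torus (\<lambda>x. \<bar>u x + v x\<bar> ^ 3)"
      using that by (simp_all add: L3_def)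
    have "(LINT x|torus. \<bar>u x + v x\<bar> ^ 3) \<le> (LINT x|torus. 9 * (\<bar>u x\<bar> ^ 3 + \<bar>v x\<bar> ^ 3))"
    proof (rule integral_mono[OF i(3)])
      show "integrable torus (\<lambda>x. 9 * (\<bar>u x\<bar> ^ 3 + \<bar>v x\<bar> ^ 3))" using i by simp
      show "\<bar>u x + v x\<bar> ^ 3 \<le> 9 * (\<bar>u x\<bar> ^ 3 + \<bar>v x\<bar> ^ 3)" for x using cube_sum3_le[of "u x" "v x" 0] by simp
    qed
    also have "\<dots> = 9 * ((LINT x|torus. \<bar>u x\<bar> ^ 3) + (LINT x|torus. \<bar>v x\<bar> ^ 3))" using i by simp
    finally show ?thesis using that(4) by simp
  qed
  show ?thesis
  proof (rule that[of "V * C0"])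
    show "0 \<le> V * C0" using V C0 by simp
    fix t :: real assume t: "0 < t" "t \<le> 1"
    note m = main[OF t]
    have et: "0 < \<epsilon> * t" using \<epsilon> t by simp
    have eq1: "(\<lambda>x. solution t x - f x) = (\<lambda>x. real_series (d t) x + (Re (heat_op (\<epsilon> * t) f x) - f x))"
      and eq2: "solution t = (\<lambda>x. real_series (d t) x + Re (heat_op (\<epsilon> * t) f x))"
      using m by (auto simp: fun_eq_iff)
    have "L3 (\<lambda>x. real_series (d t) x + (Re (heat_op (\<epsilon> * t) f x) - f x))"
      unfolding eq1[symmetric] by (rule L3_diff[OF solution_L3(1)[OF t(1)] f])
    from bound[OF _ L3_diff[OF _ f] this] m
    have "(LINT x|torus. \<bar>real_series (d t) x + (Re (heat_op (\<epsilon> * t) f x) - f x)\<bar> ^ 3)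
        \<le> 9 * (V * C0 * t powr (1 / 4) + (LINT x|torus. \<bar>Re (heat_op (\<epsilon> * t) f x) - f x\<bar> ^ 3))" by blast
    then show "(LINT x|torus. \<bar>solution t x - f x\<bar> ^ 3)
        \<le> 9 * (V * C0 * t powr (1 / 4) + (LINT x|torus. \<bar>Re (heat_op (\<epsilon> * t) f x) - f x\<bar> ^ 3))"
      by (simp only: fun_cong[OF eq1])
    have "L3 (\<lambda>x. real_series (d t) x + Re (heat_op (\<epsilon> * t) f x))"
      unfolding eq2[symmetric] by (rule solution_L3(1)[OF t(1)])
    from bound[OF _ _ this] m
    have "(LINT x|torus. \<bar>real_series (d t) x + Re (heat_op (\<epsilon> * t) f x)\<bar> ^ 3)
        \<le> 9 * (V * C0 * t powr (1 / 4) + (LINT x|torus. \<bar>Re (heat_op (\<epsilon> * t) f x)\<bar> ^ 3))" by blast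
    also have "\<dots> \<le> 9 * (V * C0 + (LINT x|torus. \<bar>f x\<bar> ^ 3))"
    proof (intro mult_left_mono add_mono)
      show "V * C0 * t powr (1 / 4) \<le> V * C0"
        using V C0 t powr_le1[of "1 / 4" t] by (intro mult_left_le) auto
    qed (use heat_op_L3_contraction(2)[OF et f] in auto)
    finally have "(LINT x|torus. \<bar>real_series (d t) x + Re (heat_op (\<epsilon> * t) f x)\<bar> ^ 3) \<le> 9 * (V * C0 + (LINT x|torus. \<bar>f x\<bar> ^ 3))" .
    then show "(LINT x|torus. \<bar>solution t x\<bar> ^ 3) \<le> 9 * (V * C0 + (LINT x|torus. \<bar>f x\<bar> ^ 3))"
      by (simp only: fun_cong[OF eq2])
  qed
qed

lemma solution_initial: "((\<lambda>t. Lp_norm 3 (\<lambda>x. solution t x - f x)) \<longlongrightarrow> 0) (at_right 0)"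
proof -
  obtain C0 where C0: "\<And>t. 0 < t \<Longrightarrow> t \<le> 1 \<Longrightarrow>
      (LINT x|torus. \<bar>solution t x - f x\<bar> ^ 3)
        \<le> 9 * (C0 * t powr (1 / 4) + (LINT x|torus. \<bar>Re (heat_op (\<epsilon> * t) f x) - f x\<bar> ^ 3))"
    by (rule solution_near_zero) blast
  have "((\<lambda>t. \<epsilon> * t) \<longlongrightarrow> \<epsilon> * 0) (at_right 0)" by (intro tendsto_intros)
  then have "filterlim (\<lambda>t. \<epsilon> * t) (at_right 0) (at_right 0)"
    using \<epsilon> by (auto simp: filterlim_at eventually_at_filter)
  from filterlim_compose[OF heat_op_tendsto_L3[OF f] this]
  have h: "((\<lambda>t. LINT x|torus. \<bar>Re (heat_op (\<epsilon> * t) f x) - f x\<bar> ^ 3) \<longlongrightarrow> 0) (at_right 0)" .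
  have p: "((\<lambda>t::real. t powr (1 / 4)) \<longlongrightarrow> 0) (at_right 0)"
    by (rule tendsto_zero_powrI[OF tendsto_ident_at tendsto_const]) (auto simp: eventually_at_filter)
  have z: "((\<lambda>t. 9 * (C0 * t powr (1 / 4) + (LINT x|torus. \<bar>Re (heat_op (\<epsilon> * t) f x) - f x\<bar> ^ 3))) \<longlongrightarrow> 0) (at_right 0)"
    by (intro tendsto_mult_right_zero tendsto_add_zero h p)
  have le1: "\<forall>\<^sub>F t in at_right 0. 0 < t \<and> t \<le> (1::real)"
    using eventually_at_right_real[of 0 1] by (auto elim: eventually_mono)
  have "((\<lambda>t. LINT x|torus. \<bar>solution t x - f x\<bar> ^ 3) \<longlongrightarrow> 0) (at_right 0)"
  proof (rule Lim_null_comparison[OF _ z])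
    show "\<forall>\<^sub>F t in at_right 0. norm (LINT x|torus. \<bar>solution t x - f x\<bar> ^ 3)
        \<le> 9 * (C0 * t powr (1 / 4) + (LINT x|torus. \<bar>Re (heat_op (\<epsilon> * t) f x) - f x\<bar> ^ 3))"
      using le1 by eventually_elim (use C0 in \<open>auto intro: integral_nonneg_AE simp: abs_of_nonneg\<close>)
  qed
  then show ?thesis
    unfolding Lp_norm_3
    by (rule tendsto_zero_powrI[OF _ tendsto_const]) (auto intro!: always_eventually integral_nonneg_AE)
qed

text \<open>Up to time 1 by the estimates near the initial time, afterwards by smoothing.\<close>

lemma solution_bounded: "\<exists>B. \<forall>t>0. Lp_norm 3 (solution t) \<le> B"
proof -
  obtain C0 where C0: "\<And>t. 0 < t \<Longrightarrow> t \<le> 1 \<Longrightarrow> (LINT x|torus. \<bar>solution t x\<bar> ^ 3) \<le> 9 * (C0 + (LINT x|torus. \<bar>f x\<bar> ^ 3))"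
    by (rule solution_near_zero) blast
  obtain K where K: "0 \<le> K" "\<And>t. 1 \<le> t \<Longrightarrow> wiener_norm (l2_nth (a t)) \<le> K * norm (a (t - 1))"
    "\<And>t. 0 < t \<Longrightarrow> \<exists>B. rapid B (l2_nth (a t))" by (rule solution_wiener_norm_le) blast
  let ?V = "((2 * pi) ^ 3) powr (1 / 3)"
  define B1 where "B1 = (9 * (C0 + (LINT x|torus. \<bar>f x\<bar> ^ 3))) powr (1 / 3)"
  define B2 where "B2 = ?V * (K * norm (a 0))"
  have "Lp_norm 3 (solution t) \<le> max B1 B2" if t: "0 < t" for t
  proof (cases "t \<le> 1")
    case True
    have "Lp_norm 3 (solution t) \<le> B1"
      unfolding Lp_norm_3 B1_def by (rule powr_mono2[OF _ _ C0[OF t True]]) (auto intro: integral_nonneg_AE)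
    then show ?thesis by simp
  next
    case False
    obtain B where "rapid B (l2_nth (a t))" using K(3)[OF t] by blast
    from real_series_Lp(2)[OF this, of 3]
    have "Lp_norm 3 (solution t) \<le> ?V * wiener_norm (l2_nth (a t))" by (simp add: solution_def)
    also have "\<dots> \<le> ?V * (K * norm (a 0))"
    proof (intro mult_left_mono)
      have "K * norm (a (t - 1)) \<le> K * norm (a 0)" using False by (intro mult_left_mono mono K(1)) auto
      then show "wiener_norm (l2_nth (a t)) \<le> K * norm (a 0)" using K(2)[of t] False by simp
    qed simp
    finally show ?thesis by (simp add: B2_def)
  qed
  then show ?thesis by blast
qed

lemma solution_in_class: "solution_class solution"
  unfolding solution_class_def BC_pos_def
  using solution_C_pos_Lp solution_bounded by (auto intro!: solution_C_pos_sobolev)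

lemma solution_coefficient_equation:
  assumes t: "0 < t"
  shows "l2_nth (a t) k = of_real (heat_symbol (\<epsilon> * t) k) * fourier_coeff f k
    - (LINT \<tau>|open_time t. duhamel_coeff \<epsilon> (\<lambda>\<tau>. quad (a \<tau>) (a \<tau>)) t \<tau> k)"
proof -
  let ?g = "\<lambda>\<tau>. duhamel_coeff \<epsilon> (\<lambda>\<tau>. quad (a \<tau>) (a \<tau>)) t \<tau> k"
  have "continuous_on UNIV (\<lambda>\<tau>. quad (a \<tau>) (a \<tau>))" using F by (simp add: forced_def)
  then have "continuous_on {0..t} ?g"
    unfolding duhamel_coeff_def heat_symbol_def
    by (intro continuous_intros) (auto intro: continuous_on_subset)
  then have si: "set_integrable lborel {0<..<t} ?g"
    by (rule set_integrable_subset[OF borel_integrable_atLeastAtMost']) auto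
  have "(LINT \<tau>|open_time t. ?g \<tau>) = (LINT \<tau>:{0<..<t}|lborel. ?g \<tau>)"
    by (simp add: set_lebesgue_integral_def integral_restrict_space)
  also have "\<dots> = integral {0<..<t} ?g" by (rule set_borel_integral_eq_integral(2)[OF si])
  also have "\<dots> = integral {0..t} ?g" by (rule integral_open_interval_real[symmetric])
  finally show ?thesis
    using forced_duhamel[OF F, of t k] t by (simp add: duhamel_coeff_def a_0 l2_nth_hat(1)[OF f])
qed

end

section \<open>Existence, uniqueness and asymptotics\<close>

lemma L3_eq_if_hat_eq:
  assumes f: "L3 f" and g: "L3 g" and eq: "hat f = hat g"
  shows "AE x in torus. f x = g x"
proof -
  have "coef (\<lambda>x. complex_of_real (f x)) k = coef (\<lambda>x. complex_of_real (g x)) k" for k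
    using arg_cong[OF eq, of "\<lambda>a. l2_nth a k"]
    by (simp add: l2_nth_hat(1)[OF f] l2_nth_hat(1)[OF g] fourier_coeff_eq_coef)
  then have "AE x in torus. complex_of_real (f x) = complex_of_real (g x)"
    by (intro AE_eq_if_coef_eq) (use L3_integrable[OF f] L3_integrable[OF g] in auto)
  then show ?thesis by simp
qed

lemma hat_bounded:
  assumes C: "BC_pos (in_Lp 3) (Lp_norm 3) \<theta>"
  obtains R where "\<And>t. 0 < t \<Longrightarrow> norm (hat (\<theta> t)) \<le> R"
proof -
  obtain B where B: "\<And>t. 0 < t \<Longrightarrow> Lp_norm 3 (\<theta> t) \<le> B" using C by (auto simp: BC_pos_def)
  show ?thesis
  proof (rule that)
    fix t :: real assume t: "0 < t"
    have "L3 (\<theta> t)" using C t by (simp add: BC_pos_def C_pos_def in_Lp_3_iff)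
    from norm_hat_le[OF this] B[OF t] show "norm (hat (\<theta> t)) \<le> 2 * B" by linarith
  qed
qed

text \<open>
  For functions that are bounded and continuous in \<open>L\<^sup>3\<close> the coefficients are bounded and
  continuous in \<open>\<ell>\<^sup>2\<close>, so the equation at each time can be read coefficientwise.
\<close>

lemma mild_solution_iff_coefficients:
  assumes N: "0 < N" and \<nu>: "0 < \<epsilon>\<^sub>\<nu>" and \<epsilon>: "0 < \<epsilon>"
    and C: "BC_pos (in_Lp 3) (Lp_norm 3) \<theta>"
  defines "quad \<equiv> drift_symbol.quad (drift N \<epsilon>\<^sub>\<nu>)"
  shows "mild_solution N \<epsilon>\<^sub>\<nu> \<epsilon> \<theta>\<^sub>0 \<theta> \<longleftrightarrow>
    (\<forall>t>0. \<forall>k. l2_nth (hat (\<theta> t)) k = of_real (heat_symbol (\<epsilon> * t) k) * fourier_coeff \<theta>\<^sub>0 k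
      - (LINT \<tau>|open_time t. duhamel_coeff \<epsilon> (\<lambda>\<tau>. quad (hat (\<theta> \<tau>)) (hat (\<theta> \<tau>))) t \<tau> k))"
proof -
  interpret D: drift_symbol "drift N \<epsilon>\<^sub>\<nu>" "3 * ((N ^ 4 + N\<^sup>2 * (1 + \<epsilon>\<^sub>\<nu>)) / \<epsilon>\<^sub>\<nu>\<^sup>2)"
    by (rule drift_symbol_drift[OF N \<nu>])
  let ?q = "\<lambda>\<tau>. quad (hat (\<theta> \<tau>)) (hat (\<theta> \<tau>))"
  have L: "L3 (\<theta> t)" if "0 < t" for t using C that by (simp add: BC_pos_def C_pos_def in_Lp_3_iff)
  have Cp: "C_pos (in_Lp 3) (Lp_norm 3) \<theta>" using C by (simp add: BC_pos_def)
  obtain R where R: "\<And>t. 0 < t \<Longrightarrow> norm (hat (\<theta> t)) \<le> R" by (rule hat_bounded[OF C]) blast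
  have qc: "continuous_on {0<..} ?q"
    unfolding quad_def by (intro D.quad.continuous_on hat_continuous[OF Cp])
  have qb: "norm (?q \<tau>) \<le> R * R * sqrt D.quad_bound" if \<tau>: "0 < \<tau>" for \<tau>
  proof -
    have "norm (?q \<tau>) \<le> norm (hat (\<theta> \<tau>)) * norm (hat (\<theta> \<tau>)) * sqrt D.quad_bound"
      unfolding quad_def by (rule D.norm_quad_le)
    also have "\<dots> \<le> R * R * sqrt D.quad_bound"
    proof (rule mult_right_mono)
      have "0 \<le> R" using R[OF \<tau>] norm_ge_zero order_trans by blast
      then show "norm (hat (\<theta> \<tau>)) * norm (hat (\<theta> \<tau>)) \<le> R * R" by (intro mult_mono R \<tau>) auto
      show "0 \<le> sqrt D.quad_bound" using D.quad_bound_nonneg by (rule real_sqrt_ge_zero)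
    qed
    finally show ?thesis .
  qed
  show ?thesis
    unfolding mild_solution_def
    using mild_iff_coefficients[where \<theta> = \<theta> and q = ?q, OF N \<nu> \<epsilon> _ L _ qc qb] L
    by (simp add: quad_def in_Lp_3_iff l2_nth_hat(1))
qed

theorem theorem2p3:
  fixes N \<epsilon>\<^sub>\<nu> \<epsilon>\<^sub>\<kappa> :: real and \<theta>\<^sub>0 :: "real^3 \<Rightarrow> real"
  assumes "N > 0" and "\<epsilon>\<^sub>\<nu> > 0" and "\<epsilon>\<^sub>\<kappa> > 0"
    and "in_Lp 3 \<theta>\<^sub>0" and "(LINT x|torus. \<theta>\<^sub>0 x) = 0"
  shows "\<exists>\<theta>. mild_solution N \<epsilon>\<^sub>\<nu> \<epsilon>\<^sub>\<kappa> \<theta>\<^sub>0 \<theta> \<and> solution_class \<theta> \<and>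
    (\<forall>\<theta>'. mild_solution N \<epsilon>\<^sub>\<nu> \<epsilon>\<^sub>\<kappa> \<theta>\<^sub>0 \<theta>' \<and> solution_class \<theta>' \<longrightarrow>
       (\<forall>t>0. AE x in torus. \<theta>' t x = \<theta> t x)) \<and>
    ((\<lambda>t. Lp_norm 3 (\<lambda>x. \<theta> t x - \<theta>\<^sub>0 x)) \<longlongrightarrow> 0) (at_right 0) \<and>
    (\<forall>s p. 0 \<le> s \<and> s < 1 \<and> 3 < p \<longrightarrow> ((\<lambda>t. sobolev_norm s p (\<theta> t)) \<longlongrightarrow> 0) at_top)"
proof -
  interpret D: drift_symbol "drift N \<epsilon>\<^sub>\<nu>" "3 * ((N ^ 4 + N\<^sup>2 * (1 + \<epsilon>\<^sub>\<nu>)) / \<epsilon>\<^sub>\<nu>\<^sup>2)"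
    by (rule drift_symbol_drift[OF assms(1,2)])
  have L0: "L3 \<theta>\<^sub>0" using assms(4) by (simp add: in_Lp_3_iff)
  \<comment> \<open>The data are real and have mean zero.\<close>
  have sym0: "symmetric_coeffs (hat \<theta>\<^sub>0)"
    by (simp add: symmetric_coeffs_def l2_nth_hat(1)[OF L0] fourier_coeff_minus)
  have "(LINT x|torus. complex_of_real (\<theta>\<^sub>0 x)) = 0" using assms(5) by simp
  then have "fourier_coeff \<theta>\<^sub>0 0 = 0" by (simp add: fourier_coeff_def)
  then have z0: "l2_nth (hat \<theta>\<^sub>0) 0 = 0" by (simp add: l2_nth_hat(1)[OF L0])
  obtain a where a: "forced \<epsilon>\<^sub>\<kappa> a (\<lambda>t. D.quad (a t) (a t))" "a 0 = hat \<theta>\<^sub>0"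
    "\<And>t. 0 \<le> t \<Longrightarrow> symmetric_coeffs (a t)" "\<And>t. 0 \<le> t \<Longrightarrow> l2_nth (a t) 0 = 0"
    "\<And>s t. 0 \<le> s \<Longrightarrow> s \<le> t \<Longrightarrow> norm (a t) \<le> norm (a s)"
    by (rule D.global_coefficients[OF assms(3) sym0 z0]) blast
  interpret S: transport_solution "drift N \<epsilon>\<^sub>\<nu>" "3 * ((N ^ 4 + N\<^sup>2 * (1 + \<epsilon>\<^sub>\<nu>)) / \<epsilon>\<^sub>\<nu>\<^sup>2)" \<epsilon>\<^sub>\<kappa> a \<theta>\<^sub>0
    by unfold_locales (use assms(3) L0 a in auto)
  have cls: "solution_class S.solution" by (rule S.solution_in_class)
  then have BC: "BC_pos (in_Lp 3) (Lp_norm 3) S.solution" by (simp add: solution_class_def)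
  note iff = mild_solution_iff_coefficients[OF assms(1-3), of _ \<theta>\<^sub>0]
  have eqS: "l2_nth (hat (S.solution t)) k = of_real (heat_symbol (\<epsilon>\<^sub>\<kappa> * t) k) * fourier_coeff \<theta>\<^sub>0 k
      - (LINT \<tau>|open_time t. duhamel_coeff \<epsilon>\<^sub>\<kappa> (\<lambda>\<tau>. D.quad (hat (S.solution \<tau>)) (hat (S.solution \<tau>))) t \<tau> k)"
    if t: "0 < t" for t k
  proof -
    have "(LINT \<tau>|open_time t. duhamel_coeff \<epsilon>\<^sub>\<kappa> (\<lambda>\<tau>. D.quad (hat (S.solution \<tau>)) (hat (S.solution \<tau>))) t \<tau> k)
      = (LINT \<tau>|open_time t. duhamel_coeff \<epsilon>\<^sub>\<kappa> (\<lambda>\<tau>. D.quad (a \<tau>) (a \<tau>)) t \<tau> k)"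
      by (intro Bochner_Integration.integral_cong refl)
        (simp add: duhamel_coeff_def space_restrict_space S.solution_L3(2))
    then show ?thesis using S.solution_coefficient_equation[OF t, of k] by (simp add: S.solution_L3(2)[OF t])
  qed
  then have mild: "mild_solution N \<epsilon>\<^sub>\<nu> \<epsilon>\<^sub>\<kappa> \<theta>\<^sub>0 S.solution" using iff[OF BC] by blast
  have unique: "AE x in torus. \<theta>' t x = S.solution t x"
    if m: "mild_solution N \<epsilon>\<^sub>\<nu> \<epsilon>\<^sub>\<kappa> \<theta>\<^sub>0 \<theta>'" and c: "solution_class \<theta>'" and t: "0 < t" for \<theta>' t
  proof -
    have BC': "BC_pos (in_Lp 3) (Lp_norm 3) \<theta>'" using c by (simp add: solution_class_def)
    obtain R R' where R: "\<And>t. 0 < t \<Longrightarrow> norm (hat (\<theta>' t)) \<le> R" "\<And>t. 0 < t \<Longrightarrow> norm (hat (S.solution t)) \<le> R'"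
      using hat_bounded[OF BC] hat_bounded[OF BC'] by metis
    have "hat (\<theta>' t) = hat (S.solution t)"
    proof (rule D.coefficient_equation_unique[OF assms(3) _ _ _ _ _ eqS t])
      show "continuous_on {0<..} (\<lambda>t. hat (\<theta>' t))" "continuous_on {0<..} (\<lambda>t. hat (S.solution t))"
        using BC BC' by (auto intro: hat_continuous simp: BC_pos_def)
      show "norm (hat (\<theta>' t)) \<le> max R R'" "norm (hat (S.solution t)) \<le> max R R'" if "0 < t" for t
        using R[OF that] by auto
      show "l2_nth (hat (\<theta>' t)) k = of_real (heat_symbol (\<epsilon>\<^sub>\<kappa> * t) k) * fourier_coeff \<theta>\<^sub>0 k
        - (LINT \<tau>|open_time t. duhamel_coeff \<epsilon>\<^sub>\<kappa> (\<lambda>\<tau>. D.quad (hat (\<theta>' \<tau>)) (hat (\<theta>' \<tau>))) t \<tau> k)" if "0 < t" for t k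
        using iff[OF BC'] m that by blast
    qed
    moreover have "L3 (\<theta>' t)" using BC' t by (simp add: BC_pos_def C_pos_def in_Lp_3_iff)
    ultimately show ?thesis using S.solution_L3(1)[OF t] by (intro L3_eq_if_hat_eq)
  qed
  have decay: "((\<lambda>t. sobolev_norm s p (S.solution t)) \<longlongrightarrow> 0) at_top" if "0 \<le> s" "s < 1" "3 < p" for s p
    using that by (intro S.solution_sobolev_decay) auto
  show ?thesis
    using mild cls unique S.solution_initial decay by blast
qed

end
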